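(* Let $G$ be a complex torus of rank $\ell>0$ and let $V$ be a faithful $1$-modular $G$-module of dimension $n$ with associated weight matrix $A\in\mathbb{Z}^{\ell\times n}$ and shell $N$. Then $N$ has a symplectic slice representation of type O if and only if there is an integer $r$ with $1\leq r\leq \ell$ and a set of $n-r-1$ columns of $A$ whose rank is $\ell-r$.
   Context: Everything is over $\mathbb{C}$; a $G$-module is a finite-dimensional rational representation. For a reductive $G$ with Lie algebra $\mathfrak{g}$ and a $G$-module $V$, let $U=V\oplus V^*$ with its canonical symplectic form $\omega$, let $\mu\colon U\to\mathfrak{g}^*$, $\mu(v,\xi)(A)=\xi(Av)$, be the canonical moment mapping, and let the shell be $N=\mu^{-1}(0)$. Weight matrix: choose $G\simeq(\mathbb{C}^\times)^\ell$ and a basis $e_1,\dots,e_n$ of $V$ on which $G$ acts diagonally; $A=(a_{i,j})$ is the matrix such that $(t_1,\dots,t_\ell)$ acts on $e_j$ by $\prod_{i=1}^\ell t_i^{a_{i,j}}$. Let $V_{(r)}=\{v\in V\mid \dim G_v=r\}$. $V$ is $k$-modular if $\operatorname{codim}_V V_{(r)}\geq r+k$ for $1\leq r\leq \dim G$. Symplectic slice representations: let $x\in N$ with $Gx$ closed, and let $H=G_x$ (a reductive group). Put $E=T_x(Gx)\subset U$ and $S=E^\omega/E$, a symplectic $H$-module, where $E^\omega$ is the $\omega$-orthogonal complement. $(S,H)$ is the symplectic slice representation at $x$. There is an $H$-module $W$ with $S\simeq W\oplus W^*$. Write $W=W^H\oplus W_0$ as $H$-modules and let $N_0\subset W_0\oplus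 W_0^*$ be the shell of the $H$-module $W_0$. $(S,H)$ is of type O if $\dim H>0$ and $\dim N_0/\!\!/H=2$, where $/\!\!/$ denotes the categorical quotient. *)

theory Defs
  imports
    "HOL-Library.Extended_Real"
    "HOL-Library.FuncSet"
    "HOL-Library.Product_Plus"
    "HOL-Algebra.Ideal"
    "Jordan_Normal_Form.DL_Rank"
    "Jordan_Normal_Form.DL_Submatrix"
begin

section \<open>Coordinate rings and dimension\<close>

text \<open>The complex algebra of functions generated by a set F of functions.\<close>

inductive_set gen_algebra :: "('a \<Rightarrow> complex) set \<Rightarrow> ('a \<Rightarrow> complex) set"
  for F :: "('a \<Rightarrow> complex) set" where
  gen: "f \<in> F \<Longrightarrow> f \<in> gen_algebra F"
| const: "(\<lambda>_. c) \<in> gen_algebra F"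
| add: "f \<in> gen_algebra F \<Longrightarrow> g \<in> gen_algebra F \<Longrightarrow> (\<lambda>x. f x + g x) \<in> gen_algebra F"
| mult: "f \<in> gen_algebra F \<Longrightarrow> g \<in> gen_algebra F \<Longrightarrow> (\<lambda>x. f x * g x) \<in> gen_algebra F"

definition poly_funs :: "nat \<Rightarrow> (complex vec \<Rightarrow> complex) set" where
  "poly_funs n = gen_algebra {\<lambda>v. v $ i | i. i < n}"

definition laurent_funs :: "nat \<Rightarrow> (complex vec \<Rightarrow> complex) set" where
  "laurent_funs l = gen_algebra ({\<lambda>t. t $ i | i. i < l} \<union> {\<lambda>t. inverse (t $ i) | i. i < l})"

text \<open>Elements of \<open>\<complex>\<^sup>k \<oplus> (\<complex>\<^sup>k)\<^sup>*\<close> are pairs (v, \<xi>), where the covector \<xi> is given by its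
  coordinates in the dual basis, so that \<xi>(v) is the scalar product \<open>\<xi> \<bullet> v\<close>.\<close>

definition cot_space :: "nat \<Rightarrow> (complex vec \<times> complex vec) set" where
  "cot_space k = carrier_vec k \<times> carrier_vec k"

definition cot_smult :: "complex \<Rightarrow> complex vec \<times> complex vec \<Rightarrow> complex vec \<times> complex vec" where
  "cot_smult c u = (c \<cdot>\<^sub>v fst u, c \<cdot>\<^sub>v snd u)"

definition cot_poly_funs :: "nat \<Rightarrow> (complex vec \<times> complex vec \<Rightarrow> complex) set" where
  "cot_poly_funs k = gen_algebra ({\<lambda>u. fst u $ i | i. i < k} \<union> {\<lambda>u. snd u $ i | i. i < k})"

definition fun_ring :: "'a set \<Rightarrow> ('a \<Rightarrow> complex) set \<Rightarrow> ('a \<Rightarrow> complex) ring" where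
  "fun_ring X F =
    \<lparr>carrier = {restrict f X | f. f \<in> F},
     monoid.mult = (\<lambda>f g. restrict (\<lambda>x. f x * g x) X),
     one = restrict (\<lambda>_. 1) X,
     zero = restrict (\<lambda>_. 0) X,
     add = (\<lambda>f g. restrict (\<lambda>x. f x + g x) X)\<rparr>"

text \<open>Krull dimension; the zero ring has no prime ideals and gets dimension \<open>-\<infinity>\<close>.\<close>

definition krull_dim :: "('a, 'b) ring_scheme \<Rightarrow> ereal" where
  "krull_dim R = Sup {ereal (real k) | k :: nat. \<exists>P :: nat \<Rightarrow> 'a set.
     (\<forall>i\<le>k. primeideal (P i) R) \<and> (\<forall>i<k. P i \<subset> P (Suc i))}"

text \<open>The ring of restrictions of polynomials to X is the coordinate ring of the Zariski closure
  of X, which has the same dimension as X when X is constructible.\<close>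

definition codim :: "nat \<Rightarrow> complex vec set \<Rightarrow> ereal" where
  "codim n X = ereal (real n) - krull_dim (fun_ring X (poly_funs n))"


section \<open>Algebraic subgroups of tori and their modules\<close>

definition torus :: "nat \<Rightarrow> complex vec set" where
  "torus l = {t \<in> carrier_vec l. \<forall>i<l. t $ i \<noteq> 0}"

definition tmult :: "complex vec \<Rightarrow> complex vec \<Rightarrow> complex vec" where
  "tmult s t = vec (dim_vec s) (\<lambda>i. s $ i * t $ i)"

definition tone :: "nat \<Rightarrow> complex vec" where
  "tone l = vec l (\<lambda>_. 1)"

definition tinv :: "complex vec \<Rightarrow> complex vec" where
  "tinv t = vec (dim_vec t) (\<lambda>i. inverse (t $ i))"

definition texp :: "complex vec \<Rightarrow> complex vec" where
  "texp X = vec (dim_vec X) (\<lambda>i. exp (X $ i))"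

text \<open>From here on, H stands for an algebraic subgroup of \<open>torus l\<close>.\<close>

definition group_dim :: "nat \<Rightarrow> complex vec set \<Rightarrow> ereal" where
  "group_dim l H = krull_dim (fun_ring H (laurent_funs l))"

definition lie_algebra :: "nat \<Rightarrow> complex vec set \<Rightarrow> complex vec set" where
  "lie_algebra l H = {X \<in> carrier_vec l. \<forall>s::complex. texp (s \<cdot>\<^sub>v X) \<in> H}"

text \<open>Rational representations \<open>\<rho> : H \<rightarrow> GL\<^sub>k(\<complex>)\<close>; only the values of \<rho> on H matter.\<close>

definition is_module :: "nat \<Rightarrow> complex vec set \<Rightarrow> nat \<Rightarrow> (complex vec \<Rightarrow> complex mat) \<Rightarrow> bool" where
  "is_module l H k \<rho> \<longleftrightarrow>
     (\<forall>h\<in>H. \<rho> h \<in> carrier_mat k k) \<and>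
     \<rho> (tone l) = 1\<^sub>m k \<and>
     (\<forall>g\<in>H. \<forall>h\<in>H. \<rho> (tmult g h) = \<rho> g * \<rho> h) \<and>
     (\<forall>i<k. \<forall>j<k. \<exists>f\<in>laurent_funs l. \<forall>h\<in>H. \<rho> h $$ (i, j) = f h)"

definition faithful :: "complex vec set \<Rightarrow> (complex vec \<Rightarrow> complex mat) \<Rightarrow> bool" where
  "faithful H \<rho> \<longleftrightarrow> inj_on \<rho> H"

text \<open>The differential of \<rho>, evaluated at an element X of the Lie algebra of H.\<close>

definition lie_action :: "nat \<Rightarrow> (complex vec \<Rightarrow> complex mat) \<Rightarrow> complex vec \<Rightarrow> complex mat" where
  "lie_action k \<rho> X = mat k k (\<lambda>(i, j).
     THE D. ((\<lambda>s::complex. \<rho> (texp (s \<cdot>\<^sub>v X)) $$ (i, j)) has_field_derivative D) (at 0))"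

definition invariant_vecs :: "complex vec set \<Rightarrow> nat \<Rightarrow> (complex vec \<Rightarrow> complex mat) \<Rightarrow> complex vec set" where
  "invariant_vecs H k \<rho> = {w \<in> carrier_vec k. \<forall>h\<in>H. \<rho> h *\<^sub>v w = w}"

definition module_iso ::
  "complex vec set \<Rightarrow> nat \<Rightarrow> (complex vec \<Rightarrow> complex mat) \<Rightarrow> (complex vec \<Rightarrow> complex mat) \<Rightarrow> bool" where
  "module_iso H k \<rho> \<sigma> \<longleftrightarrow>
     (\<exists>P \<in> carrier_mat k k. invertible_mat P \<and> (\<forall>h\<in>H. \<rho> h * P = P * \<sigma> h))"

text \<open>The direct sum of the trivial module of dimension p and the m-dimensional module \<tau>.\<close>

definition add_trivial :: "nat \<Rightarrow> nat \<Rightarrow> (complex vec \<Rightarrow> complex mat) \<Rightarrow> complex vec \<Rightarrow> complex mat" where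
  "add_trivial p m \<tau> h = four_block_mat (1\<^sub>m p) (0\<^sub>m p m) (0\<^sub>m m p) (\<tau> h)"

text \<open>\<open>W = W\<^sup>H \<oplus> W\<^sub>0\<close>, where W is the module \<sigma>, \<open>W\<^sup>H\<close> has dimension p, and \<open>W\<^sub>0\<close> is
  (isomorphic to) the m-dimensional module \<tau>. The last condition makes the trivial summand
  all of \<open>W\<^sup>H\<close>.\<close>

definition splits_off_invariants ::
  "nat \<Rightarrow> complex vec set \<Rightarrow> nat \<Rightarrow> (complex vec \<Rightarrow> complex mat) \<Rightarrow> nat \<Rightarrow> nat \<Rightarrow>
   (complex vec \<Rightarrow> complex mat) \<Rightarrow> bool" where
  "splits_off_invariants l H k \<sigma> p m \<tau> \<longleftrightarrow>
     k = p + m \<and> is_module l H m \<tau> \<and> module_iso H k \<sigma> (add_trivial p m \<tau>) \<and>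
     invariant_vecs H m \<tau> = {0\<^sub>v m}"

definition isotropy :: "complex vec set \<Rightarrow> (complex vec \<Rightarrow> complex mat) \<Rightarrow> complex vec \<Rightarrow> complex vec set" where
  "isotropy H \<rho> v = {h \<in> H. \<rho> h *\<^sub>v v = v}"

definition isotropy_stratum ::
  "nat \<Rightarrow> complex vec set \<Rightarrow> nat \<Rightarrow> (complex vec \<Rightarrow> complex mat) \<Rightarrow> nat \<Rightarrow> complex vec set" where
  "isotropy_stratum l H n \<rho> r =
     {v \<in> carrier_vec n. group_dim l (isotropy H \<rho> v) = ereal (real r)}"

text \<open>An empty stratum has codimension \<open>\<infinity>\<close>.\<close>

definition modular ::
  "nat \<Rightarrow> nat \<Rightarrow> complex vec set \<Rightarrow> nat \<Rightarrow> (complex vec \<Rightarrow> complex mat) \<Rightarrow> bool" where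
  "modular k l H n \<rho> \<longleftrightarrow>
     (\<forall>r::nat. 1 \<le> r \<and> ereal (real r) \<le> group_dim l H \<longrightarrow>
        codim n (isotropy_stratum l H n \<rho> r) \<ge> ereal (real (r + k)))"

text \<open>The column j of P is the basis vector \<open>e\<^sub>j\<close>.\<close>

definition weight_matrix ::
  "nat \<Rightarrow> nat \<Rightarrow> (complex vec \<Rightarrow> complex mat) \<Rightarrow> int mat \<Rightarrow> bool" where
  "weight_matrix l n \<rho> A \<longleftrightarrow> A \<in> carrier_mat l n \<and>
     (\<exists>P \<in> carrier_mat n n. invertible_mat P \<and>
        (\<forall>t\<in>torus l. \<forall>j<n.
           \<rho> t *\<^sub>v col P j = (\<Prod>i<l. (t $ i) powi (A $$ (i, j))) \<cdot>\<^sub>v col P j))"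


section \<open>The symplectic module and the shell\<close>

text \<open>The action on \<open>V \<oplus> V\<^sup>*\<close>, contragredient on the second summand.\<close>

definition cot_act ::
  "(complex vec \<Rightarrow> complex mat) \<Rightarrow> complex vec \<Rightarrow> complex vec \<times> complex vec \<Rightarrow> complex vec \<times> complex vec" where
  "cot_act \<rho> h u = (\<rho> h *\<^sub>v fst u, transpose_mat (\<rho> (tinv h)) *\<^sub>v snd u)"

definition omega :: "complex vec \<times> complex vec \<Rightarrow> complex vec \<times> complex vec \<Rightarrow> complex" where
  "omega u u' = snd u' \<bullet> fst u - snd u \<bullet> fst u'"

definition moment ::
  "nat \<Rightarrow> (complex vec \<Rightarrow> complex mat) \<Rightarrow> complex vec \<times> complex vec \<Rightarrow> complex vec \<Rightarrow> complex" where
  "moment k \<rho> u X = snd u \<bullet> (lie_action k \<rho> X *\<^sub>v fst u)"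

definition shell ::
  "nat \<Rightarrow> complex vec set \<Rightarrow> nat \<Rightarrow> (complex vec \<Rightarrow> complex mat) \<Rightarrow> (complex vec \<times> complex vec) set" where
  "shell l H k \<rho> = {u \<in> cot_space k. \<forall>X\<in>lie_algebra l H. moment k \<rho> u X = 0}"

text \<open>The regular functions on the shell N that are invariant under H; this is the coordinate
  ring of the categorical quotient \<open>N//H\<close>.\<close>

definition shell_quotient_ring ::
  "nat \<Rightarrow> complex vec set \<Rightarrow> nat \<Rightarrow> (complex vec \<Rightarrow> complex mat) \<Rightarrow> (complex vec \<times> complex vec \<Rightarrow> complex) ring" where
  "shell_quotient_ring l H k \<rho> = fun_ring (shell l H k \<rho>)
     {f \<in> cot_poly_funs k. \<forall>h\<in>H. \<forall>u\<in>shell l H k \<rho>. f (cot_act \<rho> h u) = f u}"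

definition cot_orbit ::
  "complex vec set \<Rightarrow> (complex vec \<Rightarrow> complex mat) \<Rightarrow> complex vec \<times> complex vec \<Rightarrow> (complex vec \<times> complex vec) set" where
  "cot_orbit H \<rho> x = (\<lambda>h. cot_act \<rho> h x) ` H"

definition cot_isotropy ::
  "complex vec set \<Rightarrow> (complex vec \<Rightarrow> complex mat) \<Rightarrow> complex vec \<times> complex vec \<Rightarrow> complex vec set" where
  "cot_isotropy H \<rho> x = {h \<in> H. cot_act \<rho> h x = x}"

definition zariski_closed :: "nat \<Rightarrow> (complex vec \<times> complex vec) set \<Rightarrow> bool" where
  "zariski_closed k X \<longleftrightarrow>
     (\<exists>F \<subseteq> cot_poly_funs k. X = {u \<in> cot_space k. \<forall>f\<in>F. f u = 0})"

text \<open>The tangent space at x of the subvariety X: those u that are annihilated by the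
  differential at x of every polynomial vanishing on X.\<close>

definition tangent_space ::
  "nat \<Rightarrow> (complex vec \<times> complex vec) set \<Rightarrow> complex vec \<times> complex vec \<Rightarrow> (complex vec \<times> complex vec) set" where
  "tangent_space k X x = {u \<in> cot_space k. \<forall>f \<in> cot_poly_funs k. (\<forall>y\<in>X. f y = 0) \<longrightarrow>
     ((\<lambda>s::complex. f (x + cot_smult s u)) has_field_derivative 0) (at 0)}"

definition omega_perp :: "nat \<Rightarrow> (complex vec \<times> complex vec) set \<Rightarrow> (complex vec \<times> complex vec) set" where
  "omega_perp k E = {u \<in> cot_space k. \<forall>e\<in>E. omega u e = 0}"


section \<open>Symplectic slice representations\<close>

text \<open>The symplectic H-modules \<open>E\<^sup>\<omega>/E\<close> and \<open>W \<oplus> W\<^sup>*\<close> are isomorphic, where E is an isotropic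
  H-submodule of \<open>V \<oplus> V\<^sup>*\<close>, V is the n-dimensional module \<rho>, and W is the k-dimensional
  module \<sigma>. An isomorphism is given as the linear map q that it induces on \<open>E\<^sup>\<omega>\<close>: q is onto
  and has kernel E.\<close>

definition slice_iso ::
  "complex vec set \<Rightarrow> nat \<Rightarrow> (complex vec \<Rightarrow> complex mat) \<Rightarrow> (complex vec \<times> complex vec) set \<Rightarrow>
   nat \<Rightarrow> (complex vec \<Rightarrow> complex mat) \<Rightarrow> bool" where
  "slice_iso H n \<rho> E k \<sigma> \<longleftrightarrow> (\<exists>q.
     (\<forall>u\<in>omega_perp n E. \<forall>u'\<in>omega_perp n E. q (u + u') = q u + q u') \<and>
     (\<forall>c. \<forall>u\<in>omega_perp n E. q (cot_smult c u) = cot_smult c (q u)) \<and>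
     q ` omega_perp n E = cot_space k \<and>
     {u \<in> omega_perp n E. q u = (0\<^sub>v k, 0\<^sub>v k)} = E \<and>
     (\<forall>h\<in>H. \<forall>u\<in>omega_perp n E. q (cot_act \<rho> h u) = cot_act \<sigma> h (q u)) \<and>
     (\<forall>u\<in>omega_perp n E. \<forall>u'\<in>omega_perp n E. omega (q u) (q u') = omega u u'))"

text \<open>The symplectic slice representation at x (a point of the shell with closed orbit) is of
  type O. The module W is determined only up to replacing summands by their duals, which does
  not affect the shell of \<open>W\<^sub>0\<close> up to isomorphism.\<close>

definition slice_type_O ::
  "nat \<Rightarrow> complex vec set \<Rightarrow> nat \<Rightarrow> (complex vec \<Rightarrow> complex mat) \<Rightarrow> complex vec \<times> complex vec \<Rightarrow> bool" where
  "slice_type_O l G n \<rho> x \<longleftrightarrow>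
     (let H = cot_isotropy G \<rho> x; E = tangent_space n (cot_orbit G \<rho> x) x in
      group_dim l H > 0 \<and>
      (\<exists>k \<sigma> p m \<tau>. is_module l H k \<sigma> \<and> slice_iso H n \<rho> E k \<sigma> \<and>
         splits_off_invariants l H k \<sigma> p m \<tau> \<and>
         krull_dim (shell_quotient_ring l H m \<tau>) = 2))"

definition has_slice_of_type_O ::
  "nat \<Rightarrow> complex vec set \<Rightarrow> nat \<Rightarrow> (complex vec \<Rightarrow> complex mat) \<Rightarrow> bool" where
  "has_slice_of_type_O l G n \<rho> \<longleftrightarrow>
     (\<exists>x \<in> shell l G n \<rho>. zariski_closed n (cot_orbit G \<rho> x) \<and> slice_type_O l G n \<rho> x)"

text \<open>The rank of the columns of A with index in J.\<close>

definition column_rank :: "int mat \<Rightarrow> nat set \<Rightarrow> nat" where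
  "column_rank A J =
     vec_space.rank (dim_row A) (map_mat rat_of_int (submatrix A UNIV J))"

end

theory Submission
  imports Defs "HOL-Complex_Analysis.Complex_Analysis"
begin

text \<open>A simultaneous eigenbasis reduces everything to diagonal actions, where 1-modularity says
  that a set S of columns of rank d < l satisfies |S| + (l - d) + 1 \<le> n. The isotropy group H of
  a point x with closed orbit in the shell is the common kernel of the columns supporting x. If
  these span rank l - r, and T is the set of all columns in their span, then the nontrivial part
  \<open>W\<^sub>0\<close> of the slice representation is given by the columns outside T, and the modularity
  bound for \<open>W\<^sub>0\<close> makes its shell quotient of dimension 2(n - |T| - r). Type O thus means
  |T| = n - r - 1. Conversely, discarding coloops from a set of n - r - 1 columns of rank l - r
  keeps |J| - rank J, so every remaining column lies in the span of the others; such a set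
  supports a point with closed orbit, and by the bound it contains every column in its span.\<close>

text \<open>The factor 2 has a structural source. A point (v, \<xi>) lies in the shell of a diagonal
  module exactly when its products v_j \<xi>_j form a vector of a linear space L cut out by the Lie
  algebra, and the exponent differences of every invariant monomial lie in the same L. The quotient
  thus has dim L directions from the products and dim L from the monomials. It suffices to tell
  dimension 2 from dimension at least 3, so only dim L = 1 needs an upper bound. Krull dimension is
  defined by chains of primes in rings of functions on sets. Lower bounds come from nested sets
  whose points are joined by entire curves; upper bounds come from counting monomials, since too
  many functions in an algebra of slow growth are algebraically dependent. Ranks are taken over the
  rationals, but isotropy groups see the lattice generated by the columns: they may be disconnected,
  and a closed orbit is cut out by binomial equations indexed by integer relations. Clearing
  denominators and extracting roots mediate between the two.\<close>

hide_type (open) Finite_Cartesian_Product.vec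
hide_const (open) Finite_Cartesian_Product.vec
no_notation Finite_Cartesian_Product.vec_nth (infixl "$" 90)

section \<open>Independence of integer columns\<close>

text \<open>Gaussian elimination by induction on the equations: one of them is solved for the
  unknown \<open>i0\<close>, which is substituted into the others. The index types are arbitrary
  because the unknowns are columns in some uses and monomials in another.\<close>

lemma homogeneous_system_solvable:
  fixes M :: "'i \<Rightarrow> 'b \<Rightarrow> 'a::field"
  assumes "finite B" "finite I" "card B < card I"
  shows "\<exists>c. (\<exists>i\<in>I. c i \<noteq> 0) \<and> (\<forall>b\<in>B. (\<Sum>i\<in>I. c i * M i b) = 0)"
  using assms
proof (induction B arbitrary: I M rule: finite_induct)
  case empty
  then have "I \<noteq> {}" by auto
  then show ?case by (intro exI[of _ "\<lambda>_. 1"]) auto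
next
  case (insert b B)
  show ?case
  proof (cases "\<forall>i\<in>I. M i b = 0")
    case True
    have "card B < card I" using insert by simp
    then obtain c where "\<exists>i\<in>I. c i \<noteq> 0" "\<forall>b\<in>B. (\<Sum>i\<in>I. c i * M i b) = 0"
      using insert.IH[OF insert.prems(1)] by blast
    moreover have "(\<Sum>i\<in>I. c i * M i b) = 0" using True by simp
    ultimately show ?thesis by auto
  next
    case False
    then obtain i0 where i0: "i0 \<in> I" "M i0 b \<noteq> 0" by auto
    define I' where "I' = I - {i0}"
    have fin: "finite I'" and I: "I = insert i0 I'" "i0 \<notin> I'"
      using i0 insert.prems unfolding I'_def by auto
    have "card B < card I'" using insert I fin by simp
    then obtain c where c: "\<exists>i\<in>I'. c i \<noteq> 0"
        "\<forall>b'\<in>B. (\<Sum>i\<in>I'. c i * (M i b' - M i b / M i0 b * M i0 b')) = 0"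
      using insert.IH[OF fin, of "\<lambda>i b'. M i b' - M i b / M i0 b * M i0 b'"] by blast
    define s where "s = - (\<Sum>i\<in>I'. c i * M i b) / M i0 b"
    define c' where "c' = c(i0 := s)"
    have sum: "(\<Sum>i\<in>I. c' i * M i b') = s * M i0 b' + (\<Sum>i\<in>I'. c i * M i b')" for b'
    proof -
      have "(\<Sum>i\<in>I'. c' i * M i b') = (\<Sum>i\<in>I'. c i * M i b')"
        using I by (intro sum.cong) (auto simp: c'_def)
      then show ?thesis using I fin by (simp add: c'_def)
    qed
    have "(\<Sum>i\<in>I. c' i * M i b') = 0" if "b' \<in> B" for b'
    proof -
      have "(\<Sum>i\<in>I'. c i * (M i b' - M i b / M i0 b * M i0 b')) =
        (\<Sum>i\<in>I'. c i * M i b') + s * M i0 b'"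
      proof -
        have "s * M i0 b' = - (\<Sum>i\<in>I'. c i * (M i b / M i0 b * M i0 b'))"
          by (simp add: s_def sum_distrib_right sum_divide_distrib mult.assoc)
        then show ?thesis by (simp add: right_diff_distrib sum_subtractf)
      qed
      then show ?thesis using c(2) that by (simp add: sum add.commute)
    qed
    moreover have "(\<Sum>i\<in>I. c' i * M i b) = 0"
      unfolding sum using i0 by (simp add: s_def)
    moreover have "\<exists>i\<in>I. c' i \<noteq> 0" using c(1) I by (auto simp: c'_def)
    ultimately show ?thesis by (intro exI[of _ c']) auto
  qed
qed

text \<open>Stated for indexed families rather than sets of vectors, so that equal columns count
  separately. Rational coefficients lose nothing for integer vectors and allow denominators to be
  cleared.\<close>

definition indep :: "nat \<Rightarrow> ('j \<Rightarrow> nat \<Rightarrow> int) \<Rightarrow> 'j set \<Rightarrow> bool" where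
  "indep l a D \<longleftrightarrow> (\<forall>c :: 'j \<Rightarrow> rat. (\<forall>i<l. (\<Sum>j\<in>D. c j * of_int (a j i)) = 0) \<longrightarrow> (\<forall>j\<in>D. c j = 0))"

definition in_span :: "nat \<Rightarrow> ('j \<Rightarrow> nat \<Rightarrow> int) \<Rightarrow> 'j set \<Rightarrow> (nat \<Rightarrow> int) \<Rightarrow> bool" where
  "in_span l a D v \<longleftrightarrow> (\<exists>c :: 'j \<Rightarrow> rat. \<forall>i<l. of_int (v i) = (\<Sum>d\<in>D. c d * of_int (a d i)))"

text \<open>A basis of the column matroid restricted to \<open>S\<close>. The rank of
  \<open>S\<close> appears throughout as the cardinality of such a basis, which
  \<open>basis_card_unique\<close> makes well defined.\<close>

definition is_basis :: "nat \<Rightarrow> ('j \<Rightarrow> nat \<Rightarrow> int) \<Rightarrow> 'j set \<Rightarrow> 'j set \<Rightarrow> bool" where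
  "is_basis l a S D \<longleftrightarrow> finite S \<and> D \<subseteq> S \<and> indep l a D \<and> (\<forall>j\<in>S. in_span l a D (a j))"

lemma indep_insert:
  assumes "indep l a D" "finite D" "j \<notin> D" "\<not> in_span l a D (a j)"
  shows "indep l a (insert j D)"
  unfolding indep_def
proof (intro allI impI)
  fix c :: "'a \<Rightarrow> rat"
  assume "\<forall>i<l. (\<Sum>k\<in>insert j D. c k * of_int (a k i)) = 0"
  then have z: "c j * of_int (a j i) + (\<Sum>k\<in>D. c k * of_int (a k i)) = 0" if "i < l" for i
    using that assms by simp
  have "c j = 0"
  proof (rule ccontr)
    assume nz: "c j \<noteq> 0"
    have "of_int (a j i) = (\<Sum>d\<in>D. (- c d / c j) * of_int (a d i))" if "i < l" for i
    proof -
      have "(\<Sum>d\<in>D. (- c d / c j) * of_int (a d i)) = - (\<Sum>d\<in>D. c d * of_int (a d i)) / c j"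
        by (simp add: sum_divide_distrib sum_negf)
      then show ?thesis using z[OF that] nz by (simp only: eq_divide_eq) (simp add: add_eq_0_iff mult.commute)
    qed
    then have "in_span l a D (a j)"
      unfolding in_span_def by (intro exI[of _ "\<lambda>d. - c d / c j"] allI impI)
    then show False using assms(4) by blast
  qed
  then show "\<forall>k\<in>insert j D. c k = 0"
    using z assms(1) unfolding indep_def by auto
qed

lemma in_span_member:
  assumes "finite D" "j \<in> D"
  shows "in_span l a D (a j)"
  unfolding in_span_def using assms
  by (intro exI[of _ "\<lambda>d. if d = j then 1 else 0"]) (simp add: if_distrib[of "\<lambda>x. x * _"] sum.delta cong: if_cong)

text \<open>A maximal independent set between \<open>D\<close> and \<open>S\<close> spans
  \<open>S\<close>, since any column outside its span could be added.\<close>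

lemma indep_extend_basis:
  assumes "finite S" "D \<subseteq> S" "indep l a D"
  shows "\<exists>D'. D \<subseteq> D' \<and> is_basis l a S D'"
proof -
  define C where "C = {E. D \<subseteq> E \<and> E \<subseteq> S \<and> indep l a E}"
  have "C \<subseteq> Pow S" and ne: "C \<noteq> {}" using assms by (auto simp: C_def)
  then have "finite C" using assms(1) by (meson finite_Pow_iff finite_subset)
  from finite_has_maximal[OF this ne]
  obtain E where "E \<in> C" and max: "\<forall>E'\<in>C. E \<subseteq> E' \<longrightarrow> E = E'" by blast
  then have E: "D \<subseteq> E" "E \<subseteq> S" "indep l a E" by (auto simp: C_def)
  have finE: "finite E" using E(2) assms(1) by (rule finite_subset)
  have "in_span l a E (a j)" if "j \<in> S" for j
  proof (cases "j \<in> E")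
    case True
    then show ?thesis by (rule in_span_member[OF finE])
  next
    case False
    show ?thesis
    proof (rule ccontr)
      assume "\<not> in_span l a E (a j)"
      then have "insert j E \<in> C" using indep_insert[OF E(3) finE False] E that by (auto simp: C_def)
      then show False using max False by blast
    qed
  qed
  then have "is_basis l a S E" using E assms(1) by (simp add: is_basis_def)
  then show ?thesis using E(1) by blast
qed

lemma basis_exists:
  assumes "finite S"
  shows "\<exists>D. is_basis l a S D"
  using indep_extend_basis[OF assms, of "{}"] by (auto simp: indep_def)

text \<open>Steinitz by counting: the coordinates of the columns of \<open>E\<close> with respect to
  \<open>D\<close> form a homogeneous system, with fewer equations than unknowns if \<open>E\<close>
  is larger; a solution is then a nontrivial relation in \<open>E\<close>.\<close>

lemma indep_card_le_spanning:
  assumes "finite E" "finite D" "indep l a E" "\<And>j. j \<in> E \<Longrightarrow> in_span l a D (a j)"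
  shows "card E \<le> card D"
proof (rule ccontr)
  assume "\<not> card E \<le> card D"
  then have lt: "card D < card E" by simp
  have "\<forall>j\<in>E. \<exists>c :: 'a \<Rightarrow> rat. \<forall>i<l. of_int (a j i) = (\<Sum>d\<in>D. c d * of_int (a d i))"
    using assms(4) unfolding in_span_def by blast
  then obtain M :: "'a \<Rightarrow> 'a \<Rightarrow> rat" where
    M: "\<And>j i. j \<in> E \<Longrightarrow> i < l \<Longrightarrow> of_int (a j i) = (\<Sum>d\<in>D. M j d * of_int (a d i))"
    by metis
  obtain c where c: "\<exists>j\<in>E. c j \<noteq> 0" "\<forall>d\<in>D. (\<Sum>j\<in>E. c j * M j d) = 0"
    using homogeneous_system_solvable[OF assms(2,1) lt] by blast
  have "(\<Sum>j\<in>E. c j * of_int (a j i)) = 0" if "i < l" for i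
  proof -
    have "(\<Sum>j\<in>E. c j * of_int (a j i)) = (\<Sum>j\<in>E. \<Sum>d\<in>D. c j * M j d * of_int (a d i))"
      using M that by (intro sum.cong) (auto simp: sum_distrib_left mult.assoc)
    also have "\<dots> = (\<Sum>d\<in>D. (\<Sum>j\<in>E. c j * M j d) * of_int (a d i))"
      by (subst sum.swap) (simp add: sum_distrib_right)
    also have "\<dots> = 0" using c(2) by simp
    finally show ?thesis .
  qed
  then show False using assms(3) c(1) unfolding indep_def by blast
qed

lemma basis_finite: "is_basis l a S D \<Longrightarrow> finite D"
  unfolding is_basis_def using finite_subset by blast

lemma indep_card_le_basis:
  assumes "is_basis l a S D" "E \<subseteq> S" "indep l a E"
  shows "card E \<le> card D"
proof (rule indep_card_le_spanning[OF _ basis_finite[OF assms(1)] assms(3)])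
  show "finite E" using assms(1,2) finite_subset unfolding is_basis_def by blast
  show "in_span l a D (a j)" if "j \<in> E" for j
    using assms(1,2) that unfolding is_basis_def by (meson subsetD)
qed

lemma basis_card_unique:
  assumes "is_basis l a S D" "is_basis l a S E"
  shows "card D = card E"
proof (rule le_antisym)
  have "D \<subseteq> S" "indep l a D" "E \<subseteq> S" "indep l a E" using assms by (auto simp: is_basis_def)
  then show "card D \<le> card E" "card E \<le> card D"
    using indep_card_le_basis[OF assms(1)] indep_card_le_basis[OF assms(2)] by auto
qed

lemma indep_subset:
  assumes "indep l a D" "E \<subseteq> D" "finite D"
  shows "indep l a E"
  unfolding indep_def
proof (intro allI impI)
  fix c :: "'a \<Rightarrow> rat"
  assume z: "\<forall>i<l. (\<Sum>j\<in>E. c j * of_int (a j i)) = 0"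
  define c' where "c' j = (if j \<in> E then c j else 0)" for j
  have "(\<Sum>j\<in>D. c' j * of_int (a j i)) = (\<Sum>j\<in>E. c j * of_int (a j i))" for i
    using assms by (intro sum.mono_neutral_cong_right) (auto simp: c'_def)
  then have "\<forall>j\<in>D. c' j = 0" using assms(1) z unfolding indep_def by auto
  then show "\<forall>j\<in>E. c j = 0" using assms(2) c'_def by (metis subsetD)
qed

text \<open>The columns \<open>Inr i\<close> are the unit vectors: extending an independent set of columns by unit
  vectors to a basis produces dual vectors.\<close>

fun ext_cols :: "(nat \<Rightarrow> nat \<Rightarrow> int) \<Rightarrow> nat + nat \<Rightarrow> nat \<Rightarrow> int" where
  "ext_cols a (Inl j) i = a j i"
| "ext_cols a (Inr k) i = (if k = i then 1 else 0)"

lemma indep_Inl: "indep l (ext_cols a) (Inl ` D) \<longleftrightarrow> indep l a D"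
proof -
  have [simp]: "(\<Sum>j\<in>Inl ` D. c j * of_int (ext_cols a j i)) = (\<Sum>j\<in>D. c (Inl j) * of_int (a j i))"
    for c :: "nat + nat \<Rightarrow> rat" and i
    by (subst sum.reindex) auto
  show ?thesis
  proof
    assume h: "indep l (ext_cols a) (Inl ` D)"
    show "indep l a D" unfolding indep_def
    proof (intro allI impI)
      fix c :: "nat \<Rightarrow> rat"
      assume "\<forall>i<l. (\<Sum>j\<in>D. c j * of_int (a j i)) = 0"
      then show "\<forall>j\<in>D. c j = 0"
        using h[unfolded indep_def, THEN spec, of "\<lambda>x. case x of Inl j \<Rightarrow> c j | Inr _ \<Rightarrow> 0"] by auto
    qed
  next
    assume h: "indep l a D"
    show "indep l (ext_cols a) (Inl ` D)" unfolding indep_def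
    proof (intro allI impI)
      fix c :: "nat + nat \<Rightarrow> rat"
      assume "\<forall>i<l. (\<Sum>j\<in>Inl ` D. c j * of_int (ext_cols a j i)) = 0"
      then show "\<forall>j\<in>Inl ` D. c j = 0"
        using h[unfolded indep_def, THEN spec, of "\<lambda>j. c (Inl j)"] by simp
    qed
  qed
qed

text \<open>Expanding the unit vectors in \<open>D\<close> yields a one-sided inverse of the matrix
  whose columns are those of \<open>D\<close>. Independence of \<open>D\<close> makes it two-sided,
  which is the second identity.\<close>

lemma basis_dual_vectors:
  assumes bas: "is_basis l (ext_cols a) (Inl ` S \<union> Inr ` {..<l}) D"
  shows "card D = l"
    and "\<exists>X :: nat + nat \<Rightarrow> nat \<Rightarrow> rat.
      (\<forall>i<l. \<forall>i'<l. (\<Sum>e\<in>D. X e i * of_int (ext_cols a e i')) = (if i = i' then 1 else 0)) \<and>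
      (\<forall>e\<in>D. \<forall>e'\<in>D. (\<Sum>i<l. X e i * of_int (ext_cols a e' i)) = (if e = e' then 1 else 0))"
proof -
  let ?U = "Inr ` {..<l} :: (nat + nat) set"
  have sumU: "(\<Sum>e\<in>?U. c e * of_int (ext_cols a e i)) = c (Inr i)"
    if "i < l" for c :: "nat + nat \<Rightarrow> rat" and i
    using that by (subst sum.reindex) (auto simp: sum.delta if_distrib cong: if_cong)
  have "is_basis l (ext_cols a) (Inl ` S \<union> ?U) ?U"
    unfolding is_basis_def
  proof (intro conjI ballI)
    show "finite (Inl ` S \<union> ?U)" using bas unfolding is_basis_def by blast
    show "indep l (ext_cols a) ?U"
      unfolding indep_def by (simp add: sumU del: ext_cols.simps)
    fix j assume "j \<in> Inl ` S \<union> ?U"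
    show "in_span l (ext_cols a) ?U (ext_cols a j)"
      unfolding in_span_def
      by (rule exI[of _ "\<lambda>e. case e of Inr i \<Rightarrow> of_int (ext_cols a j i) | Inl _ \<Rightarrow> 0"])
        (simp add: sumU del: ext_cols.simps)
  qed auto
  from basis_card_unique[OF bas this] show "card D = l"
    by (simp add: card_image)
  have finD: "finite D" using bas by (rule basis_finite)
  have "\<exists>c :: nat + nat \<Rightarrow> rat. \<forall>i'<l. (\<Sum>d\<in>D. c d * of_int (ext_cols a d i')) = (if i = i' then 1 else 0)"
    if "i < l" for i
  proof -
    have "in_span l (ext_cols a) D (ext_cols a (Inr i))"
      using bas that unfolding is_basis_def by auto
    then obtain c :: "nat + nat \<Rightarrow> rat" where
      "\<forall>i'<l. of_int (ext_cols a (Inr i) i') = (\<Sum>d\<in>D. c d * of_int (ext_cols a d i'))"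
      unfolding in_span_def by blast
    then show ?thesis by (intro exI[of _ c]) (auto split: if_splits)
  qed
  then have "\<forall>i. \<exists>c :: nat + nat \<Rightarrow> rat. i < l \<longrightarrow>
    (\<forall>i'<l. (\<Sum>d\<in>D. c d * of_int (ext_cols a d i')) = (if i = i' then 1 else 0))" by blast
  then obtain Y :: "nat \<Rightarrow> nat + nat \<Rightarrow> rat" where Y: "\<And>i i'. i < l \<Longrightarrow> i' < l \<Longrightarrow>
      (\<Sum>d\<in>D. Y i d * of_int (ext_cols a d i')) = (if i = i' then 1 else 0)"
    by metis
  have "(\<Sum>i<l. Y i e * of_int (ext_cols a e' i)) = (if e = e' then 1 else 0)"
    if e: "e \<in> D" "e' \<in> D" for e e'
  proof -
    \<comment> \<open>For fixed \<open>e'\<close>, the defect of the second identity is a relation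
      among the vectors indexed by \<open>D\<close>, hence zero.\<close>
    define z :: "nat + nat \<Rightarrow> rat" where
      "z e = (\<Sum>i<l. Y i e * of_int (ext_cols a e' i)) - (if e = e' then 1 else 0)" for e
    have "(\<Sum>d\<in>D. z d * of_int (ext_cols a d i')) = 0" if "i' < l" for i'
    proof -
      have "(\<Sum>d\<in>D. (\<Sum>i<l. Y i d * of_int (ext_cols a e' i)) * of_int (ext_cols a d i'))
        = (\<Sum>i<l. of_int (ext_cols a e' i) * (\<Sum>d\<in>D. Y i d * of_int (ext_cols a d i')))"
        unfolding sum_distrib_right sum_distrib_left
        by (subst sum.swap) (simp add: mult_ac)
      also have "\<dots> = (\<Sum>i<l. of_int (ext_cols a e' i) * (if i = i' then 1 else 0))"
        using Y that by (intro sum.cong) auto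
      also have "\<dots> = of_int (ext_cols a e' i')"
        using that by (simp add: if_distrib sum.delta cong: if_cong)
      also have "\<dots> = (\<Sum>d\<in>D. (if d = e' then 1 else 0) * of_int (ext_cols a d i'))"
        using e finD by (simp add: if_distrib[of "\<lambda>x. x * _"] sum.delta cong: if_cong)
      finally show ?thesis by (simp add: z_def left_diff_distrib sum_subtractf)
    qed
    moreover have "indep l (ext_cols a) D" using bas by (simp add: is_basis_def)
    ultimately have "z e = 0" using e(1) unfolding indep_def by simp
    then show ?thesis by (simp add: z_def)
  qed
  then show "\<exists>X :: nat + nat \<Rightarrow> nat \<Rightarrow> rat.
      (\<forall>i<l. \<forall>i'<l. (\<Sum>e\<in>D. X e i * of_int (ext_cols a e i')) = (if i = i' then 1 else 0)) \<and>
      (\<forall>e\<in>D. \<forall>e'\<in>D. (\<Sum>i<l. X e i * of_int (ext_cols a e' i)) = (if e = e' then 1 else 0))"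
    using Y by (intro exI[of _ "\<lambda>e i. Y i e"]) auto
qed

text \<open>The unit vectors that complete \<open>D\<close> to a basis are indexed by
  \<open>R\<close>. The \<open>u d\<close> are dual to the columns. The \<open>w k\<close> span the
  vectors annihilated by \<open>D\<close>, and their entries in \<open>R\<close> form an identity
  matrix, so the positions in \<open>R\<close> serve as coordinates on that space. Later this space
  is the Lie algebra of an isotropy group.\<close>

lemma indep_dual_vectors:
  fixes a :: "nat \<Rightarrow> nat \<Rightarrow> int"
  assumes "indep l a D" "finite D"
  shows "\<exists>R u w. R \<subseteq> {..<l} \<and> card R + card D = l \<and>
    (\<forall>i<l. \<forall>i'<l. (\<Sum>d\<in>D. u d i * rat_of_int (a d i')) + (if i' \<in> R then w i' i else 0) = (if i = i' then 1 else 0)) \<and>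
    (\<forall>d\<in>D. \<forall>d'\<in>D. (\<Sum>i<l. u d i * of_int (a d' i)) = (if d = d' then 1 else 0)) \<and>
    (\<forall>k\<in>R. \<forall>d\<in>D. (\<Sum>i<l. w k i * of_int (a d i)) = 0) \<and>
    (\<forall>k\<in>R. \<forall>k'\<in>R. w k k' = (if k = k' then 1 else 0))"
proof -
  let ?S = "Inl ` D \<union> Inr ` {..<l} :: (nat + nat) set"
  have "indep l (ext_cols a) (Inl ` D)" using assms(1) by (simp add: indep_Inl)
  then obtain E where E: "Inl ` D \<subseteq> E" "is_basis l (ext_cols a) ?S E"
    using indep_extend_basis[of ?S "Inl ` D" l "ext_cols a"] assms(2) by blast
  obtain X :: "nat + nat \<Rightarrow> nat \<Rightarrow> rat" where
    X1: "\<And>i i'. i < l \<Longrightarrow> i' < l \<Longrightarrow> (\<Sum>e\<in>E. X e i * of_int (ext_cols a e i')) = (if i = i' then 1 else 0)" and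
    X2: "\<And>e e'. e \<in> E \<Longrightarrow> e' \<in> E \<Longrightarrow> (\<Sum>i<l. X e i * of_int (ext_cols a e' i)) = (if e = e' then 1 else 0)"
    using basis_dual_vectors(2)[OF E(2)] by blast
  define R where "R = {k. Inr k \<in> E}"
  have Esub: "E \<subseteq> ?S" using E(2) unfolding is_basis_def by blast
  have R: "R \<subseteq> {..<l}" using Esub by (auto simp: R_def)
  then have finR: "finite R" using finite_subset by blast
  have EE: "E = Inl ` D \<union> Inr ` R" using E(1) Esub by (auto simp: R_def)
  have "card E = card D + card R"
    unfolding EE using assms(2) finR by (subst card_Un_disjoint) (auto simp: card_image)
  then have card: "card R + card D = l" using basis_dual_vectors(1)[OF E(2)] by simp
  have sumE: "(\<Sum>e\<in>E. f e) = (\<Sum>d\<in>D. f (Inl d)) + (\<Sum>k\<in>R. f (Inr k))" for f :: "nat + nat \<Rightarrow> rat"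
    unfolding EE using assms(2) finR
    by (subst sum.union_disjoint) (auto simp: sum.reindex)
  show ?thesis
  proof (rule exI[of _ R], rule exI[of _ "\<lambda>d. X (Inl d)"], rule exI[of _ "\<lambda>k. X (Inr k)"], intro conjI allI impI ballI)
    show "R \<subseteq> {..<l}" "card R + card D = l" by fact+
    fix i i' assume "i < l" "i' < l"
    then show "(\<Sum>d\<in>D. X (Inl d) i * rat_of_int (a d i')) + (if i' \<in> R then X (Inr i') i else 0) = (if i = i' then 1 else 0)"
      using X1[of i i'] finR unfolding sumE
      by (simp add: if_distrib sum.delta' cong: if_cong)
  next
    fix d d' assume "d \<in> D" "d' \<in> D"
    then show "(\<Sum>i<l. X (Inl d) i * of_int (a d' i)) = (if d = d' then 1 else 0)"
      using X2[of "Inl d" "Inl d'"] by (simp add: EE)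
  next
    fix k d assume "k \<in> R" "d \<in> D"
    then show "(\<Sum>i<l. X (Inr k) i * of_int (a d i)) = 0"
      using X2[of "Inr k" "Inl d"] by (simp add: EE)
  next
    fix k k' assume k: "k \<in> R" "k' \<in> R"
    then have "k' < l" using R by auto
    then have "(\<Sum>i<l. X (Inr k) i * of_int (ext_cols a (Inr k') i)) = X (Inr k) k'"
      by (simp add: if_distrib sum.delta cong: if_cong)
    then show "X (Inr k) k' = (if k = k' then 1 else 0)"
      using X2[of "Inr k" "Inr k'"] k by (simp add: EE)
  qed
qed

section \<open>Krull dimension of rings of functions\<close>

definition fun_algebra :: "('a \<Rightarrow> complex) set \<Rightarrow> bool" where
  "fun_algebra F \<longleftrightarrow> (\<forall>c. (\<lambda>_. c) \<in> F) \<and> (\<forall>f\<in>F. \<forall>g\<in>F. (\<lambda>x. f x + g x) \<in> F) \<and>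
     (\<forall>f\<in>F. \<forall>g\<in>F. (\<lambda>x. f x * g x) \<in> F)"

lemma fun_algebraD:
  assumes "fun_algebra F"
  shows "(\<lambda>_. c) \<in> F" "f \<in> F \<Longrightarrow> g \<in> F \<Longrightarrow> (\<lambda>x. f x + g x) \<in> F"
    "f \<in> F \<Longrightarrow> g \<in> F \<Longrightarrow> (\<lambda>x. f x * g x) \<in> F"
  using assms unfolding fun_algebra_def by auto

lemma fun_algebra_diff:
  assumes "fun_algebra F" "f \<in> F" "g \<in> F"
  shows "(\<lambda>x. f x - g x) \<in> F"
  using fun_algebraD(2)[OF assms(1) assms(2) fun_algebraD(3)[OF assms(1) fun_algebraD(1)[OF assms(1), of "-1"] assms(3)]]
  by simp

lemma fun_algebra_power:
  assumes "fun_algebra F" "f \<in> F"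
  shows "(\<lambda>x. f x ^ k) \<in> F"
proof (induction k)
  case 0
  then show ?case using fun_algebraD(1)[OF assms(1), of 1] by simp
next
  case (Suc k)
  then show ?case using fun_algebraD(3)[OF assms(1) assms(2), of "\<lambda>x. f x ^ k"] by simp
qed

lemma fun_algebra_prod:
  assumes "fun_algebra F" "\<And>i. i \<in> I \<Longrightarrow> f i \<in> F"
  shows "(\<lambda>x. \<Prod>i\<in>I. f i x) \<in> F"
  using assms(2)
proof (induction I rule: infinite_finite_induct)
  case (insert i I)
  then have "(\<lambda>x. f i x * (\<Prod>i\<in>I. f i x)) \<in> F"
    by (intro fun_algebraD(3)[OF assms(1)]) auto
  then show ?case using insert by simp
qed (use fun_algebraD(1)[OF assms(1), of 1] in auto)

lemma fun_algebra_sum: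
  assumes "fun_algebra F" "\<And>i. i \<in> I \<Longrightarrow> f i \<in> F"
  shows "(\<lambda>x. \<Sum>i\<in>I. f i x) \<in> F"
  using assms(2)
proof (induction I rule: infinite_finite_induct)
  case (insert i I)
  then have "(\<lambda>x. f i x + (\<Sum>i\<in>I. f i x)) \<in> F"
    by (intro fun_algebraD(2)[OF assms(1)]) auto
  then show ?case using insert by simp
qed (use fun_algebraD(1)[OF assms(1), of 0] in auto)

lemma gen_algebra_fun_algebra: "fun_algebra (gen_algebra F)"
  unfolding fun_algebra_def by (auto intro: gen_algebra.intros)

lemma fun_ring_cring:
  assumes "fun_algebra F"
  shows "cring (fun_ring X F)"
proof -
  let ?R = "fun_ring X F"
  have carr: "carrier ?R = {restrict f X | f. f \<in> F}" by (simp add: fun_ring_def)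
  have ops: "f \<otimes>\<^bsub>?R\<^esub> g = restrict (\<lambda>x. f x * g x) X" "f \<oplus>\<^bsub>?R\<^esub> g = restrict (\<lambda>x. f x + g x) X"
    "\<one>\<^bsub>?R\<^esub> = restrict (\<lambda>_. 1) X" "\<zero>\<^bsub>?R\<^esub> = restrict (\<lambda>_. 0) X" for f g
    by (auto simp: fun_ring_def)
  have addc: "restrict (\<lambda>x. restrict f X x + restrict g X x) X \<in> carrier ?R" if "f \<in> F" "g \<in> F" for f g
    unfolding carr using fun_algebraD(2)[OF assms that] by (auto intro!: exI[of _ "\<lambda>x. f x + g x"])
  have mulc: "restrict (\<lambda>x. restrict f X x * restrict g X x) X \<in> carrier ?R" if "f \<in> F" "g \<in> F" for f g
    unfolding carr using fun_algebraD(3)[OF assms that] by (auto intro!: exI[of _ "\<lambda>x. f x * g x"])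
  have constc: "restrict (\<lambda>_. c) X \<in> carrier ?R" for c
    unfolding carr using fun_algebraD(1)[OF assms] by auto
  show ?thesis
  proof (intro cringI abelian_groupI comm_monoidI)
    fix f assume "f \<in> carrier ?R"
    then obtain f' where f': "f' \<in> F" "f = restrict f' X" by (auto simp: carr)
    have "(\<lambda>x. (-1) * f' x) \<in> F"
      using fun_algebraD(3)[OF assms fun_algebraD(1)[OF assms, of "-1"] f'(1)] .
    then have "restrict (\<lambda>x. (-1) * f' x) X \<in> carrier ?R" unfolding carr by blast
    moreover have "restrict (\<lambda>x. (-1) * f' x) X \<oplus>\<^bsub>?R\<^esub> f = \<zero>\<^bsub>?R\<^esub>"
      unfolding ops f' by (auto simp: fun_eq_iff)
    ultimately show "\<exists>y\<in>carrier ?R. y \<oplus>\<^bsub>?R\<^esub> f = \<zero>\<^bsub>?R\<^esub>" by blast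
  qed (auto simp: ops carr addc[unfolded carr, simplified] mulc[unfolded carr, simplified]
      constc[unfolded carr, simplified] fun_eq_iff algebra_simps restrict_def
      intro!: fun_algebraD[OF assms])
qed

text \<open>A prime ideal of \<open>fun_ring X F\<close>, pulled back to \<open>F\<close>:
  containing all functions that vanish on \<open>X\<close> is what makes it a full preimage. Chains
  can then be handled without restricting functions.\<close>

definition prime_fun_ideal :: "'a set \<Rightarrow> ('a \<Rightarrow> complex) set \<Rightarrow> ('a \<Rightarrow> complex) set \<Rightarrow> bool" where
  "prime_fun_ideal X F P \<longleftrightarrow> P \<subseteq> F \<and> (\<forall>f\<in>P. \<forall>g\<in>P. (\<lambda>x. f x + g x) \<in> P) \<and>
     (\<forall>f\<in>F. \<forall>g\<in>P. (\<lambda>x. f x * g x) \<in> P) \<and>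
     (\<forall>f\<in>F. \<forall>g\<in>F. (\<lambda>x. f x * g x) \<in> P \<longrightarrow> f \<in> P \<or> g \<in> P) \<and>
     (\<lambda>_. 1) \<notin> P \<and> (\<forall>f\<in>F. (\<forall>x\<in>X. f x = 0) \<longrightarrow> f \<in> P)"

lemma prime_fun_idealD:
  assumes "prime_fun_ideal X F P"
  shows "P \<subseteq> F" "f \<in> P \<Longrightarrow> g \<in> P \<Longrightarrow> (\<lambda>x. f x + g x) \<in> P"
    "f \<in> F \<Longrightarrow> g \<in> P \<Longrightarrow> (\<lambda>x. f x * g x) \<in> P"
    "f \<in> F \<Longrightarrow> g \<in> F \<Longrightarrow> (\<lambda>x. f x * g x) \<in> P \<Longrightarrow> f \<in> P \<or> g \<in> P"
    "(\<lambda>_. 1) \<notin> P" "f \<in> F \<Longrightarrow> (\<And>x. x \<in> X \<Longrightarrow> f x = 0) \<Longrightarrow> f \<in> P"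
  using assms unfolding prime_fun_ideal_def by auto

lemma prime_fun_ideal_cong:
  assumes "fun_algebra F" "prime_fun_ideal X F P" "f \<in> P" "g \<in> F" "\<And>x. x \<in> X \<Longrightarrow> f x = g x"
  shows "g \<in> P"
proof -
  have "f \<in> F" using prime_fun_idealD(1)[OF assms(2)] assms(3) by auto
  then have "(\<lambda>x. g x - f x) \<in> P"
    using assms by (intro prime_fun_idealD(6)[OF assms(2)] fun_algebra_diff) auto
  from prime_fun_idealD(2)[OF assms(2) assms(3) this] show ?thesis by simp
qed

lemma restrict_eqD: "restrict f X = restrict g X \<Longrightarrow> x \<in> X \<Longrightarrow> f x = g x"
  by (metis restrict_apply')

text \<open>With its converse below, this is the correspondence between primes of a quotient ring
  and primes containing the kernel.\<close>

lemma primeideal_of_prime_fun_ideal: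
  assumes F: "fun_algebra F" and P: "prime_fun_ideal X F P"
  shows "primeideal ((\<lambda>f. restrict f X) ` P) (fun_ring X F)"
proof -
  let ?R = "fun_ring X F" and ?I = "(\<lambda>f. restrict f X) ` P"
  interpret R: cring ?R by (rule fun_ring_cring[OF F])
  have carr: "carrier ?R = (\<lambda>f. restrict f X) ` F" by (auto simp: fun_ring_def)
  have mult: "restrict f X \<otimes>\<^bsub>?R\<^esub> restrict g X = restrict (\<lambda>x. f x * g x) X" for f g
    by (auto simp: fun_ring_def)
  have add: "restrict f X \<oplus>\<^bsub>?R\<^esub> restrict g X = restrict (\<lambda>x. f x + g x) X" for f g
    by (auto simp: fun_ring_def)
  have backP: "f \<in> P" if "f \<in> F" "restrict f X \<in> ?I" for f
  proof -
    from that(2) obtain g where "g \<in> P" "restrict f X = restrict g X" by auto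
    then show ?thesis
      using prime_fun_ideal_cong[OF F P _ that(1)] restrict_eqD[of g X f] by metis
  qed
  have sub: "?I \<subseteq> carrier ?R" using prime_fun_idealD(1)[OF P] by (auto simp: carr)
  have lmult: "x \<otimes>\<^bsub>?R\<^esub> i \<in> ?I" if "i \<in> ?I" "x \<in> carrier ?R" for i x
  proof -
    from that obtain f g where "f \<in> F" "x = restrict f X" "g \<in> P" "i = restrict g X"
      by (auto simp: carr)
    then show ?thesis using prime_fun_idealD(3)[OF P] by (auto simp: mult)
  qed
  have neg: "\<ominus>\<^bsub>?R\<^esub> i \<in> ?I" if "i \<in> ?I" for i
  proof -
    have "\<ominus>\<^bsub>?R\<^esub> i = (\<ominus>\<^bsub>?R\<^esub> \<one>\<^bsub>?R\<^esub>) \<otimes>\<^bsub>?R\<^esub> i"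
      using that sub by (simp add: R.l_minus subsetD)
    then show ?thesis using lmult[OF that, of "\<ominus>\<^bsub>?R\<^esub> \<one>\<^bsub>?R\<^esub>"] by simp
  qed
  have "(\<lambda>_. 0) \<in> P" by (rule prime_fun_idealD(6)[OF P fun_algebraD(1)[OF F]]) simp
  then have ne: "?I \<noteq> {}" by blast
  have subg: "subgroup ?I (add_monoid ?R)"
  proof (rule R.add.subgroupI)
    show "a \<oplus>\<^bsub>?R\<^esub> b \<in> ?I" if "a \<in> ?I" "b \<in> ?I" for a b
      using that prime_fun_idealD(2)[OF P] by (auto simp: add)
  qed (use sub ne neg in \<open>auto simp: a_inv_def\<close>)
  have "ideal ?I ?R"
  proof (rule idealI)
    show "ring ?R" by (rule R.ring_axioms)
    show "i \<otimes>\<^bsub>?R\<^esub> x \<in> ?I" if "i \<in> ?I" "x \<in> carrier ?R" for i x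
      using lmult[OF that] that sub R.m_comm[of i x] by (simp add: subsetD)
  qed (use subg lmult in auto)
  then show ?thesis
  proof (rule primeidealI)
    show "cring ?R" by (rule R.cring_axioms)
    show "carrier ?R \<noteq> ?I"
    proof
      assume "carrier ?R = ?I"
      moreover have "restrict (\<lambda>_. 1) X \<in> carrier ?R"
        using fun_algebraD(1)[OF F, of 1] by (auto simp: carr)
      ultimately have "(\<lambda>_. 1) \<in> P" by (intro backP fun_algebraD(1)[OF F]) simp
      then show False using prime_fun_idealD(5)[OF P] by blast
    qed
    fix a b assume "a \<in> carrier ?R" "b \<in> carrier ?R" "a \<otimes>\<^bsub>?R\<^esub> b \<in> ?I"
    then obtain f g where fg: "f \<in> F" "g \<in> F" "a = restrict f X" "b = restrict g X"
        "restrict (\<lambda>x. f x * g x) X \<in> ?I"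
      by (auto simp: carr mult)
    then have "(\<lambda>x. f x * g x) \<in> P" by (intro backP fun_algebraD(3)[OF F]) auto
    then show "a \<in> ?I \<or> b \<in> ?I" using prime_fun_idealD(4)[OF P fg(1,2)] fg(3,4) by auto
  qed
qed

lemma prime_fun_ideal_of_primeideal:
  assumes F: "fun_algebra F" and I: "primeideal I (fun_ring X F)"
  shows "prime_fun_ideal X F {f \<in> F. restrict f X \<in> I}"
proof -
  let ?R = "fun_ring X F"
  interpret I: primeideal I ?R by (rule I)
  have carr: "carrier ?R = (\<lambda>f. restrict f X) ` F" by (auto simp: fun_ring_def)
  have mult: "restrict (\<lambda>x. f x * g x) X = restrict f X \<otimes>\<^bsub>?R\<^esub> restrict g X" for f g
    by (auto simp: fun_ring_def)
  have add: "restrict (\<lambda>x. f x + g x) X = restrict f X \<oplus>\<^bsub>?R\<^esub> restrict g X" for f g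
    by (auto simp: fun_ring_def)
  show ?thesis
    unfolding prime_fun_ideal_def
  proof (intro conjI ballI impI)
    fix f g assume "f \<in> {f \<in> F. restrict f X \<in> I}" "g \<in> {f \<in> F. restrict f X \<in> I}"
    then show "(\<lambda>x. f x + g x) \<in> {f \<in> F. restrict f X \<in> I}"
      by (auto simp: add intro: fun_algebraD(2)[OF F])
  next
    fix f g assume "f \<in> F" "g \<in> {f \<in> F. restrict f X \<in> I}"
    then show "(\<lambda>x. f x * g x) \<in> {f \<in> F. restrict f X \<in> I}"
      by (auto simp: mult carr intro!: I.I_l_closed fun_algebraD(3)[OF F])
  next
    fix f g assume "f \<in> F" "g \<in> F" "(\<lambda>x. f x * g x) \<in> {f \<in> F. restrict f X \<in> I}"
    then show "f \<in> {f \<in> F. restrict f X \<in> I} \<or> g \<in> {f \<in> F. restrict f X \<in> I}"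
      using I.I_prime[of "restrict f X" "restrict g X"] by (auto simp: mult carr)
  next
    have "\<one>\<^bsub>?R\<^esub> \<notin> I" using I.one_imp_carrier I.I_notcarr by auto
    then show "(\<lambda>_. 1) \<notin> {f \<in> F. restrict f X \<in> I}" by (simp add: fun_ring_def)
  next
    fix f assume "f \<in> F" "\<forall>x\<in>X. f x = 0"
    moreover from this have "restrict f X = \<zero>\<^bsub>?R\<^esub>" by (auto simp: fun_ring_def restrict_def)
    ultimately show "f \<in> {f \<in> F. restrict f X \<in> I}" by simp
  qed auto
qed

lemma krull_dim_geI:
  assumes F: "fun_algebra F" and P: "\<And>i. i \<le> k \<Longrightarrow> prime_fun_ideal X F (P i)"
    and less: "\<And>i. i < k \<Longrightarrow> P i \<subset> P (Suc i)"
  shows "krull_dim (fun_ring X F) \<ge> ereal (real k)"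
proof -
  define Q where "Q i = (\<lambda>f. restrict f X) ` P i" for i
  have "Q i \<subset> Q (Suc i)" if "i < k" for i
  proof -
    have "P i \<subset> P (Suc i)" using less that by simp
    then obtain f where f: "f \<in> P (Suc i)" "f \<notin> P i" by blast
    have nin: "restrict f X \<notin> Q i"
    proof
      assume "restrict f X \<in> Q i"
      then obtain g where g: "g \<in> P i" "restrict f X = restrict g X" by (auto simp: Q_def)
      have "f \<in> F" using f(1) P[of "Suc i"] that prime_fun_idealD(1) by (metis Suc_leI subsetD)
      then have "f \<in> P i"
        using prime_fun_ideal_cong[OF F _ g(1)] P[of i] that restrict_eqD[OF g(2)[symmetric]] by simp
      then show False using f(2) by blast
    qed
    have "Q i \<subseteq> Q (Suc i)" using \<open>P i \<subset> P (Suc i)\<close> unfolding Q_def by (intro image_mono) auto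
    then show ?thesis using nin imageI[OF f(1), of "\<lambda>f. restrict f X"] unfolding Q_def by auto
  qed
  moreover have "primeideal (Q i) (fun_ring X F)" if "i \<le> k" for i
    unfolding Q_def using primeideal_of_prime_fun_ideal[OF F P[OF that]] .
  ultimately show ?thesis
    unfolding krull_dim_def
    by (intro Sup_upper CollectI exI[of _ k] conjI refl exI[of _ Q] allI impI) auto
qed

text \<open>A longer chain is cut off after \<open>Suc k\<close> inclusions, so only chains of that
  one length have to be excluded.\<close>

lemma krull_dim_leI:
  assumes F: "fun_algebra F"
    and no: "\<And>P. (\<And>i. i \<le> Suc k \<Longrightarrow> prime_fun_ideal X F (P i)) \<Longrightarrow> (\<And>i. i \<le> k \<Longrightarrow> P i \<subset> P (Suc i)) \<Longrightarrow> False"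
  shows "krull_dim (fun_ring X F) \<le> ereal (real k)"
  unfolding krull_dim_def
proof (rule Sup_least, safe)
  fix j and I :: "nat \<Rightarrow> ('a \<Rightarrow> complex) set"
  assume I: "\<forall>i\<le>j. primeideal (I i) (fun_ring X F)" "\<forall>i<j. I i \<subset> I (Suc i)"
  show "ereal (real j) \<le> ereal (real k)"
  proof (rule ccontr)
    assume "\<not> ereal (real j) \<le> ereal (real k)"
    then have j: "Suc k \<le> j" by simp
    let ?P = "\<lambda>i. {f \<in> F. restrict f X \<in> I i}"
    show False
    proof (rule no[of ?P])
      show "prime_fun_ideal X F (?P i)" if "i \<le> Suc k" for i
        using prime_fun_ideal_of_primeideal[OF F] I(1) that j by auto
      fix i assume i: "i \<le> k"
      then have "I i \<subset> I (Suc i)" using I(2) j by auto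
      then obtain f where f: "f \<in> I (Suc i)" "f \<notin> I i" "I i \<subseteq> I (Suc i)" by auto
      interpret I: primeideal "I (Suc i)" "fun_ring X F" using I(1) i j by auto
      have "f \<in> carrier (fun_ring X F)" using f(1) by (rule I.a_Hcarr)
      then show "?P i \<subset> ?P (Suc i)" using f by (auto simp: fun_ring_def)
    qed
  qed
qed

text \<open>Any two points lie on an entire curve along which the functions in F are holomorphic; by
  the identity theorem the functions vanishing on such a set form a prime ideal.\<close>

definition entire_connected :: "('a \<Rightarrow> complex) set \<Rightarrow> 'a set \<Rightarrow> bool" where
  "entire_connected F Y \<longleftrightarrow> Y \<noteq> {} \<and> (\<forall>a\<in>Y. \<forall>b\<in>Y. \<exists>c :: complex \<Rightarrow> 'a. (\<forall>s. c s \<in> Y) \<and> c 0 = a \<and> c 1 = b \<and>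
     (\<forall>f\<in>F. (\<lambda>s. f (c s)) holomorphic_on UNIV))"

text \<open>\<open>f\<close> has no zero near \<open>a\<close>, so \<open>g\<close> vanishes there
  and, by the identity theorem, everywhere.\<close>

lemma entire_product_zero:
  fixes f g :: "complex \<Rightarrow> complex"
  assumes "f holomorphic_on UNIV" "g holomorphic_on UNIV" "\<And>z. f z * g z = 0" "f a \<noteq> 0"
  shows "g b = 0"
proof -
  have cont: "isCont f a"
    using assms(1) holomorphic_on_imp_continuous_on continuous_on_eq_continuous_at by blast
  define U where "U = {z. f z \<noteq> 0}"
  have "open U" unfolding U_def
    using holomorphic_on_imp_continuous_on[OF assms(1)]
    by (intro open_Collect_neq continuous_intros) auto
  then have "a islimpt U" using assms(4)
    by (intro interior_limit_point) (simp add: interior_open U_def)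
  moreover have "g z = 0" if "z \<in> U" for z using assms(3)[of z] that by (auto simp: U_def)
  ultimately show ?thesis
    using analytic_continuation[OF assms(2), of U a b] by auto
qed

lemma entire_connected_prime:
  assumes F: "fun_algebra F" and Y: "entire_connected F Y" "Y \<subseteq> X"
  shows "prime_fun_ideal X F {f \<in> F. \<forall>y\<in>Y. f y = 0}"
  unfolding prime_fun_ideal_def
proof (intro conjI ballI impI)
  fix f g assume fg: "f \<in> F" "g \<in> F" "(\<lambda>x. f x * g x) \<in> {f \<in> F. \<forall>y\<in>Y. f y = 0}"
  show "f \<in> {f \<in> F. \<forall>y\<in>Y. f y = 0} \<or> g \<in> {f \<in> F. \<forall>y\<in>Y. f y = 0}"
  proof (rule ccontr)
    assume "\<not> ?thesis"
    then obtain a b where ab: "a \<in> Y" "f a \<noteq> 0" "b \<in> Y" "g b \<noteq> 0" using fg by auto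
    have "\<exists>c :: complex \<Rightarrow> 'a. (\<forall>s. c s \<in> Y) \<and> c 0 = a \<and> c 1 = b \<and>
        (\<forall>f\<in>F. (\<lambda>s. f (c s)) holomorphic_on UNIV)"
      using Y(1) ab(1,3) unfolding entire_connected_def by simp
    then obtain c :: "complex \<Rightarrow> 'a" where c: "\<forall>s. c s \<in> Y" "c 0 = a" "c 1 = b"
        and hol: "\<forall>f\<in>F. (\<lambda>s. f (c s)) holomorphic_on UNIV" by (elim exE conjE)
    have zero: "f (c z) * g (c z) = 0" for z using fg(3) c(1) by simp
    have "g (c 1) = 0"
      using entire_product_zero[OF hol[rule_format, OF fg(1)] hol[rule_format, OF fg(2)] zero, of 0 1] c(2) ab(2) by simp
    then show False using c ab by simp
  qed
qed (use assms in \<open>auto simp: entire_connected_def intro: fun_algebraD[OF F]\<close>)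

text \<open>The vanishing ideals of decreasing sets increase, and one function of \<open>F\<close>
  for each step witnesses that the inclusion is strict. All lower bounds for dimensions in the
  sequel are obtained by exhibiting such a chain.\<close>

lemma krull_dim_ge_chain:
  assumes F: "fun_algebra F"
    and Y: "\<And>i. i \<le> k \<Longrightarrow> entire_connected F (Y i)" "\<And>i. i \<le> k \<Longrightarrow> Y i \<subseteq> X"
    and sub: "\<And>i. i < k \<Longrightarrow> Y (Suc i) \<subseteq> Y i"
    and sep: "\<And>i. i < k \<Longrightarrow> \<exists>g\<in>F. (\<forall>y\<in>Y (Suc i). g y = 0) \<and> (\<exists>y\<in>Y i. g y \<noteq> 0)"
  shows "krull_dim (fun_ring X F) \<ge> ereal (real k)"
proof (rule krull_dim_geI[OF F, where P = "\<lambda>i. {f \<in> F. \<forall>y\<in>Y i. f y = 0}"])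
  show "prime_fun_ideal X F {f \<in> F. \<forall>y\<in>Y i. f y = 0}" if "i \<le> k" for i
    by (rule entire_connected_prime[OF F Y[OF that]])
  show "{f \<in> F. \<forall>y\<in>Y i. f y = 0} \<subset> {f \<in> F. \<forall>y\<in>Y (Suc i). f y = 0}" if "i < k" for i
    using sub[OF that] sep[OF that] by blast
qed

section \<open>Spans of monomials and growth of function algebras\<close>

inductive_set fspan :: "'a set \<Rightarrow> ('a \<Rightarrow> complex) set \<Rightarrow> ('a \<Rightarrow> complex) set"
  for X M where
  zero: "(\<And>x. x \<in> X \<Longrightarrow> f x = 0) \<Longrightarrow> f \<in> fspan X M"
| step: "g \<in> fspan X M \<Longrightarrow> \<mu> \<in> M \<Longrightarrow> (\<And>x. x \<in> X \<Longrightarrow> f x = c * \<mu> x + g x) \<Longrightarrow> f \<in> fspan X M"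

lemma fspan_scaled: "\<mu> \<in> M \<Longrightarrow> (\<And>x. x \<in> X \<Longrightarrow> f x = c * \<mu> x) \<Longrightarrow> f \<in> fspan X M"
  by (rule fspan.step[OF fspan.zero[of X "\<lambda>_. 0"], of \<mu>]) auto

lemma fspan_cong:
  assumes "f \<in> fspan X M" "\<And>x. x \<in> X \<Longrightarrow> g x = f x"
  shows "g \<in> fspan X M"
  using assms(1)
proof cases
  case zero
  then show ?thesis using assms(2) by (intro fspan.zero) auto
next
  case (step h \<mu> c)
  then show ?thesis using assms(2) by (intro fspan.step[OF step(1,2)]) auto
qed

lemma fspan_mono:
  assumes "f \<in> fspan X M" "M \<subseteq> N"
  shows "f \<in> fspan X N"
  using assms(1)
proof induction
  case (zero f)
  then show ?case by (rule fspan.zero)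
next
  case (step g \<mu> f c)
  have "\<mu> \<in> N" using step.hyps(2) assms(2) by auto
  then show ?case by (rule fspan.step[OF step.IH]) (rule step.hyps(3))
qed

lemma fspan_add:
  assumes "f \<in> fspan X M" "g \<in> fspan X M"
  shows "(\<lambda>x. f x + g x) \<in> fspan X M"
  using assms(1)
proof induction
  case (zero f)
  show ?case by (rule fspan_cong[OF assms(2)]) (simp add: zero)
next
  case (step h \<mu> f c)
  show ?case by (rule fspan.step[OF step.IH step.hyps(2), of _ c]) (simp add: step.hyps(3))
qed

lemma fspan_scale:
  assumes "f \<in> fspan X M"
  shows "(\<lambda>x. c * f x) \<in> fspan X M"
  using assms
proof induction
  case (zero f)
  show ?case by (rule fspan.zero) (simp add: zero)
next
  case (step h \<mu> f d)
  show ?case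
    by (rule fspan.step[OF step.IH step.hyps(2), of _ "c * d"]) (simp add: step.hyps(3) algebra_simps)
qed

lemma fspan_fspan:
  assumes "f \<in> fspan X M" "M \<subseteq> fspan X N"
  shows "f \<in> fspan X N"
  using assms(1)
proof induction
  case (zero f)
  show ?case by (rule fspan.zero) (simp add: zero)
next
  case (step h \<mu> f d)
  have "(\<lambda>x. d * \<mu> x) \<in> fspan X N" using step.hyps(2) assms(2) by (intro fspan_scale) auto
  from fspan_add[OF this step.IH] show ?case by (rule fspan_cong) (simp add: step.hyps(3))
qed

lemma fspan_mult:
  assumes "f \<in> fspan X M" "g \<in> fspan X N" and mult: "\<And>\<mu> \<nu>. \<mu> \<in> M \<Longrightarrow> \<nu> \<in> N \<Longrightarrow> (\<lambda>x. \<mu> x * \<nu> x) \<in> K"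
  shows "(\<lambda>x. f x * g x) \<in> fspan X K"
  using assms(1)
proof induction
  case (zero f)
  show ?case by (rule fspan.zero) (simp add: zero)
next
  case (step h \<mu> f c)
  have "(\<lambda>x. \<mu> x * g x) \<in> fspan X K"
    using assms(2)
  proof induction
    case (zero f)
    show ?case by (rule fspan.zero) (simp add: zero)
  next
    case (step h \<nu> f d)
    show ?case
      by (rule fspan.step[OF step.IH mult[OF \<open>\<mu> \<in> M\<close> step.hyps(2)], of _ d])
        (simp add: step.hyps(3) algebra_simps)
  qed
  from fspan_add[OF fspan_scale[OF this, of c] step.IH] show ?case
    by (rule fspan_cong) (simp add: step.hyps(3) algebra_simps)
qed

lemma fspan_family:
  assumes "f \<in> fspan X M"
  shows "\<exists>(k::nat) c \<mu>. (\<forall>i<k. \<mu> i \<in> M) \<and> (\<forall>x\<in>X. f x = (\<Sum>i<k. c i * \<mu> i x))"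
  using assms
proof induction
  case (zero f)
  then show ?case by (intro exI[of _ 0]) auto
next
  case (step g \<mu> f c)
  then obtain k d \<nu> where k: "\<forall>i<(k::nat). \<nu> i \<in> M" "\<forall>x\<in>X. g x = (\<Sum>i<k. d i * \<nu> i x)" by auto
  show ?case
  proof (intro exI conjI)
    show "\<forall>i<Suc k. (\<nu>(k := \<mu>)) i \<in> M" using k step.hyps by (auto simp: less_Suc_eq)
    show "\<forall>x\<in>X. f x = (\<Sum>i<Suc k. (d(k := c)) i * (\<nu>(k := \<mu>)) i x)"
      using k(2) step.hyps(3) by simp
  qed
qed

lemma fspan_finite:
  assumes "f \<in> fspan X B" "finite B"
  shows "\<exists>c. \<forall>x\<in>X. f x = (\<Sum>b\<in>B. c b * b x)"
  using assms(1)
proof induction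
  case (zero f)
  then show ?case by (intro exI[of _ "\<lambda>_. 0"]) auto
next
  case (step g \<mu> f c)
  then obtain d where d: "\<forall>x\<in>X. g x = (\<Sum>b\<in>B. d b * b x)" by blast
  have "f x = (\<Sum>b\<in>B. (d(\<mu> := d \<mu> + c)) b * b x)" if "x \<in> X" for x
  proof -
    have "(\<Sum>b\<in>B. (d(\<mu> := d \<mu> + c)) b * b x) = (\<Sum>b\<in>B. d b * b x + (if b = \<mu> then c * \<mu> x else 0))"
      by (intro sum.cong) (auto simp: algebra_simps)
    also have "\<dots> = g x + c * \<mu> x"
      using assms(2) step.hyps(2) d that by (simp add: sum.distrib)
    finally show ?thesis using step.hyps(3)[OF that] by simp
  qed
  then show ?case by blast
qed

text \<open>The \<open>M k\<close> form a multiplicative filtration by families of monomials. Since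
  \<open>fspan\<close> compares functions on \<open>X\<close> only, monomials may afterwards be
  rewritten by relations that hold on \<open>X\<close>.\<close>

lemma gen_algebra_fspan:
  assumes gen: "\<And>f. f \<in> F \<Longrightarrow> \<exists>k. f \<in> fspan X (M k)"
    and one: "(\<lambda>_. 1) \<in> M (0::nat)"
    and mult: "\<And>i j \<mu> \<nu>. \<mu> \<in> M i \<Longrightarrow> \<nu> \<in> M j \<Longrightarrow> (\<lambda>x. \<mu> x * \<nu> x) \<in> M (i + j)"
    and mono: "\<And>i j. i \<le> j \<Longrightarrow> M i \<subseteq> M j"
    and f: "f \<in> gen_algebra F"
  shows "\<exists>k. f \<in> fspan X (M k)"
  using f
proof induction
  case (gen f)
  then show ?case using assms(1) by blast
next
  case (const c)
  have "(\<lambda>_. c) \<in> fspan X (M 0)" by (rule fspan_scaled[OF one]) simp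
  then show ?case by blast
next
  case (add f g)
  then obtain i j where "f \<in> fspan X (M i)" "g \<in> fspan X (M j)" by blast
  then have "f \<in> fspan X (M (i + j))" "g \<in> fspan X (M (i + j))"
    using fspan_mono[OF _ mono[of i "i + j"]] fspan_mono[OF _ mono[of j "i + j"]] by auto
  then show ?case using fspan_add by blast
next
  case (mult f g)
  then obtain i j where "f \<in> fspan X (M i)" "g \<in> fspan X (M j)" by blast
  then have "(\<lambda>x. f x * g x) \<in> fspan X (M (i + j))" by (rule fspan_mult) (rule assms(3))
  then show ?case by blast
qed

lemma prime_fun_ideal_sum:
  assumes "fun_algebra F" "prime_fun_ideal X F P" "\<And>i. i \<in> I \<Longrightarrow> f i \<in> P"
  shows "(\<lambda>x. \<Sum>i\<in>I. f i x) \<in> P"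
  using assms(3)
proof (induction I rule: infinite_finite_induct)
  case (insert i I)
  then have "(\<lambda>x. f i x + (\<Sum>i\<in>I. f i x)) \<in> P"
    by (intro prime_fun_idealD(2)[OF assms(2)]) auto
  then show ?case using insert by simp
qed (auto intro!: prime_fun_idealD(6)[OF assms(2)] fun_algebraD(1)[OF assms(1)])

lemma prime_fun_ideal_power_cancel:
  assumes "fun_algebra F" "prime_fun_ideal X F P" "x \<in> F" "x \<notin> P" "g \<in> F" "(\<lambda>y. x y ^ e * g y) \<in> P"
  shows "g \<in> P"
  using assms(6)
proof (induction e)
  case (Suc e)
  have "(\<lambda>y. x y ^ e * g y) \<in> F"
    using fun_algebraD(3)[OF assms(1) fun_algebra_power[OF assms(1,3)] assms(5)] .
  moreover have "(\<lambda>y. x y * (x y ^ e * g y)) \<in> P" using Suc.prems by (simp add: mult.assoc)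
  ultimately have "(\<lambda>y. x y ^ e * g y) \<in> P"
    using prime_fun_idealD(4)[OF assms(2,3)] assms(4) by blast
  then show ?case by (rule Suc.IH)
qed simp

text \<open>Dividing a relation by the lowest power of its first variable and reducing modulo the next
  prime ideal removes that variable, so a chain of primes yields algebraically independent
  functions.\<close>

lemma prime_chain_algebraically_independent:
  assumes F: "fun_algebra F" and P: "\<And>i. i \<le> Suc d \<Longrightarrow> prime_fun_ideal X F (P i)"
    and chain: "\<And>i. i \<le> d \<Longrightarrow> P i \<subseteq> P (Suc i)"
    and x: "\<And>i. i \<le> d \<Longrightarrow> x i \<in> P (Suc i)" "\<And>i. i \<le> d \<Longrightarrow> x i \<notin> P i"
    and A: "finite A" "A \<noteq> {}" "A \<subseteq> PiE {..d} (\<lambda>_. UNIV)" "\<And>\<alpha>. \<alpha> \<in> A \<Longrightarrow> c \<alpha> \<noteq> 0"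
    and rel: "\<And>y. y \<in> X \<Longrightarrow> (\<Sum>\<alpha>\<in>A. c \<alpha> * (\<Prod>i\<le>d. x i y ^ \<alpha> i)) = 0"
  shows False
proof -
  have xF: "x i \<in> F" if "i \<le> d" for i
    using x(1)[OF that] prime_fun_idealD(1)[OF P[of "Suc i"]] that by auto
  have monF: "(\<lambda>y. c \<alpha> * (\<Prod>j\<in>J. x j y ^ e j)) \<in> F" if "J \<subseteq> {..d}" for \<alpha> J and e :: "nat \<Rightarrow> nat"
    using that by (intro fun_algebraD(3)[OF F] fun_algebraD(1)[OF F] fun_algebra_prod[OF F]
      fun_algebra_power[OF F] xF) auto
  \<comment> \<open>Invariant at stage \<open>i\<close>: the surviving exponents agree in their
    first \<open>i\<close> places, and the relation that remains, in the variables from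
    \<open>i\<close> on, holds modulo \<open>P i\<close>.\<close>
  have "\<exists>A'\<subseteq>A. A' \<noteq> {} \<and> (\<forall>\<alpha>\<in>A'. \<forall>\<beta>\<in>A'. \<forall>j<i. \<alpha> j = \<beta> j) \<and>
    (\<lambda>y. \<Sum>\<alpha>\<in>A'. c \<alpha> * (\<Prod>j\<in>{i..d}. x j y ^ \<alpha> j)) \<in> P i" if "i \<le> Suc d" for i
    using that
  proof (induction i)
    case 0
    have "(\<lambda>y. \<Sum>\<alpha>\<in>A. c \<alpha> * (\<Prod>j\<in>{0..d}. x j y ^ \<alpha> j)) \<in> P 0"
      using rel by (intro prime_fun_idealD(6)[OF P] fun_algebra_sum[OF F] monF) (auto simp: atLeast0AtMost)
    then show ?case using A by (intro exI[of _ A]) auto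
  next
    case (Suc i)
    then have i: "i \<le> d" by simp
    obtain B where B: "B \<subseteq> A" "B \<noteq> {}" "\<forall>\<alpha>\<in>B. \<forall>\<beta>\<in>B. \<forall>j<i. \<alpha> j = \<beta> j"
        "(\<lambda>y. \<Sum>\<alpha>\<in>B. c \<alpha> * (\<Prod>j\<in>{i..d}. x j y ^ \<alpha> j)) \<in> P i"
      using Suc.IH i by auto
    have finB: "finite B" using B(1) A(1) finite_subset by blast
    define e where "e = Min ((\<lambda>\<alpha>. \<alpha> i) ` B)"
    have e: "e \<le> \<alpha> i" if "\<alpha> \<in> B" for \<alpha> using that finB by (auto simp: e_def)
    have "e \<in> (\<lambda>\<alpha>. \<alpha> i) ` B" unfolding e_def using finB B(2) by (intro Min_in) auto
    then obtain \<alpha>0 where \<alpha>0: "\<alpha>0 \<in> B" "\<alpha>0 i = e" by auto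
    define m where "m \<alpha> y = c \<alpha> * (\<Prod>j\<in>{Suc i..d}. x j y ^ \<alpha> j)" for \<alpha> y
    have mF: "m \<alpha> \<in> F" for \<alpha> unfolding m_def by (rule monF) auto
    have gF: "(\<lambda>y. x i y ^ k * m \<alpha> y) \<in> F" for k \<alpha>
      by (intro fun_algebraD(3)[OF F] fun_algebra_power[OF F] xF i mF)
    define g where "g y = (\<Sum>\<alpha>\<in>B. x i y ^ (\<alpha> i - e) * m \<alpha> y)" for y
    have "(\<lambda>y. \<Sum>\<alpha>\<in>B. c \<alpha> * (\<Prod>j\<in>{i..d}. x j y ^ \<alpha> j)) = (\<lambda>y. x i y ^ e * g y)"
    proof
      fix y
      have "{i..d} = insert i {Suc i..d}" using i by auto
      then have "c \<alpha> * (\<Prod>j\<in>{i..d}. x j y ^ \<alpha> j) = x i y ^ e * (x i y ^ (\<alpha> i - e) * m \<alpha> y)"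
        if "\<alpha> \<in> B" for \<alpha>
        using e[OF that] by (simp add: m_def mult_ac flip: power_add)
      then show "(\<Sum>\<alpha>\<in>B. c \<alpha> * (\<Prod>j\<in>{i..d}. x j y ^ \<alpha> j)) = x i y ^ e * g y"
        by (simp add: g_def sum_distrib_left)
    qed
    then have xg: "(\<lambda>y. x i y ^ e * g y) \<in> P i" using B(4) by simp
    have gF': "g \<in> F" unfolding g_def by (intro fun_algebra_sum[OF F] gF)
    have "prime_fun_ideal X F (P i)" using P i by simp
    from prime_fun_ideal_power_cancel[OF F this xF[OF i] x(2)[OF i] gF' xg]
    have "g \<in> P i" .
    then have g: "g \<in> P (Suc i)" using chain[OF i] by auto
    have PS: "prime_fun_ideal X F (P (Suc i))" using P Suc.prems by simp
    define B' where "B' = {\<alpha>\<in>B. \<alpha> i = e}"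
    define h where "h y = (\<Sum>\<alpha>\<in>B-B'. x i y ^ (\<alpha> i - e) * m \<alpha> y)" for y
    have "h \<in> P (Suc i)"
      unfolding h_def
    proof (rule prime_fun_ideal_sum[OF F PS])
      fix \<alpha> assume "\<alpha> \<in> B - B'"
      then have "e < \<alpha> i" using e[of \<alpha>] by (auto simp: B'_def le_less)
      then obtain k where "\<alpha> i - e = Suc k" by (metis Suc_diff_Suc)
      then have "(\<lambda>y. x i y ^ (\<alpha> i - e) * m \<alpha> y) = (\<lambda>y. (x i y ^ k * m \<alpha> y) * x i y)"
        by (auto simp: mult_ac)
      then show "(\<lambda>y. x i y ^ (\<alpha> i - e) * m \<alpha> y) \<in> P (Suc i)"
        using prime_fun_idealD(3)[OF PS gF x(1)[OF i]] by simp
    qed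
    then have "(\<lambda>y. (- 1) * h y) \<in> P (Suc i)"
      by (rule prime_fun_idealD(3)[OF PS fun_algebraD(1)[OF F]])
    from prime_fun_idealD(2)[OF PS g this] have "(\<lambda>y. g y - h y) \<in> P (Suc i)" by simp
    moreover have "g y - h y = (\<Sum>\<alpha>\<in>B'. m \<alpha> y)" for y
    proof -
      have "g y = (\<Sum>\<alpha>\<in>B'. x i y ^ (\<alpha> i - e) * m \<alpha> y) + h y"
        unfolding g_def h_def using finB by (subst add.commute, intro sum.subset_diff) (auto simp: B'_def)
      moreover have "(\<Sum>\<alpha>\<in>B'. x i y ^ (\<alpha> i - e) * m \<alpha> y) = (\<Sum>\<alpha>\<in>B'. m \<alpha> y)"
        by (intro sum.cong) (auto simp: B'_def)
      ultimately show ?thesis by simp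
    qed
    ultimately have "(\<lambda>y. \<Sum>\<alpha>\<in>B'. m \<alpha> y) \<in> P (Suc i)" by simp
    moreover have "B' \<subseteq> A" "B' \<noteq> {}" using B \<alpha>0 by (auto simp: B'_def)
    moreover have "\<forall>\<alpha>\<in>B'. \<forall>\<beta>\<in>B'. \<forall>j<Suc i. \<alpha> j = \<beta> j"
    proof (intro ballI allI impI)
      fix \<alpha> \<beta> j assume "\<alpha> \<in> B'" "\<beta> \<in> B'" "j < Suc i"
      then show "\<alpha> j = \<beta> j" using B(3) by (cases "j = i") (simp_all add: B'_def less_Suc_eq)
    qed
    ultimately show ?case unfolding m_def by (intro exI[of _ B'] conjI)
  qed
  from this[of "Suc d"] have "\<exists>A'\<subseteq>A. A' \<noteq> {} \<and> (\<forall>\<alpha>\<in>A'. \<forall>\<beta>\<in>A'. \<forall>j<Suc d. \<alpha> j = \<beta> j) \<and>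
      (\<lambda>y. \<Sum>\<alpha>\<in>A'. c \<alpha>) \<in> P (Suc d)"
    by simp
  then obtain A' where A': "A' \<subseteq> A" "A' \<noteq> {}"
      "\<forall>\<alpha>\<in>A'. \<forall>\<beta>\<in>A'. \<forall>j<Suc d. \<alpha> j = \<beta> j" "(\<lambda>y. \<Sum>\<alpha>\<in>A'. c \<alpha>) \<in> P (Suc d)"
    by (elim exE conjE)
  \<comment> \<open>All surviving exponents are equal, so a single term is left: a nonzero constant
    in a prime ideal.\<close>
  obtain \<alpha> where \<alpha>: "\<alpha> \<in> A'" using A'(2) by blast
  have "\<beta> = \<alpha>" if "\<beta> \<in> A'" for \<beta>
  proof
    fix j
    have ext: "\<beta> \<in> PiE {..d} (\<lambda>_. UNIV)" "\<alpha> \<in> PiE {..d} (\<lambda>_. UNIV)"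
      using that \<alpha> A'(1) A(3) by (meson subsetD)+
    show "\<beta> j = \<alpha> j"
    proof (cases "j < Suc d")
      case True
      then show ?thesis using A'(3)[rule_format, OF that \<alpha>] by simp
    next
      case False
      then have "j \<notin> {..d}" by simp
      then show ?thesis using PiE_arb[OF ext(1)] PiE_arb[OF ext(2)] by simp
    qed
  qed
  then have "A' = {\<alpha>}" using \<alpha> by blast
  then have "(\<lambda>y. c \<alpha>) \<in> P (Suc d)" using A'(4) by simp
  then have "(\<lambda>_. 1 / c \<alpha> * c \<alpha>) \<in> P (Suc d)"
    using prime_fun_idealD(3)[OF P[OF le_refl] fun_algebraD(1)[OF F]] by blast
  moreover have "c \<alpha> \<noteq> 0" using A(4) \<alpha> A'(1) by (meson subsetD)
  ultimately have "(\<lambda>_. 1) \<in> P (Suc d)" by simp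
  then show False using prime_fun_idealD(5)[OF P[of "Suc d"]] by simp
qed

text \<open>By counting, more than d functions in an algebra whose growth has degree d are
  algebraically dependent.\<close>

lemma krull_dim_le_growth:
  assumes F: "fun_algebra F"
    and M: "(\<lambda>_. 1) \<in> M (0::nat)" "\<And>i j \<mu> \<nu>. \<mu> \<in> M i \<Longrightarrow> \<nu> \<in> M j \<Longrightarrow> (\<lambda>x. \<mu> x * \<nu> x) \<in> M (i + j)"
      "\<And>i j. i \<le> j \<Longrightarrow> M i \<subseteq> M j"
    and gen: "\<And>f. f \<in> F \<Longrightarrow> \<exists>k. f \<in> fspan X (M k)"
    and B: "\<And>k. finite (B k)" "\<And>k. card (B k) \<le> C * (k + 1) ^ d" "\<And>k. M k \<subseteq> fspan X (B k)"
  shows "krull_dim (fun_ring X F) \<le> ereal (real d)"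
proof (rule krull_dim_leI[OF F])
  fix P assume P: "\<And>i. i \<le> Suc d \<Longrightarrow> prime_fun_ideal X F (P i)" and less: "\<And>i. i \<le> d \<Longrightarrow> P i \<subset> P (Suc i)"
  have "\<forall>i. \<exists>x. i \<le> d \<longrightarrow> x \<in> P (Suc i) \<and> x \<notin> P i" using less by blast
  then obtain x where x: "\<And>i. i \<le> d \<Longrightarrow> x i \<in> P (Suc i)" "\<And>i. i \<le> d \<Longrightarrow> x i \<notin> P i"
    by metis
  have xF: "x i \<in> F" if "i \<le> d" for i
    using x(1)[OF that] prime_fun_idealD(1)[OF P[of "Suc i"]] that by auto
  have "\<forall>i. \<exists>k. i \<le> d \<longrightarrow> x i \<in> fspan X (M k)" using gen xF by blast
  then obtain kk where kk: "\<And>i. i \<le> d \<Longrightarrow> x i \<in> fspan X (M (kk i))" by metis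
  define c0 where "c0 = (\<Sum>i\<le>d. kk i)"
  have xc: "x i \<in> fspan X (M c0)" if "i \<le> d" for i
    using that by (intro fspan_mono[OF kk[OF that] M(3)]) (auto simp: c0_def intro!: member_le_sum)
  have pow: "(\<lambda>y. x i y ^ e) \<in> fspan X (M (c0 * e))" if "i \<le> d" for i e
  proof (induction e)
    case 0
    show ?case by (rule fspan_scaled[of "\<lambda>_. 1" _ _ _ 1]) (use M(1) in auto)
  next
    case (Suc e)
    from fspan_mult[OF xc[OF that] Suc M(2)] show ?case by simp
  qed
  have prod: "(\<lambda>y. \<Prod>i\<in>J. x i y ^ \<alpha> i) \<in> fspan X (M (\<Sum>i\<in>J. c0 * \<alpha> i))" if "finite J" "J \<subseteq> {..d}" for J and \<alpha> :: "nat \<Rightarrow> nat"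
    using that
  proof (induction J rule: finite_induct)
    case empty
    show ?case by (rule fspan_scaled[of "\<lambda>_. 1" _ _ _ 1]) (use M(1) in auto)
  next
    case (insert i J)
    then have "(\<lambda>y. x i y ^ \<alpha> i * (\<Prod>i\<in>J. x i y ^ \<alpha> i)) \<in> fspan X (M (c0 * \<alpha> i + (\<Sum>i\<in>J. c0 * \<alpha> i)))"
      by (intro fspan_mult[OF pow _ M(2)]) auto
    then show ?case using insert by simp
  qed
  \<comment> \<open>Every \<open>x i\<close> lies in level \<open>c0\<close>, so a monomial in these
    d + 1 functions with exponents at most \<open>N\<close> lies in level \<open>K * N\<close>. The
    choice of \<open>N\<close> gives C (K N + 1)^d \<le> C (K + 1)^d (N + 1)^d = N (N + 1)^d, which
    is less than the number (N + 1)^(d + 1) of monomials.\<close>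
  define K where "K = c0 * (d + 1)"
  define N where "N = C * (K + 1) ^ d"
  define A where "A = PiE {..d} (\<lambda>_. {..N})"
  have cardA: "card A = (N + 1) ^ (d + 1)" unfolding A_def by (simp add: card_PiE)
  have finA: "finite A" unfolding A_def by (intro finite_PiE) auto
  have mon: "(\<lambda>y. \<Prod>i\<le>d. x i y ^ \<alpha> i) \<in> fspan X (B (K * N))" if "\<alpha> \<in> A" for \<alpha>
  proof -
    have "(\<Sum>i\<le>d. c0 * \<alpha> i) \<le> (\<Sum>i\<le>d. c0 * N)"
      using that by (intro sum_mono mult_left_mono) (auto simp: A_def)
    also have "\<dots> = K * N" by (simp add: K_def algebra_simps)
    finally have le: "(\<Sum>i\<le>d. c0 * \<alpha> i) \<le> K * N" .
    have "(\<lambda>y. \<Prod>i\<le>d. x i y ^ \<alpha> i) \<in> fspan X (M (\<Sum>i\<le>d. c0 * \<alpha> i))" by (rule prod) auto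
    from fspan_fspan[OF fspan_mono[OF this M(3)[OF le]] B(3)] show ?thesis .
  qed
  have "card (B (K * N)) \<le> C * (K * N + 1) ^ d" by (rule B(2))
  also have "\<dots> \<le> C * ((K + 1) * (N + 1)) ^ d" by (intro mult_left_mono power_mono) auto
  also have "\<dots> = N * (N + 1) ^ d" unfolding power_mult_distrib N_def by (simp only: mult.assoc)
  also have "\<dots> < (N + 1) ^ (d + 1)" by simp
  finally have lt: "card (B (K * N)) < card A" by (simp add: cardA)
  have "\<exists>m. \<alpha> \<in> A \<longrightarrow> (\<forall>y\<in>X. (\<Prod>i\<le>d. x i y ^ \<alpha> i) = (\<Sum>b\<in>B (K * N). m b * b y))" for \<alpha>
  proof (cases "\<alpha> \<in> A")
    case True
    from fspan_finite[OF mon[OF True] B(1)] show ?thesis by (elim exE) (intro exI impI)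
  qed simp
  then obtain m where m: "\<And>\<alpha> y. \<alpha> \<in> A \<Longrightarrow> y \<in> X \<Longrightarrow> (\<Prod>i\<le>d. x i y ^ \<alpha> i) = (\<Sum>b\<in>B (K * N). m \<alpha> b * b y)"
    by metis
  obtain c where c: "\<exists>\<alpha>\<in>A. c \<alpha> \<noteq> 0" "\<forall>b\<in>B (K * N). (\<Sum>\<alpha>\<in>A. c \<alpha> * m \<alpha> b) = 0"
    using homogeneous_system_solvable[OF B(1) finA lt] by blast
  have rel: "(\<Sum>\<alpha>\<in>A. c \<alpha> * (\<Prod>i\<le>d. x i y ^ \<alpha> i)) = 0" if "y \<in> X" for y
  proof -
    have "(\<Sum>\<alpha>\<in>A. c \<alpha> * (\<Prod>i\<le>d. x i y ^ \<alpha> i)) = (\<Sum>\<alpha>\<in>A. \<Sum>b\<in>B (K * N). c \<alpha> * m \<alpha> b * b y)"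
      using m that by (intro sum.cong) (auto simp: sum_distrib_left mult.assoc)
    also have "\<dots> = (\<Sum>b\<in>B (K * N). (\<Sum>\<alpha>\<in>A. c \<alpha> * m \<alpha> b) * b y)"
      by (subst sum.swap) (simp add: sum_distrib_right)
    also have "\<dots> = 0" using c(2) by simp
    finally show ?thesis .
  qed
  define A' where "A' = {\<alpha>\<in>A. c \<alpha> \<noteq> 0}"
  show False
  proof (rule prime_chain_algebraically_independent[where X = X and F = F and d = d and P = P and x = x and A = A' and c = c])
    show "P i \<subseteq> P (Suc i)" if "i \<le> d" for i using less[OF that] by blast
    show "finite A'" using finA by (simp add: A'_def)
    show "A' \<noteq> {}" using c(1) by (auto simp: A'_def)
    show "A' \<subseteq> PiE {..d} (\<lambda>_. UNIV)" by (auto simp: A'_def A_def PiE_def)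
    show "c \<alpha> \<noteq> 0" if "\<alpha> \<in> A'" for \<alpha> using that by (simp add: A'_def)
    fix y assume "y \<in> X"
    have "(\<Sum>\<alpha>\<in>A'. c \<alpha> * (\<Prod>i\<le>d. x i y ^ \<alpha> i)) = (\<Sum>\<alpha>\<in>A. c \<alpha> * (\<Prod>i\<le>d. x i y ^ \<alpha> i))"
      using finA by (intro sum.mono_neutral_left) (auto simp: A'_def)
    then show "(\<Sum>\<alpha>\<in>A'. c \<alpha> * (\<Prod>i\<le>d. x i y ^ \<alpha> i)) = 0" using rel[OF \<open>y \<in> X\<close>] by simp
  qed (use F P x in simp_all)
qed

text \<open>Independence of characters, in a form that replaces averaging over the group: a
  combination that is constant in \<open>h\<close> equals the part with trivial characters. The
  \<open>\<psi> i\<close> may coincide, so nontrivial indices are removed one at a time instead of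
  comparing coefficients.\<close>

lemma sum_trivial_characters:
  fixes \<psi> :: "'i \<Rightarrow> 'h \<Rightarrow> complex" and H :: "'h set"
  assumes "finite I" "H \<noteq> {}" and cl: "\<And>g h. g \<in> H \<Longrightarrow> h \<in> H \<Longrightarrow> m g h \<in> H"
    and hom: "\<And>i g h. i \<in> I \<Longrightarrow> g \<in> H \<Longrightarrow> h \<in> H \<Longrightarrow> \<psi> i (m g h) = \<psi> i g * \<psi> i h"
    and sum: "\<And>h. h \<in> H \<Longrightarrow> (\<Sum>i\<in>I. c i * \<psi> i h) = f"
  shows "(\<Sum>i | i \<in> I \<and> (\<forall>h\<in>H. \<psi> i h = 1). c i) = f"
  using assms(1) hom sum
proof (induction I arbitrary: c f rule: finite_psubset_induct)
  case (psubset I)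
  show ?case
  proof (cases "\<forall>i\<in>I. \<forall>h\<in>H. \<psi> i h = 1")
    case True
    obtain h where "h \<in> H" using assms(2) by auto
    then have "(\<Sum>i\<in>I. c i) = f" using psubset.prems(2)[of h] True by simp
    moreover have "{i. i \<in> I \<and> (\<forall>h\<in>H. \<psi> i h = 1)} = I" using True by auto
    ultimately show ?thesis by simp
  next
    case False
    then obtain k g where k: "k \<in> I" "g \<in> H" "\<psi> k g \<noteq> 1" by auto
    \<comment> \<open>Translating the relation by \<open>g\<close> and subtracting
      \<open>\<psi> k g\<close> times the original removes the index \<open>k\<close>. Every trivial
      character is merely scaled by the nonzero factor 1 - \<open>\<psi> k g\<close>.\<close>
    have "(\<Sum>i\<in>I-{k}. c i * (\<psi> i g - \<psi> k g) * \<psi> i h) = f * (1 - \<psi> k g)" if "h \<in> H" for h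
    proof -
      have "(\<Sum>i\<in>I-{k}. c i * (\<psi> i g - \<psi> k g) * \<psi> i h) = (\<Sum>i\<in>I. c i * (\<psi> i g - \<psi> k g) * \<psi> i h)"
        using psubset.hyps k(1) by (intro sum.mono_neutral_left) auto
      also have "\<dots> = (\<Sum>i\<in>I. c i * \<psi> i (m g h)) - \<psi> k g * (\<Sum>i\<in>I. c i * \<psi> i h)"
        using psubset.prems(1) k(2) that
        by (simp add: sum_distrib_left algebra_simps flip: sum_subtractf)
      also have "\<dots> = f - \<psi> k g * f"
        using psubset.prems(2) that cl[OF k(2) that] by simp
      finally show ?thesis by (simp add: algebra_simps)
    qed
    then have "(\<Sum>i | i \<in> I - {k} \<and> (\<forall>h\<in>H. \<psi> i h = 1). c i * (\<psi> i g - \<psi> k g)) = f * (1 - \<psi> k g)"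
      using k(1) psubset.prems(1) by (intro psubset.IH) auto
    moreover have "{i. i \<in> I - {k} \<and> (\<forall>h\<in>H. \<psi> i h = 1)} = {i. i \<in> I \<and> (\<forall>h\<in>H. \<psi> i h = 1)}"
      using k by auto
    moreover have "(\<Sum>i | i \<in> I \<and> (\<forall>h\<in>H. \<psi> i h = 1). c i * (\<psi> i g - \<psi> k g)) =
      (\<Sum>i | i \<in> I \<and> (\<forall>h\<in>H. \<psi> i h = 1). c i) * (1 - \<psi> k g)"
      using k(2) by (simp add: sum_distrib_right)
    ultimately show ?thesis using k(3) by simp
  qed
qed

no_notation fps_nth (infixl "$" 75)

section \<open>Diagonalizable groups\<close>

definition chr :: "nat \<Rightarrow> (nat \<Rightarrow> int) \<Rightarrow> complex vec \<Rightarrow> complex" where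
  "chr l b t = (\<Prod>i<l. (t $ i) powi (b i))"

text \<open>All isotropy groups of diagonal modules have this form. The group need not be connected:
  it depends on the lattice generated by the columns in \<open>S\<close>, whereas its Lie algebra
  \<open>ann l a S\<close> depends only on their span.\<close>

definition stab :: "nat \<Rightarrow> (nat \<Rightarrow> nat \<Rightarrow> int) \<Rightarrow> nat set \<Rightarrow> complex vec set" where
  "stab l a S = {t \<in> torus l. \<forall>j\<in>S. chr l (a j) t = 1}"

definition ann :: "nat \<Rightarrow> (nat \<Rightarrow> nat \<Rightarrow> int) \<Rightarrow> nat set \<Rightarrow> complex vec set" where
  "ann l a S = {X \<in> carrier_vec l. \<forall>j\<in>S. (\<Sum>i<l. of_int (a j i) * X $ i) = 0}"

lemma torusD: "t \<in> torus l \<Longrightarrow> t \<in> carrier_vec l" "t \<in> torus l \<Longrightarrow> dim_vec t = l"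
  "t \<in> torus l \<Longrightarrow> i < l \<Longrightarrow> t $ i \<noteq> 0"
  unfolding torus_def by auto

lemma torus_tmult: "s \<in> torus l \<Longrightarrow> t \<in> torus l \<Longrightarrow> tmult s t \<in> torus l"
  and torus_tone: "tone l \<in> torus l"
  and torus_tinv: "t \<in> torus l \<Longrightarrow> tinv t \<in> torus l"
  and torus_texp: "X \<in> carrier_vec l \<Longrightarrow> texp X \<in> torus l"
  unfolding torus_def tmult_def tone_def tinv_def texp_def by auto

lemma chr_nonzero: "t \<in> torus l \<Longrightarrow> chr l b t \<noteq> 0"
  unfolding chr_def torus_def by (auto simp: power_int_eq_0_iff)

lemma chr_tmult: "s \<in> torus l \<Longrightarrow> t \<in> torus l \<Longrightarrow> chr l b (tmult s t) = chr l b s * chr l b t"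
proof -
  assume "s \<in> torus l" "t \<in> torus l"
  then have "chr l b (tmult s t) = (\<Prod>i<l. (s $ i) powi (b i) * (t $ i) powi (b i))"
    unfolding chr_def by (intro prod.cong) (simp_all add: tmult_def torusD power_int_mult_distrib)
  then show ?thesis by (simp add: chr_def prod.distrib)
qed

lemma chr_tone: "chr l b (tone l) = 1"
  unfolding chr_def tone_def by simp

lemma chr_tinv: "t \<in> torus l \<Longrightarrow> chr l b (tinv t) = inverse (chr l b t)"
proof -
  assume "t \<in> torus l"
  then have "chr l b (tinv t) = (\<Prod>i<l. inverse ((t $ i) powi (b i)))"
    unfolding chr_def by (intro prod.cong) (simp_all add: tinv_def torusD power_int_inverse)
  then show ?thesis using prod_inversef[of "\<lambda>i. (t $ i) powi (b i)" "{..<l}"] by (simp add: chr_def o_def)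
qed

lemma chr_add: "t \<in> torus l \<Longrightarrow> chr l (\<lambda>i. b i + c i) t = chr l b t * chr l c t"
proof -
  assume "t \<in> torus l"
  then have "chr l (\<lambda>i. b i + c i) t = (\<Prod>i<l. (t $ i) powi (b i) * (t $ i) powi (c i))"
    unfolding chr_def by (intro prod.cong) (simp_all add: torusD power_int_add)
  then show ?thesis by (simp add: chr_def prod.distrib)
qed

lemma chr_smult: "chr l (\<lambda>i. c * b i) t = chr l b t powi c"
  unfolding chr_def
proof (induction l)
  case (Suc l)
  then show ?case by (simp add: power_int_mult_distrib power_int_mult[symmetric] mult.commute)
qed simp

lemma chr_zero: "chr l (\<lambda>_. 0) t = 1"
  unfolding chr_def by simp

lemma chr_sum:
  assumes "t \<in> torus l"
  shows "chr l (\<lambda>i. \<Sum>d\<in>D. U d * a d i) t = (\<Prod>d\<in>D. chr l (a d) t powi U d)"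
proof (induction D rule: infinite_finite_induct)
  case (insert x F)
  then show ?case
    using chr_add[OF assms, of "\<lambda>i. U x * a x i" "\<lambda>i. \<Sum>d\<in>F. U d * a d i"]
    by (simp add: chr_smult)
qed (auto simp: chr_zero)

lemma chr_cong: "(\<And>i. i < l \<Longrightarrow> b i = c i) \<Longrightarrow> chr l b t = chr l c t"
  unfolding chr_def by simp

lemma chr_unit:
  assumes "i < l"
  shows "chr l (\<lambda>i'. if i = i' then c else 0) t = (t $ i) powi c"
proof -
  have "(\<Prod>i'<l. (t $ i') powi (if i = i' then c else 0)) = (\<Prod>i'<l. if i = i' then (t $ i) powi c else 1)"
    by (intro prod.cong) auto
  then show ?thesis using assms by (simp add: chr_def)
qed

lemma chr_texp:
  assumes "X \<in> carrier_vec l"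
  shows "chr l b (texp X) = exp (\<Sum>i<l. of_int (b i) * X $ i)"
proof -
  have "chr l b (texp X) = (\<Prod>i<l. exp (of_int (b i) * X $ i))"
    unfolding chr_def texp_def using assms by (intro prod.cong) (auto simp: exp_power_int)
  then show ?thesis by (simp add: exp_sum)
qed

lemma stabD: "t \<in> stab l a S \<Longrightarrow> t \<in> torus l" "t \<in> stab l a S \<Longrightarrow> j \<in> S \<Longrightarrow> chr l (a j) t = 1"
  unfolding stab_def by auto

lemma stab_tmult: "s \<in> stab l a S \<Longrightarrow> t \<in> stab l a S \<Longrightarrow> tmult s t \<in> stab l a S"
  and stab_tone: "tone l \<in> stab l a S"
  and stab_tinv: "t \<in> stab l a S \<Longrightarrow> tinv t \<in> stab l a S"
  unfolding stab_def by (auto simp: torus_tmult torus_tone torus_tinv chr_tmult chr_tone chr_tinv)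

lemma stab_texp:
  assumes "X \<in> ann l a S"
  shows "texp X \<in> stab l a S"
  using assms unfolding stab_def ann_def by (auto simp: torus_texp chr_texp)

lemma ann_smult: "X \<in> ann l a S \<Longrightarrow> s \<cdot>\<^sub>v X \<in> ann l a S"
proof -
  assume X: "X \<in> ann l a S"
  have "(\<Sum>i<l. of_int (a j i) * (s \<cdot>\<^sub>v X) $ i) = s * (\<Sum>i<l. of_int (a j i) * X $ i)" for j
    using X by (auto simp: ann_def sum_distrib_left mult_ac intro!: sum.cong)
  then show ?thesis using X by (auto simp: ann_def)
qed

lemma exp_one_neq_one: "exp (1::complex) \<noteq> 1"
proof
  assume "exp (1::complex) = 1"
  then have "exp (1::real) = 1" by (metis exp_of_real of_real_1 of_real_eq_iff)
  then show False using exp_gt_one[of 1] by simp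
qed

text \<open>If a column of \<open>S\<close> took a value c \<noteq> 0 on \<open>X\<close>, the
  element at s = 1/c of the one-parameter group would have character value exp 1, which is not
  1.\<close>

lemma lie_algebra_stab: "lie_algebra l (stab l a S) = ann l a S"
proof (intro equalityI subsetI)
  fix X assume "X \<in> ann l a S"
  then show "X \<in> lie_algebra l (stab l a S)"
    using stab_texp[OF ann_smult] by (simp add: lie_algebra_def) (simp add: ann_def)
next
  fix X assume X: "X \<in> lie_algebra l (stab l a S)"
  then have car: "X \<in> carrier_vec l" unfolding lie_algebra_def by auto
  have "(\<Sum>i<l. of_int (a j i) * X $ i) = 0" if "j \<in> S" for j
  proof (rule ccontr)
    define c where "c = (\<Sum>i<l. of_int (a j i) * X $ i)"
    assume "(\<Sum>i<l. of_int (a j i) * X $ i) \<noteq> 0"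
    then have c: "c \<noteq> 0" by (simp add: c_def)
    have "texp ((1 / c) \<cdot>\<^sub>v X) \<in> stab l a S" using X unfolding lie_algebra_def by auto
    then have "chr l (a j) (texp ((1 / c) \<cdot>\<^sub>v X)) = 1" using that by (rule stabD)
    moreover have "(\<Sum>i<l. of_int (a j i) * ((1 / c) \<cdot>\<^sub>v X) $ i) = 1 / c * c"
      unfolding c_def sum_distrib_left using car by (intro sum.cong) auto
    ultimately have "exp (1::complex) = 1"
      using car c by (subst (asm) chr_texp) auto
    then show False using exp_one_neq_one by simp
  qed
  then show "X \<in> ann l a S" using car unfolding ann_def by auto
qed

lemma chr_laurent: "chr l b \<in> laurent_funs l"
proof -
  have alg: "fun_algebra (laurent_funs l)"
    unfolding laurent_funs_def by (rule gen_algebra_fun_algebra)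
  have "(\<lambda>t. (t $ i) powi n) \<in> laurent_funs l" if "i < l" for i n
  proof -
    have "(\<lambda>t. t $ i) \<in> laurent_funs l" "(\<lambda>t. inverse (t $ i)) \<in> laurent_funs l"
      unfolding laurent_funs_def using that by (auto intro!: gen_algebra.gen)
    from this[THEN fun_algebra_power[OF alg]] show ?thesis
      by (cases "n \<ge> 0") (simp_all add: power_int_def)
  qed
  then have "(\<lambda>t. \<Prod>i<l. (t $ i) powi (b i)) \<in> laurent_funs l"
    by (intro fun_algebra_prod[OF alg]) auto
  then show ?thesis unfolding chr_def[abs_def] .
qed

section \<open>Dimension of diagonalizable groups\<close>

lemma rat_common_denominator:
  fixes f :: "'i \<Rightarrow> rat"
  assumes "finite I"
  shows "\<exists>N::int. N > 0 \<and> (\<forall>i\<in>I. \<exists>z::int. of_int N * f i = of_int z)"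
  using assms
proof (induction I rule: finite_induct)
  case empty
  show ?case by (intro exI[of _ 1]) auto
next
  case (insert i I)
  then obtain N where N: "N > 0" "\<forall>i\<in>I. \<exists>z::int. of_int N * f i = of_int z" by blast
  obtain p q where q: "quotient_of (f i) = (p, q)" by (cases "quotient_of (f i)") auto
  have qpos: "q > 0" using quotient_of_denom_pos[OF q] .
  have fi: "f i = of_int p / of_int q" using quotient_of_div[OF q] .
  have "\<exists>z::int. of_int (N * q) * f j = of_int z" if j: "j \<in> insert i I" for j
  proof (cases "j = i")
    case True
    then show ?thesis using fi qpos by (intro exI[of _ "N * p"]) simp
  next
    case False
    then obtain z :: int where "of_int N * f j = of_int z" using N(2) j by blast
    then show ?thesis by (intro exI[of _ "z * q"]) (simp add: mult_ac)
  qed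
  then show ?case using N(1) qpos by (intro exI[of _ "N * q"]) auto
qed

lemma gen_algebra_holomorphic:
  assumes "f \<in> gen_algebra F" "\<And>g. g \<in> F \<Longrightarrow> (\<lambda>s. g (c s)) holomorphic_on UNIV"
  shows "(\<lambda>s. f (c s)) holomorphic_on UNIV"
  using assms(1) by induction (auto intro: assms(2) holomorphic_intros)

text \<open>On the group, the \<open>N\<close>-th power of each coordinate is a monomial in the
  coordinates from \<open>R\<close>, where \<open>N\<close> is a common denominator of the dual
  vectors. Up to finitely many remainders, a character with exponents at most \<open>k\<close> is
  thus a monomial in card R = l - card D coordinates with exponents of order \<open>k\<close>, and
  the growth has that degree.\<close>

lemma group_dim_stab_le:
  assumes D: "is_basis l a S D"
  shows "group_dim l (stab l a S) \<le> ereal (real (l - card D))"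
proof -
  let ?H = "stab l a S"
  have finD: "finite D" using basis_finite[OF D] .
  have "indep l a D" and DS: "D \<subseteq> S" using D by (auto simp: is_basis_def)
  from indep_dual_vectors[OF this(1) finD] obtain R u w where R: "R \<subseteq> {..<l}" "card R + card D = l"
    and uw: "\<forall>i<l. \<forall>i'<l. (\<Sum>d\<in>D. u d i * rat_of_int (a d i')) + (if i' \<in> R then w i' i else 0) = (if i = i' then 1 else 0)"
    by (elim exE conjE)
  have finR: "finite R" using R(1) finite_subset by blast
  obtain N1 where N1: "N1 > 0" "\<forall>p\<in>D\<times>{..<l}. \<exists>z::int. of_int N1 * (case p of (d, i) \<Rightarrow> u d i) = of_int z"
    using rat_common_denominator[of "D \<times> {..<l}" "\<lambda>(d, i). u d i"] finD by auto
  obtain N2 where N2: "N2 > 0" "\<forall>p\<in>R\<times>{..<l}. \<exists>z::int. of_int N2 * (case p of (k, i) \<Rightarrow> w k i) = of_int z"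
    using rat_common_denominator[of "R \<times> {..<l}" "\<lambda>(d, i). w d i"] finR by auto
  define N where "N = N1 * N2"
  have N: "N > 0" using N1 N2 by (simp add: N_def)
  have "\<exists>z::int. d \<in> D \<longrightarrow> i < l \<longrightarrow> of_int N * u d i = of_int z" for d i
  proof (cases "d \<in> D \<and> i < l")
    case True
    then obtain z :: int where "of_int N1 * u d i = of_int z" using N1(2) by auto
    then show ?thesis by (intro exI[of _ "N2 * z"]) (simp add: N_def mult_ac)
  qed simp
  then obtain U where U: "\<And>d i. d \<in> D \<Longrightarrow> i < l \<Longrightarrow> of_int N * u d i = of_int (U d i)" by metis
  have "\<exists>z::int. k \<in> R \<longrightarrow> i < l \<longrightarrow> of_int N * w k i = of_int z" for k i
  proof (cases "k \<in> R \<and> i < l")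
    case True
    then obtain z :: int where "of_int N2 * w k i = of_int z" using N2(2) by auto
    then show ?thesis by (intro exI[of _ "N1 * z"]) (simp add: N_def mult_ac)
  qed simp
  then obtain W where W: "\<And>k i. k \<in> R \<Longrightarrow> i < l \<Longrightarrow> of_int N * w k i = of_int (W k i)" by metis
  have UW: "(\<Sum>d\<in>D. U d i * a d i') + (if i' \<in> R then W i' i else 0) = (if i = i' then N else 0)"
    if "i < l" "i' < l" for i i'
  proof -
    have "rat_of_int ((\<Sum>d\<in>D. U d i * a d i') + (if i' \<in> R then W i' i else 0)) =
      of_int N * ((\<Sum>d\<in>D. u d i * rat_of_int (a d i')) + (if i' \<in> R then w i' i else 0))"
      using U W that by (simp add: distrib_left sum_distrib_left flip: mult.assoc)
    also have "\<dots> = rat_of_int (if i = i' then N else 0)" using uw[rule_format, OF that] by simp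
    finally show ?thesis by (simp only: of_int_eq_iff)
  qed
  \<comment> \<open>\<open>N\<close> times the unit vector at \<open>i\<close> is an integer
    combination of columns of \<open>D\<close>, whose characters are trivial on the group, and of
    unit vectors indexed by \<open>R\<close>.\<close>
  have key: "(t $ i) powi N = (\<Prod>k\<in>R. (t $ k) powi W k i)" if t: "t \<in> ?H" "i < l" for t i
  proof -
    have tt: "t \<in> torus l" using t(1) by (rule stabD)
    have "(t $ i) powi N = chr l (\<lambda>i'. (\<Sum>d\<in>D. U d i * a d i') + (if i' \<in> R then W i' i else 0)) t"
      using chr_unit[OF t(2), of N t] UW[OF t(2)] by (simp cong: chr_cong)
    also have "\<dots> = (\<Prod>d\<in>D. chr l (a d) t powi U d i) * chr l (\<lambda>i'. if i' \<in> R then W i' i else 0) t"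
      unfolding chr_add[OF tt] chr_sum[OF tt, of "\<lambda>d. U d i" a D] ..
    also have "(\<Prod>d\<in>D. chr l (a d) t powi U d i) = 1"
      using stabD(2)[OF t(1)] DS by (intro prod.neutral) auto
    also have "chr l (\<lambda>i'. if i' \<in> R then W i' i else 0) t = (\<Prod>k\<in>R. (t $ k) powi W k i)"
      unfolding chr_def using R(1) by (intro prod.mono_neutral_cong_right) auto
    finally show ?thesis by simp
  qed
  define C1 where "C1 = (\<Sum>k\<in>R. \<Sum>i<l. \<bar>W k i\<bar>)"
  have C1: "(\<Sum>i<l. \<bar>W k i\<bar>) \<le> C1" if "k \<in> R" for k
    unfolding C1_def using that finR by (intro member_le_sum) (auto intro: sum_nonneg)
  have C1_nonneg: "C1 \<ge> 0" unfolding C1_def by (auto intro: sum_nonneg)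
  define Idx where "Idx k = PiE R (\<lambda>_. {- (C1 * int k) .. C1 * int k}) \<times> PiE {..<l} (\<lambda>_. {0..<N})" for k :: nat
  define G where "G p = (\<lambda>t :: complex vec. (\<Prod>k\<in>R. (t $ k) powi (fst p k)) * (\<Prod>i<l. (t $ i) powi (snd p i)))"
    for p :: "(nat \<Rightarrow> int) \<times> (nat \<Rightarrow> int)"
  \<comment> \<open>Agreement is demanded on the torus only: where a coordinate is 0, the convention
    \<open>inverse 0 = 0\<close> breaks the multiplicativity of characters in their
    exponents.\<close>
  define M where "M k = {f. \<exists>b. (\<forall>i. \<bar>b i\<bar> \<le> int k) \<and> (\<forall>t\<in>torus l. f t = chr l b t)}" for k :: nat
  show ?thesis unfolding group_dim_def
  proof (rule krull_dim_le_growth[where M = M and B = "\<lambda>k. G ` Idx k" and C = "nat ((2 * C1 + 1) ^ card R * N ^ l)"])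
    show "fun_algebra (laurent_funs l)"
      unfolding laurent_funs_def by (rule gen_algebra_fun_algebra)
    show M0: "(\<lambda>_. 1) \<in> M 0" unfolding M_def by (auto intro!: exI[of _ "\<lambda>_. 0"] simp: chr_zero)
    show Mm: "(\<lambda>x. \<mu> x * \<nu> x) \<in> M (i + j)" if mn: "\<mu> \<in> M i" "\<nu> \<in> M j" for i j \<mu> \<nu>
    proof -
      from mn obtain b c where bc: "\<forall>i'. \<bar>b i'\<bar> \<le> int i" "\<forall>t\<in>torus l. \<mu> t = chr l b t"
        "\<forall>i'. \<bar>c i'\<bar> \<le> int j" "\<forall>t\<in>torus l. \<nu> t = chr l c t" unfolding M_def by blast
      have "\<bar>b k + c k\<bar> \<le> int (i + j)" for k
        using bc(1)[rule_format, of k] bc(3)[rule_format, of k] by linarith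
      moreover have "\<mu> t * \<nu> t = chr l (\<lambda>i. b i + c i) t" if "t \<in> torus l" for t
        using bc(2,4) that by (simp add: chr_add)
      ultimately show ?thesis unfolding M_def by (intro CollectI exI[of _ "\<lambda>i. b i + c i"]) simp
    qed
    show Mle: "M i \<subseteq> M j" if "i \<le> j" for i j
    proof
      fix f assume "f \<in> M i"
      then obtain b where b: "\<forall>i'. \<bar>b i'\<bar> \<le> int i" "\<forall>t\<in>torus l. f t = chr l b t" unfolding M_def by blast
      have "\<bar>b i'\<bar> \<le> int j" for i' using b(1)[rule_format, of i'] that by linarith
      then show "f \<in> M j" unfolding M_def using b(2) by blast
    qed
    show "\<exists>k. f \<in> fspan ?H (M k)" if "f \<in> laurent_funs l" for f
    proof (rule gen_algebra_fspan[OF _ M0 Mm Mle that[unfolded laurent_funs_def]])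
      fix f :: "complex vec \<Rightarrow> complex" assume "f \<in> {\<lambda>t. t $ i | i. i < l} \<union> {\<lambda>t. inverse (t $ i) | i. i < l}"
      then consider i where "i < l" "f = (\<lambda>t. t $ i)" | i where "i < l" "f = (\<lambda>t. inverse (t $ i))" by blast
      then obtain i c where i: "i < l" "c \<in> {1, -1}" and f: "f = (\<lambda>t. (t $ i) powi c)"
      proof cases
        case 1
        then show ?thesis by (intro that[of _ 1]) auto
      next
        case 2
        then show ?thesis by (intro that[of _ "-1"]) (auto simp: power_int_minus)
      qed
      have "f \<in> M 1" unfolding M_def f using i chr_unit[OF i(1), of c]
        by (intro CollectI exI[of _ "\<lambda>i'. if i = i' then c else 0"]) auto
      then have "f \<in> fspan ?H (M 1)" by (rule fspan_scaled[where c = 1]) simp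
      then show "\<exists>k. f \<in> fspan ?H (M k)" by blast
    qed
    fix k
    have finIdx: "finite (Idx k)" unfolding Idx_def using finR by (intro finite_cartesian_product finite_PiE) auto
    then show "finite (G ` Idx k)" by simp
    have "card (G ` Idx k) \<le> card (Idx k)" using finIdx by (rule card_image_le)
    also have "\<dots> = nat (2 * (C1 * int k) + 1) ^ card R * nat N ^ l"
      unfolding Idx_def using finR by (simp add: card_cartesian_product card_PiE)
    also have "nat (2 * (C1 * int k) + 1) \<le> nat ((2 * C1 + 1) * (int k + 1))"
      using C1_nonneg by (intro nat_mono) (simp add: algebra_simps)
    then have "nat (2 * (C1 * int k) + 1) ^ card R * nat N ^ l \<le> nat ((2 * C1 + 1) * (int k + 1)) ^ card R * nat N ^ l"
      by (intro mult_right_mono power_mono) auto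
    also have "\<dots> = nat ((2 * C1 + 1) ^ card R * N ^ l) * (k + 1) ^ card R"
    proof -
      have "nat (int k + 1) = k + 1" by simp
      then show ?thesis using C1_nonneg N
        by (simp only: nat_mult_distrib nat_power_eq power_mult_distrib) (simp add: nat_mult_distrib nat_power_eq power_mult_distrib mult_ac)
    qed
    finally show "card (G ` Idx k) \<le> nat ((2 * C1 + 1) ^ card R * N ^ l) * (k + 1) ^ (l - card D)"
      using R(2) by (metis diff_add_inverse2)
    show "M k \<subseteq> fspan ?H (G ` Idx k)"
    proof
      fix f assume "f \<in> M k"
      then obtain b where b: "\<And>i'. \<bar>b i'\<bar> \<le> int k" and f: "\<And>t. t \<in> torus l \<Longrightarrow> f t = chr l b t" unfolding M_def by blast
      \<comment> \<open>Write each exponent as N (b i div N) + (b i mod N): \<open>key\<close> moves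
        the multiples of \<open>N\<close> to the coordinates in \<open>R\<close>, and the remainders
        range over a finite set.\<close>
      define \<beta> where "\<beta> = restrict (\<lambda>k. \<Sum>i<l. W k i * (b i div N)) R"
      define \<gamma> where "\<gamma> = restrict (\<lambda>i. b i mod N) {..<l}"
      have bdiv: "\<bar>b i div N\<bar> \<le> int k" for i
      proof -
        have "\<bar>b i div N\<bar> \<le> \<bar>b i\<bar>"
        proof (cases "b i \<ge> 0")
          case True
          then show ?thesis
            using zdiv_mono2[OF True, of 1 N] pos_imp_zdiv_nonneg_iff[OF N, of "b i"] N by simp
        next
          case False
          then show ?thesis
            using zdiv_mono2_neg[of "b i" 1 N] pos_imp_zdiv_neg_iff[OF N, of "b i"] N by simp
        qed
        then show ?thesis using b[of i] by linarith
      qed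
      have "\<bar>\<Sum>i<l. W k' i * (b i div N)\<bar> \<le> C1 * int k" if "k' \<in> R" for k'
      proof -
        have "\<bar>\<Sum>i<l. W k' i * (b i div N)\<bar> \<le> (\<Sum>i<l. \<bar>W k' i\<bar> * int k)"
          by (rule order_trans[OF sum_abs]) (auto simp: abs_mult intro!: sum_mono mult_left_mono bdiv)
        also have "\<dots> = (\<Sum>i<l. \<bar>W k' i\<bar>) * int k" by (simp add: sum_distrib_right)
        also have "\<dots> \<le> C1 * int k" using C1[OF that] by (intro mult_right_mono) auto
        finally show ?thesis .
      qed
      then have bb: "\<beta> \<in> PiE R (\<lambda>_. {- (C1 * int k) .. C1 * int k})"
        unfolding \<beta>_def by (auto simp: abs_le_iff minus_le_iff)
      have "\<gamma> \<in> PiE {..<l} (\<lambda>_. {0..<N})" unfolding \<gamma>_def using N by auto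
      then have mem: "G (\<beta>, \<gamma>) \<in> G ` Idx k" unfolding Idx_def using bb by blast
      have "f t = 1 * G (\<beta>, \<gamma>) t" if t: "t \<in> ?H" for t
      proof -
        have tt: "t \<in> torus l" using t by (rule stabD)
        have tnz: "t $ i \<noteq> 0" if "i < l" for i using torusD(3)[OF tt that] .
        have "f t = (\<Prod>i<l. ((t $ i) powi N) powi (b i div N) * (t $ i) powi (b i mod N))"
          unfolding f[OF tt] chr_def
        proof (rule prod.cong[OF refl])
          fix i assume "i \<in> {..<l}"
          then have "(t $ i) powi (N * (b i div N) + b i mod N) = (t $ i) powi (N * (b i div N)) * (t $ i) powi (b i mod N)"
            using tnz by (intro power_int_add) auto
          then show "(t $ i) powi b i = ((t $ i) powi N) powi (b i div N) * (t $ i) powi (b i mod N)"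
            by (simp add: power_int_mult)
        qed
        also have "\<dots> = (\<Prod>i<l. (\<Prod>k\<in>R. (t $ k) powi W k i) powi (b i div N)) * (\<Prod>i<l. (t $ i) powi (b i mod N))"
          using key[OF t] by (simp add: prod.distrib)
        also have "(\<Prod>i<l. (\<Prod>k\<in>R. (t $ k) powi W k i) powi (b i div N)) = (\<Prod>k\<in>R. (t $ k) powi (\<Sum>i<l. W k i * (b i div N)))"
        proof -
          have pp: "(\<Prod>k\<in>R. x k) powi n = (\<Prod>k\<in>R. x k powi n)" for x :: "nat \<Rightarrow> complex" and n
            using finR by (induction R rule: finite_induct) (auto simp: power_int_mult_distrib)
          have ps: "x powi (\<Sum>i<l. g i) = (\<Prod>i<l. x powi g i)" if "x \<noteq> 0" for x :: complex and g and l :: nat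
            using that by (induction l) (auto simp: power_int_add)
          have "(\<Prod>i<l. (\<Prod>k\<in>R. (t $ k) powi W k i) powi (b i div N)) = (\<Prod>k\<in>R. \<Prod>i<l. (t $ k) powi (W k i * (b i div N)))"
            unfolding pp by (subst prod.swap) (simp add: power_int_mult)
          also have "\<dots> = (\<Prod>k\<in>R. (t $ k) powi (\<Sum>i<l. W k i * (b i div N)))"
            using tnz R(1) by (intro prod.cong ps[symmetric]) auto
          finally show ?thesis .
        qed
        finally show ?thesis by (simp add: G_def \<beta>_def \<gamma>_def)
      qed
      then show "f \<in> fspan ?H (G ` Idx k)" by (rule fspan_scaled[OF mem])
    qed
  qed
qed

lemma ann_line:
  assumes "X \<in> carrier_vec l" "Y \<in> carrier_vec l" "(\<Sum>i<l. c i * X $ i) = 0" "(\<Sum>i<l. c i * Y $ i) = (0::complex)"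
  shows "(\<Sum>i<l. c i * (X + s \<cdot>\<^sub>v (Y - X)) $ i) = 0"
proof -
  have "(\<Sum>i<l. c i * (X + s \<cdot>\<^sub>v (Y - X)) $ i) = (\<Sum>i<l. c i * X $ i) + s * ((\<Sum>i<l. c i * Y $ i) - (\<Sum>i<l. c i * X $ i))"
    unfolding sum_subtractf[symmetric] sum_distrib_left sum.distrib[symmetric]
    using assms(1,2) by (intro sum.cong) (auto simp: algebra_simps)
  then show ?thesis using assms by simp
qed

text \<open>The exponentials of a flag of subspaces of the Lie algebra form the chain; a line in the
  Lie algebra exponentiates to an entire curve. \<open>Z i\<close> asks for zeros at the first
  \<open>i\<close> positions of \<open>R\<close>, and the dual vector at the next position, with
  entry 1 there, shows that each step is strict because exp 1 \<noteq> 1.\<close>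

lemma group_dim_stab_ge:
  assumes D: "is_basis l a S D"
  shows "group_dim l (stab l a S) \<ge> ereal (real (l - card D))"
proof -
  let ?H = "stab l a S"
  have finD: "finite D" using basis_finite[OF D] .
  have "indep l a D" and DS: "D \<subseteq> S" using D by (auto simp: is_basis_def)
  from indep_dual_vectors[OF this(1) finD] obtain R w where R: "R \<subseteq> {..<l}" "card R + card D = l"
    and w0: "\<forall>k\<in>R. \<forall>d\<in>D. (\<Sum>i<l. w k i * rat_of_int (a d i)) = 0"
    and w1: "\<forall>k\<in>R. \<forall>k'\<in>R. w k k' = (if k = k' then 1 else (0::rat))"
    by (elim exE conjE)
  have finR: "finite R" using R(1) finite_subset by blast
  define r where "r = l - card D"
  have "card R = r" using R(2) by (simp add: r_def)
  then obtain e where e: "bij_betw e {..<r} R" using ex_bij_betw_nat_finite[OF finR] by (auto simp: atLeast0LessThan)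
  have eR: "e i \<in> R" "e i < l" if "i < r" for i using e R(1) that by (auto simp: bij_betw_def)
  define Z where "Z i = {X \<in> ann l a S. \<forall>i'<i. X $ e i' = 0}" for i
  define x where "x k = vec l (\<lambda>i. complex_of_rat (w k i))" for k
  have annS: "X \<in> ann l a S" if "X \<in> carrier_vec l" "\<And>d. d \<in> D \<Longrightarrow> (\<Sum>i<l. of_int (a d i) * X $ i) = 0" for X
    unfolding ann_def
  proof (intro CollectI conjI ballI that(1))
    fix j assume "j \<in> S"
    then have "in_span l a D (a j)" using D by (simp add: is_basis_def)
    then obtain c :: "nat \<Rightarrow> rat" where c: "\<forall>i<l. of_int (a j i) = (\<Sum>d\<in>D. c d * of_int (a d i))"
      unfolding in_span_def by blast
    have "complex_of_int (a j i) = (\<Sum>d\<in>D. of_rat (c d) * of_int (a d i))" if "i < l" for i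
      using arg_cong[OF c[rule_format, OF that], of complex_of_rat] by (simp add: of_rat_sum of_rat_mult)
    then have "(\<Sum>i<l. of_int (a j i) * X $ i) = (\<Sum>i<l. \<Sum>d\<in>D. of_rat (c d) * (of_int (a d i) * X $ i))"
      by (intro sum.cong) (auto simp: sum_distrib_right mult.assoc)
    also have "\<dots> = (\<Sum>d\<in>D. of_rat (c d) * (\<Sum>i<l. of_int (a d i) * X $ i))"
      by (subst sum.swap) (simp add: sum_distrib_left)
    also have "\<dots> = 0" using that(2) by simp
    finally show "(\<Sum>i<l. of_int (a j i) * X $ i) = 0" .
  qed
  have xann: "x k \<in> ann l a S" if "k \<in> R" for k
  proof (rule annS)
    fix d assume "d \<in> D"
    from arg_cong[OF w0[rule_format, OF that this], of complex_of_rat]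
    have "(\<Sum>i<l. of_rat (w k i) * complex_of_int (a d i)) = 0" by (simp add: of_rat_sum of_rat_mult)
    then show "(\<Sum>i<l. of_int (a d i) * x k $ i) = 0" by (simp add: x_def mult.commute)
  qed (simp add: x_def)
  have alg: "fun_algebra (laurent_funs l)"
    unfolding laurent_funs_def by (rule gen_algebra_fun_algebra)
  have ZC: "X \<in> carrier_vec l" if "X \<in> Z i" for X i using that by (auto simp: Z_def ann_def)
  have "ereal (real r) \<le> krull_dim (fun_ring ?H (laurent_funs l))"
  proof (rule krull_dim_ge_chain[OF alg, where Y = "\<lambda>i. texp ` Z i"])
    fix i assume i: "i \<le> r"
    show "texp ` Z i \<subseteq> ?H" using stab_texp by (auto simp: Z_def)
    show "entire_connected (laurent_funs l) (texp ` Z i)"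
      unfolding entire_connected_def
    proof (intro conjI ballI)
      have "0\<^sub>v l \<in> Z i" using eR i by (auto simp: Z_def ann_def)
      then show "texp ` Z i \<noteq> {}" by blast
      fix p q assume "p \<in> texp ` Z i" "q \<in> texp ` Z i"
      then obtain X Y where X: "X \<in> Z i" "p = texp X" and Y: "Y \<in> Z i" "q = texp Y" by auto
      have cX: "X \<in> carrier_vec l" "Y \<in> carrier_vec l" using X Y ZC by auto
      let ?c = "\<lambda>s. X + s \<cdot>\<^sub>v (Y - X)"
      have cZ: "?c s \<in> Z i" for s
      proof -
        have "(\<Sum>k<l. of_int (a j k) * ?c s $ k) = 0" if "j \<in> S" for j
          using X Y that by (intro ann_line cX) (auto simp: Z_def ann_def)
        moreover have "?c s $ e i' = 0" if "i' < i" for i'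
          using X Y that eR(2)[of i'] i cX by (auto simp: Z_def)
        ultimately show ?thesis using cX by (auto simp: Z_def ann_def)
      qed
      have hol: "(\<lambda>s. f (texp (?c s))) holomorphic_on UNIV" if "f \<in> laurent_funs l" for f
      proof (rule gen_algebra_holomorphic[OF that[unfolded laurent_funs_def]])
        fix g :: "complex vec \<Rightarrow> complex" assume "g \<in> {\<lambda>t. t $ i | i. i < l} \<union> {\<lambda>t. inverse (t $ i) | i. i < l}"
        then obtain j where j: "j < l" "g = (\<lambda>t. t $ j) \<or> g = (\<lambda>t. inverse (t $ j))" by auto
        have "texp (?c s) $ j = exp (X $ j + s * (Y $ j - X $ j))" for s
          using cX j(1) by (simp add: texp_def)
        then show "(\<lambda>s. g (texp (?c s))) holomorphic_on UNIV"
          using j(2) by (auto intro!: holomorphic_intros)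
      qed
      have "?c 0 = X" "?c 1 = Y" using cX by auto
      then show "\<exists>c. (\<forall>s. c s \<in> texp ` Z i) \<and> c 0 = p \<and> c 1 = q \<and>
          (\<forall>f\<in>laurent_funs l. (\<lambda>s. f (c s)) holomorphic_on UNIV)"
        using cZ hol X(2) Y(2) by (intro exI[of _ "\<lambda>s. texp (?c s)"]) auto
    qed
  next
    fix i assume i: "i < r"
    show "texp ` Z (Suc i) \<subseteq> texp ` Z i" by (auto simp: Z_def)
    have "(\<lambda>t. t $ e i) \<in> laurent_funs l" using eR[OF i] unfolding laurent_funs_def by (auto intro!: gen_algebra.gen)
    then have "(\<lambda>t. t $ e i - 1) \<in> laurent_funs l" by (intro fun_algebra_diff[OF alg] fun_algebraD(1)[OF alg])
    moreover have "t $ e i - 1 = 0" if t: "t \<in> texp ` Z (Suc i)" for t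
    proof -
      obtain X where "X \<in> Z (Suc i)" "t = texp X" using t by auto
      then show ?thesis using ZC[of X "Suc i"] eR(2)[OF i] by (auto simp: Z_def texp_def)
    qed
    moreover have "x (e i) \<in> Z i"
      unfolding Z_def
    proof (intro CollectI conjI allI impI xann eR(1)[OF i])
      fix i' assume "i' < i"
      then have "e i \<noteq> e i'" using inj_on_eq_iff[OF bij_betw_imp_inj_on[OF e], of i i'] i by simp
      then show "x (e i) $ e i' = 0"
        using \<open>i' < i\<close> i eR[of i'] eR[OF i] w1[rule_format, of "e i" "e i'"] by (simp add: x_def)
    qed
    moreover have "texp (x (e i)) $ e i - 1 \<noteq> 0"
    proof -
      have "texp (x (e i)) $ e i = exp 1" using eR[OF i] w1[rule_format, of "e i" "e i"] by (simp add: texp_def x_def)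
      then show ?thesis using exp_one_neq_one by simp
    qed
    ultimately show "\<exists>g\<in>laurent_funs l. (\<forall>y\<in>texp ` Z (Suc i). g y = 0) \<and> (\<exists>y\<in>texp ` Z i. g y \<noteq> 0)"
      by (intro bexI[of _ "\<lambda>t. t $ e i - 1"]) auto
  qed
  then show ?thesis by (simp add: group_dim_def r_def)
qed

lemma group_dim_stab:
  assumes "is_basis l a S D"
  shows "group_dim l (stab l a S) = ereal (real (l - card D))"
  using group_dim_stab_le[OF assms] group_dim_stab_ge[OF assms] by (rule antisym)

hide_const (open) Finite_Cartesian_Product.mat Finite_Cartesian_Product.row

section \<open>Matrix rank in terms of bases of columns\<close>

lemma column_rank_rank:
  "A \<in> carrier_mat l n \<Longrightarrow> column_rank A J = vec_space.rank l (map_mat rat_of_int (submatrix A UNIV J))"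
  unfolding Defs.column_rank_def by simp

text \<open>The matrix rank is computed from the set of columns of a submatrix, while
  \<open>D\<close> indexes a family. Independent columns are distinct, so \<open>D\<close> maps
  injectively to a maximal independent subset, even if \<open>J\<close> contains repeated
  columns.\<close>

lemma column_rank_eq_card_basis:
  assumes A: "A \<in> carrier_mat l n" and J: "J \<subseteq> {..<n}" and D: "is_basis l (\<lambda>j i. A $$ (i, j)) J D"
  shows "column_rank A J = card D"
proof -
  interpret vec_space "TYPE(rat)" l .
  let ?M = "map_mat rat_of_int (submatrix A UNIV J)"
  define vc where "vc j = vec l (\<lambda>i. rat_of_int (A $$ (i, j)))" for j
  have finJ: "finite J" using J finite_subset by blast
  have finD: "finite D" and DJ: "D \<subseteq> J" using D basis_finite[OF D] by (auto simp: is_basis_def)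
  have Jn: "{j. j < dim_col A \<and> j \<in> J} = J" using A J by auto
  have Al: "dim_row A = l" using A by auto
  have dims: "dim_row (submatrix A UNIV J) = l" "dim_col (submatrix A UNIV J) = card J"
    unfolding dim_submatrix Jn using Al by auto
  have M: "?M \<in> carrier_mat l (card J)" using dims by (intro carrier_matI) auto
  have colk: "col ?M k = vc (pick J k)" if "k < card J" for k
  proof (rule eq_vecI)
    fix i assume "i < dim_vec (vc (pick J k))"
    then have i: "i < l" by (simp add: vc_def)
    have "submatrix A UNIV J $$ (i, k) = A $$ (pick UNIV i, pick J k)"
      using i that Al Jn by (intro submatrix_index) auto
    then show "col ?M k $ i = vc (pick J k) $ i"
      using i that dims by (simp add: vc_def pick_UNIV)
  qed (use that dims in \<open>simp add: vc_def\<close>)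
  have colsM: "set (cols ?M) = col ?M ` {..<card J}"
    using dims by (simp add: cols_def atLeast0LessThan)
  have cols: "set (cols ?M) = vc ` J"
  proof
    show "set (cols ?M) \<subseteq> vc ` J"
    proof
      fix x assume "x \<in> set (cols ?M)"
      then obtain k where "k < card J" "x = col ?M k" unfolding colsM by blast
      then show "x \<in> vc ` J" using colk pick_in_set_le[of k J] by auto
    qed
    show "vc ` J \<subseteq> set (cols ?M)"
    proof
      fix x assume "x \<in> vc ` J"
      then obtain j where j: "j \<in> J" "x = vc j" by auto
      let ?k = "card {a \<in> J. a < j}"
      have "{a \<in> J. a < j} \<subset> J" using j(1) by auto
      then have k: "?k < card J" by (rule psubset_card_mono[OF finJ])
      have cj: "x = col ?M ?k" using colk[OF k] pick_card_in_set[OF j(1)] j(2) by simp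
      have "?k \<in> {..<card J}" using k by simp
      then show "x \<in> set (cols ?M)" unfolding colsM cj by (rule imageI)
    qed
  qed
  have vcC: "vc j \<in> carrier_vec l" for j by (simp add: vc_def)
  have indD: "\<And>c :: nat \<Rightarrow> rat. (\<forall>i<l. (\<Sum>j\<in>D. c j * of_int (A $$ (i, j))) = 0) \<Longrightarrow> \<forall>j\<in>D. c j = 0"
    using D by (simp add: is_basis_def indep_def)
  have inj: "inj_on vc D"
  proof (rule inj_onI, rule ccontr)
    fix j k assume jk: "j \<in> D" "k \<in> D" "vc j = vc k" "j \<noteq> k"
    define c :: "nat \<Rightarrow> rat" where "c x = (if x = j then 1 else 0) - (if x = k then 1 else 0)" for x
    have "(\<Sum>x\<in>D. c x * of_int (A $$ (i, x))) = 0" if "i < l" for i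
    proof -
      have "(\<Sum>x\<in>D. c x * of_int (A $$ (i, x))) = of_int (A $$ (i, j)) - of_int (A $$ (i, k))"
        unfolding c_def left_diff_distrib sum_subtractf using jk finD
        by (simp add: if_distrib[of "\<lambda>x. x * _"] cong: if_cong)
      also have "\<dots> = vc j $ i - vc k $ i" using that by (simp add: vc_def)
      finally show ?thesis using jk(3) by simp
    qed
    then have "c j = 0" using indD[of c] jk(1) by blast
    then show False using jk(4) by (simp add: c_def)
  qed
  have indep1: "\<not> lin_dep (vc ` D)"
  proof
    assume "lin_dep (vc ` D)"
    from this[unfolded lin_dep_def] obtain B b v where
      B: "finite B" "B \<subseteq> vc ` D" "lincomb b B = 0\<^sub>v l" "v \<in> B" "b v \<noteq> 0"
      by auto
    define c where "c j = (if vc j \<in> B then b (vc j) else 0)" for j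
    have "(\<Sum>j\<in>D. c j * of_int (A $$ (i, j))) = 0" if "i < l" for i
    proof -
      have BC: "B \<subseteq> carrier_vec l" using B(2) vcC by auto
      have "(\<Sum>j\<in>D. c j * of_int (A $$ (i, j))) = (\<Sum>j\<in>D. (if vc j \<in> B then b (vc j) else 0) * vc j $ i)"
        using that by (intro sum.cong) (auto simp: c_def vc_def)
      also have "\<dots> = (\<Sum>x\<in>vc ` D. (if x \<in> B then b x else 0) * x $ i)"
        by (simp add: sum.reindex[OF inj])
      also have "\<dots> = (\<Sum>x\<in>B. b x * x $ i)"
        using B(2) finD by (intro sum.mono_neutral_cong_right) auto
      also have "\<dots> = lincomb b B $ i" using lincomb_index[OF that BC] by simp
      also have "\<dots> = 0" using B(3) that by simp
      finally show ?thesis .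
    qed
    then have "\<forall>j\<in>D. c j = 0" by (intro indD) blast
    moreover obtain j where "j \<in> D" "v = vc j" using B(2,4) by auto
    ultimately show False using B(4,5) by (auto simp: c_def)
  qed
  have "maximal (vc ` D) (\<lambda>T. T \<subseteq> set (cols ?M) \<and> \<not> lin_dep T)"
    unfolding maximal_def cols
  proof (intro conjI allI impI)
    show "vc ` D \<subseteq> vc ` J" using DJ by blast
    show "\<not> lin_dep (vc ` D)" by (rule indep1)
    fix T assume T: "vc ` D \<subseteq> T \<and> T \<subseteq> vc ` J \<and> \<not> lin_dep T"
    show "T = vc ` D"
    proof (rule ccontr)
      assume "T \<noteq> vc ` D"
      then obtain v where v: "v \<in> T" "v \<notin> vc ` D" using T by blast
      then obtain j where j: "j \<in> J" "v = vc j" using T by blast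
      have "in_span l (\<lambda>j i. A $$ (i, j)) D (\<lambda>i. A $$ (i, j))" using D j(1) unfolding is_basis_def by simp
      then obtain c :: "nat \<Rightarrow> rat" where c: "\<forall>i<l. of_int (A $$ (i, j)) = (\<Sum>d\<in>D. c d * of_int (A $$ (i, d)))"
        unfolding in_span_def by blast
      \<comment> \<open>A column outside the image of \<open>D\<close> still lies in its span;
        moving it to the other side with coefficient -1 gives a dependence.\<close>
      define b where "b x = (if x = v then -1 else c (the_inv_into D vc x))" for x
      let ?B = "insert v (vc ` D)"
      have BC: "?B \<subseteq> carrier_vec l" using vcC j by auto
      have "lincomb b ?B = 0\<^sub>v l"
      proof (rule eq_vecI)
        fix i assume "i < dim_vec (0\<^sub>v l)"
        then have i: "i < l" by simp
        have "lincomb b ?B $ i = (\<Sum>x\<in>?B. b x * x $ i)" by (rule lincomb_index[OF i BC])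
        also have "\<dots> = - v $ i + (\<Sum>x\<in>vc ` D. b x * x $ i)"
          using v(2) finD by (subst sum.insert) (auto simp: b_def)
        also have "(\<Sum>x\<in>vc ` D. b x * x $ i) = (\<Sum>d\<in>D. c d * of_int (A $$ (i, d)))"
          unfolding sum.reindex[OF inj]
        proof (intro sum.cong refl)
          fix d assume d: "d \<in> D"
          then have "vc d \<noteq> v" using v(2) by auto
          then have "b (vc d) = c d" using the_inv_into_f_f[OF inj d] by (simp add: b_def)
          moreover have "vc d $ i = of_int (A $$ (i, d))" using i by (simp add: vc_def)
          ultimately show "((\<lambda>x. b x * x $ i) \<circ> vc) d = c d * of_int (A $$ (i, d))" by simp
        qed
        also have "\<dots> = v $ i" using c i by (simp add: j(2) vc_def)
        finally show "lincomb b ?B $ i = 0\<^sub>v l $ i" using i by simp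
      next
        have "lincomb b ?B \<in> carrier_vec l" using BC by (intro lincomb_closed) auto
        then show "dim_vec (lincomb b ?B) = dim_vec (0\<^sub>v l)" by simp
      qed
      then have "lin_dep T"
        unfolding lin_dep_def using finD T v(1)
        by (intro exI[of _ ?B] exI[of _ b] exI[of _ v]) (auto simp: b_def)
      then show False using T by blast
    qed
  qed
  from rank_card_indpt[OF M this] have "rank ?M = card (vc ` D)" .
  moreover have "column_rank A J = rank ?M" by (rule column_rank_rank[OF A])
  ultimately show ?thesis using card_image[OF inj] by simp
qed

section \<open>Diagonal modules\<close>

text \<open>The map \<open>e\<close> selects columns: \<open>id\<close> gives the whole module, and
  an enumeration of the columns outside a set gives the complementary summand.\<close>

definition drep :: "nat \<Rightarrow> (nat \<Rightarrow> nat \<Rightarrow> int) \<Rightarrow> (nat \<Rightarrow> nat) \<Rightarrow> nat \<Rightarrow> complex vec \<Rightarrow> complex mat" where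
  "drep l a e m t = mat m m (\<lambda>(i, j). if i = j then chr l (a (e j)) t else 0)"

lemma mat_vec_index:
  assumes "M \<in> carrier_mat n n'" "v \<in> carrier_vec n'" "i < n"
  shows "(M *\<^sub>v v) $ i = (\<Sum>j<n'. M $$ (i, j) * v $ j)"
  using assms by (auto simp: scalar_prod_def atLeast0LessThan intro!: sum.cong)

lemma scalar_prod_sum:
  assumes "w \<in> carrier_vec n"
  shows "v \<bullet> w = (\<Sum>i<n. v $ i * w $ i)"
  using assms by (auto simp: scalar_prod_def atLeast0LessThan)

lemma drep_carrier: "drep l a e m t \<in> carrier_mat m m"
  by (simp add: drep_def)

lemma drep_mult_vec:
  assumes "v \<in> carrier_vec m"
  shows "drep l a e m t *\<^sub>v v = vec m (\<lambda>i. chr l (a (e i)) t * v $ i)"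
proof (rule eq_vecI)
  fix i assume "i < dim_vec (vec m (\<lambda>i. chr l (a (e i)) t * v $ i))"
  then have i: "i < m" by simp
  have "(drep l a e m t *\<^sub>v v) $ i = (\<Sum>j<m. drep l a e m t $$ (i, j) * v $ j)"
    by (rule mat_vec_index[OF drep_carrier assms i])
  also have "\<dots> = (\<Sum>j<m. if i = j then chr l (a (e i)) t * v $ i else 0)"
    using i by (intro sum.cong) (auto simp: drep_def)
  finally show "(drep l a e m t *\<^sub>v v) $ i = vec m (\<lambda>i. chr l (a (e i)) t * v $ i) $ i"
    using i by simp
qed (simp add: drep_def)

lemma drep_transpose: "transpose_mat (drep l a e m t) = drep l a e m t"
  by (rule eq_matI) (auto simp: drep_def)

lemma drep_tmult:
  assumes "s \<in> torus l" "t \<in> torus l"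
  shows "drep l a e m (tmult s t) = drep l a e m s * drep l a e m t"
proof (rule eq_matI)
  fix i j assume "i < dim_row (drep l a e m s * drep l a e m t)" "j < dim_col (drep l a e m s * drep l a e m t)"
  then have ij: "i < m" "j < m" by (auto simp: drep_def)
  have "(drep l a e m s * drep l a e m t) $$ (i, j) = (\<Sum>k<m. drep l a e m s $$ (i, k) * drep l a e m t $$ (k, j))"
    using ij by (simp add: drep_def scalar_prod_def atLeast0LessThan)
  also have "\<dots> = (\<Sum>k<m. if k = i then drep l a e m s $$ (i, i) * drep l a e m t $$ (i, j) else 0)"
    using ij by (intro sum.cong) (auto simp: drep_def)
  also have "\<dots> = drep l a e m (tmult s t) $$ (i, j)"
    using ij assms by (auto simp: drep_def chr_tmult)
  finally show "drep l a e m (tmult s t) $$ (i, j) = (drep l a e m s * drep l a e m t) $$ (i, j)" by simp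
qed (auto simp: drep_def)

lemma drep_tone: "drep l a e m (tone l) = 1\<^sub>m m"
  by (rule eq_matI) (auto simp: drep_def chr_tone)

lemma drep_is_module:
  assumes "H \<subseteq> torus l"
  shows "is_module l H m (drep l a e m)"
  unfolding is_module_def
proof (intro conjI ballI allI impI)
  fix g h assume "g \<in> H" "h \<in> H"
  then show "drep l a e m (tmult g h) = drep l a e m g * drep l a e m h"
    using assms by (intro drep_tmult) auto
next
  fix i j assume ij: "i < m" "j < m"
  have "(\<lambda>_. 0) \<in> laurent_funs l" unfolding laurent_funs_def by (rule gen_algebra.const)
  then have "(\<lambda>h. drep l a e m h $$ (i, j)) \<in> laurent_funs l"
    using ij chr_laurent[of l "a (e j)"] by (cases "i = j") (simp_all add: drep_def)
  then show "\<exists>f\<in>laurent_funs l. \<forall>h\<in>H. drep l a e m h $$ (i, j) = f h" by (rule bexI[rotated]) simp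
qed (simp_all add: drep_carrier drep_tone)

lemma cot_act_drep:
  assumes "h \<in> torus l" "v \<in> carrier_vec m" "\<xi> \<in> carrier_vec m"
  shows "cot_act (drep l a e m) h (v, \<xi>) =
    (vec m (\<lambda>i. chr l (a (e i)) h * v $ i), vec m (\<lambda>i. inverse (chr l (a (e i)) h) * \<xi> $ i))"
  using assms by (simp add: cot_act_def drep_transpose drep_mult_vec chr_tinv)

lemma invertible_mat_inverse:
  assumes "P \<in> carrier_mat n n" "invertible_mat P"
  obtains Q where "Q \<in> carrier_mat n n" "P * Q = 1\<^sub>m n" "Q * P = 1\<^sub>m n"
proof -
  obtain Q where Q: "P * Q = 1\<^sub>m n" "Q * P = 1\<^sub>m (dim_row Q)"
    using assms unfolding invertible_mat_def inverts_mat_def by auto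
  have "dim_col Q = n" using arg_cong[OF Q(1), of dim_col] by simp
  moreover have "dim_row Q = n" using arg_cong[OF Q(2), of dim_col] assms(1) by simp
  ultimately show thesis using Q by (intro that[of Q]) auto
qed

lemma weight_matrix_diagonalize:
  assumes mod: "is_module l (torus l) n \<rho>" and W: "weight_matrix l n \<rho> A"
  obtains P Q where "P \<in> carrier_mat n n" "Q \<in> carrier_mat n n" "P * Q = 1\<^sub>m n" "Q * P = 1\<^sub>m n"
    "\<And>t. t \<in> torus l \<Longrightarrow> \<rho> t * P = P * drep l (\<lambda>j i. A $$ (i, j)) id n t"
proof -
  obtain P where P: "P \<in> carrier_mat n n" "invertible_mat P"
    and eig: "\<forall>t\<in>torus l. \<forall>j<n. \<rho> t *\<^sub>v col P j = (\<Prod>i<l. (t $ i) powi (A $$ (i, j))) \<cdot>\<^sub>v col P j"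
    using W unfolding weight_matrix_def by auto
  obtain Q where Q: "Q \<in> carrier_mat n n" "P * Q = 1\<^sub>m n" "Q * P = 1\<^sub>m n"
    using invertible_mat_inverse[OF P] .
  have "\<rho> t * P = P * drep l (\<lambda>j i. A $$ (i, j)) id n t" if t: "t \<in> torus l" for t
  proof (rule eq_matI)
    have \<rho>: "\<rho> t \<in> carrier_mat n n" using mod t unfolding is_module_def by auto
    let ?D = "drep l (\<lambda>j i. A $$ (i, j)) id n t"
    fix i j assume "i < dim_row (P * ?D)" "j < dim_col (P * ?D)"
    then have ij: "i < n" "j < n" using P(1) by (auto simp: drep_def)
    have "(P * ?D) $$ (i, j) = (\<Sum>k<n. P $$ (i, k) * ?D $$ (k, j))"
      using ij P(1) by (simp add: drep_def scalar_prod_def atLeast0LessThan)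
    also have "\<dots> = (\<Sum>k<n. if k = j then P $$ (i, j) * ?D $$ (j, j) else 0)"
      using ij by (intro sum.cong) (auto simp: drep_def)
    also have "\<dots> = P $$ (i, j) * chr l (\<lambda>i. A $$ (i, j)) t" using ij by (simp add: drep_def)
    also have "\<dots> = (\<rho> t *\<^sub>v col P j) $ i" using eig t ij P(1) by (simp add: chr_def)
    also have "\<dots> = (\<rho> t * P) $$ (i, j)" using ij P(1) \<rho> by simp
    finally show "(\<rho> t * P) $$ (i, j) = (P * ?D) $$ (i, j)" by simp
  next
    have \<rho>: "\<rho> t \<in> carrier_mat n n" using mod t unfolding is_module_def by auto
    then show "dim_row (\<rho> t * P) = dim_row (P * drep l (\<lambda>j i. A $$ (i, j)) id n t)"
      "dim_col (\<rho> t * P) = dim_col (P * drep l (\<lambda>j i. A $$ (i, j)) id n t)"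
      using P(1) by (auto simp: drep_def)
  qed
  then show thesis using P(1) Q by (intro that[of P Q])
qed

section \<open>Modularity as a bound on sets of columns\<close>

lemma poly_funs_sum: "(\<lambda>v. \<Sum>j<n. c j * v $ j) \<in> poly_funs n"
  unfolding poly_funs_def
  by (intro fun_algebra_sum[OF gen_algebra_fun_algebra] fun_algebraD(3)[OF gen_algebra_fun_algebra]
      gen_algebra.const gen_algebra.gen) auto

lemma basis_empty: "is_basis l a {} {}"
  by (simp add: is_basis_def indep_def)

lemma stab_empty: "stab l a {} = torus l"
  by (simp add: stab_def)

text \<open>In eigencoordinates, all vectors with support exactly \<open>S\<close> have the common
  kernel of the columns in \<open>S\<close> as isotropy group, of dimension r = l - card D, so they
  lie in one stratum. They contribute dimension at least card S to it, while modularity makes its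
  codimension at least r + 1.\<close>

lemma modular_card_bound:
  assumes mod: "is_module l (torus l) n \<rho>" and modular: "modular 1 l (torus l) n \<rho>"
    and W: "weight_matrix l n \<rho> A"
    and S: "S \<subseteq> {..<n}" and D: "is_basis l (\<lambda>j i. A $$ (i, j)) S D" and lt: "card D < l"
  shows "card S + (l - card D) + 1 \<le> n"
proof -
  let ?a = "\<lambda>j i. A $$ (i, j)"
  define r where "r = l - card D"
  obtain P Q where P: "P \<in> carrier_mat n n" and Q: "Q \<in> carrier_mat n n" and PQ: "P * Q = 1\<^sub>m n" and QP: "Q * P = 1\<^sub>m n"
    and diag: "\<And>t. t \<in> torus l \<Longrightarrow> \<rho> t * P = P * drep l ?a id n t"
    using weight_matrix_diagonalize[OF mod W] by metis
  have Qcancel: "Q *\<^sub>v (P *\<^sub>v w) = w" if "w \<in> carrier_vec n" for w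
    using that P Q QP by (simp flip: assoc_mult_mat_vec)
  have finS: "finite S" using S finite_subset by blast
  define s where "s = card S"
  obtain e where e: "bij_betw e {..<s} S" using ex_bij_betw_nat_finite[OF finS] by (auto simp: atLeast0LessThan s_def)
  have eS: "e i \<in> S" "e i < n" if "i < s" for i using e S that by (auto simp: bij_betw_def)
  \<comment> \<open>Fixing one coordinate after another at the value 1 produces the chain; the
    support stays \<open>S\<close>, so every member stays in the stratum.\<close>
  define Z :: "nat \<Rightarrow> complex vec set" where "Z i = {w \<in> carrier_vec n. (\<forall>j<n. w $ j \<noteq> 0 \<longleftrightarrow> j \<in> S) \<and> (\<forall>i'<i. w $ e i' = 1)}" for i :: nat
  define X where "X = isotropy_stratum l (torus l) n \<rho> r"
  have iso: "isotropy (torus l) \<rho> (P *\<^sub>v w) = stab l ?a S" if w: "w \<in> carrier_vec n" "\<forall>j<n. w $ j \<noteq> 0 \<longleftrightarrow> j \<in> S" for w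
  proof -
    have "\<rho> t *\<^sub>v (P *\<^sub>v w) = P *\<^sub>v w \<longleftrightarrow> (\<forall>j\<in>S. chr l (?a j) t = 1)" if t: "t \<in> torus l" for t
    proof -
      have \<rho>: "\<rho> t \<in> carrier_mat n n" using mod t unfolding is_module_def by auto
      let ?d = "vec n (\<lambda>i. chr l (?a i) t * w $ i)"
      have dw: "drep l ?a id n t *\<^sub>v w = ?d" using drep_mult_vec[OF w(1), of l ?a id t] by simp
      have "\<rho> t *\<^sub>v (P *\<^sub>v w) = (\<rho> t * P) *\<^sub>v w" using \<rho> P w(1) by simp
      also have "\<dots> = P *\<^sub>v (drep l ?a id n t *\<^sub>v w)"
        unfolding diag[OF t] using P w(1) drep_carrier by (intro assoc_mult_mat_vec) auto
      also have "\<dots> = P *\<^sub>v ?d" by (simp only: dw)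
      finally have eq: "\<rho> t *\<^sub>v (P *\<^sub>v w) = P *\<^sub>v ?d" .
      have "P *\<^sub>v ?d = P *\<^sub>v w \<longleftrightarrow> ?d = w"
      proof
        assume "P *\<^sub>v ?d = P *\<^sub>v w"
        from arg_cong[OF this, of "\<lambda>x. Q *\<^sub>v x"] show "?d = w"
          using Qcancel[of ?d] Qcancel[OF w(1)] by (simp only: vec_carrier)
      qed simp
      also have "\<dots> \<longleftrightarrow> (\<forall>j<n. chr l (?a j) t * w $ j = w $ j)"
      proof
        assume eq: "?d = w"
        show "\<forall>j<n. chr l (?a j) t * w $ j = w $ j"
        proof (intro allI impI)
          fix j assume "j < n"
          then show "chr l (?a j) t * w $ j = w $ j"
            using arg_cong[OF eq, of "\<lambda>v. v $ j"] by (simp only: index_vec)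
        qed
      next
        assume "\<forall>j<n. chr l (?a j) t * w $ j = w $ j"
        then show "?d = w" using w(1) by (intro eq_vecI) auto
      qed
      also have "\<dots> \<longleftrightarrow> (\<forall>j\<in>S. chr l (?a j) t = 1)"
        using w(2) S by (auto simp: subset_iff)
      finally show ?thesis unfolding eq .
    qed
    then show ?thesis unfolding isotropy_def stab_def by blast
  qed
  have PZ: "P *\<^sub>v w \<in> X" if "w \<in> Z i" for w i
  proof -
    have w: "w \<in> carrier_vec n" "\<forall>j<n. w $ j \<noteq> 0 \<longleftrightarrow> j \<in> S" using that by (auto simp: Z_def)
    have "P *\<^sub>v w \<in> carrier_vec n" using P w(1) by simp
    then show ?thesis unfolding X_def isotropy_stratum_def using iso[OF w] group_dim_stab[OF D] by (simp add: r_def)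
  qed
  have alg: "fun_algebra (poly_funs n)" unfolding poly_funs_def by (rule gen_algebra_fun_algebra)
  have "ereal (real s) \<le> krull_dim (fun_ring X (poly_funs n))"
  proof (rule krull_dim_ge_chain[OF alg, where Y = "\<lambda>i. (\<lambda>w. P *\<^sub>v w) ` Z i"])
    fix i assume i: "i \<le> s"
    show "(\<lambda>w. P *\<^sub>v w) ` Z i \<subseteq> X" using PZ by auto
    show "entire_connected (poly_funs n) ((\<lambda>w. P *\<^sub>v w) ` Z i)"
      unfolding entire_connected_def
    proof (intro conjI ballI)
      have "vec n (\<lambda>j. if j \<in> S then 1 else 0) \<in> Z i" using eS i by (auto simp: Z_def)
      then show "(\<lambda>w. P *\<^sub>v w) ` Z i \<noteq> {}" by blast
      fix p q assume "p \<in> (\<lambda>w. P *\<^sub>v w) ` Z i" "q \<in> (\<lambda>w. P *\<^sub>v w) ` Z i"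
      then obtain x y where x: "x \<in> Z i" "p = P *\<^sub>v x" and y: "y \<in> Z i" "q = P *\<^sub>v y" by auto
      have cx: "x \<in> carrier_vec n" "y \<in> carrier_vec n" using x y by (auto simp: Z_def)
      \<comment> \<open>The coordinates are joined multiplicatively, so that none of those in
        \<open>S\<close> passes through 0; outside \<open>S\<close> the factor \<open>x $ j\<close>
        keeps the coordinate 0.\<close>
      define c where "c s = vec n (\<lambda>j. x $ j * exp (s * Ln (y $ j / x $ j)))" for s :: complex
      have cC: "c s \<in> carrier_vec n" for s by (simp add: c_def)
      have cZ: "c s \<in> Z i" for s
      proof -
        have "c s $ j \<noteq> 0 \<longleftrightarrow> j \<in> S" if "j < n" for j using x(1) that by (simp add: c_def Z_def)
        moreover have "c s $ e i' = 1" if "i' < i" for i'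
          using x(1) y(1) that eS(2)[of i'] i by (simp add: c_def Z_def)
        ultimately show ?thesis using cC unfolding Z_def by blast
      qed
      have c0: "c 0 = x" using cx by (auto simp: c_def vec_eq_iff)
      have c1: "c 1 = y"
      proof (rule eq_vecI)
        fix j assume "j < dim_vec y"
        then have j: "j < n" using cx by simp
        show "c 1 $ j = y $ j"
        proof (cases "j \<in> S")
          case True
          then have "x $ j \<noteq> 0" "y $ j \<noteq> 0" using x(1) y(1) j by (simp_all add: Z_def)
          then show ?thesis using j by (simp add: c_def)
        next
          case False
          have "x $ j \<noteq> 0 \<longleftrightarrow> j \<in> S" "y $ j \<noteq> 0 \<longleftrightarrow> j \<in> S" using x(1) y(1) j unfolding Z_def by blast+
          then have "x $ j = 0" "y $ j = 0" using False by blast+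
          then show ?thesis using j by (simp add: c_def)
        qed
      qed (use cx in \<open>simp add: c_def\<close>)
      have hol: "(\<lambda>s. f (P *\<^sub>v c s)) holomorphic_on UNIV" if "f \<in> poly_funs n" for f
      proof (rule gen_algebra_holomorphic[OF that[unfolded poly_funs_def]])
        fix g :: "complex vec \<Rightarrow> complex" assume "g \<in> {\<lambda>v. v $ i | i. i < n}"
        then obtain j where j: "j < n" "g = (\<lambda>v. v $ j)" by auto
        have "(P *\<^sub>v c s) $ j = (\<Sum>k<n. P $$ (j, k) * (x $ k * exp (s * Ln (y $ k / x $ k))))" for s
          unfolding mat_vec_index[OF P cC j(1)] by (intro sum.cong) (auto simp: c_def)
        then show "(\<lambda>s. g (P *\<^sub>v c s)) holomorphic_on UNIV"
          unfolding j(2) by (simp only:) (intro holomorphic_intros)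
      qed
      show "\<exists>c. (\<forall>s. c s \<in> (\<lambda>w. P *\<^sub>v w) ` Z i) \<and> c 0 = p \<and> c 1 = q \<and>
          (\<forall>f\<in>poly_funs n. (\<lambda>s. f (c s)) holomorphic_on UNIV)"
      proof (intro exI[of _ "\<lambda>s. P *\<^sub>v c s"] conjI allI ballI)
        show "P *\<^sub>v c s \<in> (\<lambda>w. P *\<^sub>v w) ` Z i" for s using cZ by (rule imageI)
      qed (use hol c0 c1 x y in simp_all)
    qed
  next
    fix i assume i: "i < s"
    show "(\<lambda>w. P *\<^sub>v w) ` Z (Suc i) \<subseteq> (\<lambda>w. P *\<^sub>v w) ` Z i" by (auto simp: Z_def)
    \<comment> \<open>Polynomial functions refer to the original coordinates; the row
      \<open>e i\<close> of \<open>Q\<close> recovers an eigencoordinate from them.\<close>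
    let ?g = "\<lambda>v. (\<Sum>j<n. Q $$ (e i, j) * v $ j) - 1"
    have gF: "?g \<in> poly_funs n"
      by (intro fun_algebra_diff[OF alg poly_funs_sum] fun_algebraD(1)[OF alg])
    have gv: "?g (P *\<^sub>v w) = w $ e i - 1" if "w \<in> carrier_vec n" for w
      using mat_vec_index[OF Q, of "P *\<^sub>v w" "e i"] Qcancel[OF that] eS[OF i] P that by simp
    have "?g v = 0" if "v \<in> (\<lambda>w. P *\<^sub>v w) ` Z (Suc i)" for v
    proof -
      obtain w where w: "w \<in> Z (Suc i)" "v = P *\<^sub>v w" using \<open>v \<in> _\<close> by auto
      then have "w \<in> carrier_vec n" "w $ e i = 1" by (simp_all add: Z_def)
      then show ?thesis using gv w(2) by simp
    qed
    moreover have "\<exists>v\<in>(\<lambda>w. P *\<^sub>v w) ` Z i. ?g v \<noteq> 0"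
    proof -
      let ?w = "vec n (\<lambda>j. if j = e i then 2 else if j \<in> S then 1 else (0::complex))"
      have "?w $ e i' = 1" if "i' < i" for i'
      proof -
        have "e i' \<noteq> e i" using inj_on_eq_iff[OF bij_betw_imp_inj_on[OF e], of i' i] i that by simp
        then show ?thesis using eS[of i'] that i by simp
      qed
      moreover have "?w $ j \<noteq> 0 \<longleftrightarrow> j \<in> S" if "j < n" for j using that eS[OF i] by simp
      ultimately have "?w \<in> Z i" unfolding Z_def by simp
      moreover have "?g (P *\<^sub>v ?w) \<noteq> 0" using gv[of ?w] eS[OF i] by simp
      ultimately show ?thesis by blast
    qed
    ultimately show "\<exists>g\<in>poly_funs n. (\<forall>y\<in>(\<lambda>w. P *\<^sub>v w) ` Z (Suc i). g y = 0) \<and> (\<exists>y\<in>(\<lambda>w. P *\<^sub>v w) ` Z i. g y \<noteq> 0)"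
      using gF by (intro bexI[of _ ?g]) blast+
  qed
  moreover have "group_dim l (torus l) = ereal (real l)"
    using group_dim_stab[OF basis_empty[of l ?a]] by (simp add: stab_empty)
  then have "1 \<le> r \<and> ereal (real r) \<le> group_dim l (torus l)"
    using lt by (simp add: r_def)
  then have "codim n X \<ge> ereal (real (r + 1))"
    using modular unfolding modular_def X_def by blast
  then have "ereal (real (r + 1)) \<le> ereal (real n) - krull_dim (fun_ring X (poly_funs n))"
    by (simp add: codim_def)
  ultimately have "ereal (real (r + 1)) \<le> ereal (real n) - ereal (real s)"
    using ereal_minus_mono[OF order_refl, of "ereal (real s)" "krull_dim (fun_ring X (poly_funs n))" "ereal (real n)"]
    by (meson order_trans)
  then show ?thesis by (simp add: s_def r_def)
qed

section \<open>Symplectic isomorphisms\<close>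

lemma cot_poly_funs_algebra: "fun_algebra (cot_poly_funs k)"
  unfolding cot_poly_funs_def by (rule gen_algebra_fun_algebra)

lemma cot_spaceD: "u \<in> cot_space k \<Longrightarrow> fst u \<in> carrier_vec k" "u \<in> cot_space k \<Longrightarrow> snd u \<in> carrier_vec k"
  by (auto simp: cot_space_def)

lemma cot_spaceI: "fst u \<in> carrier_vec k \<Longrightarrow> snd u \<in> carrier_vec k \<Longrightarrow> u \<in> cot_space k"
  by (cases u) (auto simp: cot_space_def)

lemma cot_space_add: "u \<in> cot_space k \<Longrightarrow> u' \<in> cot_space k \<Longrightarrow> u + u' \<in> cot_space k"
  by (auto simp: cot_space_def plus_prod_def)

lemma cot_space_smult: "u \<in> cot_space k \<Longrightarrow> cot_smult c u \<in> cot_space k"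
  by (auto simp: cot_space_def cot_smult_def)

lemma fst_cot_smult: "fst (cot_smult c u) = c \<cdot>\<^sub>v fst u"
  and snd_cot_smult: "snd (cot_smult c u) = c \<cdot>\<^sub>v snd u"
  by (simp_all add: cot_smult_def)

lemma cot_coord_poly: "i < k \<Longrightarrow> (\<lambda>u. fst u $ i) \<in> cot_poly_funs k" "i < k \<Longrightarrow> (\<lambda>u. snd u $ i) \<in> cot_poly_funs k"
  unfolding cot_poly_funs_def by (auto intro!: gen_algebra.gen)

lemma cot_linear_poly:
  "(\<lambda>u. (\<Sum>j<k. c j * fst u $ j) + (\<Sum>j<k. d j * snd u $ j)) \<in> cot_poly_funs k"
  by (intro fun_algebraD(2)[OF cot_poly_funs_algebra] fun_algebra_sum[OF cot_poly_funs_algebra]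
      fun_algebraD(3)[OF cot_poly_funs_algebra] fun_algebraD(1)[OF cot_poly_funs_algebra] cot_coord_poly) auto

lemma cot_poly_pullback:
  assumes f: "f \<in> cot_poly_funs k"
    and fst: "\<And>i. i < k \<Longrightarrow> \<exists>g\<in>cot_poly_funs m. \<forall>u\<in>X. g u = fst (\<Phi> u) $ i"
    and snd: "\<And>i. i < k \<Longrightarrow> \<exists>g\<in>cot_poly_funs m. \<forall>u\<in>X. g u = snd (\<Phi> u) $ i"
  shows "\<exists>g\<in>cot_poly_funs m. \<forall>u\<in>X. g u = f (\<Phi> u)"
  using f unfolding cot_poly_funs_def[of k]
proof induction
  case (gen f)
  then consider i where "i < k" "f = (\<lambda>u. fst u $ i)" | i where "i < k" "f = (\<lambda>u. snd u $ i)" by blast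
  then show ?case
  proof cases
    case 1
    then show ?thesis using fst[of i] by simp
  next
    case 2
    then show ?thesis using snd[of i] by simp
  qed
next
  case (const c)
  show ?case by (rule bexI[of _ "\<lambda>_. c"]) (simp_all add: fun_algebraD(1)[OF cot_poly_funs_algebra])
next
  case (add f g)
  then obtain f' g' where "f' \<in> cot_poly_funs m" "g' \<in> cot_poly_funs m" "\<forall>u\<in>X. f' u = f (\<Phi> u)" "\<forall>u\<in>X. g' u = g (\<Phi> u)"
    by blast
  then show ?case
    by (intro bexI[of _ "\<lambda>u. f' u + g' u"] fun_algebraD(2)[OF cot_poly_funs_algebra]) simp_all
next
  case (mult f g)
  then obtain f' g' where "f' \<in> cot_poly_funs m" "g' \<in> cot_poly_funs m" "\<forall>u\<in>X. f' u = f (\<Phi> u)" "\<forall>u\<in>X. g' u = g (\<Phi> u)"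
    by blast
  then show ?case
    by (intro bexI[of _ "\<lambda>u. f' u * g' u"] fun_algebraD(3)[OF cot_poly_funs_algebra]) simp_all
qed

text \<open>Linear maps occur as bare functions, for instance in \<open>slice_iso\<close>, and this
  puts them into coordinates. The expansion is proved by adding one entry of \<open>v\<close> at a
  time.\<close>

lemma vec_functional:
  fixes L :: "complex vec \<Rightarrow> complex"
  assumes add: "\<And>v w. v \<in> carrier_vec m \<Longrightarrow> w \<in> carrier_vec m \<Longrightarrow> L (v + w) = L v + L w"
    and smult: "\<And>c v. v \<in> carrier_vec m \<Longrightarrow> L (c \<cdot>\<^sub>v v) = c * L v"
    and v: "v \<in> carrier_vec m"
  shows "L v = (\<Sum>j<m. L (unit_vec m j) * v $ j)"
proof -
  define tr where "tr p = vec m (\<lambda>j. if j < p then v $ j else 0)" for p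
  have trC: "tr p \<in> carrier_vec m" for p by (simp add: tr_def)
  have "p \<le> m \<Longrightarrow> L (tr p) = (\<Sum>j<p. L (unit_vec m j) * v $ j)" for p
  proof (induction p)
    case 0
    have "tr 0 = 0 \<cdot>\<^sub>v tr 0" by (rule eq_vecI) (auto simp: tr_def)
    then have "L (tr 0) = L (0 \<cdot>\<^sub>v tr 0)" by simp
    also have "\<dots> = 0" using smult[OF trC] by simp
    finally show ?case by simp
  next
    case (Suc p)
    have "tr (Suc p) = tr p + v $ p \<cdot>\<^sub>v unit_vec m p"
      using Suc.prems by (intro eq_vecI) (auto simp: tr_def unit_vec_def less_Suc_eq)
    then have "L (tr (Suc p)) = L (tr p) + v $ p * L (unit_vec m p)"
      using add[OF trC, of "v $ p \<cdot>\<^sub>v unit_vec m p"] smult[of "unit_vec m p"] by simp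
    then show ?case using Suc by simp
  qed
  from this[of m] have "L (tr m) = (\<Sum>j<m. L (unit_vec m j) * v $ j)" by simp
  moreover have "tr m = v" using v by (intro eq_vecI) (auto simp: tr_def)
  ultimately show ?thesis by simp
qed

lemma smult_zero_vec: "c \<cdot>\<^sub>v 0\<^sub>v m = (0\<^sub>v m :: complex vec)"
  by (rule eq_vecI) auto

lemma cot_functional:
  fixes L :: "complex vec \<times> complex vec \<Rightarrow> complex"
  assumes add: "\<And>u u'. u \<in> cot_space m \<Longrightarrow> u' \<in> cot_space m \<Longrightarrow> L (u + u') = L u + L u'"
    and smult: "\<And>c u. u \<in> cot_space m \<Longrightarrow> L (cot_smult c u) = c * L u"
  shows "\<exists>c d. \<forall>u\<in>cot_space m. L u = (\<Sum>j<m. c j * fst u $ j) + (\<Sum>j<m. d j * snd u $ j)"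
proof (rule exI[of _ "\<lambda>j. L (unit_vec m j, 0\<^sub>v m)"], rule exI[of _ "\<lambda>j. L (0\<^sub>v m, unit_vec m j)"], rule ballI)
  fix u assume u: "u \<in> cot_space m"
  then have C: "fst u \<in> carrier_vec m" "snd u \<in> carrier_vec m" by (rule cot_spaceD)+
  have "L (fst u, 0\<^sub>v m) = (\<Sum>j<m. L (unit_vec m j, 0\<^sub>v m) * fst u $ j)"
  proof (rule vec_functional[of m "\<lambda>v. L (v, 0\<^sub>v m)", OF _ _ C(1)])
    show "L (v + w, 0\<^sub>v m) = L (v, 0\<^sub>v m) + L (w, 0\<^sub>v m)" if "v \<in> carrier_vec m" "w \<in> carrier_vec m" for v w
      using add[of "(v, 0\<^sub>v m)" "(w, 0\<^sub>v m)"] that by (simp add: cot_space_def plus_prod_def)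
    show "L (c \<cdot>\<^sub>v v, 0\<^sub>v m) = c * L (v, 0\<^sub>v m)" if "v \<in> carrier_vec m" for c v
      using smult[of "(v, 0\<^sub>v m)" c] that by (simp add: cot_space_def cot_smult_def smult_zero_vec)
  qed
  moreover have "L (0\<^sub>v m, snd u) = (\<Sum>j<m. L (0\<^sub>v m, unit_vec m j) * snd u $ j)"
  proof (rule vec_functional[of m "\<lambda>v. L (0\<^sub>v m, v)", OF _ _ C(2)])
    show "L (0\<^sub>v m, v + w) = L (0\<^sub>v m, v) + L (0\<^sub>v m, w)" if "v \<in> carrier_vec m" "w \<in> carrier_vec m" for v w
      using add[of "(0\<^sub>v m, v)" "(0\<^sub>v m, w)"] that by (simp add: cot_space_def plus_prod_def)
    show "L (0\<^sub>v m, c \<cdot>\<^sub>v v) = c * L (0\<^sub>v m, v)" if "v \<in> carrier_vec m" for c v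
      using smult[of "(0\<^sub>v m, v)" c] that by (simp add: cot_space_def cot_smult_def smult_zero_vec)
  qed
  moreover have "u = (fst u, 0\<^sub>v m) + (0\<^sub>v m, snd u)" using C by (simp add: prod_eq_iff plus_prod_def)
  then have "L u = L (fst u, 0\<^sub>v m) + L (0\<^sub>v m, snd u)"
    using add[of "(fst u, 0\<^sub>v m)" "(0\<^sub>v m, snd u)"] C by (simp add: cot_space_def)
  ultimately show "L u = (\<Sum>j<m. L (unit_vec m j, 0\<^sub>v m) * fst u $ j) + (\<Sum>j<m. L (0\<^sub>v m, unit_vec m j) * snd u $ j)"
    by simp
qed

definition cot_linear :: "nat \<Rightarrow> nat \<Rightarrow> (complex vec \<times> complex vec \<Rightarrow> complex vec \<times> complex vec) \<Rightarrow> bool" where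
  "cot_linear m k \<Phi> \<longleftrightarrow> (\<forall>u\<in>cot_space m. \<Phi> u \<in> cot_space k) \<and>
     (\<forall>u\<in>cot_space m. \<forall>u'\<in>cot_space m. \<Phi> (u + u') = \<Phi> u + \<Phi> u') \<and>
     (\<forall>c. \<forall>u\<in>cot_space m. \<Phi> (cot_smult c u) = cot_smult c (\<Phi> u))"

lemma cot_linearD:
  assumes "cot_linear m k \<Phi>"
  shows "u \<in> cot_space m \<Longrightarrow> \<Phi> u \<in> cot_space k"
    "u \<in> cot_space m \<Longrightarrow> u' \<in> cot_space m \<Longrightarrow> \<Phi> (u + u') = \<Phi> u + \<Phi> u'"
    "u \<in> cot_space m \<Longrightarrow> \<Phi> (cot_smult c u) = cot_smult c (\<Phi> u)"
  using assms unfolding cot_linear_def by auto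

text \<open>The polynomial agrees with the pullback on \<open>cot_space m\<close> only, since
  nothing is known about \<open>\<Phi>\<close> elsewhere.\<close>

lemma cot_linear_pullback:
  assumes lin: "cot_linear m k \<Phi>" and f: "f \<in> cot_poly_funs k"
  shows "\<exists>g\<in>cot_poly_funs m. \<forall>u\<in>cot_space m. g u = f (\<Phi> u)"
proof (rule cot_poly_pullback[OF f])
  fix i assume i: "i < k"
  have C: "fst (\<Phi> u) \<in> carrier_vec k" "snd (\<Phi> u) \<in> carrier_vec k" if "u \<in> cot_space m" for u
    using cot_linearD(1)[OF lin that] by (auto dest: cot_spaceD)
  have "fst (\<Phi> (u + u')) $ i = fst (\<Phi> u) $ i + fst (\<Phi> u') $ i" if "u \<in> cot_space m" "u' \<in> cot_space m" for u u'
    using C[OF that(1)] C[OF that(2)] i by (simp add: cot_linearD(2)[OF lin that])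
  moreover have "fst (\<Phi> (cot_smult c u)) $ i = c * fst (\<Phi> u) $ i" if "u \<in> cot_space m" for c u
    using C[OF that] i by (simp add: cot_linearD(3)[OF lin that] fst_cot_smult snd_cot_smult)
  ultimately have "\<exists>c d. \<forall>u\<in>cot_space m. fst (\<Phi> u) $ i = (\<Sum>j<m. c j * fst u $ j) + (\<Sum>j<m. d j * snd u $ j)"
    by (rule cot_functional[where L = "\<lambda>u. fst (\<Phi> u) $ i"])
  then obtain c d where "\<forall>u\<in>cot_space m. fst (\<Phi> u) $ i = (\<Sum>j<m. c j * fst u $ j) + (\<Sum>j<m. d j * snd u $ j)"
    by (elim exE)
  then show "\<exists>g\<in>cot_poly_funs m. \<forall>u\<in>cot_space m. g u = fst (\<Phi> u) $ i"
    by (intro bexI[OF _ cot_linear_poly[where k = m and c = c and d = d]]) simp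
  have "snd (\<Phi> (u + u')) $ i = snd (\<Phi> u) $ i + snd (\<Phi> u') $ i" if "u \<in> cot_space m" "u' \<in> cot_space m" for u u'
    using C[OF that(1)] C[OF that(2)] i by (simp add: cot_linearD(2)[OF lin that])
  moreover have "snd (\<Phi> (cot_smult c u)) $ i = c * snd (\<Phi> u) $ i" if "u \<in> cot_space m" for c u
    using C[OF that] i by (simp add: cot_linearD(3)[OF lin that] fst_cot_smult snd_cot_smult)
  ultimately have "\<exists>c d. \<forall>u\<in>cot_space m. snd (\<Phi> u) $ i = (\<Sum>j<m. c j * fst u $ j) + (\<Sum>j<m. d j * snd u $ j)"
    by (rule cot_functional[where L = "\<lambda>u. snd (\<Phi> u) $ i"])
  then obtain c' d' where "\<forall>u\<in>cot_space m. snd (\<Phi> u) $ i = (\<Sum>j<m. c' j * fst u $ j) + (\<Sum>j<m. d' j * snd u $ j)"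
    by (elim exE)
  then show "\<exists>g\<in>cot_poly_funs m. \<forall>u\<in>cot_space m. g u = snd (\<Phi> u) $ i"
    by (intro bexI[OF _ cot_linear_poly[where k = m and c = c' and d = d']]) simp
qed

text \<open>The map need not respect the splitting into a module and its dual, which leaves room for
  modules that differ by dualizing summands. The shell and its quotient are nevertheless
  preserved.\<close>

definition sympl_iso ::
  "complex vec set \<Rightarrow> nat \<Rightarrow> (complex vec \<Rightarrow> complex mat) \<Rightarrow> nat \<Rightarrow> (complex vec \<Rightarrow> complex mat) \<Rightarrow>
   (complex vec \<times> complex vec \<Rightarrow> complex vec \<times> complex vec) \<Rightarrow>
   (complex vec \<times> complex vec \<Rightarrow> complex vec \<times> complex vec) \<Rightarrow> bool" where
  "sympl_iso H m \<rho> m' \<rho>' \<Phi> \<Psi> \<longleftrightarrow> cot_linear m m' \<Phi> \<and> (\<forall>u\<in>cot_space m. \<Psi> (\<Phi> u) = u) \<and>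
     (\<forall>u\<in>cot_space m'. \<Psi> u \<in> cot_space m \<and> \<Phi> (\<Psi> u) = u) \<and>
     (\<forall>u\<in>cot_space m. \<forall>u'\<in>cot_space m. omega (\<Phi> u) (\<Phi> u') = omega u u') \<and>
     (\<forall>h\<in>H. \<forall>u\<in>cot_space m. \<Phi> (cot_act \<rho> h u) = cot_act \<rho>' h (\<Phi> u))"

lemma sympl_isoD:
  assumes "sympl_iso H m \<rho> m' \<rho>' \<Phi> \<Psi>"
  shows "cot_linear m m' \<Phi>" "u \<in> cot_space m \<Longrightarrow> \<Psi> (\<Phi> u) = u"
    "w \<in> cot_space m' \<Longrightarrow> \<Psi> w \<in> cot_space m" "w \<in> cot_space m' \<Longrightarrow> \<Phi> (\<Psi> w) = w"
    "u \<in> cot_space m \<Longrightarrow> u' \<in> cot_space m \<Longrightarrow> omega (\<Phi> u) (\<Phi> u') = omega u u'"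
    "h \<in> H \<Longrightarrow> u \<in> cot_space m \<Longrightarrow> \<Phi> (cot_act \<rho> h u) = cot_act \<rho>' h (\<Phi> u)"
  using assms unfolding sympl_iso_def by auto

lemma is_module_carrier: "is_module l H k \<rho> \<Longrightarrow> h \<in> H \<Longrightarrow> \<rho> h \<in> carrier_mat k k"
  unfolding is_module_def by auto

lemma cot_act_in_cot_space:
  assumes "\<rho> h \<in> carrier_mat k k" "\<rho> (tinv h) \<in> carrier_mat k k" "u \<in> cot_space k"
  shows "cot_act \<rho> h u \<in> cot_space k"
  using assms by (intro cot_spaceI) (auto simp: cot_act_def dest: cot_spaceD)

lemma sympl_iso_sym:
  assumes iso: "sympl_iso H m \<rho> m' \<rho>' \<Phi> \<Psi>" and mod: "is_module l H m \<rho>" and inv: "\<And>h. h \<in> H \<Longrightarrow> tinv h \<in> H"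
  shows "sympl_iso H m' \<rho>' m \<rho> \<Psi> \<Phi>"
  unfolding sympl_iso_def cot_linear_def
proof (intro conjI ballI allI)
  note lin = sympl_isoD(1)[OF iso]
  fix u assume u: "u \<in> cot_space m'"
  show "\<Psi> u \<in> cot_space m" "\<Phi> (\<Psi> u) = u" using sympl_isoD(3,4)[OF iso u] by auto
  show "\<Psi> (cot_smult c u) = cot_smult c (\<Psi> u)" for c
    using sympl_isoD(2)[OF iso, of "cot_smult c (\<Psi> u)"] cot_linearD(3)[OF lin, of "\<Psi> u" c] sympl_isoD(3,4)[OF iso u]
    by (simp add: cot_space_smult)
  show "\<Psi> (cot_act \<rho>' h u) = cot_act \<rho> h (\<Psi> u)" if h: "h \<in> H" for h
  proof -
    have "cot_act \<rho> h (\<Psi> u) \<in> cot_space m"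
      using is_module_carrier[OF mod h] is_module_carrier[OF mod inv[OF h]] sympl_isoD(3)[OF iso u]
      by (rule cot_act_in_cot_space)
    then show ?thesis
      using sympl_isoD(2)[OF iso, of "cot_act \<rho> h (\<Psi> u)"] sympl_isoD(6)[OF iso h, of "\<Psi> u"] sympl_isoD(3,4)[OF iso u] by simp
  qed
  fix u' assume u': "u' \<in> cot_space m'"
  show "\<Psi> (u + u') = \<Psi> u + \<Psi> u'"
    using sympl_isoD(2)[OF iso, of "\<Psi> u + \<Psi> u'"] cot_linearD(2)[OF lin, of "\<Psi> u" "\<Psi> u'"]
      sympl_isoD(3,4)[OF iso u] sympl_isoD(3,4)[OF iso u'] by (simp add: cot_space_add)
  show "omega (\<Psi> u) (\<Psi> u') = omega u u'"
    using sympl_isoD(5)[OF iso, of "\<Psi> u" "\<Psi> u'"] sympl_isoD(3,4)[OF iso u] sympl_isoD(3,4)[OF iso u'] by simp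
next
  fix u assume "u \<in> cot_space m"
  then show "\<Phi> u \<in> cot_space m'" "\<Psi> (\<Phi> u) = u" using sympl_isoD(2)[OF iso] cot_linearD(1)[OF sympl_isoD(1)[OF iso]] by auto
qed

section \<open>Lie algebra action, moment map and shell\<close>

lemma lie_algebra_texp: "X \<in> lie_algebra l H \<Longrightarrow> texp (s \<cdot>\<^sub>v X) \<in> H"
  unfolding lie_algebra_def by auto

lemma tinv_texp: "X \<in> carrier_vec l \<Longrightarrow> tinv (texp (s \<cdot>\<^sub>v X)) = texp ((- s) \<cdot>\<^sub>v X)"
  by (rule eq_vecI) (auto simp: tinv_def texp_def exp_minus)

text \<open>Matrix coefficients are Laurent functions on \<open>H\<close>, hence holomorphic along
  one-parameter groups. The derivative therefore exists, and the definite description in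
  \<open>lie_action\<close> denotes it.\<close>

lemma lie_action_derivative:
  assumes mod: "is_module l H k \<rho>" and X: "X \<in> lie_algebra l H" and ij: "i < k" "j < k"
  shows "((\<lambda>s. \<rho> (texp (s \<cdot>\<^sub>v X)) $$ (i, j)) has_field_derivative lie_action k \<rho> X $$ (i, j)) (at 0)"
proof -
  have XC: "X \<in> carrier_vec l" using X by (simp add: lie_algebra_def)
  obtain f where f: "f \<in> laurent_funs l" "\<forall>h\<in>H. \<rho> h $$ (i, j) = f h"
    using mod ij unfolding is_module_def by meson
  have "(\<lambda>s. f (texp (s \<cdot>\<^sub>v X))) holomorphic_on UNIV"
  proof (rule gen_algebra_holomorphic[OF f(1)[unfolded laurent_funs_def]])
    fix g :: "complex vec \<Rightarrow> complex" assume "g \<in> {\<lambda>t. t $ i | i. i < l} \<union> {\<lambda>t. inverse (t $ i) | i. i < l}"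
    then obtain j where j: "j < l" "g = (\<lambda>t. t $ j) \<or> g = (\<lambda>t. inverse (t $ j))" by auto
    have "texp (s \<cdot>\<^sub>v X) $ j = exp (s * X $ j)" for s
      using XC j(1) by (simp add: texp_def)
    then show "(\<lambda>s. g (texp (s \<cdot>\<^sub>v X))) holomorphic_on UNIV"
      using j(2) by (auto intro!: holomorphic_intros)
  qed
  moreover have "(\<lambda>s. f (texp (s \<cdot>\<^sub>v X))) = (\<lambda>s. \<rho> (texp (s \<cdot>\<^sub>v X)) $$ (i, j))"
    using f(2) lie_algebra_texp[OF X] by simp
  ultimately have "(\<lambda>s. \<rho> (texp (s \<cdot>\<^sub>v X)) $$ (i, j)) holomorphic_on UNIV" by simp
  from holomorphic_derivI[OF this open_UNIV UNIV_I[of 0]]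
  have D: "((\<lambda>s. \<rho> (texp (s \<cdot>\<^sub>v X)) $$ (i, j)) has_field_derivative deriv (\<lambda>s. \<rho> (texp (s \<cdot>\<^sub>v X)) $$ (i, j)) 0) (at 0)" .
  have "lie_action k \<rho> X $$ (i, j) = deriv (\<lambda>s. \<rho> (texp (s \<cdot>\<^sub>v X)) $$ (i, j)) 0"
  proof -
    have "(THE D. ((\<lambda>s. \<rho> (texp (s \<cdot>\<^sub>v X)) $$ (i, j)) has_field_derivative D) (at 0)) =
        deriv (\<lambda>s. \<rho> (texp (s \<cdot>\<^sub>v X)) $$ (i, j)) 0"
    proof (rule the_equality)
      fix D' assume "((\<lambda>s. \<rho> (texp (s \<cdot>\<^sub>v X)) $$ (i, j)) has_field_derivative D') (at 0)"
      then show "D' = deriv (\<lambda>s. \<rho> (texp (s \<cdot>\<^sub>v X)) $$ (i, j)) 0" by (rule DERIV_unique[OF _ D])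
    qed (rule D)
    then show ?thesis unfolding lie_action_def using ij by simp
  qed
  then show ?thesis using D by simp
qed

text \<open>The moment map is determined by the symplectic form and the action, so it is compatible
  with symplectic isomorphisms.\<close>

lemma moment_derivative:
  assumes mod: "is_module l H k \<rho>" and X: "X \<in> lie_algebra l H" and u: "u \<in> cot_space k"
  shows "((\<lambda>s. omega (cot_act \<rho> (texp (s \<cdot>\<^sub>v X)) u) u) has_field_derivative 2 * moment k \<rho> u X) (at 0)"
proof -
  let ?v = "fst u" and ?x = "snd u" and ?r = "\<lambda>s. \<rho> (texp (s \<cdot>\<^sub>v X))" and ?L = "lie_action k \<rho> X"
  have C: "?v \<in> carrier_vec k" "?x \<in> carrier_vec k" using u by (auto dest: cot_spaceD)
  have XC: "X \<in> carrier_vec l" using X by (simp add: lie_algebra_def)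
  have rC: "?r s \<in> carrier_mat k k" for s
    using is_module_carrier[OF mod lie_algebra_texp[OF X]] .
  have LC: "?L \<in> carrier_mat k k" by (simp add: lie_action_def)
  have om: "omega (cot_act \<rho> (texp (s \<cdot>\<^sub>v X)) u) u =
      (\<Sum>i<k. ?x $ i * (\<Sum>j<k. ?r s $$ (i, j) * ?v $ j)) - (\<Sum>i<k. (\<Sum>j<k. ?r (- s) $$ (j, i) * ?x $ j) * ?v $ i)" for s
  proof -
    have "(transpose_mat (?r (- s)) *\<^sub>v ?x) $ i = (\<Sum>j<k. ?r (- s) $$ (j, i) * ?x $ j)" if "i < k" for i
      using mat_vec_index[of "transpose_mat (?r (- s))" k k ?x i] rC[of "- s"] C that by simp
    moreover have "(?r s *\<^sub>v ?v) $ i = (\<Sum>j<k. ?r s $$ (i, j) * ?v $ j)" if "i < k" for i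
      using mat_vec_index[OF rC C(1) that] .
    moreover have "?r s *\<^sub>v ?v \<in> carrier_vec k" by (rule mult_mat_vec_carrier[OF rC C(1)])
    ultimately show ?thesis
      unfolding omega_def cot_act_def fst_conv snd_conv tinv_texp[OF XC]
      using scalar_prod_sum[of "?r s *\<^sub>v ?v" k ?x] scalar_prod_sum[OF C(1), of "transpose_mat (?r (- s)) *\<^sub>v ?x"]
      by simp
  qed
  have neg: "((\<lambda>s. ?r (- s) $$ (i, j)) has_field_derivative - ?L $$ (i, j)) (at 0)" if "i < k" "j < k" for i j
  proof -
    have "((\<lambda>s. ?r s $$ (i, j)) has_field_derivative ?L $$ (i, j)) (at (- 0))"
      using lie_action_derivative[OF mod X that] by simp
    then have "((\<lambda>s. ?r (- s) $$ (i, j)) has_field_derivative ?L $$ (i, j) * (- 1)) (at 0)"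
      by (rule DERIV_chain2[where f = "\<lambda>s. ?r s $$ (i, j)" and g = uminus]) (auto intro!: derivative_eq_intros)
    then show ?thesis by simp
  qed
  have "((\<lambda>s. (\<Sum>i<k. ?x $ i * (\<Sum>j<k. ?r s $$ (i, j) * ?v $ j)) - (\<Sum>i<k. (\<Sum>j<k. ?r (- s) $$ (j, i) * ?x $ j) * ?v $ i))
     has_field_derivative (\<Sum>i<k. ?x $ i * (\<Sum>j<k. ?L $$ (i, j) * ?v $ j)) - (\<Sum>i<k. (\<Sum>j<k. - ?L $$ (j, i) * ?x $ j) * ?v $ i)) (at 0)"
    by (intro DERIV_diff DERIV_sum DERIV_cmult DERIV_cmult_right lie_action_derivative[OF mod X] neg) auto
  \<comment> \<open>The contragredient action contributes a second copy of \<xi>(Av) with the same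
    sign, hence the factor 2.\<close>
  moreover have "(\<Sum>i<k. (\<Sum>j<k. - ?L $$ (j, i) * ?x $ j) * ?v $ i) = - (\<Sum>i<k. ?x $ i * (\<Sum>j<k. ?L $$ (i, j) * ?v $ j))"
    unfolding sum_distrib_left sum_distrib_right sum_negf[symmetric]
    by (subst sum.swap) (simp add: mult_ac)
  moreover have "moment k \<rho> u X = (\<Sum>i<k. ?x $ i * (\<Sum>j<k. ?L $$ (i, j) * ?v $ j))"
    unfolding moment_def using LC C mat_vec_index[OF LC C(1)]
    by (subst scalar_prod_sum[of _ k]) auto
  ultimately show ?thesis unfolding om by simp
qed

lemma sympl_iso_shell:
  assumes iso: "sympl_iso H m \<rho> m' \<rho>' \<Phi> \<Psi>" and mod: "is_module l H m \<rho>" "is_module l H m' \<rho>'"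
    and inv: "\<And>h. h \<in> H \<Longrightarrow> tinv h \<in> H" and u: "u \<in> shell l H m \<rho>"
  shows "\<Phi> u \<in> shell l H m' \<rho>'"
proof -
  have uC: "u \<in> cot_space m" using u by (simp add: shell_def)
  have \<Phi>C: "\<Phi> u \<in> cot_space m'" using cot_linearD(1)[OF sympl_isoD(1)[OF iso] uC] .
  have "moment m' \<rho>' (\<Phi> u) X = 0" if X: "X \<in> lie_algebra l H" for X
  proof -
    have "omega (cot_act \<rho>' h (\<Phi> u)) (\<Phi> u) = omega (cot_act \<rho> h u) u" if h: "h \<in> H" for h
    proof -
      have "cot_act \<rho> h u \<in> cot_space m"
        using is_module_carrier[OF mod(1) h] is_module_carrier[OF mod(1) inv[OF h]] uC by (rule cot_act_in_cot_space)
      from sympl_isoD(5)[OF iso this uC] show ?thesis using sympl_isoD(6)[OF iso h uC] by simp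
    qed
    then have "(\<lambda>s. omega (cot_act \<rho>' (texp (s \<cdot>\<^sub>v X)) (\<Phi> u)) (\<Phi> u)) = (\<lambda>s. omega (cot_act \<rho> (texp (s \<cdot>\<^sub>v X)) u) u)"
      using lie_algebra_texp[OF X] by simp
    with moment_derivative[OF mod(2) X \<Phi>C] moment_derivative[OF mod(1) X uC]
    have "2 * moment m' \<rho>' (\<Phi> u) X = 2 * moment m \<rho> u X" by (metis DERIV_unique)
    then show ?thesis using u X by (simp add: shell_def)
  qed
  then show ?thesis using \<Phi>C by (simp add: shell_def)
qed

text \<open>Composition with \<open>\<phi>\<close> presents the ring on \<open>X\<close> as a
  quotient of the ring on \<open>X'\<close>: \<open>down\<close> provides the homomorphism and
  \<open>up\<close> its surjectivity. Primes are contracted along it, and strict inclusions remain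
  strict.\<close>

lemma krull_dim_pullback_le:
  assumes F: "fun_algebra F" and F': "fun_algebra F'"
    and down: "\<And>f'. f' \<in> F' \<Longrightarrow> \<exists>f\<in>F. \<forall>x\<in>X. f x = f' (\<phi> x)"
    and up: "\<And>f. f \<in> F \<Longrightarrow> \<exists>f'\<in>F'. \<forall>x\<in>X. f x = f' (\<phi> x)"
    and \<phi>: "\<And>x. x \<in> X \<Longrightarrow> \<phi> x \<in> X'"
  shows "krull_dim (fun_ring X F) \<le> krull_dim (fun_ring X' F')"
proof -
  define pb where "pb P = {f' \<in> F'. \<exists>f\<in>P. \<forall>x\<in>X. f x = f' (\<phi> x)}" for P
  have pbI: "f' \<in> pb P \<longleftrightarrow> f \<in> P" if P: "prime_fun_ideal X F P" and f: "f' \<in> F'" "f \<in> F" "\<And>x. x \<in> X \<Longrightarrow> f x = f' (\<phi> x)" for P f f'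
  proof
    assume "f' \<in> pb P"
    then obtain g where "g \<in> P" "\<forall>x\<in>X. g x = f' (\<phi> x)" by (auto simp: pb_def)
    then show "f \<in> P" using prime_fun_ideal_cong[OF F P _ f(2)] f(3) by simp
  next
    assume "f \<in> P"
    then show "f' \<in> pb P" unfolding pb_def using f by blast
  qed
  have prime: "prime_fun_ideal X' F' (pb P)" if P: "prime_fun_ideal X F P" for P
    unfolding prime_fun_ideal_def
  proof (intro conjI ballI impI)
    show "pb P \<subseteq> F'" by (auto simp: pb_def)
    show "(\<lambda>_. 1) \<notin> pb P"
      using pbI[OF P fun_algebraD(1)[OF F'] fun_algebraD(1)[OF F], of 1 1] prime_fun_idealD(5)[OF P] by simp
  next
    fix f' assume f': "f' \<in> F'" "\<forall>x\<in>X'. f' x = 0"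
    have "(\<lambda>_. 0) \<in> P" by (rule prime_fun_idealD(6)[OF P fun_algebraD(1)[OF F]]) simp
    then show "f' \<in> pb P" using pbI[OF P f'(1) fun_algebraD(1)[OF F], of 0] f'(2) \<phi> by simp
  next
    fix f' g' assume fg: "f' \<in> F'" "g' \<in> F'" and prod: "(\<lambda>x. f' x * g' x) \<in> pb P"
    obtain f g where f: "f \<in> F" "\<forall>x\<in>X. f x = f' (\<phi> x)" and g: "g \<in> F" "\<forall>x\<in>X. g x = g' (\<phi> x)"
      using down fg by blast
    have "(\<lambda>x. f x * g x) \<in> P"
      using pbI[OF P fun_algebraD(3)[OF F' fg] fun_algebraD(3)[OF F f(1) g(1)]] prod f(2) g(2) by simp
    then have "f \<in> P \<or> g \<in> P" by (rule prime_fun_idealD(4)[OF P f(1) g(1)])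
    then show "f' \<in> pb P \<or> g' \<in> pb P"
      using pbI[OF P fg(1) f(1)] pbI[OF P fg(2) g(1)] f(2) g(2) by simp
  next
    fix f' g' assume fg: "f' \<in> F'" "g' \<in> pb P"
    then have g': "g' \<in> F'" by (simp add: pb_def)
    obtain f g where f: "f \<in> F" "\<forall>x\<in>X. f x = f' (\<phi> x)" and g: "g \<in> F" "\<forall>x\<in>X. g x = g' (\<phi> x)"
      using down fg(1) g' by blast
    have "g \<in> P" using pbI[OF P g' g(1)] g(2) fg(2) by simp
    then have "(\<lambda>x. f x * g x) \<in> P" by (rule prime_fun_idealD(3)[OF P f(1)])
    then show "(\<lambda>x. f' x * g' x) \<in> pb P"
      using pbI[OF P fun_algebraD(3)[OF F' fg(1) g'] fun_algebraD(3)[OF F f(1) g(1)]] f(2) g(2) by simp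
  next
    fix f' g' assume fg: "f' \<in> pb P" "g' \<in> pb P"
    then have fg': "f' \<in> F'" "g' \<in> F'" by (simp_all add: pb_def)
    obtain f g where f: "f \<in> F" "\<forall>x\<in>X. f x = f' (\<phi> x)" and g: "g \<in> F" "\<forall>x\<in>X. g x = g' (\<phi> x)"
      using down fg' by blast
    have "f \<in> P" "g \<in> P" using pbI[OF P fg'(1) f(1)] pbI[OF P fg'(2) g(1)] f(2) g(2) fg by simp_all
    then have "(\<lambda>x. f x + g x) \<in> P" by (rule prime_fun_idealD(2)[OF P])
    then show "(\<lambda>x. f' x + g' x) \<in> pb P"
      using pbI[OF P fun_algebraD(2)[OF F' fg'] fun_algebraD(2)[OF F f(1) g(1)]] f(2) g(2) by simp
  qed
  show ?thesis
    unfolding krull_dim_def[of "fun_ring X F"]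
  proof (rule Sup_least, safe)
    fix k and I :: "nat \<Rightarrow> ('a \<Rightarrow> complex) set"
    assume I: "\<forall>i\<le>k. primeideal (I i) (fun_ring X F)" "\<forall>i<k. I i \<subset> I (Suc i)"
    define P where "P i = {f \<in> F. restrict f X \<in> I i}" for i
    have P: "prime_fun_ideal X F (P i)" if "i \<le> k" for i
      unfolding P_def using prime_fun_ideal_of_primeideal[OF F] I(1) that by auto
    show "ereal (real k) \<le> krull_dim (fun_ring X' F')"
    proof (rule krull_dim_geI[OF F', where P = "\<lambda>i. pb (P i)"])
      show "prime_fun_ideal X' F' (pb (P i))" if "i \<le> k" for i by (rule prime[OF P[OF that]])
      fix i assume i: "i < k"
      then have sub: "I i \<subset> I (Suc i)" using I(2) by auto
      then obtain f0 where f0: "f0 \<in> I (Suc i)" "f0 \<notin> I i" by auto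
      interpret I: primeideal "I (Suc i)" "fun_ring X F" using I(1) i by auto
      have "f0 \<in> carrier (fun_ring X F)" using f0(1) by (rule I.a_Hcarr)
      then obtain f where f: "f \<in> F" "f0 = restrict f X" by (auto simp: fun_ring_def)
      obtain f' where f': "f' \<in> F'" "\<forall>x\<in>X. f x = f' (\<phi> x)" using up[OF f(1)] by blast
      have "f' \<in> pb (P (Suc i))" "f' \<notin> pb (P i)"
        using pbI[OF P f'(1) f(1), of "Suc i"] pbI[OF P f'(1) f(1), of i] f'(2) f0 f i by (simp_all add: P_def)
      moreover have "pb (P i) \<subseteq> pb (P (Suc i))" using sub unfolding pb_def P_def by blast
      ultimately show "pb (P i) \<subset> pb (P (Suc i))" by blast
    qed
  qed
qed

lemma invariant_algebra:
  "fun_algebra {f \<in> cot_poly_funs k. \<forall>h\<in>H. \<forall>u\<in>X. f (T h u) = f u}"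
  using fun_algebraD[OF cot_poly_funs_algebra] by (auto simp: fun_algebra_def)

lemma shell_act:
  assumes iso: "is_module l H m \<rho>" and grp: "\<And>h. h \<in> H \<Longrightarrow> tinv h \<in> H"
    and "h \<in> H" "u \<in> shell l H m \<rho>"
  shows "cot_act \<rho> h u \<in> cot_space m"
  using is_module_carrier[OF iso assms(3)] is_module_carrier[OF iso grp[OF assms(3)]]
  by (rule cot_act_in_cot_space) (use assms(4) in \<open>simp add: shell_def\<close>)

text \<open>Invariants can be pulled back along both \<open>\<Phi>\<close> and
  \<open>\<Psi>\<close>, so composition with \<open>\<Phi>\<close> induces a surjection of the rings
  of invariants. One inequality suffices: the dimension of a slice bounds that of its diagonal
  model.\<close>

lemma sympl_iso_quotient_dim:
  assumes iso: "sympl_iso H m \<rho> m' \<rho>' \<Phi> \<Psi>" and mod: "is_module l H m \<rho>" "is_module l H m' \<rho>'"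
    and inv: "\<And>h. h \<in> H \<Longrightarrow> tinv h \<in> H"
  shows "krull_dim (shell_quotient_ring l H m \<rho>) \<le> krull_dim (shell_quotient_ring l H m' \<rho>')"
proof -
  let ?F = "{f \<in> cot_poly_funs m. \<forall>h\<in>H. \<forall>u\<in>shell l H m \<rho>. f (cot_act \<rho> h u) = f u}"
  let ?F' = "{f \<in> cot_poly_funs m'. \<forall>h\<in>H. \<forall>u\<in>shell l H m' \<rho>'. f (cot_act \<rho>' h u) = f u}"
  have iso': "sympl_iso H m' \<rho>' m \<rho> \<Psi> \<Phi>" by (rule sympl_iso_sym[OF iso mod(1) inv])
  have sh: "\<Phi> u \<in> shell l H m' \<rho>'" if "u \<in> shell l H m \<rho>" for u
    by (rule sympl_iso_shell[OF iso mod inv that])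
  have sh': "\<Psi> u \<in> shell l H m \<rho>" if "u \<in> shell l H m' \<rho>'" for u
    by (rule sympl_iso_shell[OF iso' mod(2,1) inv that])
  have shC: "u \<in> cot_space m" if "u \<in> shell l H m \<rho>" for u using that by (simp add: shell_def)
  have shC': "u \<in> cot_space m'" if "u \<in> shell l H m' \<rho>'" for u using that by (simp add: shell_def)
  show ?thesis
    unfolding shell_quotient_ring_def
  proof (rule krull_dim_pullback_le[where \<phi> = \<Phi>])
    fix f' assume f': "f' \<in> ?F'"
    then obtain g where g: "g \<in> cot_poly_funs m" "\<forall>u\<in>cot_space m. g u = f' (\<Phi> u)"
      using cot_linear_pullback[OF sympl_isoD(1)[OF iso], of f'] by blast
    have "g (cot_act \<rho> h u) = g u" if h: "h \<in> H" and u: "u \<in> shell l H m \<rho>" for h u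
    proof -
      have "g (cot_act \<rho> h u) = f' (cot_act \<rho>' h (\<Phi> u))"
        using g(2) shell_act[OF mod(1) inv h u] sympl_isoD(6)[OF iso h shC[OF u]] by simp
      also have "\<dots> = f' (\<Phi> u)" using f' h sh[OF u] by blast
      finally show ?thesis using g(2) shC[OF u] by simp
    qed
    then show "\<exists>f\<in>?F. \<forall>u\<in>shell l H m \<rho>. f u = f' (\<Phi> u)"
      using g shC by (intro bexI[of _ g]) simp_all
  next
    fix f assume f: "f \<in> ?F"
    then obtain g where g: "g \<in> cot_poly_funs m'" "\<forall>u\<in>cot_space m'. g u = f (\<Psi> u)"
      using cot_linear_pullback[OF sympl_isoD(1)[OF iso'], of f] by blast
    have "g (cot_act \<rho>' h u) = g u" if h: "h \<in> H" and u: "u \<in> shell l H m' \<rho>'" for h u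
    proof -
      have "g (cot_act \<rho>' h u) = f (cot_act \<rho> h (\<Psi> u))"
        using g(2) shell_act[OF mod(2) inv h u] sympl_isoD(6)[OF iso' h shC'[OF u]] by simp
      also have "\<dots> = f (\<Psi> u)" using f h sh'[OF u] by blast
      finally show ?thesis using g(2) shC'[OF u] by simp
    qed
    moreover have "f u = g (\<Phi> u)" if "u \<in> shell l H m \<rho>" for u
      using g(2) shC'[OF sh[OF that]] sympl_isoD(2)[OF iso shC[OF that]] by simp
    ultimately show "\<exists>f'\<in>?F'. \<forall>u\<in>shell l H m \<rho>. f u = f' (\<Phi> u)"
      using g by (intro bexI[of _ g]) simp_all
  qed (use invariant_algebra sh in auto)
qed

lemma sympl_iso_tangent_space:
  assumes iso: "sympl_iso H n \<rho> n \<rho>' \<Phi> \<Psi>" and X: "X \<subseteq> cot_space n" and x: "x \<in> cot_space n"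
    and u: "u \<in> tangent_space n X x"
  shows "\<Phi> u \<in> tangent_space n (\<Phi> ` X) (\<Phi> x)"
proof -
  note lin = sympl_isoD(1)[OF iso]
  have uC: "u \<in> cot_space n" using u by (simp add: tangent_space_def)
  have "((\<lambda>s. f (\<Phi> x + cot_smult s (\<Phi> u))) has_field_derivative 0) (at 0)"
    if f: "f \<in> cot_poly_funs n" "\<forall>y\<in>\<Phi> ` X. f y = 0" for f
  proof -
    obtain g where g: "g \<in> cot_poly_funs n" "\<forall>u\<in>cot_space n. g u = f (\<Phi> u)"
      using cot_linear_pullback[OF lin f(1)] by blast
    have "\<forall>y\<in>X. g y = 0" using g(2) f(2) X by auto
    then have "((\<lambda>s. g (x + cot_smult s u)) has_field_derivative 0) (at 0)"
      using u g(1) by (simp add: tangent_space_def)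
    moreover have "g (x + cot_smult s u) = f (\<Phi> x + cot_smult s (\<Phi> u))" for s
      using g(2) x uC by (simp add: cot_space_add cot_space_smult cot_linearD(2)[OF lin] cot_linearD(3)[OF lin])
    ultimately show ?thesis by simp
  qed
  then show ?thesis using cot_linearD(1)[OF lin uC] by (simp add: tangent_space_def)
qed

text \<open>Shell, closed orbits, tangent spaces and isotropy groups are all transported by
  \<open>\<Phi>\<close>, and a slice map is composed with \<open>\<Psi>\<close>. This reduces a
  torus module to the diagonal module in its eigenbasis.\<close>

lemma sympl_iso_slice_type_O:
  assumes iso: "sympl_iso G n \<rho> n \<rho>' \<Phi> \<Psi>" and mod: "is_module l G n \<rho>" "is_module l G n \<rho>'"
    and inv: "\<And>h. h \<in> G \<Longrightarrow> tinv h \<in> G" and O: "has_slice_of_type_O l G n \<rho>"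
  shows "has_slice_of_type_O l G n \<rho>'"
proof -
  note lin = sympl_isoD(1)[OF iso]
  have iso': "sympl_iso G n \<rho>' n \<rho> \<Psi> \<Phi>" by (rule sympl_iso_sym[OF iso mod(1) inv])
  note lin' = sympl_isoD(1)[OF iso']
  obtain x where x: "x \<in> shell l G n \<rho>" "zariski_closed n (cot_orbit G \<rho> x)" "slice_type_O l G n \<rho> x"
    using O unfolding has_slice_of_type_O_def by blast
  have xC: "x \<in> cot_space n" using x(1) by (simp add: shell_def)
  have \<Phi>xC: "\<Phi> x \<in> cot_space n" by (rule cot_linearD(1)[OF lin xC])
  have actC: "cot_act \<rho> h u \<in> cot_space n" if "h \<in> G" "u \<in> cot_space n" for h u
    using is_module_carrier[OF mod(1) that(1)] is_module_carrier[OF mod(1) inv[OF that(1)]] that(2) by (rule cot_act_in_cot_space)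
  have orbC: "cot_orbit G \<rho> x \<subseteq> cot_space n" unfolding cot_orbit_def using actC[OF _ xC] by blast
  have orb: "cot_orbit G \<rho>' (\<Phi> x) = \<Phi> ` cot_orbit G \<rho> x"
    unfolding cot_orbit_def image_image using sympl_isoD(6)[OF iso _ xC] by (intro image_cong) simp_all
  have closed: "zariski_closed n (\<Phi> ` cot_orbit G \<rho> x)"
  proof -
    obtain F where F: "F \<subseteq> cot_poly_funs n" "cot_orbit G \<rho> x = {u \<in> cot_space n. \<forall>f\<in>F. f u = 0}"
      using x(2) unfolding zariski_closed_def by blast
    define F' where "F' = {g \<in> cot_poly_funs n. \<exists>f\<in>F. \<forall>u\<in>cot_space n. g u = f (\<Psi> u)}"
    have "\<Phi> ` cot_orbit G \<rho> x = {u \<in> cot_space n. \<forall>g\<in>F'. g u = 0}"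
    proof (intro equalityI subsetI)
      fix u assume "u \<in> \<Phi> ` cot_orbit G \<rho> x"
      then obtain y where y: "y \<in> cot_space n" "\<forall>f\<in>F. f y = 0" "u = \<Phi> y" unfolding F(2) by blast
      have uC: "u \<in> cot_space n" using y cot_linearD(1)[OF lin] by simp
      have "g u = 0" if "g \<in> F'" for g
      proof -
        from that uC obtain f where "f \<in> F" "g u = f (\<Psi> u)" unfolding F'_def by blast
        then show ?thesis using y sympl_isoD(2)[OF iso y(1)] by simp
      qed
      then show "u \<in> {u \<in> cot_space n. \<forall>g\<in>F'. g u = 0}" using uC by simp
    next
      fix u assume u: "u \<in> {u \<in> cot_space n. \<forall>g\<in>F'. g u = 0}"
      then have uC: "u \<in> cot_space n" by simp
      have "f (\<Psi> u) = 0" if "f \<in> F" for f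
      proof -
        have "f \<in> cot_poly_funs n" using F(1) that by blast
        then obtain g where g: "g \<in> cot_poly_funs n" "\<forall>u\<in>cot_space n. g u = f (\<Psi> u)"
          using cot_linear_pullback[OF lin'] by blast
        then have "g \<in> F'" using that unfolding F'_def by blast
        then show ?thesis using g(2) u by auto
      qed
      then have "\<Psi> u \<in> cot_orbit G \<rho> x" unfolding F(2) using cot_linearD(1)[OF lin' uC] by simp
      then show "u \<in> \<Phi> ` cot_orbit G \<rho> x" using sympl_isoD(4)[OF iso uC] by (metis imageI)
    qed
    moreover have "F' \<subseteq> cot_poly_funs n" by (auto simp: F'_def)
    ultimately show ?thesis unfolding zariski_closed_def by blast
  qed
  define E where "E = tangent_space n (cot_orbit G \<rho> x) x"
  have E: "tangent_space n (\<Phi> ` cot_orbit G \<rho> x) (\<Phi> x) = \<Phi> ` E"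
  proof (intro equalityI subsetI)
    fix u assume "u \<in> \<Phi> ` E"
    then show "u \<in> tangent_space n (\<Phi> ` cot_orbit G \<rho> x) (\<Phi> x)"
      unfolding E_def using sympl_iso_tangent_space[OF iso orbC xC] by blast
  next
    fix u assume u: "u \<in> tangent_space n (\<Phi> ` cot_orbit G \<rho> x) (\<Phi> x)"
    then have uC: "u \<in> cot_space n" by (simp add: tangent_space_def)
    have "\<Phi> ` cot_orbit G \<rho> x \<subseteq> cot_space n" using orbC cot_linearD(1)[OF lin] by auto
    from sympl_iso_tangent_space[OF iso' this \<Phi>xC u]
    have "\<Psi> u \<in> tangent_space n (\<Psi> ` \<Phi> ` cot_orbit G \<rho> x) (\<Psi> (\<Phi> x))" .
    moreover have "\<Psi> ` \<Phi> ` cot_orbit G \<rho> x = cot_orbit G \<rho> x"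
      using orbC sympl_isoD(2)[OF iso] by (force simp: image_image)
    ultimately have "\<Psi> u \<in> E" using sympl_isoD(2)[OF iso xC] by (simp add: E_def)
    then show "u \<in> \<Phi> ` E" using sympl_isoD(4)[OF iso uC] by (metis imageI)
  qed
  have EC: "E \<subseteq> cot_space n" by (auto simp: E_def tangent_space_def)
  have perp: "u \<in> omega_perp n (\<Phi> ` E) \<longleftrightarrow> u \<in> cot_space n \<and> \<Psi> u \<in> omega_perp n E" for u
  proof (cases "u \<in> cot_space n")
    case True
    have "omega u (\<Phi> e) = omega (\<Psi> u) e" if "e \<in> E" for e
      using sympl_isoD(5)[OF iso, of "\<Psi> u" e] sympl_isoD(3,4)[OF iso True] EC that by auto
    then show ?thesis using True sympl_isoD(3)[OF iso True] by (simp add: omega_perp_def)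
  qed (simp add: omega_perp_def)
  define H where "H = cot_isotropy G \<rho> x"
  have HG: "H \<subseteq> G" by (auto simp: H_def cot_isotropy_def)
  have H: "cot_isotropy G \<rho>' (\<Phi> x) = H"
    unfolding H_def cot_isotropy_def
  proof (intro Collect_cong conj_cong refl)
    fix h assume h: "h \<in> G"
    have "cot_act \<rho>' h (\<Phi> x) = \<Phi> (cot_act \<rho> h x)" using sympl_isoD(6)[OF iso h xC] by simp
    then show "(cot_act \<rho>' h (\<Phi> x) = \<Phi> x) = (cot_act \<rho> h x = x)"
      using sympl_isoD(2)[OF iso actC[OF h xC]] sympl_isoD(2)[OF iso xC] by metis
  qed
  have slice: "slice_iso H n \<rho>' (\<Phi> ` E) k \<sigma>" if "slice_iso H n \<rho> E k \<sigma>" for k \<sigma>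
  proof -
    from that obtain q where q:
      "\<forall>u\<in>omega_perp n E. \<forall>u'\<in>omega_perp n E. q (u + u') = q u + q u'"
      "\<forall>c. \<forall>u\<in>omega_perp n E. q (cot_smult c u) = cot_smult c (q u)"
      "q ` omega_perp n E = cot_space k"
      "{u \<in> omega_perp n E. q u = (0\<^sub>v k, 0\<^sub>v k)} = E"
      "\<forall>h\<in>H. \<forall>u\<in>omega_perp n E. q (cot_act \<rho> h u) = cot_act \<sigma> h (q u)"
      "\<forall>u\<in>omega_perp n E. \<forall>u'\<in>omega_perp n E. omega (q u) (q u') = omega u u'"
      unfolding slice_iso_def by (elim exE conjE)
    have im: "\<Psi> ` omega_perp n (\<Phi> ` E) = omega_perp n E"
    proof (intro equalityI subsetI)
      fix u assume "u \<in> \<Psi> ` omega_perp n (\<Phi> ` E)"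
      then show "u \<in> omega_perp n E" using perp by auto
    next
      fix u assume u: "u \<in> omega_perp n E"
      then have uC: "u \<in> cot_space n" by (simp add: omega_perp_def)
      have "\<Phi> u \<in> omega_perp n (\<Phi> ` E)"
        unfolding perp using u cot_linearD(1)[OF lin uC] sympl_isoD(2)[OF iso uC] by simp
      then show "u \<in> \<Psi> ` omega_perp n (\<Phi> ` E)" using sympl_isoD(2)[OF iso uC] by (metis imageI)
    qed
    show ?thesis
      unfolding slice_iso_def
    proof (intro exI[of _ "\<lambda>u. q (\<Psi> u)"] conjI ballI allI)
      fix u assume "u \<in> omega_perp n (\<Phi> ` E)"
      then have u: "u \<in> cot_space n" "\<Psi> u \<in> omega_perp n E" by (simp_all add: perp)
      show "q (\<Psi> (cot_smult c u)) = cot_smult c (q (\<Psi> u))" for c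
        using q(2) u by (simp add: cot_linearD(3)[OF lin'])
      show "q (\<Psi> (cot_act \<rho>' h u)) = cot_act \<sigma> h (q (\<Psi> u))" if "h \<in> H" for h
        using q(5) u sympl_isoD(6)[OF iso' _ u(1), of h] that HG by auto
      fix u' assume "u' \<in> omega_perp n (\<Phi> ` E)"
      then have u': "u' \<in> cot_space n" "\<Psi> u' \<in> omega_perp n E" by (simp_all add: perp)
      show "q (\<Psi> (u + u')) = q (\<Psi> u) + q (\<Psi> u')"
        using q(1) u u' by (simp add: cot_linearD(2)[OF lin'])
      show "omega (q (\<Psi> u)) (q (\<Psi> u')) = omega u u'"
        using q(6) u u' by (simp add: sympl_isoD(5)[OF iso'])
    next
      show "(\<lambda>u. q (\<Psi> u)) ` omega_perp n (\<Phi> ` E) = cot_space k"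
        using q(3) im by (metis image_image)
      show "{u \<in> omega_perp n (\<Phi> ` E). q (\<Psi> u) = (0\<^sub>v k, 0\<^sub>v k)} = \<Phi> ` E"
      proof (intro equalityI subsetI)
        fix u assume "u \<in> {u \<in> omega_perp n (\<Phi> ` E). q (\<Psi> u) = (0\<^sub>v k, 0\<^sub>v k)}"
        then have u: "u \<in> cot_space n" "\<Psi> u \<in> {u \<in> omega_perp n E. q u = (0\<^sub>v k, 0\<^sub>v k)}" by (simp_all add: perp)
        then have "\<Psi> u \<in> E" unfolding q(4) by simp
        then show "u \<in> \<Phi> ` E" using sympl_isoD(4)[OF iso u(1)] by (metis imageI)
      next
        fix u assume "u \<in> \<Phi> ` E"
        then obtain e where e: "e \<in> E" "u = \<Phi> e" by blast
        then have eC: "e \<in> cot_space n" using EC by auto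
        have "e \<in> {u \<in> omega_perp n E. q u = (0\<^sub>v k, 0\<^sub>v k)}" using e(1) unfolding q(4) .
        then show "u \<in> {u \<in> omega_perp n (\<Phi> ` E). q (\<Psi> u) = (0\<^sub>v k, 0\<^sub>v k)}"
          using e(2) sympl_isoD(2)[OF iso eC] cot_linearD(1)[OF lin eC] by (simp add: perp)
      qed
    qed
  qed
  have "slice_type_O l G n \<rho>' (\<Phi> x)"
    using x(3) slice unfolding slice_type_O_def Let_def orb E H H_def[symmetric] E_def[symmetric] by blast
  then show ?thesis
    unfolding has_slice_of_type_O_def using sympl_iso_shell[OF iso mod inv x(1)] closed orb
    by (intro bexI[of _ "\<Phi> x"] conjI) simp_all
qed

lemma scalar_prod_transpose:
  fixes M :: "complex mat"
  assumes "M \<in> carrier_mat n n" "v \<in> carrier_vec n" "w \<in> carrier_vec n"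
  shows "(transpose_mat M *\<^sub>v w) \<bullet> v = w \<bullet> (M *\<^sub>v v)"
proof -
  have "(transpose_mat M *\<^sub>v w) \<bullet> v = (\<Sum>i<n. (\<Sum>j<n. M $$ (j, i) * w $ j) * v $ i)"
    unfolding scalar_prod_sum[OF assms(2)]
    using assms mat_vec_index[of "transpose_mat M" n n w] by (intro sum.cong) auto
  also have "\<dots> = (\<Sum>j<n. w $ j * (\<Sum>i<n. M $$ (j, i) * v $ i))"
    unfolding sum_distrib_left sum_distrib_right by (subst sum.swap) (simp add: mult_ac)
  also have "\<dots> = w \<bullet> (M *\<^sub>v v)"
    using assms mat_vec_index[OF assms(1,2)] by (subst scalar_prod_sum[of "M *\<^sub>v v" n]) auto
  finally show ?thesis .
qed

lemma conjugate_sympl_iso: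
  fixes P Q :: "complex mat"
  assumes P: "P \<in> carrier_mat n n" and Q: "Q \<in> carrier_mat n n" and PQ: "P * Q = 1\<^sub>m n" and QP: "Q * P = 1\<^sub>m n"
    and mod: "is_module l G n \<rho>" "is_module l G n \<rho>'" and inv: "\<And>h. h \<in> G \<Longrightarrow> tinv h \<in> G"
    and conj: "\<And>t. t \<in> G \<Longrightarrow> \<rho> t * P = P * \<rho>' t"
  shows "sympl_iso G n \<rho> n \<rho>' (\<lambda>u. (Q *\<^sub>v fst u, transpose_mat P *\<^sub>v snd u)) (\<lambda>u. (P *\<^sub>v fst u, transpose_mat Q *\<^sub>v snd u))"
  unfolding sympl_iso_def cot_linear_def
proof (intro conjI ballI allI)
  have tPQ: "transpose_mat P * transpose_mat Q = 1\<^sub>m n" "transpose_mat Q * transpose_mat P = 1\<^sub>m n"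
    using P Q PQ QP by (simp_all flip: transpose_mult)
  fix u assume u: "u \<in> cot_space n"
  then have C: "fst u \<in> carrier_vec n" "snd u \<in> carrier_vec n" by (auto dest: cot_spaceD)
  show "(Q *\<^sub>v fst u, transpose_mat P *\<^sub>v snd u) \<in> cot_space n"
    "(P *\<^sub>v fst u, transpose_mat Q *\<^sub>v snd u) \<in> cot_space n"
    using C P Q by (auto simp: cot_space_def)
  show "(P *\<^sub>v fst (Q *\<^sub>v fst u, transpose_mat P *\<^sub>v snd u), transpose_mat Q *\<^sub>v snd (Q *\<^sub>v fst u, transpose_mat P *\<^sub>v snd u)) = u"
    using C P Q PQ tPQ by (simp flip: assoc_mult_mat_vec[of _ n n _ n])
  show "(Q *\<^sub>v fst (P *\<^sub>v fst u, transpose_mat Q *\<^sub>v snd u), transpose_mat P *\<^sub>v snd (P *\<^sub>v fst u, transpose_mat Q *\<^sub>v snd u)) = u"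
    using C P Q QP tPQ by (simp flip: assoc_mult_mat_vec[of _ n n _ n])
  show "(Q *\<^sub>v fst (cot_smult c u), transpose_mat P *\<^sub>v snd (cot_smult c u)) =
      cot_smult c (Q *\<^sub>v fst u, transpose_mat P *\<^sub>v snd u)" for c
    using C P Q by (simp add: cot_smult_def mult_mat_vec)
  show "(Q *\<^sub>v fst (cot_act \<rho> h u), transpose_mat P *\<^sub>v snd (cot_act \<rho> h u)) =
      cot_act \<rho>' h (Q *\<^sub>v fst u, transpose_mat P *\<^sub>v snd u)" if h: "h \<in> G" for h
  proof -
    have r: "\<rho> h \<in> carrier_mat n n" "\<rho>' h \<in> carrier_mat n n" "\<rho> (tinv h) \<in> carrier_mat n n" "\<rho>' (tinv h) \<in> carrier_mat n n"
      using mod h inv[OF h] by (auto dest: is_module_carrier)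
    have "Q * \<rho> h = Q * \<rho> h * (P * Q)" using Q r PQ by simp
    also have "\<dots> = Q * (\<rho> h * P) * Q" using Q r P by (simp add: assoc_mult_mat[of _ n n _ n _ n])
    also have "\<dots> = (Q * P) * \<rho>' h * Q" unfolding conj[OF h] using Q r P by (simp add: assoc_mult_mat[of _ n n _ n _ n])
    also have "\<dots> = \<rho>' h * Q" using QP r by simp
    finally have "Q *\<^sub>v (\<rho> h *\<^sub>v fst u) = \<rho>' h *\<^sub>v (Q *\<^sub>v fst u)"
      using Q r C by (metis assoc_mult_mat_vec)
    moreover have "transpose_mat P * transpose_mat (\<rho> (tinv h)) = transpose_mat (\<rho>' (tinv h)) * transpose_mat P"
      using arg_cong[OF conj[OF inv[OF h]], of transpose_mat] r P by (simp add: transpose_mult)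
    then have "transpose_mat P *\<^sub>v (transpose_mat (\<rho> (tinv h)) *\<^sub>v snd u) = transpose_mat (\<rho>' (tinv h)) *\<^sub>v (transpose_mat P *\<^sub>v snd u)"
      using P r C by (metis assoc_mult_mat_vec transpose_carrier_mat)
    ultimately show ?thesis by (simp add: cot_act_def)
  qed
  fix u' assume u': "u' \<in> cot_space n"
  then have C': "fst u' \<in> carrier_vec n" "snd u' \<in> carrier_vec n" by (auto dest: cot_spaceD)
  show "(Q *\<^sub>v fst (u + u'), transpose_mat P *\<^sub>v snd (u + u')) =
      (Q *\<^sub>v fst u, transpose_mat P *\<^sub>v snd u) + (Q *\<^sub>v fst u', transpose_mat P *\<^sub>v snd u')"
    using C C' P Q by (simp add: plus_prod_def mult_add_distrib_mat_vec[of _ n n])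
  have tr: "(transpose_mat P *\<^sub>v \<xi>) \<bullet> (Q *\<^sub>v v) = \<xi> \<bullet> v" if "v \<in> carrier_vec n" "\<xi> \<in> carrier_vec n" for v \<xi>
  proof -
    have "(transpose_mat P *\<^sub>v \<xi>) \<bullet> (Q *\<^sub>v v) = \<xi> \<bullet> (P *\<^sub>v (Q *\<^sub>v v))"
      using that P Q by (intro scalar_prod_transpose) auto
    also have "P *\<^sub>v (Q *\<^sub>v v) = v" using that P Q PQ by (simp flip: assoc_mult_mat_vec[of _ n n _ n])
    finally show ?thesis .
  qed
  show "omega (Q *\<^sub>v fst u, transpose_mat P *\<^sub>v snd u) (Q *\<^sub>v fst u', transpose_mat P *\<^sub>v snd u') = omega u u'"
    using tr C C' by (simp add: omega_def)
qed

section \<open>The quotient of the shell of a diagonal module\<close>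

text \<open>The differential of the character with weight \<open>b\<close>.\<close>

definition lam :: "nat \<Rightarrow> (nat \<Rightarrow> int) \<Rightarrow> complex vec \<Rightarrow> complex" where
  "lam l b X = (\<Sum>i<l. of_int (b i) * X $ i)"

lemma exp_multiples_one:
  fixes c :: complex
  assumes "\<And>s. exp (s * c) = 1"
  shows "c = 0"
proof (rule ccontr)
  assume "c \<noteq> 0"
  then show False using assms[of "1 / c"] exp_one_neq_one by simp
qed

lemma chr_texp_smult: "X \<in> carrier_vec l \<Longrightarrow> chr l b (texp (s \<cdot>\<^sub>v X)) = exp (s * lam l b X)"
proof -
  assume X: "X \<in> carrier_vec l"
  have "(\<Sum>i<l. of_int (b i) * (s \<cdot>\<^sub>v X) $ i) = s * lam l b X"
    unfolding lam_def sum_distrib_left using X by (intro sum.cong) auto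
  then show ?thesis using chr_texp[of "s \<cdot>\<^sub>v X" l b] X by simp
qed

lemma stab_subset_torus: "stab l a S \<subseteq> torus l"
  by (auto simp: stab_def)

lemma drep_stab_module: "is_module l (stab l a S) m (drep l a e m)"
  by (rule drep_is_module[OF stab_subset_torus])

lemma cot_act_drep':
  assumes "h \<in> torus l" "u \<in> cot_space m"
  shows "cot_act (drep l a e m) h u =
    (vec m (\<lambda>i. chr l (a (e i)) h * fst u $ i), vec m (\<lambda>i. inverse (chr l (a (e i)) h) * snd u $ i))"
  using cot_act_drep[OF assms(1) cot_spaceD[OF assms(2)]] by simp

text \<open>The action along a one-parameter group is explicit, so its derivative can be compared
  with \<open>moment_derivative\<close>; the matrix \<open>lie_action\<close> never has to be
  evaluated.\<close>

lemma moment_drep: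
  assumes X: "X \<in> ann l a S" and u: "u \<in> cot_space m"
  shows "moment m (drep l a e m) u X = (\<Sum>j<m. lam l (a (e j)) X * (fst u $ j * snd u $ j))"
proof -
  let ?\<rho> = "drep l a e m" and ?v = "fst u" and ?x = "snd u" and ?c = "\<lambda>j. lam l (a (e j)) X"
  have XC: "X \<in> carrier_vec l" using X by (simp add: ann_def)
  have C: "?v \<in> carrier_vec m" "?x \<in> carrier_vec m" using u by (auto dest: cot_spaceD)
  have "omega (cot_act ?\<rho> (texp (s \<cdot>\<^sub>v X)) u) u =
    (\<Sum>j<m. ?x $ j * (exp (s * ?c j) * ?v $ j)) - (\<Sum>j<m. inverse (exp (s * ?c j)) * ?x $ j * ?v $ j)" for s
  proof -
    have "texp (s \<cdot>\<^sub>v X) \<in> torus l" using XC by (intro torus_texp) simp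
    then show ?thesis
      using C by (simp add: cot_act_drep' u omega_def scalar_prod_sum[of _ m] chr_texp_smult[OF XC])
  qed
  moreover have "((\<lambda>s. (\<Sum>j<m. ?x $ j * (exp (s * ?c j) * ?v $ j)) - (\<Sum>j<m. inverse (exp (s * ?c j)) * ?x $ j * ?v $ j))
      has_field_derivative (\<Sum>j<m. ?x $ j * (?c j * ?v $ j)) - (\<Sum>j<m. - ?c j * ?x $ j * ?v $ j)) (at 0)"
    by (intro DERIV_diff DERIV_sum) (auto intro!: derivative_eq_intros)
  ultimately have "((\<lambda>s. omega (cot_act ?\<rho> (texp (s \<cdot>\<^sub>v X)) u) u) has_field_derivative
      (\<Sum>j<m. ?x $ j * (?c j * ?v $ j)) - (\<Sum>j<m. - ?c j * ?x $ j * ?v $ j)) (at 0)" by simp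
  moreover have "X \<in> lie_algebra l (stab l a S)" using X by (simp add: lie_algebra_stab)
  from moment_derivative[OF drep_stab_module this u]
  have "((\<lambda>s. omega (cot_act ?\<rho> (texp (s \<cdot>\<^sub>v X)) u) u) has_field_derivative 2 * moment m ?\<rho> u X) (at 0)" .
  ultimately have "2 * moment m ?\<rho> u X = (\<Sum>j<m. ?x $ j * (?c j * ?v $ j)) - (\<Sum>j<m. - ?c j * ?x $ j * ?v $ j)"
    by (rule DERIV_unique[rotated])
  also have "\<dots> = 2 * (\<Sum>j<m. ?c j * (?v $ j * ?x $ j))"
    unfolding sum_subtractf[symmetric] sum_distrib_left by (intro sum.cong) (simp_all add: algebra_simps)
  finally show ?thesis by simp
qed

text \<open>The linear space of moment equations for the products v_j \<xi>_j: the shell is its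
  preimage. By \<open>wgt_relation\<close> it also contains the exponent differences of the
  invariant monomials.\<close>

definition relations :: "nat \<Rightarrow> (nat \<Rightarrow> nat \<Rightarrow> int) \<Rightarrow> nat set \<Rightarrow> (nat \<Rightarrow> nat) \<Rightarrow> nat \<Rightarrow> (nat \<Rightarrow> complex) set" where
  "relations l a S e m = {z. \<forall>X\<in>ann l a S. (\<Sum>j<m. lam l (a (e j)) X * z j) = 0}"

lemma shell_drep:
  "shell l (stab l a S) m (drep l a e m) =
    {u \<in> cot_space m. (\<lambda>j. fst u $ j * snd u $ j) \<in> relations l a S e m}"
  unfolding shell_def relations_def lie_algebra_stab by (auto simp: moment_drep)

text \<open>The action leaves each product v_j \<xi>_j unchanged.\<close>

lemma shell_drep_act:
  assumes "h \<in> stab l a S" "u \<in> shell l (stab l a S) m (drep l a e m)"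
  shows "cot_act (drep l a e m) h u \<in> shell l (stab l a S) m (drep l a e m)"
proof -
  have h: "h \<in> torus l" using assms(1) by (rule stabD)
  have u: "u \<in> cot_space m" using assms(2) by (simp add: shell_def)
  have "(\<Sum>j<m. lam l (a (e j)) X * (fst (cot_act (drep l a e m) h u) $ j * snd (cot_act (drep l a e m) h u) $ j)) =
    (\<Sum>j<m. lam l (a (e j)) X * (fst u $ j * snd u $ j))" for X
    using chr_nonzero[OF h] by (intro sum.cong) (simp_all add: cot_act_drep'[OF h u])
  moreover have "cot_act (drep l a e m) h u \<in> cot_space m" by (simp add: cot_act_drep'[OF h u] cot_space_def)
  ultimately show ?thesis using assms(2) by (simp add: shell_drep relations_def)
qed

text \<open>The condition says that the vector of invariants \<open>v\<^sub>j \<xi>\<^sub>j\<close> lies in Z.\<close>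

definition over :: "nat \<Rightarrow> (nat \<Rightarrow> complex) set \<Rightarrow> (complex vec \<times> complex vec) set" where
  "over m Z = {u \<in> cot_space m. (\<forall>j<m. fst u $ j \<noteq> 0) \<and> (\<exists>z\<in>Z. \<forall>j<m. snd u $ j = z j / fst u $ j)}"

lemma over_shell:
  assumes "Z \<subseteq> relations l a S e m"
  shows "over m Z \<subseteq> shell l (stab l a S) m (drep l a e m)"
proof
  fix u assume "u \<in> over m Z"
  then obtain z where u: "u \<in> cot_space m" "\<forall>j<m. fst u $ j \<noteq> 0" "z \<in> Z" "\<forall>j<m. snd u $ j = z j / fst u $ j"
    unfolding over_def by blast
  have "(\<Sum>j<m. lam l (a (e j)) X * (fst u $ j * snd u $ j)) = (\<Sum>j<m. lam l (a (e j)) X * z j)" for X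
    using u by (intro sum.cong) auto
  then show "u \<in> shell l (stab l a S) m (drep l a e m)"
    using u(1,3) assms by (auto simp: shell_drep relations_def)
qed

text \<open>The vector coordinates move along exponentials, which have no zeros, and the products
  along a straight line in \<open>Z\<close>; the covector coordinates are the quotients.\<close>

lemma over_entire_connected:
  assumes Z: "Z \<noteq> {}" "\<And>z z' s. z \<in> Z \<Longrightarrow> z' \<in> Z \<Longrightarrow> (\<lambda>j. z j + s * (z' j - z j)) \<in> Z"
    and F: "F \<subseteq> cot_poly_funs m"
  shows "entire_connected F (over m Z)"
  unfolding entire_connected_def
proof (intro conjI ballI)
  obtain z where "z \<in> Z" using Z(1) by blast
  then have "(vec m (\<lambda>_. 1), vec m z) \<in> over m Z" by (auto simp: over_def cot_space_def)
  then show "over m Z \<noteq> {}" by blast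
  fix p q assume "p \<in> over m Z" "q \<in> over m Z"
  then obtain z z' where p: "p \<in> cot_space m" "\<forall>j<m. fst p $ j \<noteq> 0" "z \<in> Z" "\<forall>j<m. snd p $ j = z j / fst p $ j"
    and q: "q \<in> cot_space m" "\<forall>j<m. fst q $ j \<noteq> 0" "z' \<in> Z" "\<forall>j<m. snd q $ j = z' j / fst q $ j"
    unfolding over_def by blast
  define v where "v s j = fst p $ j * exp (s * Ln (fst q $ j / fst p $ j))" for s j
  define x where "x s j = (z j + s * (z' j - z j)) / v s j" for s j
  define c where "c s = (vec m (v s), vec m (x s))" for s
  have v: "v s j \<noteq> 0" if "j < m" for s j using p(2) that by (simp add: v_def)
  have cmem: "c s \<in> over m Z" for s
    unfolding over_def
  proof (intro CollectI conjI)
    show "c s \<in> cot_space m" by (simp add: c_def cot_space_def)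
    show "\<forall>j<m. fst (c s) $ j \<noteq> 0" using v by (simp add: c_def)
    show "\<exists>z\<in>Z. \<forall>j<m. snd (c s) $ j = z j / fst (c s) $ j"
      by (rule bexI[OF _ Z(2)[OF p(3) q(3), of s]]) (simp add: c_def x_def)
  qed
  have pC: "fst p \<in> carrier_vec m" "snd p \<in> carrier_vec m" and qC: "fst q \<in> carrier_vec m" "snd q \<in> carrier_vec m"
    using p(1) q(1) by (auto dest: cot_spaceD)
  have v0: "v 0 j = fst p $ j" for j by (simp add: v_def)
  have v1: "v 1 j = fst q $ j" if "j < m" for j using p(2) q(2) that by (simp add: v_def)
  have "c 0 = p"
    unfolding c_def prod_eq_iff fst_conv snd_conv
    using pC p(4) by (intro conjI eq_vecI) (auto simp: v0 x_def)
  moreover have "c 1 = q"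
    unfolding c_def prod_eq_iff fst_conv snd_conv
    using qC q(4) by (intro conjI eq_vecI) (auto simp: v1 x_def)
  moreover have "(\<lambda>s. f (c s)) holomorphic_on UNIV" if "f \<in> F" for f
  proof -
    have "f \<in> cot_poly_funs m" using that F by blast
    from this[unfolded cot_poly_funs_def] show ?thesis
    proof (rule gen_algebra_holomorphic)
      fix g :: "complex vec \<times> complex vec \<Rightarrow> complex"
      assume "g \<in> {\<lambda>u. fst u $ i | i. i < m} \<union> {\<lambda>u. snd u $ i | i. i < m}"
      then obtain i where i: "i < m" "g = (\<lambda>u. fst u $ i) \<or> g = (\<lambda>u. snd u $ i)" by blast
      have "(\<lambda>s. v s i) holomorphic_on UNIV" unfolding v_def by (intro holomorphic_intros)
      moreover from this have "(\<lambda>s. x s i) holomorphic_on UNIV"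
        unfolding x_def using v[OF i(1)] by (intro holomorphic_intros) auto
      moreover have "(\<lambda>s. fst (c s) $ i) = (\<lambda>s. v s i)" "(\<lambda>s. snd (c s) $ i) = (\<lambda>s. x s i)"
        using i(1) by (simp_all add: c_def)
      ultimately show "(\<lambda>s. g (c s)) holomorphic_on UNIV" using i(2) by auto
    qed
  qed
  ultimately show "\<exists>c. (\<forall>s. c s \<in> over m Z) \<and> c 0 = p \<and> c 1 = q \<and> (\<forall>f\<in>F. (\<lambda>s. f (c s)) holomorphic_on UNIV)"
    using cmem by (intro exI[of _ c]) simp
qed

lemma over_mono: "Z \<subseteq> Z' \<Longrightarrow> over m Z \<subseteq> over m Z'"
  by (auto simp: over_def)

lemma over_member: "z \<in> Z \<Longrightarrow> (vec m (\<lambda>_. 1), vec m z) \<in> over m Z"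
  by (auto simp: over_def cot_space_def)

text \<open>The Laurent monomial in v with exponents \<open>b\<close>, where negative powers of v_j
  are replaced by powers of \<xi>_j, which has the opposite weight.\<close>

definition bimonomial :: "nat \<Rightarrow> (nat \<Rightarrow> int) \<Rightarrow> complex vec \<times> complex vec \<Rightarrow> complex" where
  "bimonomial m b u = (\<Prod>j<m. fst u $ j ^ nat (b j) * snd u $ j ^ nat (- b j))"

lemma bimonomial_poly: "bimonomial m b \<in> cot_poly_funs m"
  unfolding bimonomial_def[abs_def]
  by (intro fun_algebra_prod[OF cot_poly_funs_algebra] fun_algebraD(3)[OF cot_poly_funs_algebra]
      fun_algebra_power[OF cot_poly_funs_algebra] cot_coord_poly) auto

lemma power_nat_split: "x \<noteq> 0 \<Longrightarrow> x ^ nat b * inverse x ^ nat (- b) = (x :: complex) powi b"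
  by (cases "b \<ge> 0") (simp_all add: power_int_def)

lemma bimonomial_act:
  assumes "h \<in> torus l" "u \<in> cot_space m"
  shows "bimonomial m b (cot_act (drep l a e m) h u) = (\<Prod>j<m. chr l (a (e j)) h powi b j) * bimonomial m b u"
  unfolding bimonomial_def prod.distrib[symmetric]
proof (rule prod.cong[OF refl])
  fix j assume "j \<in> {..<m}"
  then show "fst (cot_act (drep l a e m) h u) $ j ^ nat (b j) * snd (cot_act (drep l a e m) h u) $ j ^ nat (- b j) =
      chr l (a (e j)) h powi b j * (fst u $ j ^ nat (b j) * snd u $ j ^ nat (- b j))"
    using power_nat_split[OF chr_nonzero[OF assms(1)], of "a (e j)" "b j"]
    by (simp add: cot_act_drep'[OF assms] power_mult_distrib mult_ac)
qed

abbreviation invariants where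
  "invariants l a S e m \<equiv> {f \<in> cot_poly_funs m. \<forall>h\<in>stab l a S. \<forall>u\<in>shell l (stab l a S) m (drep l a e m).
     f (cot_act (drep l a e m) h u) = f u}"

lemma coordinate_product_invariant:
  assumes "i < m"
  shows "(\<lambda>u. fst u $ i * snd u $ i - c) \<in> invariants l a S e m"
proof -
  have "(\<lambda>u. fst u $ i * snd u $ i - c) \<in> cot_poly_funs m"
    using assms by (intro fun_algebra_diff[OF cot_poly_funs_algebra] fun_algebraD[OF cot_poly_funs_algebra] cot_coord_poly)
  moreover have "fst (cot_act (drep l a e m) h u) $ i * snd (cot_act (drep l a e m) h u) $ i = fst u $ i * snd u $ i"
    if "h \<in> stab l a S" "u \<in> shell l (stab l a S) m (drep l a e m)" for h u
  proof -
    have h: "h \<in> torus l" using that(1) by (rule stabD)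
    have u: "u \<in> cot_space m" using that(2) by (simp add: shell_def)
    show ?thesis using assms chr_nonzero[OF h] by (simp add: cot_act_drep'[OF h u])
  qed
  ultimately show ?thesis by simp
qed

lemma over_product: "u \<in> over m Z \<Longrightarrow> \<exists>z\<in>Z. \<forall>i<m. fst u $ i * snd u $ i = z i"
  unfolding over_def by fastforce

text \<open>On the fibre over \<open>z0\<close> all products v_j \<xi>_j are constant, so an
  invariant monomial has to separate its points. Doubling v_j and halving \<xi>_j at j =
  \<open>j0\<close> stays in the fibre and multiplies the monomial by 2 to the power
  \<open>b j0\<close>, which is not 1.\<close>

lemma monomial_separates:
  assumes z0: "\<And>j. j < m \<Longrightarrow> z0 j \<noteq> 0" and b: "j0 < m" "b j0 \<noteq> 0"
    and inv: "\<And>h. h \<in> stab l a S \<Longrightarrow> (\<Prod>j<m. chr l (a (e j)) h powi b j) = 1"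
  shows "\<exists>g\<in>invariants l a S e m. g (vec m (\<lambda>_. 1), vec m z0) = 0 \<and> (\<exists>y\<in>over m {z0}. g y \<noteq> 0)"
proof -
  let ?p = "(vec m (\<lambda>_. 1), vec m z0)"
  define c where "c = bimonomial m b ?p"
  define g where "g u = bimonomial m b u - c" for u
  have cz: "c = (\<Prod>j<m. z0 j ^ nat (- b j))" by (simp add: c_def bimonomial_def)
  then have c0: "c \<noteq> 0" using z0 by simp
  have "g \<in> cot_poly_funs m" unfolding g_def[abs_def]
    by (intro fun_algebra_diff[OF cot_poly_funs_algebra] bimonomial_poly fun_algebraD(1)[OF cot_poly_funs_algebra])
  moreover have "g (cot_act (drep l a e m) h u) = g u"
    if "h \<in> stab l a S" "u \<in> shell l (stab l a S) m (drep l a e m)" for h u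
    using bimonomial_act[of h l u m b a e] inv[OF that(1)] stabD(1)[OF that(1)] that(2) by (simp add: g_def shell_def)
  ultimately have "g \<in> invariants l a S e m" by simp
  moreover have "g ?p = 0" by (simp add: g_def c_def)
  moreover
  define y :: "complex vec \<times> complex vec" where "y = (vec m (\<lambda>j. if j = j0 then 2 else 1), vec m (\<lambda>j. if j = j0 then z0 j / 2 else z0 j))"
  have "y \<in> over m {z0}"
    unfolding over_def by (intro CollectI conjI bexI[of _ z0] allI impI) (simp_all add: y_def cot_space_def)
  moreover have "g y \<noteq> 0"
  proof -
    have "bimonomial m b y = (\<Prod>j<m. (if j = j0 then 2 powi b j0 else 1) * z0 j ^ nat (- b j))"
      unfolding bimonomial_def
    proof (rule prod.cong[OF refl])
      fix j assume "j \<in> {..<m}"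
      then have j: "j < m" by simp
      show "fst y $ j ^ nat (b j) * snd y $ j ^ nat (- b j) = (if j = j0 then 2 powi b j0 else 1) * z0 j ^ nat (- b j)"
      proof (cases "j = j0")
        case True
        then have "fst y $ j ^ nat (b j) * snd y $ j ^ nat (- b j) = 2 ^ nat (b j) * (inverse 2 * z0 j) ^ nat (- b j)"
          using j by (simp add: y_def)
        also have "\<dots> = 2 powi b j * z0 j ^ nat (- b j)"
          unfolding power_mult_distrib mult.assoc[symmetric] by (subst power_nat_split) simp_all
        finally show ?thesis using True by simp
      qed (use j in \<open>simp add: y_def\<close>)
    qed
    also have "\<dots> = 2 powi b j0 * c" using b(1) by (simp add: prod.distrib cz)
    finally have "g y = (2 powi b j0 - 1) * c" by (simp add: g_def algebra_simps)
    moreover have "(2::complex) powi b j0 \<noteq> 1"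
    proof
      assume "(2::complex) powi b j0 = 1"
      then have "cmod (2 powi b j0) = 1" by simp
      then have "(2::real) powi b j0 = 2 powi 0" by (simp add: norm_power_int)
      then show False
        using b(2) power_int_strict_increasing[of "b j0" 0 "2::real"] power_int_strict_increasing[of 0 "b j0" "2::real"]
        by (cases "b j0 < 0") auto
    qed
    ultimately show ?thesis using c0 by simp
  qed
  ultimately show ?thesis by blast
qed

lemma entire_connected_singleton: "entire_connected F {p}"
  unfolding entire_connected_def by (auto intro!: exI[of _ "\<lambda>_. p"])

lemma shell_quotient_drep:
  "shell_quotient_ring l (stab l a S) m (drep l a e m) =
    fun_ring (shell l (stab l a S) m (drep l a e m)) (invariants l a S e m)"
  by (simp add: shell_quotient_ring_def)

lemma relations_linear:
  assumes "z \<in> relations l a S e m" "z' \<in> relations l a S e m"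
  shows "(\<lambda>j. c * z j + d * z' j) \<in> relations l a S e m"
proof -
  have "(\<Sum>j<m. lam l (a (e j)) X * (c * z j + d * z' j)) =
      c * (\<Sum>j<m. lam l (a (e j)) X * z j) + d * (\<Sum>j<m. lam l (a (e j)) X * z' j)" for X
    unfolding sum_distrib_left sum.distrib[symmetric] by (intro sum.cong) (simp_all add: algebra_simps)
  then show ?thesis using assms by (simp add: relations_def)
qed

text \<open>The chain consists of the set over the line spanned by \<open>z0\<close>, the fibre over
  \<open>z0\<close>, and a point of it. A product v_j \<xi>_j separates the first two, an invariant
  monomial the last two.\<close>

lemma shell_quotient_dim_ge_2:
  assumes z0: "z0 \<in> relations l a S e m" "\<And>j. j < m \<Longrightarrow> z0 j \<noteq> 0" and b: "j0 < m" "b j0 \<noteq> 0"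
    and inv: "\<And>h. h \<in> stab l a S \<Longrightarrow> (\<Prod>j<m. chr l (a (e j)) h powi b j) = 1"
  shows "krull_dim (shell_quotient_ring l (stab l a S) m (drep l a e m)) \<ge> 2"
proof -
  let ?p = "(vec m (\<lambda>_. 1), vec m z0)" and ?F = "invariants l a S e m"
  define Z where "Z = {\<lambda>j. c * z0 j | c. True}"
  have z0Z: "z0 \<in> Z" unfolding Z_def by (auto intro!: exI[of _ 1])
  have Zrel: "Z \<subseteq> relations l a S e m"
  proof
    fix z assume "z \<in> Z"
    then obtain c where "z = (\<lambda>j. c * z0 j + 0 * z0 j)" by (auto simp: Z_def)
    then show "z \<in> relations l a S e m" using relations_linear[OF z0(1) z0(1), of c 0] by simp
  qed
  define Y where "Y i = (if i = 0 then over m Z else if i = 1 then over m {z0} else {?p})" for i :: nat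
  have FC: "?F \<subseteq> cot_poly_funs m" by blast
  have "ereal (real 2) \<le> krull_dim (fun_ring (shell l (stab l a S) m (drep l a e m)) ?F)"
  proof (rule krull_dim_ge_chain[where Y = Y])
    show "fun_algebra ?F" by (rule invariant_algebra)
    have "entire_connected ?F (over m Z)"
    proof (rule over_entire_connected[OF _ _ FC])
      show "Z \<noteq> {}" using z0Z by blast
      fix z z' s assume "z \<in> Z" "z' \<in> Z"
      then obtain c c' where "z = (\<lambda>j. c * z0 j)" "z' = (\<lambda>j. c' * z0 j)" by (auto simp: Z_def)
      then have "(\<lambda>j. z j + s * (z' j - z j)) = (\<lambda>j. (c + s * (c' - c)) * z0 j)" by (simp add: algebra_simps)
      then show "(\<lambda>j. z j + s * (z' j - z j)) \<in> Z" unfolding Z_def by blast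
    qed
    moreover have "entire_connected ?F (over m {z0})" by (rule over_entire_connected[OF _ _ FC]) auto
    ultimately show "entire_connected ?F (Y i)" if "i \<le> 2" for i
      using entire_connected_singleton by (auto simp: Y_def)
    have pm: "?p \<in> over m {z0}" by (rule over_member) simp
    have s1: "over m {z0} \<subseteq> over m Z" using z0Z by (intro over_mono) simp
    have s0: "over m Z \<subseteq> shell l (stab l a S) m (drep l a e m)" by (rule over_shell[OF Zrel])
    show "Y i \<subseteq> shell l (stab l a S) m (drep l a e m)" if "i \<le> 2" for i
      using pm s1 s0 by (auto simp: Y_def)
    show "Y (Suc i) \<subseteq> Y i" if "i < 2" for i using pm s1 by (auto simp: Y_def)
    show "\<exists>g\<in>?F. (\<forall>y\<in>Y (Suc i). g y = 0) \<and> (\<exists>y\<in>Y i. g y \<noteq> 0)" if "i < 2" for i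
    proof (cases "i = 0")
      case True
      let ?g = "\<lambda>u. fst u $ j0 * snd u $ j0 - z0 j0" and ?y = "(vec m (\<lambda>_. 1), vec m (\<lambda>_. 0))"
      have Yi: "Y i = over m Z" "Y (Suc i) = over m {z0}" using True by (simp_all add: Y_def)
      show ?thesis
        unfolding Yi
      proof (rule bexI[of _ ?g], rule conjI)
        show "\<forall>y\<in>over m {z0}. ?g y = 0"
        proof
          fix y :: "complex vec \<times> complex vec" assume "y \<in> over m {z0}"
          from over_product[OF this] show "?g y = 0" using b(1) by simp
        qed
        have "?y \<in> over m Z" by (rule over_member) (auto simp: Z_def intro!: exI[of _ 0])
        then show "\<exists>y\<in>over m Z. ?g y \<noteq> 0" by (rule bexI[rotated]) (use b(1) z0(2) in simp)
      qed (rule coordinate_product_invariant[OF b(1)])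
    next
      case False
      then have "i = 1" using \<open>i < 2\<close> by simp
      then have "Y i = over m {z0}" "Y (Suc i) = {?p}" by (simp_all add: Y_def)
      then show ?thesis using monomial_separates[where m = m and ?z0.0 = z0 and ?j0.0 = j0 and b = b and l = l and a = a and S = S and e = e, OF z0(2) b inv]
          by simp
    qed
  qed
  then show ?thesis by (simp add: shell_quotient_drep)
qed

text \<open>A second relation \<open>z1\<close> makes room for one more step: the plane spanned by
  \<open>z0\<close> and \<open>z1\<close>, the affine line through \<open>z0\<close> in direction
  \<open>z1\<close>, then \<open>z0\<close>, then a point of its fibre. Because \<open>z1\<close>
  vanishes at \<open>i1\<close>, the product at \<open>i1\<close> is constant over the affine line
  but not over the plane; the product at \<open>j1\<close> distinguishes the affine line from
  \<open>z0\<close>.\<close>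

lemma shell_quotient_dim_ge_3:
  assumes z0: "z0 \<in> relations l a S e m" "\<And>j. j < m \<Longrightarrow> z0 j \<noteq> 0" and b: "j0 < m" "b j0 \<noteq> 0"
    and z1: "z1 \<in> relations l a S e m" "i1 < m" "z1 i1 = 0" "j1 < m" "z1 j1 \<noteq> 0"
    and inv: "\<And>h. h \<in> stab l a S \<Longrightarrow> (\<Prod>j<m. chr l (a (e j)) h powi b j) = 1"
  shows "krull_dim (shell_quotient_ring l (stab l a S) m (drep l a e m)) \<ge> 3"
proof -
  let ?p = "(vec m (\<lambda>_. 1), vec m z0)" and ?F = "invariants l a S e m"
  define Z where "Z = {\<lambda>j. c * z0 j + d * z1 j | c d. True}"
  define Z' where "Z' = {\<lambda>j. 1 * z0 j + d * z1 j | d. True}"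
  have z0Z: "z0 \<in> Z'" unfolding Z'_def by (auto intro!: exI[of _ 0])
  have Zrel: "Z \<subseteq> relations l a S e m" unfolding Z_def using relations_linear[OF z0(1) z1(1)] by blast
  define Y where "Y i = (if i = 0 then over m Z else if i = 1 then over m Z' else if i = 2 then over m {z0} else {?p})" for i :: nat
  have FC: "?F \<subseteq> cot_poly_funs m" by blast
  have ZZ: "Z' \<subseteq> Z" unfolding Z_def Z'_def by blast
  have "ereal (real 3) \<le> krull_dim (fun_ring (shell l (stab l a S) m (drep l a e m)) ?F)"
  proof (rule krull_dim_ge_chain[where Y = Y])
    show "fun_algebra ?F" by (rule invariant_algebra)
    have "entire_connected ?F (over m Z)"
    proof (rule over_entire_connected[OF _ _ FC])
      show "Z \<noteq> {}" using z0Z ZZ by blast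
      fix z z' s assume "z \<in> Z" "z' \<in> Z"
      then obtain c d c' d' where "z = (\<lambda>j. c * z0 j + d * z1 j)" "z' = (\<lambda>j. c' * z0 j + d' * z1 j)" by (auto simp: Z_def)
      then have "(\<lambda>j. z j + s * (z' j - z j)) = (\<lambda>j. (c + s * (c' - c)) * z0 j + (d + s * (d' - d)) * z1 j)"
        by (simp add: algebra_simps)
      then show "(\<lambda>j. z j + s * (z' j - z j)) \<in> Z" unfolding Z_def by blast
    qed
    moreover have "entire_connected ?F (over m Z')"
    proof (rule over_entire_connected[OF _ _ FC])
      show "Z' \<noteq> {}" using z0Z by blast
      fix z z' s assume "z \<in> Z'" "z' \<in> Z'"
      then obtain d d' where "z = (\<lambda>j. 1 * z0 j + d * z1 j)" "z' = (\<lambda>j. 1 * z0 j + d' * z1 j)" by (auto simp: Z'_def)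
      then have "(\<lambda>j. z j + s * (z' j - z j)) = (\<lambda>j. 1 * z0 j + (d + s * (d' - d)) * z1 j)"
        by (simp add: algebra_simps)
      then show "(\<lambda>j. z j + s * (z' j - z j)) \<in> Z'" unfolding Z'_def by blast
    qed
    moreover have "entire_connected ?F (over m {z0})" by (rule over_entire_connected[OF _ _ FC]) auto
    ultimately show "entire_connected ?F (Y i)" if "i \<le> 3" for i
      using entire_connected_singleton by (auto simp: Y_def)
    have pm: "?p \<in> over m {z0}" by (rule over_member) simp
    have s2: "over m {z0} \<subseteq> over m Z'" using z0Z by (intro over_mono) simp
    have s1: "over m Z' \<subseteq> over m Z" by (rule over_mono[OF ZZ])
    have s0: "over m Z \<subseteq> shell l (stab l a S) m (drep l a e m)" by (rule over_shell[OF Zrel])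
    show "Y i \<subseteq> shell l (stab l a S) m (drep l a e m)" if "i \<le> 3" for i
      using pm s2 s1 s0 by (auto simp: Y_def)
    show "Y (Suc i) \<subseteq> Y i" if "i < 3" for i using pm s1 s2 by (auto simp: Y_def)
    show "\<exists>g\<in>?F. (\<forall>y\<in>Y (Suc i). g y = 0) \<and> (\<exists>y\<in>Y i. g y \<noteq> 0)" if i3: "i < 3" for i
    proof -
      consider "i = 0" | "i = 1" | "i = 2" using i3 by linarith
      then show ?thesis
      proof cases
        case 1
        let ?g = "\<lambda>u. fst u $ i1 * snd u $ i1 - z0 i1" and ?y = "(vec m (\<lambda>_. 1), vec m (\<lambda>_. 0))"
        have Yi: "Y i = over m Z" "Y (Suc i) = over m Z'" using 1 by (simp_all add: Y_def)
        show ?thesis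
          unfolding Yi
        proof (rule bexI[of _ ?g], rule conjI)
          show "\<forall>y\<in>over m Z'. ?g y = 0"
          proof
            fix y :: "complex vec \<times> complex vec" assume "y \<in> over m Z'"
            from over_product[OF this] show "?g y = 0" using z1(2,3) by (auto simp: Z'_def)
          qed
          have "?y \<in> over m Z" by (rule over_member) (auto simp: Z_def intro!: exI[of _ 0])
          then show "\<exists>y\<in>over m Z. ?g y \<noteq> 0" by (rule bexI[rotated]) (use z1(2) z0(2) in simp)
        qed (rule coordinate_product_invariant[OF z1(2)])
      next
        case 2
        let ?g = "\<lambda>u. fst u $ j1 * snd u $ j1 - z0 j1" and ?y = "(vec m (\<lambda>_. 1), vec m (\<lambda>j. 1 * z0 j + 1 * z1 j))"
        have Yi: "Y i = over m Z'" "Y (Suc i) = over m {z0}" using 2 by (simp_all add: Y_def)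
        show ?thesis
          unfolding Yi
        proof (rule bexI[of _ ?g], rule conjI)
          show "\<forall>y\<in>over m {z0}. ?g y = 0"
          proof
            fix y :: "complex vec \<times> complex vec" assume "y \<in> over m {z0}"
            from over_product[OF this] show "?g y = 0" using z1(4) by simp
          qed
          have "?y \<in> over m Z'" by (rule over_member) (unfold Z'_def, blast)
          then show "\<exists>y\<in>over m Z'. ?g y \<noteq> 0" by (rule bexI[rotated]) (use z1(4,5) in simp)
        qed (rule coordinate_product_invariant[OF z1(4)])
      next
        case 3
        then have "Y i = over m {z0}" "Y (Suc i) = {?p}" by (simp_all add: Y_def)
        then show ?thesis using monomial_separates[where m = m and ?z0.0 = z0 and ?j0.0 = j0 and b = b and l = l and a = a and S = S and e = e, OF z0(2) b inv]
          by simp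
      qed
    qed
  qed
  then show ?thesis by (simp add: shell_quotient_drep)
qed

section \<open>Counting invariant monomials on the shell\<close>

definition mono2 :: "nat \<Rightarrow> (nat \<Rightarrow> nat) \<Rightarrow> (nat \<Rightarrow> nat) \<Rightarrow> complex vec \<times> complex vec \<Rightarrow> complex" where
  "mono2 m \<alpha> \<beta> u = (\<Prod>j<m. fst u $ j ^ \<alpha> j * snd u $ j ^ \<beta> j)"

text \<open>The character by which the group acts on
  \<open>mono2 m \<alpha> \<beta>\<close>.\<close>

definition wgt :: "nat \<Rightarrow> (nat \<Rightarrow> nat \<Rightarrow> int) \<Rightarrow> (nat \<Rightarrow> nat) \<Rightarrow> nat \<Rightarrow> (nat \<Rightarrow> nat) \<Rightarrow> (nat \<Rightarrow> nat) \<Rightarrow> complex vec \<Rightarrow> complex" where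
  "wgt l a e m \<alpha> \<beta> h = (\<Prod>j<m. chr l (a (e j)) h ^ \<alpha> j * inverse (chr l (a (e j)) h) ^ \<beta> j)"

lemma mono2_add: "mono2 m (\<lambda>j. \<alpha> j + \<alpha>' j) (\<lambda>j. \<beta> j + \<beta>' j) u = mono2 m \<alpha> \<beta> u * mono2 m \<alpha>' \<beta>' u"
  unfolding mono2_def prod.distrib[symmetric] by (intro prod.cong) (simp_all add: power_add mult_ac)

lemma wgt_add: "wgt l a e m (\<lambda>j. \<alpha> j + \<alpha>' j) (\<lambda>j. \<beta> j + \<beta>' j) h = wgt l a e m \<alpha> \<beta> h * wgt l a e m \<alpha>' \<beta>' h"
  unfolding wgt_def prod.distrib[symmetric] by (intro prod.cong) (simp_all add: power_add mult_ac)

lemma mono2_act: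
  assumes "h \<in> torus l" "u \<in> cot_space m"
  shows "mono2 m \<alpha> \<beta> (cot_act (drep l a e m) h u) = mono2 m \<alpha> \<beta> u * wgt l a e m \<alpha> \<beta> h"
  unfolding mono2_def wgt_def prod.distrib[symmetric]
  by (intro prod.cong) (simp_all add: cot_act_drep'[OF assms] power_mult_distrib mult_ac)

lemma wgt_tmult:
  assumes "g \<in> torus l" "h \<in> torus l"
  shows "wgt l a e m \<alpha> \<beta> (tmult g h) = wgt l a e m \<alpha> \<beta> g * wgt l a e m \<alpha> \<beta> h"
  unfolding wgt_def prod.distrib[symmetric]
  by (intro prod.cong) (simp_all add: chr_tmult[OF assms] power_mult_distrib mult_ac)

lemma fspan_sum:
  assumes "\<And>i. i \<in> I \<Longrightarrow> f i \<in> fspan X M"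
  shows "(\<lambda>x. \<Sum>i\<in>I. f i x) \<in> fspan X M"
  using assms
proof (induction I rule: infinite_finite_induct)
  case (insert i I)
  then have "(\<lambda>x. f i x + (\<Sum>i\<in>I. f i x)) \<in> fspan X M" by (intro fspan_add) auto
  then show ?case using insert by simp
qed (auto intro: fspan.zero)

text \<open>Along a one-parameter group, triviality of the weight reads exp(s c) = 1 for all s,
  which forces its differential c to vanish.\<close>

lemma wgt_relation:
  assumes "\<And>h. h \<in> stab l a S \<Longrightarrow> wgt l a e m \<alpha> \<beta> h = 1"
  shows "(\<lambda>j. of_nat (\<alpha> j) - of_nat (\<beta> j)) \<in> relations l a S e m"
  unfolding relations_def
proof (intro CollectI ballI)
  fix X assume X: "X \<in> ann l a S"
  then have XC: "X \<in> carrier_vec l" by (simp add: ann_def)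
  let ?c = "\<Sum>j<m. lam l (a (e j)) X * (of_nat (\<alpha> j) - of_nat (\<beta> j))"
  have "exp (s * ?c) = 1" for s
  proof -
    have "texp (s \<cdot>\<^sub>v X) \<in> stab l a S" by (rule stab_texp[OF ann_smult[OF X]])
    then have "wgt l a e m \<alpha> \<beta> (texp (s \<cdot>\<^sub>v X)) = 1" by (rule assms)
    moreover have "wgt l a e m \<alpha> \<beta> (texp (s \<cdot>\<^sub>v X)) = (\<Prod>j<m. exp (s * (lam l (a (e j)) X * (of_nat (\<alpha> j) - of_nat (\<beta> j)))))"
      unfolding wgt_def
    proof (rule prod.cong[OF refl])
      fix j
      let ?L = "lam l (a (e j)) X"
      have "exp (s * (?L * (of_nat (\<alpha> j) - of_nat (\<beta> j)))) = exp (of_nat (\<alpha> j) * (s * ?L) + of_nat (\<beta> j) * (- (s * ?L)))"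
        by (simp add: algebra_simps)
      also have "\<dots> = exp (s * ?L) ^ \<alpha> j * exp (- (s * ?L)) ^ \<beta> j"
        unfolding exp_add exp_of_nat_mult ..
      finally show "chr l (a (e j)) (texp (s \<cdot>\<^sub>v X)) ^ \<alpha> j * inverse (chr l (a (e j)) (texp (s \<cdot>\<^sub>v X))) ^ \<beta> j =
          exp (s * (?L * (of_nat (\<alpha> j) - of_nat (\<beta> j))))"
        by (simp add: chr_texp_smult[OF XC] exp_minus)
    qed
    ultimately show ?thesis by (simp add: exp_sum sum_distrib_left)
  qed
  then show "?c = 0" by (rule exp_multiples_one)
qed

text \<open>If all relations are multiples of \<open>c\<close>, then on the shell every product is a
  fixed multiple of v_0 \<xi>_0, and the exponent differences of an invariant monomial are
  determined by the one at 0. Up to scalars, the invariant monomials of level \<open>k\<close> are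
  therefore indexed by a power of v_0 \<xi>_0 and by that difference, which gives quadratic
  growth.\<close>

lemma shell_quotient_dim_le_2:
  assumes m: "0 < m" and c: "\<And>j. j < m \<Longrightarrow> c j \<noteq> 0"
    and line: "\<And>z. z \<in> relations l a S e m \<Longrightarrow> \<exists>t. \<forall>j<m. z j = t * c j"
  shows "krull_dim (shell_quotient_ring l (stab l a S) m (drep l a e m)) \<le> 2"
proof -
  let ?H = "stab l a S" and ?N = "shell l (stab l a S) m (drep l a e m)" and ?F = "invariants l a S e m"
  have NC: "u \<in> cot_space m" if "u \<in> ?N" for u using that by (simp add: shell_def)
  define Mall where "Mall k = {mono2 m \<alpha> \<beta> | \<alpha> \<beta>. \<forall>j<m. \<alpha> j \<le> k \<and> \<beta> j \<le> k}" for k :: nat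
  define M where "M k = {mono2 m \<alpha> \<beta> | \<alpha> \<beta>. (\<forall>j<m. \<alpha> j \<le> k \<and> \<beta> j \<le> k) \<and> (\<forall>h\<in>?H. wgt l a e m \<alpha> \<beta> h = 1)}" for k :: nat
  \<comment> \<open>The exponent difference at \<open>j\<close> forced by the difference
    \<open>s\<close> at 0. The rounding is exact when \<open>s\<close> comes from an invariant
    monomial.\<close>
  define \<delta> where "\<delta> s j = \<lfloor>Re (of_int s * c j / c 0)\<rfloor>" for s :: int and j
  define G where "G p = (\<lambda>u. (fst u $ 0 * snd u $ 0) ^ (fst p) * bimonomial m (\<delta> (snd p)) u)" for p :: "nat \<times> int"
  define Idx where "Idx k = {..m * k} \<times> {- int k..int k}" for k :: nat
  have one: "(\<lambda>_. 1) = mono2 m (\<lambda>_. 0) (\<lambda>_. 0)" by (simp add: mono2_def fun_eq_iff)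
  have w0: "wgt l a e m (\<lambda>_. 0) (\<lambda>_. 0) h = 1" for h by (simp add: wgt_def)
  have Mall0: "(\<lambda>_. 1) \<in> Mall 0" unfolding Mall_def one by auto
  have M0: "(\<lambda>_. 1) \<in> M 0" unfolding M_def one using w0 by auto
  have Mallm: "(\<lambda>x. \<mu> x * \<nu> x) \<in> Mall (i + j)" if mn: "\<mu> \<in> Mall i" "\<nu> \<in> Mall j" for i j \<mu> \<nu>
  proof -
    from mn obtain \<alpha> \<beta> \<alpha>' \<beta>' where "\<mu> = mono2 m \<alpha> \<beta>" "\<nu> = mono2 m \<alpha>' \<beta>'"
      "\<forall>j<m. \<alpha> j \<le> i \<and> \<beta> j \<le> i" "\<forall>j'<m. \<alpha>' j' \<le> j \<and> \<beta>' j' \<le> j" unfolding Mall_def by blast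
    then show ?thesis unfolding Mall_def
      by (intro CollectI exI[of _ "\<lambda>j. \<alpha> j + \<alpha>' j"] exI[of _ "\<lambda>j. \<beta> j + \<beta>' j"]) (simp add: mono2_add fun_eq_iff add_mono)
  qed
  have Mm: "(\<lambda>x. \<mu> x * \<nu> x) \<in> M (i + j)" if mn: "\<mu> \<in> M i" "\<nu> \<in> M j" for i j \<mu> \<nu>
  proof -
    from mn obtain \<alpha> \<beta> \<alpha>' \<beta>' where "\<mu> = mono2 m \<alpha> \<beta>" "\<nu> = mono2 m \<alpha>' \<beta>'"
      "\<forall>j<m. \<alpha> j \<le> i \<and> \<beta> j \<le> i" "\<forall>j'<m. \<alpha>' j' \<le> j \<and> \<beta>' j' \<le> j"
      "\<forall>h\<in>?H. wgt l a e m \<alpha> \<beta> h = 1" "\<forall>h\<in>?H. wgt l a e m \<alpha>' \<beta>' h = 1" unfolding M_def by blast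
    then show ?thesis unfolding M_def
      by (intro CollectI exI[of _ "\<lambda>j. \<alpha> j + \<alpha>' j"] exI[of _ "\<lambda>j. \<beta> j + \<beta>' j"]) (simp add: mono2_add wgt_add fun_eq_iff add_mono)
  qed
  have Malle: "Mall i \<subseteq> Mall j" if "i \<le> j" for i j
    unfolding Mall_def using that by (blast intro: order_trans)
  have Mle: "M i \<subseteq> M j" if "i \<le> j" for i j
    unfolding M_def using that by (blast intro: order_trans)
  have "krull_dim (fun_ring ?N ?F) \<le> ereal (real 2)"
  proof (rule krull_dim_le_growth[where M = M and B = "\<lambda>k. G ` Idx k" and C = "2 * (m + 1)"])
    show "fun_algebra ?F" by (rule invariant_algebra)
    show "(\<lambda>_. 1) \<in> M 0" by (rule M0)
    show "(\<lambda>x. \<mu> x * \<nu> x) \<in> M (i + j)" if "\<mu> \<in> M i" "\<nu> \<in> M j" for i j \<mu> \<nu> using that by (rule Mm)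
    show "M i \<subseteq> M j" if "i \<le> j" for i j using that by (rule Mle)
    show "\<exists>k. f \<in> fspan ?N (M k)" if fF: "f \<in> ?F" for f
    proof -
      have fgen: "f \<in> gen_algebra ({\<lambda>u. fst u $ i | i. i < m} \<union> {\<lambda>u. snd u $ i | i. i < m})"
        using fF by (simp add: cot_poly_funs_def)
      have "\<exists>k. f \<in> fspan ?N (Mall k)"
      proof (rule gen_algebra_fspan[where X = ?N and M = Mall, OF _ Mall0 Mallm Malle fgen])
        fix g :: "complex vec \<times> complex vec \<Rightarrow> complex"
        assume "g \<in> {\<lambda>u. fst u $ i | i. i < m} \<union> {\<lambda>u. snd u $ i | i. i < m}"
        then consider i where "i < m" "g = (\<lambda>u. fst u $ i)" | i where "i < m" "g = (\<lambda>u. snd u $ i)" by blast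
        then have "g \<in> Mall 1"
        proof cases
          case 1
          have g: "g = mono2 m (\<lambda>j. if j = i then 1 else 0) (\<lambda>_. 0)"
            using 1 by (simp add: fun_eq_iff mono2_def if_distrib[of "\<lambda>n. _ ^ n"] prod.delta cong: if_cong)
          show ?thesis unfolding Mall_def g by (intro CollectI exI conjI refl) auto
        next
          case 2
          have g: "g = mono2 m (\<lambda>_. 0) (\<lambda>j. if j = i then 1 else 0)"
            using 2 by (simp add: fun_eq_iff mono2_def if_distrib[of "\<lambda>n. _ ^ n"] prod.delta cong: if_cong)
          show ?thesis unfolding Mall_def g by (intro CollectI exI conjI refl) auto
        qed
        then have "g \<in> fspan ?N (Mall 1)" by (rule fspan_scaled[where c = 1]) simp
        then show "\<exists>k. g \<in> fspan ?N (Mall k)" by blast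
      qed
      then obtain k where "f \<in> fspan ?N (Mall k)" by blast
      from fspan_family[OF this] obtain N d \<mu> where \<mu>: "\<forall>i<(N::nat). \<mu> i \<in> Mall k" "\<forall>u\<in>?N. f u = (\<Sum>i<N. d i * \<mu> i u)"
        by (elim exE conjE)
      have "\<forall>i. \<exists>p. i < N \<longrightarrow> \<mu> i = mono2 m (fst p) (snd p) \<and> (\<forall>j<m. fst p j \<le> k \<and> snd p j \<le> k)"
        using \<mu>(1) unfolding Mall_def by fastforce
      then obtain p where p: "\<And>i. i < N \<Longrightarrow> \<mu> i = mono2 m (fst (p i)) (snd (p i))"
          "\<And>i j. i < N \<Longrightarrow> j < m \<Longrightarrow> fst (p i) j \<le> k \<and> snd (p i) j \<le> k" by metis
      let ?w = "\<lambda>i. wgt l a e m (fst (p i)) (snd (p i))"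
      define I where "I = {i. i \<in> {..<N} \<and> (\<forall>h\<in>?H. ?w i h = 1)}"
      have fI: "f u = (\<Sum>i\<in>I. d i * \<mu> i u)" if u: "u \<in> ?N" for u
      proof -
        \<comment> \<open>With \<open>u\<close> fixed, the value of \<open>f\<close> at the
          translate of \<open>u\<close> by \<open>h\<close> is a combination of characters in
          \<open>h\<close>, and it is constant because \<open>f\<close> is invariant. Only the
          invariant monomials of \<open>f\<close> survive.\<close>
        have "(\<Sum>i | i \<in> {..<N} \<and> (\<forall>h\<in>?H. ?w i h = 1). d i * \<mu> i u) = f u"
        proof (rule sum_trivial_characters[where m = tmult])
          show "finite {..<N}" "?H \<noteq> {}" using stab_tone by auto
          show "tmult g h \<in> ?H" if "g \<in> ?H" "h \<in> ?H" for g h using that by (rule stab_tmult)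
          show "?w i (tmult g h) = ?w i g * ?w i h" if "g \<in> ?H" "h \<in> ?H" for i g h
            using that by (intro wgt_tmult) (auto dest: stabD(1))
          fix h assume h: "h \<in> ?H"
          have "f u = f (cot_act (drep l a e m) h u)" using fF h u by simp
          also have "\<dots> = (\<Sum>i<N. d i * \<mu> i (cot_act (drep l a e m) h u))"
            using \<mu>(2) shell_drep_act[OF h u] by simp
          also have "\<dots> = (\<Sum>i<N. d i * \<mu> i u * ?w i h)"
            using p(1) mono2_act[OF stabD(1)[OF h] NC[OF u]] by (intro sum.cong) (simp_all add: mult.assoc)
          finally show "(\<Sum>i<N. d i * \<mu> i u * ?w i h) = f u" by simp
        qed
        then show ?thesis by (simp add: I_def)
      qed
      have "(\<lambda>u. d i * \<mu> i u) \<in> fspan ?N (M k)" if "i \<in> I" for i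
      proof -
        have i: "i < N" "\<forall>h\<in>?H. ?w i h = 1" using that by (simp_all add: I_def)
        have "\<mu> i \<in> M k" unfolding M_def using p[OF i(1)] i(2) by blast
        then show ?thesis by (rule fspan_scaled[where c = "d i"]) simp
      qed
      then have "(\<lambda>u. \<Sum>i\<in>I. d i * \<mu> i u) \<in> fspan ?N (M k)" by (rule fspan_sum)
      then have "f \<in> fspan ?N (M k)" by (rule fspan_cong) (rule fI)
      then show ?thesis by blast
    qed
    fix k
    show "finite (G ` Idx k)" by (simp add: Idx_def)
    have "card (G ` Idx k) \<le> card (Idx k)" by (rule card_image_le) (simp add: Idx_def)
    also have "\<dots> = (m * k + 1) * (2 * k + 1)"
    proof -
      have "nat (2 * int k + 1) = 2 * k + 1" by simp
      then show ?thesis unfolding Idx_def card_cartesian_product by simp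
    qed
    also have "\<dots> \<le> ((m + 1) * (k + 1)) * (2 * (k + 1))" by (rule mult_mono) auto
    also have "\<dots> = 2 * (m + 1) * (k + 1) ^ 2" by (simp only: power2_eq_square mult_ac)
    finally show "card (G ` Idx k) \<le> 2 * (m + 1) * (k + 1) ^ 2" .
    show "M k \<subseteq> fspan ?N (G ` Idx k)"
    proof
      fix f assume "f \<in> M k"
      then obtain \<alpha> \<beta> where f: "f = mono2 m \<alpha> \<beta>" and bnd: "\<forall>j<m. \<alpha> j \<le> k \<and> \<beta> j \<le> k" and w: "\<forall>h\<in>?H. wgt l a e m \<alpha> \<beta> h = 1"
        unfolding M_def by blast
      define s where "s = int (\<alpha> 0) - int (\<beta> 0)"
      \<comment> \<open>The common part of \<open>\<alpha>\<close> and \<open>\<beta>\<close> is a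
        product of the v_j \<xi>_j, each of which is a multiple of v_0 \<xi>_0 on the shell;
        \<open>A\<close> is the total power that results.\<close>
      define A where "A = (\<Sum>j<m. min (\<alpha> j) (\<beta> j))"
      obtain t where t: "\<forall>j<m. of_nat (\<alpha> j) - of_nat (\<beta> j) = t * c j"
        using line[OF wgt_relation[of l a S e m \<alpha> \<beta>]] w by blast
      have \<delta>: "\<delta> s j = int (\<alpha> j) - int (\<beta> j)" if "j < m" for j
      proof -
        have "of_int s = t * c 0" using t m by (simp add: s_def)
        then have "of_int s * c j / c 0 = t * c j" using c[OF m] by simp
        also have "\<dots> = of_int (int (\<alpha> j) - int (\<beta> j))" using t that by simp
        finally show ?thesis unfolding \<delta>_def by (simp only: complex_Re_of_int floor_of_int)
      qed
      have "A \<le> (\<Sum>j<m. k)" unfolding A_def using bnd by (intro sum_mono) auto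
      moreover have "\<bar>s\<bar> \<le> int k" using bnd m by (auto simp: s_def abs_le_iff)
      ultimately have "(A, s) \<in> Idx k" by (auto simp: Idx_def abs_le_iff)
      then have mem: "G (A, s) \<in> G ` Idx k" by (rule imageI)
      show "f \<in> fspan ?N (G ` Idx k)"
      proof (rule fspan_scaled[OF mem])
        fix u assume u: "u \<in> ?N"
        obtain t' where t': "\<forall>j<m. fst u $ j * snd u $ j = t' * c j"
          using line[of "\<lambda>j. fst u $ j * snd u $ j"] u by (auto simp: shell_drep)
        have z: "fst u $ j * snd u $ j = (c j / c 0) * (fst u $ 0 * snd u $ 0)" if "j < m" for j
          using t' that m c[OF m] by simp
        have "f u = (\<Prod>j<m. (fst u $ j * snd u $ j) ^ min (\<alpha> j) (\<beta> j) * (fst u $ j ^ nat (\<delta> s j) * snd u $ j ^ nat (- \<delta> s j)))"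
          unfolding f mono2_def
        proof (rule prod.cong[OF refl])
          fix j assume "j \<in> {..<m}"
          then have \<delta>': "\<delta> s j = int (\<alpha> j) - int (\<beta> j)" using \<delta> by simp
          have \<alpha>\<beta>: "\<alpha> j = min (\<alpha> j) (\<beta> j) + nat (\<delta> s j)" "\<beta> j = min (\<alpha> j) (\<beta> j) + nat (- \<delta> s j)"
            unfolding \<delta>' by linarith+
          have "fst u $ j ^ \<alpha> j * snd u $ j ^ \<beta> j =
              fst u $ j ^ (min (\<alpha> j) (\<beta> j) + nat (\<delta> s j)) * snd u $ j ^ (min (\<alpha> j) (\<beta> j) + nat (- \<delta> s j))"
            by (rule arg_cong2[OF \<alpha>\<beta>, of "\<lambda>x y. fst u $ j ^ x * snd u $ j ^ y"])
          then show "fst u $ j ^ \<alpha> j * snd u $ j ^ \<beta> j =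
              (fst u $ j * snd u $ j) ^ min (\<alpha> j) (\<beta> j) * (fst u $ j ^ nat (\<delta> s j) * snd u $ j ^ nat (- \<delta> s j))"
            by (simp add: power_add power_mult_distrib mult_ac)
        qed
        also have "\<dots> = (\<Prod>j<m. (fst u $ j * snd u $ j) ^ min (\<alpha> j) (\<beta> j)) * bimonomial m (\<delta> s) u"
          by (simp add: prod.distrib bimonomial_def)
        also have "(\<Prod>j<m. (fst u $ j * snd u $ j) ^ min (\<alpha> j) (\<beta> j)) =
            (\<Prod>j<m. (c j / c 0) ^ min (\<alpha> j) (\<beta> j) * (fst u $ 0 * snd u $ 0) ^ min (\<alpha> j) (\<beta> j))"
        proof (rule prod.cong[OF refl])
          fix j assume "j \<in> {..<m}"
          then show "(fst u $ j * snd u $ j) ^ min (\<alpha> j) (\<beta> j) =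
              (c j / c 0) ^ min (\<alpha> j) (\<beta> j) * (fst u $ 0 * snd u $ 0) ^ min (\<alpha> j) (\<beta> j)"
            by (subst z) (simp_all only: power_mult_distrib lessThan_iff)
        qed
        also have "\<dots> = (\<Prod>j<m. (c j / c 0) ^ min (\<alpha> j) (\<beta> j)) * (fst u $ 0 * snd u $ 0) ^ A"
          by (simp add: prod.distrib A_def power_sum)
        finally show "f u = (\<Prod>j<m. (c j / c 0) ^ min (\<alpha> j) (\<beta> j)) * G (A, s) u"
          by (simp add: G_def mult.assoc)
      qed
    qed
  qed
  then show ?thesis by (simp add: shell_quotient_drep)
qed

section \<open>Consequences of 1-modularity\<close>

text \<open>The combinatorial content of 1-modularity. The sets of columns in the theorem are those
  of rank less than \<open>l\<close> that attain equality.\<close>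

definition card_bound :: "nat \<Rightarrow> nat \<Rightarrow> (nat \<Rightarrow> nat \<Rightarrow> int) \<Rightarrow> bool" where
  "card_bound l n a \<longleftrightarrow> (\<forall>S D. S \<subseteq> {..<n} \<longrightarrow> is_basis l a S D \<longrightarrow> card D < l \<longrightarrow> card S + (l - card D) + 1 \<le> n)"

lemma card_boundD:
  "card_bound l n a \<Longrightarrow> S \<subseteq> {..<n} \<Longrightarrow> is_basis l a S D \<Longrightarrow> card D < l \<Longrightarrow> card S + (l - card D) + 1 \<le> n"
  unfolding card_bound_def by blast

lemma indep_card_le:
  fixes a :: "nat \<Rightarrow> nat \<Rightarrow> int"
  assumes "indep l a D" "finite D"
  shows "card D \<le> l"
proof -
  have "\<exists>R. R \<subseteq> {..<l} \<and> card R + card D = l" using indep_dual_vectors[OF assms] by (elim exE conjE) (intro exI conjI)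
  then show ?thesis by auto
qed

lemma is_basisD:
  assumes "is_basis l a S D"
  shows "finite S" "D \<subseteq> S" "indep l a D" "j \<in> S \<Longrightarrow> in_span l a D (a j)"
  using assms unfolding is_basis_def by simp_all

text \<open>Omitting one column leaves n - 1 columns, too many for the bound unless they have full
  rank. In other words, no column is a coloop.\<close>

lemma rank_remove_one:
  assumes "card_bound l n a" "i < n" "is_basis l a ({..<n} - {i}) D"
  shows "card D = l"
proof (rule ccontr)
  have "card D \<le> l" by (rule indep_card_le[OF is_basisD(3)[OF assms(3)] basis_finite[OF assms(3)]])
  moreover assume "card D \<noteq> l"
  ultimately have lt: "card D < l" by simp
  have "card ({..<n} - {i}) + (l - card D) + 1 \<le> n"
    by (rule card_boundD[OF assms(1) _ assms(3) lt]) auto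
  moreover have "card ({..<n} - {i}) = n - 1" using assms(2) by simp
  ultimately show False using lt assms(2) by linarith
qed

lemma in_span_mono:
  assumes "in_span l a D v" "D \<subseteq> E" "finite E"
  shows "in_span l a E v"
proof -
  obtain c :: "'a \<Rightarrow> rat" where c: "\<forall>i<l. of_int (v i) = (\<Sum>d\<in>D. c d * of_int (a d i))"
    using assms(1) unfolding in_span_def by blast
  have "(\<Sum>d\<in>E. (if d \<in> D then c d else 0) * of_int (a d i)) = (\<Sum>d\<in>D. c d * of_int (a d i))" for i
    using assms(2,3) by (intro sum.mono_neutral_cong_right) auto
  then show ?thesis using c unfolding in_span_def by (intro exI[of _ "\<lambda>d. if d \<in> D then c d else 0"]) simp
qed

text \<open>Otherwise the column could be added to \<open>D\<close>, giving more than
  \<open>l\<close> independent vectors.\<close>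

lemma full_rank_in_span:
  fixes a :: "nat \<Rightarrow> nat \<Rightarrow> int"
  assumes "indep l a D" "finite D" "card D = l"
  shows "in_span l a D (a j)"
proof (cases "j \<in> D")
  case True
  then show ?thesis by (rule in_span_member[OF assms(2)])
next
  case False
  show ?thesis
  proof (rule ccontr)
    assume "\<not> in_span l a D (a j)"
    from indep_card_le[OF indep_insert[OF assms(1,2) False this]] show False using assms False by simp
  qed
qed

lemma in_span_remove_one:
  assumes "card_bound l n a" "i < n"
  shows "in_span l a ({..<n} - {i}) (a i)"
proof -
  obtain D where D: "is_basis l a ({..<n} - {i}) D" using basis_exists[of "{..<n} - {i}" l a] by auto
  have "in_span l a D (a i)"
    by (rule full_rank_in_span[OF is_basisD(3)[OF D] basis_finite[OF D] rank_remove_one[OF assms D]])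
  then show ?thesis by (rule in_span_mono[OF _ is_basisD(2)[OF D]]) simp
qed

text \<open>For each \<open>j\<close> the hypothesis supplies a relation with a nonzero entry at
  \<open>j\<close>, and a generic combination of these has no zero entry. The induction runs over
  the set \<open>T\<close> of entries already made nonzero.\<close>

lemma full_support_relation:
  fixes a :: "nat \<Rightarrow> nat \<Rightarrow> int"
  assumes J: "finite J" and span: "\<And>j. j \<in> J \<Longrightarrow> in_span l a (J - {j}) (a j)"
  shows "\<exists>z :: nat \<Rightarrow> rat. (\<forall>j\<in>J. z j \<noteq> 0) \<and> (\<forall>i<l. (\<Sum>j\<in>J. z j * of_int (a j i)) = 0)"
proof -
  have "\<exists>z :: nat \<Rightarrow> rat. (\<forall>j\<in>T. z j \<noteq> 0) \<and> (\<forall>i<l. (\<Sum>j\<in>J. z j * of_int (a j i)) = 0)" if "finite T" "T \<subseteq> J" for T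
    using that
  proof (induction T rule: finite_induct)
    case empty
    show ?case by (intro exI[of _ "\<lambda>_. 0"]) simp
  next
    case (insert k T)
    then obtain z :: "nat \<Rightarrow> rat" where z: "\<forall>j\<in>T. z j \<noteq> 0" "\<forall>i<l. (\<Sum>j\<in>J. z j * of_int (a j i)) = 0" by auto
    have k: "k \<in> J" using insert by simp
    obtain c :: "nat \<Rightarrow> rat" where c: "\<forall>i<l. of_int (a k i) = (\<Sum>d\<in>J-{k}. c d * of_int (a d i))"
      using span[OF k] unfolding in_span_def by blast
    define y where "y j = (if j = k then - 1 else c j)" for j
    have y0: "(\<Sum>j\<in>J. y j * of_int (a j i)) = 0" if "i < l" for i
    proof -
      have "(\<Sum>j\<in>J. y j * of_int (a j i)) = - of_int (a k i) + (\<Sum>j\<in>J-{k}. y j * of_int (a j i))"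
        using sum.remove[OF J k, of "\<lambda>j. y j * of_int (a j i)"] by (simp add: y_def)
      also have "(\<Sum>j\<in>J-{k}. y j * of_int (a j i)) = (\<Sum>j\<in>J-{k}. c j * of_int (a j i))"
        by (intro sum.cong) (simp_all add: y_def)
      finally show ?thesis using c that by simp
    qed
    \<comment> \<open>Adding \<open>s\<close> times \<open>y\<close> has to keep the entries in
      \<open>T\<close> nonzero and make the entry at \<open>k\<close> nonzero, where
      \<open>y\<close> is -1; each entry forbids at most one value of \<open>s\<close>.\<close>
    let ?bad = "insert (z k) ((\<lambda>j. - z j / y j) ` T)"
    have "finite ?bad" using insert.hyps by simp
    then obtain s where s: "s \<notin> ?bad" using ex_new_if_finite[OF infinite_UNIV_char_0] by blast
    have "z j + s * y j \<noteq> 0" if "j \<in> insert k T" for j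
    proof (cases "j = k")
      case True
      then show ?thesis using s by (simp add: y_def)
    next
      case False
      then have j: "j \<in> T" using that by simp
      show ?thesis
      proof
        assume eq: "z j + s * y j = 0"
        then have "y j \<noteq> 0" using z(1) j by auto
        then have "s = - z j / y j" using eq by (simp add: field_simps eq_neg_iff_add_eq_0)
        then show False using s j by simp
      qed
    qed
    moreover have "(\<Sum>j\<in>J. (z j + s * y j) * of_int (a j i)) = 0" if "i < l" for i
    proof -
      have "(\<Sum>j\<in>J. (z j + s * y j) * of_int (a j i)) =
          (\<Sum>j\<in>J. z j * of_int (a j i)) + s * (\<Sum>j\<in>J. y j * of_int (a j i))"
        unfolding sum_distrib_left sum.distrib[symmetric] by (intro sum.cong) (simp_all add: algebra_simps)
      then show ?thesis using z(2) y0 that by simp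
    qed
    ultimately show ?case by (intro exI[of _ "\<lambda>j. z j + s * y j"]) simp
  qed
  from this[OF J order_refl] show ?thesis .
qed

lemma ann_basis:
  fixes a :: "nat \<Rightarrow> nat \<Rightarrow> int"
  assumes D: "is_basis l a S D" and X: "X \<in> carrier_vec l" and ann: "\<And>d. d \<in> D \<Longrightarrow> lam l (a d) X = 0"
  shows "X \<in> ann l a S"
  unfolding ann_def
proof (intro CollectI conjI ballI X)
  fix j assume "j \<in> S"
  then have "in_span l a D (a j)" by (rule is_basisD(4)[OF D])
  then obtain c :: "nat \<Rightarrow> rat" where c: "\<forall>i<l. of_int (a j i) = (\<Sum>d\<in>D. c d * of_int (a d i))"
    unfolding in_span_def by blast
  have "complex_of_int (a j i) = (\<Sum>d\<in>D. of_rat (c d) * of_int (a d i))" if "i < l" for i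
    using arg_cong[OF c[rule_format, OF that], of complex_of_rat] by (simp add: of_rat_sum of_rat_mult)
  then have "(\<Sum>i<l. of_int (a j i) * X $ i) = (\<Sum>i<l. \<Sum>d\<in>D. of_rat (c d) * (of_int (a d i) * X $ i))"
    by (intro sum.cong) (simp_all add: sum_distrib_right mult.assoc)
  also have "\<dots> = (\<Sum>d\<in>D. of_rat (c d) * lam l (a d) X)"
    unfolding lam_def by (subst sum.swap) (simp add: sum_distrib_left)
  also have "\<dots> = 0" using ann by simp
  finally show "(\<Sum>i<l. of_int (a j i) * X $ i) = 0" .
qed

lemma ann_lam: "X \<in> ann l a S \<Longrightarrow> j \<in> S \<Longrightarrow> lam l (a j) X = 0"
  by (simp add: ann_def lam_def)

text \<open>Columns in \<open>T\<close> vanish on the annihilator of \<open>T\<close>, so a linear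
  relation among all \<open>n\<close> columns leaves a solution of the moment equations outside
  \<open>T\<close>.\<close>

lemma relation_of_kernel:
  assumes e: "bij_betw e {..<m} ({..<n} - T)" and T: "T \<subseteq> {..<n}"
    and z: "\<And>i. i < l \<Longrightarrow> (\<Sum>j<n. z j * of_int (a j i)) = 0"
  shows "(\<lambda>j. z (e j)) \<in> relations l a T e m"
  unfolding relations_def
proof (intro CollectI ballI)
  fix X assume X: "X \<in> ann l a T"
  have "(\<Sum>j<m. lam l (a (e j)) X * z (e j)) = (\<Sum>j\<in>{..<n}-T. lam l (a j) X * z j)"
    by (rule sum.reindex_bij_betw[OF e])
  also have "\<dots> = (\<Sum>j<n. lam l (a j) X * z j)"
    using ann_lam[OF X] by (intro sum.mono_neutral_left) auto
  also have "\<dots> = (\<Sum>i<l. X $ i * (\<Sum>j<n. z j * of_int (a j i)))"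
    unfolding lam_def sum_distrib_left sum_distrib_right by (subst sum.swap) (simp add: mult_ac)
  also have "\<dots> = 0" using z by simp
  finally show "(\<Sum>j<m. lam l (a (e j)) X * z (e j)) = 0" .
qed

text \<open>Counting: more columns than rows (and extra conditions B) yield a rational relation; it
  involves a column outside T because D is independent.\<close>

lemma kernel_vector:
  fixes a :: "nat \<Rightarrow> nat \<Rightarrow> int"
  assumes T: "T \<subseteq> {..<n}" and D: "is_basis l a T D" and B: "finite B" "B \<subseteq> {..<n} - T"
    and card: "l + card B < card D + card ({..<n} - T)"
  shows "\<exists>c :: nat \<Rightarrow> rat. (\<exists>j\<in>{..<n}-T. c j \<noteq> 0) \<and> (\<forall>j\<in>B. c j = 0) \<and> (\<forall>i<l. (\<Sum>j<n. c j * of_int (a j i)) = 0)"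
proof -
  have finD: "finite D" and DT: "D \<subseteq> T" and indep: "indep l a D"
    using basis_finite[OF D] is_basisD[OF D] by auto
  let ?I = "D \<union> ({..<n} - T)"
  \<comment> \<open>The equations indexed by \<open>Inl\<close> are the \<open>l\<close> coordinates
    of the relation; those indexed by \<open>Inr\<close> force its entries in \<open>B\<close> to
    vanish.\<close>
  define M where "M j b = (case b of Inl i \<Rightarrow> of_int (a j i) | Inr k \<Rightarrow> if j = k then 1 else (0::rat))" for j and b :: "nat + nat"
  have "card ?I = card D + card ({..<n} - T)" using finD DT by (intro card_Un_disjoint) auto
  moreover have "card (Inl ` {..<l} \<union> Inr ` B :: (nat + nat) set) = l + card B"
    using B(1) by (subst card_Un_disjoint) (auto simp: card_image)
  ultimately have "card (Inl ` {..<l} \<union> Inr ` B :: (nat + nat) set) < card ?I" using card by simp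
  moreover have "finite (Inl ` {..<l} \<union> Inr ` B :: (nat + nat) set)" "finite ?I" using B(1) finD by auto
  ultimately obtain c where c: "\<exists>j\<in>?I. c j \<noteq> 0" "\<forall>b\<in>Inl ` {..<l} \<union> Inr ` B. (\<Sum>j\<in>?I. c j * M j b) = 0"
    using homogeneous_system_solvable[of "Inl ` {..<l} \<union> Inr ` B" ?I M] by blast
  define c' where "c' j = (if j \<in> ?I then c j else 0)" for j
  have ker: "(\<Sum>j<n. c' j * of_int (a j i)) = 0" if "i < l" for i
  proof -
    have "(\<Sum>j<n. c' j * of_int (a j i)) = (\<Sum>j\<in>?I. c j * M j (Inl i))"
      using DT T by (intro sum.mono_neutral_cong_right) (auto simp: c'_def M_def)
    then show ?thesis using c(2) that by simp
  qed
  moreover have "c' k = 0" if k: "k \<in> B" for k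
  proof -
    have "(\<Sum>j\<in>?I. c j * M j (Inr k)) = (\<Sum>j\<in>?I. if j = k then c j else 0)"
      by (intro sum.cong) (simp_all add: M_def)
    also have "\<dots> = c k" using k B(2) finD by auto
    finally show ?thesis using c(2) k by (simp add: c'_def)
  qed
  moreover have "\<exists>j\<in>{..<n}-T. c' j \<noteq> 0"
  proof (rule ccontr)
    assume "\<not> ?thesis"
    then have z: "c' j = 0" if "j \<in> {..<n} - T" for j using that by blast
    have "(\<Sum>j\<in>D. c' j * of_int (a j i)) = 0" if "i < l" for i
    proof -
      have "(\<Sum>j<n. c' j * of_int (a j i)) = (\<Sum>j\<in>D. c' j * of_int (a j i))"
      proof (rule sum.mono_neutral_right)
        show "\<forall>j\<in>{..<n} - D. c' j * of_int (a j i) = 0"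
        proof
          fix j assume "j \<in> {..<n} - D"
          then show "c' j * of_int (a j i) = 0" using z[of j] by (cases "j \<in> T") (simp_all add: c'_def)
        qed
      qed (use DT T in auto)
      then show ?thesis using ker[OF that] by simp
    qed
    then have "\<forall>j\<in>D. c' j = 0" using indep unfolding indep_def by simp
    moreover obtain j where "j \<in> ?I" "c j \<noteq> 0" using c(1) by blast
    moreover have "c' j = c j" using \<open>j \<in> ?I\<close> by (simp only: c'_def if_True)
    ultimately show False using z[of j] by auto
  qed
  ultimately show ?thesis by (intro exI[of _ c']) simp
qed

text \<open>The multiplicative counterpart of \<open>relation_of_kernel\<close>: the characters in
  \<open>T\<close> are trivial on the group, so an integer relation among all columns yields
  exponents of an invariant monomial outside \<open>T\<close>.\<close>

lemma integer_relation_invariant: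
  assumes e: "bij_betw e {..<m} ({..<n} - T)" and T: "T \<subseteq> {..<n}"
    and z: "\<And>i. i < l \<Longrightarrow> (\<Sum>j<n. \<beta> j * a j i) = 0" and h: "h \<in> stab l a T"
  shows "(\<Prod>j<m. chr l (a (e j)) h powi \<beta> (e j)) = 1"
proof -
  have "(\<Prod>j<m. chr l (a (e j)) h powi \<beta> (e j)) = (\<Prod>j\<in>{..<n}-T. chr l (a j) h powi \<beta> j)"
    by (rule prod.reindex_bij_betw[OF e])
  also have "\<dots> = (\<Prod>j<n. chr l (a j) h powi \<beta> j)"
    using stabD(2)[OF h] by (intro prod.mono_neutral_left) auto
  also have "\<dots> = chr l (\<lambda>i. \<Sum>j<n. \<beta> j * a j i) h"
    by (rule chr_sum[symmetric, OF stabD(1)[OF h]])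
  also have "\<dots> = chr l (\<lambda>_. 0) h" using z by (intro chr_cong) simp
  finally show ?thesis by (simp add: chr_zero)
qed

lemma of_rat_kernel:
  fixes c :: "nat \<Rightarrow> rat"
  assumes "(\<Sum>j\<in>J. c j * of_int (a j)) = 0"
  shows "(\<Sum>j\<in>J. complex_of_rat (c j) * of_int (a j)) = 0"
  using arg_cong[OF assms, of complex_of_rat] by (simp add: of_rat_sum of_rat_mult)

section \<open>The diagonal model on the columns outside a set\<close>

context
  fixes l n m :: nat and a :: "nat \<Rightarrow> nat \<Rightarrow> int" and T D :: "nat set" and e :: "nat \<Rightarrow> nat"
  assumes bound: "card_bound l n a" and T: "T \<subseteq> {..<n}" and D: "is_basis l a T D" and lt: "card D < l"
    and e: "bij_betw e {..<m} ({..<n} - T)"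
begin

lemma card_complement: "m = n - card T" "m \<ge> l - card D + 1"
proof -
  have finT: "finite T" using T finite_subset by blast
  have "m = card ({..<n} - T)" using bij_betw_same_card[OF e] by simp
  then show m: "m = n - card T" using T finT by (simp add: card_Diff_subset)
  show "m \<ge> l - card D + 1" using card_boundD[OF bound T D lt] m by linarith
qed

lemma card_complement': "card ({..<n} - T) = m"
  using bij_betw_same_card[OF e] by simp

lemma e_mem: "j < m \<Longrightarrow> e j \<in> {..<n} - T"
  using e by (auto simp: bij_betw_def)

text \<open>The set of all columns has no coloop, so it carries a relation without zero entries; its
  entries outside \<open>T\<close> give the point.\<close>

lemma full_support_point:
  "\<exists>z0\<in>relations l a T e m. \<forall>j<m. z0 j \<noteq> 0"
proof -
  obtain z :: "nat \<Rightarrow> rat" where z: "\<forall>j\<in>{..<n}. z j \<noteq> 0" "\<forall>i<l. (\<Sum>j\<in>{..<n}. z j * of_int (a j i)) = 0"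
    using full_support_relation[of "{..<n}" l a] in_span_remove_one[OF bound] by auto
  have "(\<Sum>j<n. complex_of_rat (z j) * of_int (a j i)) = 0" if "i < l" for i
    using z(2) that by (intro of_rat_kernel) simp
  from relation_of_kernel[where z = "\<lambda>j. complex_of_rat (z j)", OF e T this]
  have "(\<lambda>j. complex_of_rat (z (e j))) \<in> relations l a T e m" by simp
  moreover have "complex_of_rat (z (e j)) \<noteq> 0" if "j < m" for j using z(1) e_mem[OF that] by simp
  ultimately show ?thesis by (intro bexI[of _ "\<lambda>j. complex_of_rat (z (e j))"]) simp_all
qed

text \<open>By the bound, \<open>D\<close> and the columns outside \<open>T\<close> together number
  more than \<open>l\<close>. The resulting rational relation is cleared of denominators to become a
  vector of exponents.\<close>

lemma invariant_relation:
  "\<exists>b j0. j0 < m \<and> b j0 \<noteq> (0::int) \<and> (\<forall>h\<in>stab l a T. (\<Prod>j<m. chr l (a (e j)) h powi b j) = 1)"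
proof -
  have "l + card {} < card D + card ({..<n} - T)" using card_complement(2) lt card_complement' by simp
  from kernel_vector[OF T D _ _ this] obtain c :: "nat \<Rightarrow> rat" where
    c: "\<exists>j\<in>{..<n}-T. c j \<noteq> 0" "\<forall>i<l. (\<Sum>j<n. c j * of_int (a j i)) = 0" by auto
  obtain N where N: "N > 0" "\<forall>j\<in>{..<n}. \<exists>z::int. of_int N * c j = of_int z"
    using rat_common_denominator[of "{..<n}" c] by auto
  then have "\<forall>j. \<exists>z::int. j < n \<longrightarrow> of_int N * c j = of_int z" by auto
  then obtain \<beta> :: "nat \<Rightarrow> int" where \<beta>: "\<And>j. j < n \<Longrightarrow> of_int N * c j = of_int (\<beta> j)" by metis
  have "(\<Sum>j<n. \<beta> j * a j i) = 0" if "i < l" for i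
  proof -
    have "rat_of_int (\<Sum>j<n. \<beta> j * a j i) = of_int N * (\<Sum>j<n. c j * of_int (a j i))"
      using \<beta> by (simp add: sum_distrib_left mult.assoc[symmetric])
    then show ?thesis using c(2) that by (simp only: mult_zero_right)
  qed
  from integer_relation_invariant[where \<beta> = \<beta> and a = a and l = l, OF e T this]
  have inv: "\<forall>h\<in>stab l a T. (\<Prod>j<m. chr l (a (e j)) h powi \<beta> (e j)) = 1" by blast
  obtain j where j: "j \<in> {..<n} - T" "c j \<noteq> 0" using c(1) by blast
  then have "j \<in> e ` {..<m}" using bij_betw_imp_surj_on[OF e] by simp
  then obtain j0 where j0: "j0 < m" "e j0 = j" by blast
  have "rat_of_int (\<beta> j) \<noteq> 0" using \<beta>[of j] j N(1) by auto
  then have "\<beta> (e j0) \<noteq> 0" using j0(2) by auto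
  then show ?thesis using inv j0(1) by (intro exI[of _ "\<lambda>j. \<beta> (e j)"] exI[of _ j0]) simp
qed

text \<open>One column beyond the minimum forced by the bound leaves room for one more linear
  condition: a relation that vanishes at \<open>e 0\<close>, but not at all columns outside
  \<open>T\<close>, serves as the second relation.\<close>

lemma model_dim_ge_3:
  assumes "m \<ge> l - card D + 2"
  shows "krull_dim (shell_quotient_ring l (stab l a T) m (drep l a e m)) \<ge> 3"
proof -
  obtain z0 where z0: "z0 \<in> relations l a T e m" "\<forall>j<m. z0 j \<noteq> 0" using full_support_point by blast
  obtain b j0 where b: "j0 < m" "b j0 \<noteq> (0::int)" "\<forall>h\<in>stab l a T. (\<Prod>j<m. chr l (a (e j)) h powi b j) = 1"
    using invariant_relation by (elim exE conjE)
  have m: "0 < m" using assms by simp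
  have "l + card {e 0} < card D + card ({..<n} - T)" using assms lt card_complement' by simp
  moreover have "{e 0} \<subseteq> {..<n} - T" using e_mem[OF m] by simp
  ultimately obtain c :: "nat \<Rightarrow> rat" where
    c: "\<exists>j\<in>{..<n}-T. c j \<noteq> 0" "c (e 0) = 0" "\<forall>i<l. (\<Sum>j<n. c j * of_int (a j i)) = 0"
    using kernel_vector[OF T D, of "{e 0}"] by auto
  obtain j where j: "j \<in> {..<n} - T" "c j \<noteq> 0" using c(1) by blast
  then have "j \<in> e ` {..<m}" using bij_betw_imp_surj_on[OF e] by simp
  then obtain j1 where j1: "j1 < m" "e j1 = j" by blast
  have "(\<Sum>j<n. complex_of_rat (c j) * of_int (a j i)) = 0" if "i < l" for i
    using c(3) that by (intro of_rat_kernel) simp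
  from relation_of_kernel[where z = "\<lambda>j. complex_of_rat (c j)", OF e T this]
  have z1: "(\<lambda>j. complex_of_rat (c (e j))) \<in> relations l a T e m" by simp
  show ?thesis
  proof (rule shell_quotient_dim_ge_3[where ?z0.0 = z0 and ?z1.0 = "\<lambda>j. complex_of_rat (c (e j))"
        and b = b and ?j0.0 = j0 and ?i1.0 = 0 and ?j1.0 = j1])
    show "complex_of_rat (c (e j1)) \<noteq> 0" using j(2) j1(2) by simp
    show "complex_of_rat (c (e 0)) = 0" using c(2) by simp
    show "(\<Prod>j<m. chr l (a (e j)) h powi b j) = 1" if "h \<in> stab l a T" for h using b(3) that by blast
  qed (use z0 z1 b m j1 in simp_all)
qed

text \<open>For this value of \<open>m\<close>, the columns of \<open>D\<close> and those outside
  \<open>T\<close> other than \<open>e 0\<close> form a basis. The dual vectors at the latter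
  annihilate \<open>T\<close>, and the moment equation of each isolates a single entry. A relation
  that vanishes at the index 0 is therefore zero.\<close>

lemma relations_line:
  assumes m: "m = l - card D + 1" and z0: "z0 \<in> relations l a T e m" "\<forall>j<m. z0 j \<noteq> 0"
    and z: "z \<in> relations l a T e m"
  shows "\<exists>t. \<forall>j<m. z j = t * z0 j"
proof -
  have m0: "0 < m" using m by simp
  have finD: "finite D" and DT: "D \<subseteq> T" and indepD: "indep l a D"
    using basis_finite[OF D] is_basisD[OF D] by auto
  have e0: "e 0 \<in> {..<n} - T" by (rule e_mem[OF m0])
  have DS: "D \<subseteq> {..<n} - {e 0}" using DT T e0 by auto
  obtain E where E: "D \<subseteq> E" "is_basis l a ({..<n} - {e 0}) E"
    using indep_extend_basis[OF _ DS indepD] by auto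
  have finE: "finite E" by (rule basis_finite[OF E(2)])
  have cardE: "card E = l" by (rule rank_remove_one[OF bound _ E(2)]) (use e0 in simp)
  let ?I = "D \<union> ({..<n} - T - {e 0})"
  \<comment> \<open>Inside \<open>T\<close> the independent set \<open>E\<close> cannot be larger
    than \<open>D\<close>, which already spans \<open>T\<close>.\<close>
  have "E \<subseteq> ?I"
  proof
    fix j assume j: "j \<in> E"
    show "j \<in> ?I"
    proof (cases "j \<in> T")
      case True
      show ?thesis
      proof (rule ccontr)
        assume "j \<notin> ?I"
        then have jD: "j \<notin> D" by simp
        have "indep l a (insert j D)" using indep_subset[OF is_basisD(3)[OF E(2)] _ finE, of "insert j D"] j E(1) by simp
        moreover obtain c :: "nat \<Rightarrow> rat" where c: "\<forall>i<l. of_int (a j i) = (\<Sum>d\<in>D. c d * of_int (a d i))"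
          using is_basisD(4)[OF D True] unfolding in_span_def by blast
        define c' where "c' k = (if k = j then - 1 else c k)" for k
        have "(\<Sum>k\<in>insert j D. c' k * of_int (a k i)) = 0" if "i < l" for i
        proof -
          have "(\<Sum>k\<in>D. c' k * of_int (a k i)) = (\<Sum>k\<in>D. c k * of_int (a k i))"
            using jD by (intro sum.cong) (auto simp: c'_def)
          then show ?thesis using c that jD finD by (simp add: c'_def)
        qed
        ultimately have "c' j = 0" unfolding indep_def by blast
        then show False by (simp add: c'_def)
      qed
    next
      case False
      then show ?thesis using j is_basisD(2)[OF E(2)] by auto
    qed
  qed
  moreover have "card ?I = l"
  proof -
    have "card ({..<n} - T - {e 0}) = m - 1" using card_complement' e0 by simp
    moreover have "card ?I = card D + card ({..<n} - T - {e 0})" using finD DT by (intro card_Un_disjoint) auto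
    ultimately show ?thesis using m lt by simp
  qed
  ultimately have EI: "E = ?I" using cardE finD by (intro card_subset_eq) auto
  obtain u :: "nat \<Rightarrow> nat \<Rightarrow> rat" where
    u: "\<forall>d\<in>E. \<forall>d'\<in>E. (\<Sum>i<l. u d i * of_int (a d' i)) = (if d = d' then 1 else 0)"
    using indep_dual_vectors[OF is_basisD(3)[OF E(2)] finE] by (elim exE conjE)
  define X where "X d = vec l (\<lambda>i. complex_of_rat (u d i))" for d
  have lamX: "lam l (a d') (X d) = (if d = d' then 1 else 0)" if "d \<in> E" "d' \<in> E" for d d'
  proof -
    have "lam l (a d') (X d) = complex_of_rat (\<Sum>i<l. u d i * of_int (a d' i))"
      unfolding lam_def X_def of_rat_sum by (intro sum.cong) (simp_all add: of_rat_mult mult.commute)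
    also have "(\<Sum>i<l. u d i * of_int (a d' i)) = (if d = d' then 1 else 0)" using u that by blast
    finally show ?thesis by simp
  qed
  \<comment> \<open>The multiple of \<open>z0\<close> whose subtraction makes the entry at 0
    vanish.\<close>
  define t where "t = z 0 / z0 0"
  define y where "y j = 1 * z j + (- t) * z0 j" for j
  have yrel: "y \<in> relations l a T e m" unfolding y_def[abs_def] by (rule relations_linear[OF z z0(1)])
  have y0: "y 0 = 0" using z0(2) m0 by (simp add: y_def t_def)
  have "y k = 0" if k: "k < m" for k
  proof (cases "k = 0")
    case False
    have inj: "inj_on e {..<m}" using e by (simp add: bij_betw_def)
    have emem: "e j \<in> E" if "j < m" "j \<noteq> 0" for j
    proof -
      have "e j \<noteq> e 0" using inj_on_eq_iff[OF inj, of j 0] that m0 by simp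
      then show ?thesis unfolding EI using e_mem[OF that(1)] by simp
    qed
    have "X (e k) \<in> ann l a T"
    proof (rule ann_basis[OF D])
      show "X (e k) \<in> carrier_vec l" by (simp add: X_def)
      fix d assume d: "d \<in> D"
      then have "e k \<noteq> d" using e_mem[OF k] DT by auto
      then show "lam l (a d) (X (e k)) = 0" using lamX[OF emem[OF k False], of d] d E(1) by auto
    qed
    then have "(\<Sum>j<m. lam l (a (e j)) (X (e k)) * y j) = 0" using yrel by (simp add: relations_def)
    moreover have "(\<Sum>j<m. lam l (a (e j)) (X (e k)) * y j) = (\<Sum>j<m. if j = k then y j else 0)"
    proof (rule sum.cong[OF refl])
      fix j assume "j \<in> {..<m}"
      then have j: "j < m" by simp
      show "lam l (a (e j)) (X (e k)) * y j = (if j = k then y j else 0)"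
      proof (cases "j = 0")
        case True
        then show ?thesis using y0 by simp
      next
        case j0: False
        have "e k = e j \<longleftrightarrow> k = j" using inj_on_eq_iff[OF inj, of k j] j k by simp
        then show ?thesis using lamX[OF emem[OF k False] emem[OF j j0]] by auto
      qed
    qed
    ultimately show ?thesis using k by simp
  qed (use y0 in simp)
  then have "\<forall>j<m. z j = t * z0 j" by (simp add: y_def)
  then show ?thesis by blast
qed

lemma model_dim_eq_2:
  assumes m: "m = l - card D + 1"
  shows "krull_dim (shell_quotient_ring l (stab l a T) m (drep l a e m)) = 2"
proof (rule antisym)
  obtain z0 where z0: "z0 \<in> relations l a T e m" "\<forall>j<m. z0 j \<noteq> 0" using full_support_point by blast
  obtain b j0 where b: "j0 < m" "b j0 \<noteq> (0::int)" "\<forall>h\<in>stab l a T. (\<Prod>j<m. chr l (a (e j)) h powi b j) = 1"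
    using invariant_relation by (elim exE conjE)
  show "krull_dim (shell_quotient_ring l (stab l a T) m (drep l a e m)) \<le> 2"
  proof (rule shell_quotient_dim_le_2[where c = z0])
    show "\<exists>t. \<forall>j<m. z j = t * z0 j" if "z \<in> relations l a T e m" for z
      by (rule relations_line[OF m z0 that])
  qed (use m z0 in simp_all)
  show "2 \<le> krull_dim (shell_quotient_ring l (stab l a T) m (drep l a e m))"
  proof (rule shell_quotient_dim_ge_2[where ?z0.0 = z0 and b = b and ?j0.0 = j0])
    show "(\<Prod>j<m. chr l (a (e j)) h powi b j) = 1" if "h \<in> stab l a T" for h using b(3) that by blast
  qed (use z0 b in simp_all)
qed

end

section \<open>Slice representations of type O\<close>

lemma add_trivial_carrier: "\<tau> h \<in> carrier_mat m m \<Longrightarrow> add_trivial p m \<tau> h \<in> carrier_mat (p + m) (p + m)"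
  unfolding add_trivial_def by auto

lemma add_trivial_mult_vec:
  assumes "\<tau> h \<in> carrier_mat m m" "v \<in> carrier_vec p" "w \<in> carrier_vec m"
  shows "add_trivial p m \<tau> h *\<^sub>v (v @\<^sub>v w) = v @\<^sub>v (\<tau> h *\<^sub>v w)"
  unfolding add_trivial_def using assms
  by (subst four_block_mat_mult_vec[of _ p p _ m _ m]) auto

lemma transpose_add_trivial:
  assumes "\<tau> h \<in> carrier_mat m m"
  shows "transpose_mat (add_trivial p m \<tau> h) = add_trivial p m (\<lambda>h. transpose_mat (\<tau> h)) h"
  unfolding add_trivial_def using assms
  by (subst transpose_four_block_mat[of _ p p _ m _ m]) auto

lemma add_trivial_is_module:
  assumes mod: "is_module l H m \<tau>"
  shows "is_module l H (p + m) (add_trivial p m \<tau>)"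
  unfolding is_module_def
proof (intro conjI ballI allI impI)
  fix h assume "h \<in> H"
  then show "add_trivial p m \<tau> h \<in> carrier_mat (p + m) (p + m)"
    by (intro add_trivial_carrier is_module_carrier[OF mod])
next
  show "add_trivial p m \<tau> (tone l) = 1\<^sub>m (p + m)"
    using mod by (simp add: is_module_def add_trivial_def)
next
  fix g h assume gh: "g \<in> H" "h \<in> H"
  have C: "\<tau> g \<in> carrier_mat m m" "\<tau> h \<in> carrier_mat m m" using gh is_module_carrier[OF mod] by auto
  have "\<tau> (tmult g h) = \<tau> g * \<tau> h" using mod gh by (simp add: is_module_def)
  then show "add_trivial p m \<tau> (tmult g h) = add_trivial p m \<tau> g * add_trivial p m \<tau> h"
    unfolding add_trivial_def using C by (subst mult_four_block_mat[of _ p p _ m _ m]) auto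
next
  fix i j assume ij: "i < p + m" "j < p + m"
  have const: "(\<lambda>_. c) \<in> laurent_funs l" for c unfolding laurent_funs_def by (rule gen_algebra.const)
  have dims: "dim_row (\<tau> h) = m" "dim_col (\<tau> h) = m" if "h \<in> H" for h
    using is_module_carrier[OF mod that] by auto
  show "\<exists>f\<in>laurent_funs l. \<forall>h\<in>H. add_trivial p m \<tau> h $$ (i, j) = f h"
  proof (cases "i < p \<or> j < p")
    case True
    have "add_trivial p m \<tau> h $$ (i, j) = (if i = j then 1 else 0)" if "h \<in> H" for h
      using True ij dims[OF that] by (auto simp: add_trivial_def)
    then show ?thesis using const[of "if i = j then 1 else 0"] by (intro bexI[of _ "\<lambda>_. if i = j then 1 else 0"]) auto
  next
    case False
    then have "i - p < m" "j - p < m" using ij by auto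
    then obtain f where f: "f \<in> laurent_funs l" "\<forall>h\<in>H. \<tau> h $$ (i - p, j - p) = f h"
      using mod unfolding is_module_def by meson
    have "add_trivial p m \<tau> h $$ (i, j) = f h" if "h \<in> H" for h
      using False ij dims[OF that] f(2) that by (simp add: add_trivial_def)
    then show ?thesis using f(1) by (intro bexI[of _ f]) auto
  qed
qed

text \<open>Allows the module \<open>\<sigma>\<close> of a slice to be replaced by its normal form,
  a trivial module plus the part without invariants.\<close>

lemma slice_iso_compose:
  assumes slice: "slice_iso H n \<rho> E k \<sigma>" and iso: "sympl_iso H k \<sigma> k \<sigma>' \<Phi> \<Psi>"
  shows "slice_iso H n \<rho> E k \<sigma>'"
proof -
  note lin = sympl_isoD(1)[OF iso]
  from slice obtain q where q:
    "\<forall>u\<in>omega_perp n E. \<forall>u'\<in>omega_perp n E. q (u + u') = q u + q u'"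
    "\<forall>c. \<forall>u\<in>omega_perp n E. q (cot_smult c u) = cot_smult c (q u)"
    "q ` omega_perp n E = cot_space k"
    "{u \<in> omega_perp n E. q u = (0\<^sub>v k, 0\<^sub>v k)} = E"
    "\<forall>h\<in>H. \<forall>u\<in>omega_perp n E. q (cot_act \<rho> h u) = cot_act \<sigma> h (q u)"
    "\<forall>u\<in>omega_perp n E. \<forall>u'\<in>omega_perp n E. omega (q u) (q u') = omega u u'"
    unfolding slice_iso_def by (elim exE conjE)
  have qC: "q u \<in> cot_space k" if "u \<in> omega_perp n E" for u using q(3) that by blast
  have z: "(0\<^sub>v k, 0\<^sub>v k) \<in> cot_space k" by (simp add: cot_space_def)
  have zz: "\<Phi> (0\<^sub>v k, 0\<^sub>v k) = (0\<^sub>v k, 0\<^sub>v k)"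
  proof -
    have *: "cot_smult 0 w = (0\<^sub>v k, 0\<^sub>v k)" if "w \<in> cot_space k" for w
      using that by (auto simp: cot_smult_def cot_space_def intro!: eq_vecI)
    have "\<Phi> (cot_smult 0 (0\<^sub>v k, 0\<^sub>v k)) = cot_smult 0 (\<Phi> (0\<^sub>v k, 0\<^sub>v k))" by (rule cot_linearD(3)[OF lin z])
    then show ?thesis using *[OF z] *[OF cot_linearD(1)[OF lin z]] by simp
  qed
  have inj0: "\<Phi> w = (0\<^sub>v k, 0\<^sub>v k) \<longleftrightarrow> w = (0\<^sub>v k, 0\<^sub>v k)" if "w \<in> cot_space k" for w
    using sympl_isoD(2)[OF iso that] sympl_isoD(2)[OF iso z] zz by metis
  show ?thesis
    unfolding slice_iso_def
  proof (intro exI[of _ "\<lambda>u. \<Phi> (q u)"] conjI ballI allI)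
    fix u assume u: "u \<in> omega_perp n E"
    show "\<Phi> (q (cot_smult c u)) = cot_smult c (\<Phi> (q u))" for c
      using q(2) u cot_linearD(3)[OF lin qC[OF u]] by simp
    show "\<Phi> (q (cot_act \<rho> h u)) = cot_act \<sigma>' h (\<Phi> (q u))" if "h \<in> H" for h
      using q(5) u that sympl_isoD(6)[OF iso that qC[OF u]] by simp
    fix u' assume u': "u' \<in> omega_perp n E"
    show "\<Phi> (q (u + u')) = \<Phi> (q u) + \<Phi> (q u')"
      using q(1) u u' cot_linearD(2)[OF lin qC[OF u] qC[OF u']] by simp
    show "omega (\<Phi> (q u)) (\<Phi> (q u')) = omega u u'"
      using q(6) u u' sympl_isoD(5)[OF iso qC[OF u] qC[OF u']] by simp
  next
    have "\<Phi> ` cot_space k = cot_space k"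
    proof (intro equalityI subsetI)
      fix w assume "w \<in> cot_space k"
      then show "w \<in> \<Phi> ` cot_space k" using sympl_isoD(3,4)[OF iso] by (metis imageI)
    qed (use cot_linearD(1)[OF lin] in auto)
    then show "(\<lambda>u. \<Phi> (q u)) ` omega_perp n E = cot_space k" using q(3) by (metis image_image)
    have "{u \<in> omega_perp n E. \<Phi> (q u) = (0\<^sub>v k, 0\<^sub>v k)} = {u \<in> omega_perp n E. q u = (0\<^sub>v k, 0\<^sub>v k)}"
      by (intro Collect_cong conj_cong refl inj0 qC)
    then show "{u \<in> omega_perp n E. \<Phi> (q u) = (0\<^sub>v k, 0\<^sub>v k)} = E" using q(4) by simp
  qed
qed

lemma mult_mat_zero_vec:
  fixes M :: "complex mat"
  assumes "M \<in> carrier_mat n m"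
  shows "M *\<^sub>v 0\<^sub>v m = 0\<^sub>v n"
  using assms mat_vec_index[OF assms zero_carrier_vec] by (intro eq_vecI) auto

lemma cot_space_add_left_cancel:
  assumes "w + x = w + y" "w \<in> cot_space k" "x \<in> cot_space k" "y \<in> cot_space k"
  shows "x = y"
proof -
  have "fst x $ i = fst y $ i \<and> snd x $ i = snd y $ i" if "i < k" for i
  proof -
    have "fst (w + x) $ i = fst (w + y) $ i" "snd (w + x) $ i = snd (w + y) $ i" using assms(1) by simp_all
    then show ?thesis
      using that cot_spaceD[OF assms(2)] cot_spaceD[OF assms(3)] cot_spaceD[OF assms(4)] by simp
  qed
  then show ?thesis
    using cot_spaceD[OF assms(3)] cot_spaceD[OF assms(4)] unfolding prod_eq_iff by (intro conjI eq_vecI) auto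
qed

text \<open>The inclusion of the symplectic summand on the columns selected by \<open>e\<close> into
  the full symplectic module.\<close>

definition emb :: "nat \<Rightarrow> (nat \<Rightarrow> nat) \<Rightarrow> nat \<Rightarrow> complex vec \<times> complex vec \<Rightarrow> complex vec \<times> complex vec" where
  "emb n e m u = (vec n (\<lambda>j. if j \<in> e ` {..<m} then fst u $ (the_inv_into {..<m} e j) else 0),
     vec n (\<lambda>j. if j \<in> e ` {..<m} then snd u $ (the_inv_into {..<m} e j) else 0))"

text \<open>The projection of the slice onto its nontrivial part, that is, the second summand of
  \<open>add_trivial\<close> together with its dual.\<close>

definition tail :: "nat \<Rightarrow> nat \<Rightarrow> complex vec \<times> complex vec \<Rightarrow> complex vec \<times> complex vec" where
  "tail p m u = (vec m (\<lambda>i. fst u $ (p + i)), vec m (\<lambda>i. snd u $ (p + i)))"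

lemma sum_split_add: "(\<Sum>i<p + m. f i) = (\<Sum>i<p. f i) + (\<Sum>i<m. f (p + i) :: 'a :: comm_monoid_add)" for p m :: nat
  by (induction m) (simp_all add: add.assoc)

lemma omega_sum:
  assumes "u \<in> cot_space k" "w \<in> cot_space k"
  shows "omega u w = (\<Sum>i<k. snd w $ i * fst u $ i - snd u $ i * fst w $ i)"
  using cot_spaceD[OF assms(1)] cot_spaceD[OF assms(2)]
  by (simp add: omega_def scalar_prod_sum[of _ k] sum_subtractf)

lemma tail_cot_space: "tail p m u \<in> cot_space m"
  by (simp add: tail_def cot_space_def)

lemma cot_act_add_trivial:
  assumes C: "\<tau> h \<in> carrier_mat m m" "\<tau> (tinv h) \<in> carrier_mat m m" and u: "u \<in> cot_space (p + m)"
  shows "tail p m (cot_act (add_trivial p m \<tau>) h u) = cot_act \<tau> h (tail p m u)"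
    and "i < p \<Longrightarrow> fst (cot_act (add_trivial p m \<tau>) h u) $ i = fst u $ i"
    and "i < p \<Longrightarrow> snd (cot_act (add_trivial p m \<tau>) h u) $ i = snd u $ i"
proof -
  let ?hd = "\<lambda>v. vec p (\<lambda>i. v $ i)" and ?tl = "\<lambda>v. vec m (\<lambda>i. v $ (p + i))"
  have split: "v = ?hd v @\<^sub>v ?tl v" if "v \<in> carrier_vec (p + m)" for v :: "complex vec"
    using that by (intro eq_vecI) auto
  have uC: "fst u \<in> carrier_vec (p + m)" "snd u \<in> carrier_vec (p + m)" using u by (auto dest: cot_spaceD)
  have 1: "add_trivial p m \<tau> h *\<^sub>v fst u = ?hd (fst u) @\<^sub>v (\<tau> h *\<^sub>v ?tl (fst u))"
    by (subst split[OF uC(1)]) (rule add_trivial_mult_vec[where \<tau> = \<tau>, OF C(1)]; simp)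
  have 2: "transpose_mat (add_trivial p m \<tau> (tinv h)) *\<^sub>v snd u = ?hd (snd u) @\<^sub>v (transpose_mat (\<tau> (tinv h)) *\<^sub>v ?tl (snd u))"
    unfolding transpose_add_trivial[where \<tau> = \<tau>, OF C(2)]
    by (subst split[OF uC(2)]) (rule add_trivial_mult_vec[where \<tau> = "\<lambda>h. transpose_mat (\<tau> h)"]; simp add: C(2))
  have dim: "dim_vec (\<tau> h *\<^sub>v ?tl (fst u)) = m" "dim_vec (transpose_mat (\<tau> (tinv h)) *\<^sub>v ?tl (snd u)) = m"
    using C by auto
  have tl: "vec m (\<lambda>i. (?hd v @\<^sub>v w) $ (p + i)) = w" if "dim_vec w = m" for v w :: "complex vec"
    using that by (intro eq_vecI) auto
  show "tail p m (cot_act (add_trivial p m \<tau>) h u) = cot_act \<tau> h (tail p m u)"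
    unfolding tail_def cot_act_def fst_conv snd_conv 1 2 tl[OF dim(1)] tl[OF dim(2)] ..
  show "fst (cot_act (add_trivial p m \<tau>) h u) $ i = fst u $ i" if "i < p"
    unfolding cot_act_def fst_conv 1 using that dim by simp
  show "snd (cot_act (add_trivial p m \<tau>) h u) $ i = snd u $ i" if "i < p"
    unfolding cot_act_def snd_conv 2 using that dim by simp
qed

text \<open>The invariants of the slice representation are the image of the part of \<open>E\<^sup>\<omega>\<close> supported
  on T, and the part supported off T is their symplectic complement; hence the latter is
  \<open>W\<^sub>0 \<oplus> W\<^sub>0\<^sup>*\<close>.\<close>

lemma slice_nontrivial_part:
  fixes a :: "nat \<Rightarrow> nat \<Rightarrow> int"
  assumes slice: "slice_iso H n (drep l a id n) E (p + m') (add_trivial p m' \<tau>)"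
    and H: "H = stab l a T" and mod: "is_module l H m' \<tau>" and inv: "invariant_vecs H m' \<tau> = {0\<^sub>v m'}"
    and T: "T \<subseteq> {..<n}" "\<And>j. j < n \<Longrightarrow> j \<notin> T \<Longrightarrow> \<exists>h\<in>H. chr l (a j) h \<noteq> 1"
    and e: "bij_betw e {..<m} ({..<n} - T)"
    and E: "\<And>u j. u \<in> E \<Longrightarrow> j < n \<Longrightarrow> j \<notin> T \<Longrightarrow> fst u $ j = 0 \<and> snd u $ j = 0"
  shows "\<exists>\<Phi> \<Psi>. sympl_iso H m (drep l a e m) m' \<tau> \<Phi> \<Psi>"
proof -
  let ?r = "drep l a id n" and ?s = "add_trivial p m' \<tau>" and ?k = "p + m'" and ?N = "omega_perp n E"
  from slice obtain q where q:
    "\<forall>u\<in>?N. \<forall>u'\<in>?N. q (u + u') = q u + q u'"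
    "\<forall>c. \<forall>u\<in>?N. q (cot_smult c u) = cot_smult c (q u)"
    "q ` ?N = cot_space ?k"
    "{u \<in> ?N. q u = (0\<^sub>v ?k, 0\<^sub>v ?k)} = E"
    "\<forall>h\<in>H. \<forall>u\<in>?N. q (cot_act ?r h u) = cot_act ?s h (q u)"
    "\<forall>u\<in>?N. \<forall>u'\<in>?N. omega (q u) (q u') = omega u u'"
    unfolding slice_iso_def by (elim exE conjE)
  have Ht: "h \<in> torus l" if "h \<in> H" for h using that unfolding H by (rule stabD)
  have Hinv: "tinv h \<in> H" if "h \<in> H" for h using that unfolding H by (rule stab_tinv)
  have \<tau>C: "\<tau> h \<in> carrier_mat m' m'" if "h \<in> H" for h by (rule is_module_carrier[OF mod that])
  have NC: "u \<in> cot_space n" if "u \<in> ?N" for u using that by (simp add: omega_perp_def)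
  have EN: "E \<subseteq> ?N" using q(4) by blast
  have EC: "u \<in> cot_space n" if "u \<in> E" for u using EN NC that by blast
  have qC: "q u \<in> cot_space ?k" if "u \<in> ?N" for u using q(3) that by blast
  have inj: "inj_on e {..<m}" and im: "e ` {..<m} = {..<n} - T" using e by (auto simp: bij_betw_def)
  have en: "e i < n" "e i \<notin> T" if "i < m" for i using im that by auto
  note emb_def' = emb_def[of n e m, unfolded im]
  have emb_e: "fst (emb n e m u) $ e i = fst u $ i" "snd (emb n e m u) $ e i = snd u $ i" if "i < m" for u i
    using en[OF that] the_inv_into_f_f[OF inj, of i] that by (simp_all add: emb_def')
  have emb_T: "fst (emb n e m u) $ j = 0" "snd (emb n e m u) $ j = 0" if "j \<in> T" for u j
    using that T(1) by (auto simp: emb_def')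
  have emb_C: "emb n e m u \<in> cot_space n" for u by (simp add: emb_def cot_space_def)
  have emb_eq: "emb n e m u = w" if w: "w \<in> cot_space n" and wT: "\<And>j. j \<in> T \<Longrightarrow> fst w $ j = 0 \<and> snd w $ j = 0"
      and we: "\<And>i. i < m \<Longrightarrow> fst w $ e i = fst u $ i \<and> snd w $ e i = snd u $ i" for u w
  proof -
    have eq: "fst (emb n e m u) $ j = fst w $ j \<and> snd (emb n e m u) $ j = snd w $ j" if j: "j < n" for j
    proof (cases "j \<in> T")
      case True
      then show ?thesis using emb_T wT by simp
    next
      case False
      then have "j \<in> e ` {..<m}" using j im by simp
      then obtain i where "i < m" "j = e i" by auto
      then show ?thesis using emb_e we by simp
    qed
    show ?thesis
      unfolding prod_eq_iff using eq cot_spaceD[OF w] cot_spaceD[OF emb_C[of u]]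
      by (intro conjI eq_vecI) auto
  qed
  have emb_add: "emb n e m (u + u') = emb n e m u + emb n e m u'" if "u \<in> cot_space m" "u' \<in> cot_space m" for u u'
  proof (rule emb_eq)
    show "emb n e m u + emb n e m u' \<in> cot_space n" by (intro cot_space_add emb_C)
    have C: "fst (emb n e m u') \<in> carrier_vec n" "snd (emb n e m u') \<in> carrier_vec n" by (rule cot_spaceD[OF emb_C])+
    show "fst (emb n e m u + emb n e m u') $ j = 0 \<and> snd (emb n e m u + emb n e m u') $ j = 0" if "j \<in> T" for j
      using emb_T[OF that] C subsetD[OF T(1) that] by simp
    show "fst (emb n e m u + emb n e m u') $ e i = fst (u + u') $ i \<and> snd (emb n e m u + emb n e m u') $ e i = snd (u + u') $ i"
      if "i < m" for i
      using emb_e[OF that] C en[OF that] cot_spaceD[OF \<open>u' \<in> cot_space m\<close>] that by simp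
  qed
  have emb_smult: "emb n e m (cot_smult c u) = cot_smult c (emb n e m u)" if "u \<in> cot_space m" for c u
  proof (rule emb_eq)
    show "cot_smult c (emb n e m u) \<in> cot_space n" by (intro cot_space_smult emb_C)
    have C: "fst (emb n e m u) \<in> carrier_vec n" "snd (emb n e m u) \<in> carrier_vec n" by (rule cot_spaceD[OF emb_C])+
    show "fst (cot_smult c (emb n e m u)) $ j = 0 \<and> snd (cot_smult c (emb n e m u)) $ j = 0" if "j \<in> T" for j
      using emb_T[OF that] C subsetD[OF T(1) that] by (simp add: cot_smult_def)
    show "fst (cot_smult c (emb n e m u)) $ e i = fst (cot_smult c u) $ i \<and> snd (cot_smult c (emb n e m u)) $ e i = snd (cot_smult c u) $ i"
      if "i < m" for i
      using emb_e[OF that] C en[OF that] cot_spaceD[OF \<open>u \<in> cot_space m\<close>] that by (simp add: cot_smult_def)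
  qed
  have emb_act: "emb n e m (cot_act (drep l a e m) h u) = cot_act ?r h (emb n e m u)" if h: "h \<in> H" and u: "u \<in> cot_space m" for h u
  proof (rule emb_eq)
    note act = cot_act_drep'[OF Ht[OF h] emb_C, of a id u]
    show "cot_act ?r h (emb n e m u) \<in> cot_space n" unfolding act by (simp add: cot_space_def)
    show "fst (cot_act ?r h (emb n e m u)) $ j = 0 \<and> snd (cot_act ?r h (emb n e m u)) $ j = 0" if "j \<in> T" for j
      unfolding act using emb_T[OF that] subsetD[OF T(1) that] by simp
    show "fst (cot_act ?r h (emb n e m u)) $ e i = fst (cot_act (drep l a e m) h u) $ i \<and>
        snd (cot_act ?r h (emb n e m u)) $ e i = snd (cot_act (drep l a e m) h u) $ i" if "i < m" for i
      unfolding act cot_act_drep'[OF Ht[OF h] u] using emb_e[OF that] en[OF that] that by simp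
  qed
  have emb_omega: "omega (emb n e m u) w = (\<Sum>i<m. snd w $ e i * fst u $ i - snd u $ i * fst w $ e i)" if w: "w \<in> cot_space n" for u w
  proof -
    have "omega (emb n e m u) w = (\<Sum>j\<in>{..<n}-T. snd w $ j * fst (emb n e m u) $ j - snd (emb n e m u) $ j * fst w $ j)"
      unfolding omega_sum[OF emb_C w] by (intro sum.mono_neutral_right ballI) (auto simp: emb_T[of _ u])
    also have "\<dots> = (\<Sum>i<m. snd w $ e i * fst (emb n e m u) $ e i - snd (emb n e m u) $ e i * fst w $ e i)"
      by (rule sum.reindex_bij_betw[OF e, symmetric])
    also have "\<dots> = (\<Sum>i<m. snd w $ e i * fst u $ i - snd u $ i * fst w $ e i)"
      using emb_e by (intro sum.cong) simp_all
    finally show ?thesis .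
  qed
  have emb_N: "emb n e m u \<in> ?N" for u
  proof -
    have "omega (emb n e m u) \<epsilon> = 0" if "\<epsilon> \<in> E" for \<epsilon>
      unfolding emb_omega[OF EC[OF that]] using E[OF that en] by simp
    then show ?thesis using emb_C by (simp add: omega_perp_def)
  qed
  have omega_diff_left: "omega (w + cot_smult (- 1) v) \<epsilon> = omega w \<epsilon> - omega v \<epsilon>"
    if "w \<in> cot_space k" "v \<in> cot_space k" "\<epsilon> \<in> cot_space k" for w v \<epsilon> k
  proof -
    have "w + cot_smult (- 1) v \<in> cot_space k" using that by (intro cot_space_add cot_space_smult)
    from omega_sum[OF this that(3)] show ?thesis
      unfolding omega_sum[OF that(1,3)] omega_sum[OF that(2,3)] sum_subtractf[symmetric]
      using cot_spaceD[OF that(1)] cot_spaceD[OF that(2)]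
      by (elim ssubst, intro sum.cong) (simp_all add: cot_smult_def algebra_simps)
  qed
  have N_diff: "w + cot_smult (- 1) v \<in> ?N" if "w \<in> ?N" "v \<in> ?N" for w v
  proof -
    have "w + cot_smult (- 1) v \<in> cot_space n" using that NC by (intro cot_space_add cot_space_smult)
    moreover have "omega (w + cot_smult (- 1) v) \<epsilon> = 0" if "\<epsilon> \<in> E" for \<epsilon>
      using omega_diff_left[OF NC[OF \<open>w \<in> ?N\<close>] NC[OF \<open>v \<in> ?N\<close>] EC[OF that]] \<open>w \<in> ?N\<close> \<open>v \<in> ?N\<close> that
      by (simp add: omega_perp_def)
    ultimately show ?thesis by (simp add: omega_perp_def)
  qed
  define Q where "Q u = q (emb n e m u)" for u
  have QC: "Q u \<in> cot_space ?k" for u unfolding Q_def by (rule qC[OF emb_N])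
  define fixed where "fixed w \<longleftrightarrow> (\<forall>h\<in>H. cot_act ?s h w = w)" for w
  \<comment> \<open>Lift \<open>w\<close> to \<open>y\<close> and split off the coordinates outside
    \<open>T\<close>. What remains is supported on \<open>T\<close>, where \<open>H\<close> acts
    trivially, and is orthogonal to everything supported off \<open>T\<close>.\<close>
  have decompose: "\<exists>w1 u. u \<in> cot_space m \<and> w1 \<in> cot_space ?k \<and> w = w1 + Q u \<and> fixed w1 \<and> (\<forall>u'. omega w1 (Q u') = 0)"
    if w: "w \<in> cot_space ?k" for w
  proof -
    from w q(3) obtain y where y: "y \<in> ?N" "w = q y" by blast
    have yC: "fst y \<in> carrier_vec n" "snd y \<in> carrier_vec n" using NC[OF y(1)] by (auto dest: cot_spaceD)
    define u where "u = (vec m (\<lambda>i. fst y $ e i), vec m (\<lambda>i. snd y $ e i))"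
    have uC: "u \<in> cot_space m" by (simp add: u_def cot_space_def)
    define y1 where "y1 = y + cot_smult (- 1) (emb n e m u)"
    have y1N: "y1 \<in> ?N" unfolding y1_def by (rule N_diff[OF y(1) emb_N])
    have eC: "fst (emb n e m u) \<in> carrier_vec n" "snd (emb n e m u) \<in> carrier_vec n" by (rule cot_spaceD[OF emb_C])+
    have y1e: "fst y1 $ e i = 0 \<and> snd y1 $ e i = 0" if "i < m" for i
      using emb_e[OF that] en[OF that] yC eC that by (simp add: y1_def cot_smult_def u_def)
    have y1off: "fst y1 $ j = 0 \<and> snd y1 $ j = 0" if "j < n" "j \<notin> T" for j
    proof -
      have "j \<in> e ` {..<m}" using that im by simp
      then show ?thesis using y1e by auto
    qed
    have "y = y1 + emb n e m u"
      using yC eC unfolding prod_eq_iff y1_def by (intro conjI eq_vecI) (auto simp: cot_smult_def)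
    then have "w = q y1 + Q u" unfolding y(2) Q_def using q(1) y1N emb_N by simp
    moreover have "fixed (q y1)"
      unfolding fixed_def
    proof
      fix h assume h: "h \<in> H"
      have y1C: "fst y1 \<in> carrier_vec n" "snd y1 \<in> carrier_vec n" using NC[OF y1N] by (auto dest: cot_spaceD)
      have "chr l (a j) h * fst y1 $ j = fst y1 $ j \<and> inverse (chr l (a j) h) * snd y1 $ j = snd y1 $ j" if "j < n" for j
        using y1off[OF that] h stabD(2)[of h l a T j] unfolding H by (cases "j \<in> T") simp_all
      then have "cot_act ?r h y1 = y1"
        unfolding cot_act_drep'[OF Ht[OF h] NC[OF y1N]] prod_eq_iff using y1C by (intro conjI eq_vecI) auto
      then show "cot_act ?s h (q y1) = q y1" using q(5) h y1N by metis
    qed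
    moreover have "omega (q y1) (Q u') = 0" for u'
    proof -
      have "omega (q y1) (Q u') = omega y1 (emb n e m u')" unfolding Q_def using q(6) y1N emb_N by blast
      also have "\<dots> = - omega (emb n e m u') y1" by (simp add: omega_def)
      also have "\<dots> = 0" unfolding emb_omega[OF NC[OF y1N]] using y1e by simp
      finally show ?thesis .
    qed
    ultimately show ?thesis using qC[OF y1N] uC by blast
  qed
  \<comment> \<open>If \<open>Q u\<close> is fixed, the difference between the embedded
    \<open>u\<close> and its translate lies in the kernel \<open>E\<close> of \<open>q\<close>,
    which vanishes off \<open>T\<close>. For each column outside \<open>T\<close> some
    \<open>h\<close> has character value other than 1, so the coordinate is 0.\<close>
  have Q_fixed: "Q u = (0\<^sub>v ?k, 0\<^sub>v ?k)" if u: "u \<in> cot_space m" and fx: "fixed (Q u)" for u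
  proof -
    have coord: "fst u $ i = 0 \<and> snd u $ i = 0" if i: "i < m" for i
    proof -
      obtain h where h: "h \<in> H" "chr l (a (e i)) h \<noteq> 1" using T(2) en[OF i] by blast
      let ?d = "cot_act ?r h (emb n e m u) + cot_smult (- 1) (emb n e m u)"
      have actN: "cot_act ?r h (emb n e m u) \<in> ?N" using emb_act[OF h(1) u] emb_N by metis
      have dN: "?d \<in> ?N" by (rule N_diff[OF actN emb_N])
      have "q ?d = q (cot_act ?r h (emb n e m u)) + cot_smult (- 1) (Q u)"
      proof -
        have "cot_smult (- 1) (emb n e m u) \<in> ?N" using emb_smult[OF u, of "- 1"] emb_N by metis
        then show ?thesis unfolding Q_def using q(1,2) actN emb_N by simp
      qed
      also have "\<dots> = Q u + cot_smult (- 1) (Q u)"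
        using q(5) emb_N h(1) fx unfolding fixed_def Q_def by simp
      also have "\<dots> = (0\<^sub>v ?k, 0\<^sub>v ?k)"
        using cot_spaceD[OF QC[of u]] unfolding prod_eq_iff by (intro conjI eq_vecI) (auto simp: cot_smult_def)
      finally have "?d \<in> E" using q(4) dN by blast
      from E[OF this en[OF i]] have d: "fst ?d $ e i = 0" "snd ?d $ e i = 0" by simp_all
      have eC: "fst (emb n e m u) \<in> carrier_vec n" "snd (emb n e m u) \<in> carrier_vec n" by (rule cot_spaceD[OF emb_C])+
      have "(chr l (a (e i)) h - 1) * fst u $ i = 0" "(inverse (chr l (a (e i)) h) - 1) * snd u $ i = 0"
        using d emb_e[OF i, of u] en[OF i] eC unfolding cot_act_drep'[OF Ht[OF h(1)] emb_C]
        by (simp_all add: cot_smult_def algebra_simps)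
      then show ?thesis using h(2) by (auto simp: inverse_eq_1_iff)
    qed
    have "emb n e m u = emb n e m (cot_smult 0 u)"
      by (rule emb_eq[OF emb_C]) (use emb_T emb_e coord cot_spaceD[OF u] in \<open>simp_all add: cot_smult_def\<close>)
    also have "\<dots> = cot_smult 0 (emb n e m u)" by (rule emb_smult[OF u])
    finally have "Q u = cot_smult 0 (Q u)" unfolding Q_def using q(2) emb_N by metis
    also have "\<dots> = (0\<^sub>v ?k, 0\<^sub>v ?k)"
      using cot_spaceD[OF QC[of u]] unfolding prod_eq_iff by (intro conjI eq_vecI) (auto simp: cot_smult_def)
    finally show ?thesis .
  qed
  have add_zero: "w + (0\<^sub>v ?k, 0\<^sub>v ?k) = w" if "w \<in> cot_space ?k" for w
    using cot_spaceD[OF that] by (simp add: prod_eq_iff)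
  have actC: "cot_act ?s h w \<in> cot_space ?k" if "h \<in> H" "w \<in> cot_space ?k" for h w
    using that \<tau>C Hinv by (intro cot_act_in_cot_space add_trivial_carrier[where \<tau> = \<tau>]) auto
  have act_add: "cot_act ?s h (w + w') = cot_act ?s h w + cot_act ?s h w'" if "h \<in> H" "w \<in> cot_space ?k" "w' \<in> cot_space ?k" for h w w'
    using add_trivial_carrier[where \<tau> = \<tau> and p = p, OF \<tau>C[OF that(1)]]
      add_trivial_carrier[where \<tau> = \<tau> and p = p, OF \<tau>C[OF Hinv[OF that(1)]]]
      cot_spaceD[OF that(2)] cot_spaceD[OF that(3)]
    by (simp add: cot_act_def mult_add_distrib_mat_vec[of _ ?k ?k])
  \<comment> \<open>In the decomposition of a fixed vector the \<open>Q\<close> component is fixed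
    too, hence zero by \<open>Q_fixed\<close>.\<close>
  have fixed_orth: "omega w (Q u') = 0" if w: "w \<in> cot_space ?k" and fx: "fixed w" for w u'
  proof -
    obtain w1 u where d: "u \<in> cot_space m" "w1 \<in> cot_space ?k" "w = w1 + Q u" "fixed w1" "\<forall>u'. omega w1 (Q u') = 0"
      using decompose[OF w] by blast
    have "fixed (Q u)"
      unfolding fixed_def
    proof
      fix h assume h: "h \<in> H"
      have "w1 + cot_act ?s h (Q u) = w1 + Q u"
        using act_add[OF h d(2) QC[of u]] fx d(3,4) h unfolding fixed_def by metis
      then show "cot_act ?s h (Q u) = Q u"
        by (rule cot_space_add_left_cancel[OF _ d(2) actC[OF h QC] QC])
    qed
    then have "Q u = (0\<^sub>v ?k, 0\<^sub>v ?k)" by (rule Q_fixed[OF d(1)])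
    then have "w = w1" using d(3) add_zero[OF d(2)] by simp
    then show ?thesis by (simp only: d(5)[rule_format])
  qed
  \<comment> \<open>The first \<open>p\<close> coordinates are read off by pairing with unit vectors
    of the trivial summand and of its dual; these are fixed, hence orthogonal to
    \<open>Q u\<close>.\<close>
  have Q_head: "fst (Q u) $ i = 0" "snd (Q u) $ i = 0" if i: "i < p" for u i
  proof -
    have fixI: "fixed w" if w: "w \<in> cot_space ?k" and tl: "tail p m' w = (0\<^sub>v m', 0\<^sub>v m')" for w
      unfolding fixed_def
    proof
      fix h assume h: "h \<in> H"
      note A = cot_act_add_trivial[where \<tau> = \<tau> and p = p, OF \<tau>C[OF h] \<tau>C[OF Hinv[OF h]] w]
      have "cot_act \<tau> h (0\<^sub>v m', 0\<^sub>v m') = (0\<^sub>v m', 0\<^sub>v m')"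
        using mult_mat_zero_vec[OF \<tau>C[OF h]] mult_mat_zero_vec[of "transpose_mat (\<tau> (tinv h))" m' m'] \<tau>C[OF Hinv[OF h]]
        by (simp add: cot_act_def)
      then have t: "tail p m' (cot_act ?s h w) = tail p m' w" using A(1) tl by simp
      have eq: "fst (cot_act ?s h w) $ j = fst w $ j \<and> snd (cot_act ?s h w) $ j = snd w $ j" if j: "j < ?k" for j
      proof (cases "j < p")
        case True
        then show ?thesis using A(2,3) by simp
      next
        case False
        then have j': "j - p < m'" "p + (j - p) = j" using j by auto
        have "fst (tail p m' (cot_act ?s h w)) $ (j - p) = fst (tail p m' w) $ (j - p)"
          "snd (tail p m' (cot_act ?s h w)) $ (j - p) = snd (tail p m' w) $ (j - p)" using t by simp_all
        then show ?thesis using j' by (simp add: tail_def)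
      qed
      show "cot_act ?s h w = w"
        using eq cot_spaceD[OF w] cot_spaceD[OF actC[OF h w]] unfolding prod_eq_iff by (intro conjI eq_vecI) auto
    qed
    let ?w = "(0\<^sub>v ?k, unit_vec ?k i)" and ?w' = "(unit_vec ?k i, 0\<^sub>v ?k)"
    have C: "?w \<in> cot_space ?k" "?w' \<in> cot_space ?k" by (simp_all add: cot_space_def)
    have "fixed ?w" using i by (intro fixI C) (auto simp: tail_def)
    from fixed_orth[OF C(1) this, of u] have "(\<Sum>j<?k. if j = i then fst (Q u) $ j else 0) = 0"
      unfolding omega_sum[OF C(1) QC] using i
      by (subst (asm) sum.cong[OF refl, where h = "\<lambda>j. - (if j = i then fst (Q u) $ j else 0)"])
        (auto simp: unit_vec_def sum_negf)
    then show "fst (Q u) $ i = 0" using i by simp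
    have "fixed ?w'" using i by (intro fixI C) (auto simp: tail_def)
    from fixed_orth[OF C(2) this, of u] have "(\<Sum>j<?k. if j = i then snd (Q u) $ j else 0) = 0"
      unfolding omega_sum[OF C(2) QC] using i
      by (subst (asm) sum.cong[OF refl, where h = "\<lambda>j. (if j = i then snd (Q u) $ j else 0)"])
        (auto simp: unit_vec_def)
    then show "snd (Q u) $ i = 0" using i by simp
  qed
  have tl_omega: "omega w w' = omega (tail p m' w) (tail p m' w')"
    if "w \<in> cot_space ?k" "w' \<in> cot_space ?k" "\<And>i. i < p \<Longrightarrow> fst w $ i = 0 \<and> snd w $ i = 0" for w w'
    unfolding omega_sum[OF that(1,2)] omega_sum[OF tail_cot_space tail_cot_space] sum_split_add
    using that(3) by (simp add: tail_def)
  define \<Phi> where "\<Phi> u = tail p m' (Q u)" for u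
  have \<Phi>_add: "\<Phi> (u + u') = \<Phi> u + \<Phi> u'" if "u \<in> cot_space m" "u' \<in> cot_space m" for u u'
  proof -
    have "Q (u + u') = Q u + Q u'" unfolding Q_def emb_add[OF that] using q(1) emb_N by simp
    then show ?thesis using cot_spaceD[OF QC[of u']]
      unfolding \<Phi>_def tail_def prod_eq_iff by (intro conjI eq_vecI) auto
  qed
  have \<Phi>_smult: "\<Phi> (cot_smult c u) = cot_smult c (\<Phi> u)" if "u \<in> cot_space m" for c u
  proof -
    have "Q (cot_smult c u) = cot_smult c (Q u)" unfolding Q_def emb_smult[OF that] using q(2) emb_N by simp
    then show ?thesis using cot_spaceD[OF QC[of u]]
      unfolding \<Phi>_def tail_def prod_eq_iff cot_smult_def by (intro conjI eq_vecI) auto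
  qed
  have \<Phi>_omega: "omega (\<Phi> u) (\<Phi> u') = omega u u'" if "u \<in> cot_space m" "u' \<in> cot_space m" for u u'
  proof -
    have "omega (\<Phi> u) (\<Phi> u') = omega (Q u) (Q u')"
      unfolding \<Phi>_def using tl_omega[OF QC[of u] QC[of u']] Q_head by simp
    also have "\<dots> = omega (emb n e m u) (emb n e m u')" unfolding Q_def using q(6) emb_N by blast
    also have "\<dots> = omega u u'"
      unfolding emb_omega[OF emb_C] omega_sum[OF that] using emb_e by (intro sum.cong) simp_all
    finally show ?thesis .
  qed
  have \<Phi>_act: "\<Phi> (cot_act (drep l a e m) h u) = cot_act \<tau> h (\<Phi> u)" if h: "h \<in> H" and u: "u \<in> cot_space m" for h u
  proof -
    have "Q (cot_act (drep l a e m) h u) = cot_act ?s h (Q u)"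
      unfolding Q_def emb_act[OF h u] using q(5) h emb_N by simp
    then show ?thesis unfolding \<Phi>_def
      using cot_act_add_trivial(1)[where \<tau> = \<tau> and p = p, OF \<tau>C[OF h] \<tau>C[OF Hinv[OF h]] QC] by simp
  qed
  have \<Phi>_inj: "u = u'" if u: "u \<in> cot_space m" "u' \<in> cot_space m" and eq: "\<Phi> u = \<Phi> u'" for u u'
  proof -
    have om: "omega u w = omega u' w" if "w \<in> cot_space m" for w
      using \<Phi>_omega[OF u(1) that] \<Phi>_omega[OF u(2) that] eq by simp
    have "fst u $ i = fst u' $ i \<and> snd u $ i = snd u' $ i" if i: "i < m" for i
    proof -
      have C: "(0\<^sub>v m, unit_vec m i) \<in> cot_space m" "(unit_vec m i, 0\<^sub>v m) \<in> cot_space m" by (simp_all add: cot_space_def)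
      have 1: "omega v (0\<^sub>v m, unit_vec m i) = fst v $ i" if "v \<in> cot_space m" for v
      proof -
        have "omega v (0\<^sub>v m, unit_vec m i) = (\<Sum>j<m. if j = i then fst v $ j else 0)"
          unfolding omega_sum[OF that C(1)] using i by (intro sum.cong) (auto simp: unit_vec_def)
        then show ?thesis using i by simp
      qed
      have 2: "omega v (unit_vec m i, 0\<^sub>v m) = - snd v $ i" if "v \<in> cot_space m" for v
      proof -
        have "omega v (unit_vec m i, 0\<^sub>v m) = (\<Sum>j<m. if j = i then - snd v $ j else 0)"
          unfolding omega_sum[OF that C(2)] using i by (intro sum.cong) (auto simp: unit_vec_def)
        then show ?thesis using i by simp
      qed
      show ?thesis using om[OF C(1)] om[OF C(2)] 1[OF u(1)] 1[OF u(2)] 2[OF u(1)] 2[OF u(2)] by simp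
    qed
    then show ?thesis using cot_spaceD[OF u(1)] cot_spaceD[OF u(2)] unfolding prod_eq_iff by (intro conjI eq_vecI) auto
  qed
  \<comment> \<open>The hypothesis on invariants speaks about the module and not about its dual, so
    only the first component is settled here. The second one is obtained from the symplectic form in
    \<open>snd0\<close>.\<close>
  have fixed_tail: "fst (tail p m' w) = 0\<^sub>v m'" if w: "w \<in> cot_space ?k" and fx: "fixed w" for w
  proof -
    have "\<tau> h *\<^sub>v fst (tail p m' w) = fst (tail p m' w)" if h: "h \<in> H" for h
    proof -
      have "cot_act \<tau> h (tail p m' w) = tail p m' w"
        using cot_act_add_trivial(1)[where \<tau> = \<tau> and p = p, OF \<tau>C[OF h] \<tau>C[OF Hinv[OF h]] w] fx h unfolding fixed_def by simp
      then show ?thesis by (metis cot_act_def fst_conv)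
    qed
    then have "fst (tail p m' w) \<in> invariant_vecs H m' \<tau>" by (simp add: invariant_vecs_def tail_def)
    then show ?thesis using inv by blast
  qed
  have \<Phi>_surj: "\<exists>u\<in>cot_space m. \<Phi> u = y" if y: "y \<in> cot_space m'" for y
  proof -
    have yC: "fst y \<in> carrier_vec m'" "snd y \<in> carrier_vec m'" using y by (auto dest: cot_spaceD)
    define pad where "pad v = vec ?k (\<lambda>i. if i < p then 0 else v $ (i - p))" for v :: "complex vec"
    have pad_tl: "vec m' (\<lambda>i. pad v $ (p + i)) = v" if "v \<in> carrier_vec m'" for v
      using that by (intro eq_vecI) (auto simp: pad_def)
    define w where "w = (pad (fst y), pad (snd y))"
    have wC: "w \<in> cot_space ?k" by (simp add: w_def cot_space_def pad_def)
    have wtl: "tail p m' w = y" using pad_tl yC by (simp add: tail_def w_def)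
    have whd: "fst w $ i = 0" "snd w $ i = 0" if "i < p" for i using that by (simp_all add: w_def pad_def)
    obtain w1 u where d: "u \<in> cot_space m" "w1 \<in> cot_space ?k" "w = w1 + Q u" "fixed w1" "\<forall>u'. omega w1 (Q u') = 0"
      using decompose[OF wC] by blast
    have w1hd: "fst w1 $ i = 0" "snd w1 $ i = 0" if "i < p" for i
    proof -
      have "fst w $ i = fst w1 $ i + fst (Q u) $ i" "snd w $ i = snd w1 $ i + snd (Q u) $ i"
        unfolding d(3) using cot_spaceD[OF QC[of u]] that by simp_all
      then show "fst w1 $ i = 0" "snd w1 $ i = 0" using whd[OF that] Q_head[OF that] by simp_all
    qed
    have w1tl: "fst (tail p m' w1) = 0\<^sub>v m'" by (rule fixed_tail[OF d(2,4)])
    \<comment> \<open>The entry is the pairing of \<open>w1\<close> with a unit vector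
      \<open>v\<close> of the module. The \<open>Q\<close> part of \<open>v\<close> is orthogonal to
      \<open>w1\<close>. The fixed part of \<open>v\<close>, like \<open>w1\<close> itself, has no
      module component in its tail, and \<open>w1\<close> has no head, so these two pair to zero as
      well.\<close>
    have snd0: "snd w1 $ (p + i) = 0" if i: "i < m'" for i
    proof -
      define v :: "complex vec \<times> complex vec" where "v = (unit_vec ?k (p + i), 0\<^sub>v ?k)"
      have vC: "v \<in> cot_space ?k" by (simp add: v_def cot_space_def)
      obtain v1 u' where d': "v1 \<in> cot_space ?k" "v = v1 + Q u'" "fixed v1" using decompose[OF vC] by blast
      have "omega w1 v = omega w1 v1 + omega w1 (Q u')"
        unfolding d'(2) omega_sum[OF d(2) cot_space_add[OF d'(1) QC]] omega_sum[OF d(2) d'(1)] omega_sum[OF d(2) QC]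
          sum.distrib[symmetric]
        using cot_spaceD[OF d'(1)] cot_spaceD[OF QC[of u']] by (intro sum.cong) (simp_all add: algebra_simps)
      also have "omega w1 (Q u') = 0" using d(5) by blast
      also have "omega w1 v1 = 0"
      proof -
        have "omega w1 v1 = omega (tail p m' w1) (tail p m' v1)"
          by (rule tl_omega[OF d(2) d'(1)]) (use w1hd in simp)
        also have "\<dots> = 0"
          unfolding omega_sum[OF tail_cot_space tail_cot_space] using w1tl fixed_tail[OF d'(1,3)] by simp
        finally show ?thesis .
      qed
      finally have "omega w1 v = 0" by simp
      moreover have "omega w1 v = (\<Sum>j<?k. if j = p + i then - snd w1 $ j else 0)"
        unfolding omega_sum[OF d(2) vC] using i by (intro sum.cong) (auto simp: v_def unit_vec_def)
      ultimately show ?thesis using i by simp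
    qed
    have fst0: "fst w1 $ (p + i) = 0" if "i < m'" for i
      using arg_cong[OF w1tl, of "\<lambda>v. v $ i"] that by (simp add: tail_def)
    have w10: "fst w1 $ j = 0 \<and> snd w1 $ j = 0" if "j < ?k" for j
    proof (cases "j < p")
      case False
      then have "j - p < m'" "p + (j - p) = j" using that by auto
      then show ?thesis using fst0[of "j - p"] snd0[of "j - p"] by simp
    qed (use w1hd in simp)
    have "w = Q u"
      unfolding d(3) prod_eq_iff using w10 cot_spaceD[OF d(2)] cot_spaceD[OF QC[of u]] by (intro conjI eq_vecI) auto
    then have "\<Phi> u = y" unfolding \<Phi>_def using wtl by simp
    then show ?thesis using d(1) by blast
  qed
  define \<Psi> where "\<Psi> = inv_into (cot_space m) \<Phi>"
  have inj\<Phi>: "inj_on \<Phi> (cot_space m)" using \<Phi>_inj by (rule inj_onI)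
  have "\<Psi> y \<in> cot_space m \<and> \<Phi> (\<Psi> y) = y" if "y \<in> cot_space m'" for y
  proof -
    have "y \<in> \<Phi> ` cot_space m" using \<Phi>_surj[OF that] by blast
    then show ?thesis unfolding \<Psi>_def using inv_into_into f_inv_into_f by metis
  qed
  moreover have "\<Phi> u \<in> cot_space m'" for u unfolding \<Phi>_def by (rule tail_cot_space)
  ultimately have "sympl_iso H m (drep l a e m) m' \<tau> \<Phi> \<Psi>"
    unfolding sympl_iso_def cot_linear_def
    using \<Phi>_add \<Phi>_smult \<Phi>_omega \<Phi>_act inv_into_f_f[OF inj\<Phi>] by (simp add: \<Psi>_def)
  then show ?thesis by blast
qed

section \<open>From a slice of type O to a set of columns\<close>

lemma isotropy_drep:
  assumes x: "x \<in> cot_space n"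
  shows "cot_isotropy (torus l) (drep l a id n) x = stab l a {j. j < n \<and> (fst x $ j \<noteq> 0 \<or> snd x $ j \<noteq> 0)}"
proof -
  have C: "fst x \<in> carrier_vec n" "snd x \<in> carrier_vec n" by (rule cot_spaceD[OF x])+
  have "cot_act (drep l a id n) h x = x \<longleftrightarrow> (\<forall>j\<in>{j. j < n \<and> (fst x $ j \<noteq> 0 \<or> snd x $ j \<noteq> 0)}. chr l (a j) h = 1)"
    if h: "h \<in> torus l" for h
  proof
    assume eq: "cot_act (drep l a id n) h x = x"
    show "\<forall>j\<in>{j. j < n \<and> (fst x $ j \<noteq> 0 \<or> snd x $ j \<noteq> 0)}. chr l (a j) h = 1"
    proof
      fix j assume j: "j \<in> {j. j < n \<and> (fst x $ j \<noteq> 0 \<or> snd x $ j \<noteq> 0)}"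
      have "fst (cot_act (drep l a id n) h x) $ j = fst x $ j" "snd (cot_act (drep l a id n) h x) $ j = snd x $ j"
        using eq by simp_all
      then have "chr l (a j) h * fst x $ j = fst x $ j" "inverse (chr l (a j) h) * snd x $ j = snd x $ j"
        using j unfolding cot_act_drep'[OF h x] by simp_all
      then show "chr l (a j) h = 1" using j by (auto simp: inverse_eq_1_iff)
    qed
  next
    assume one: "\<forall>j\<in>{j. j < n \<and> (fst x $ j \<noteq> 0 \<or> snd x $ j \<noteq> 0)}. chr l (a j) h = 1"
    have "chr l (a j) h * fst x $ j = fst x $ j \<and> inverse (chr l (a j) h) * snd x $ j = snd x $ j" if "j < n" for j
      using one that by (cases "fst x $ j = 0 \<and> snd x $ j = 0") auto
    then show "cot_act (drep l a id n) h x = x"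
      unfolding cot_act_drep'[OF h x] prod_eq_iff using C by (intro conjI eq_vecI) auto
  qed
  then show ?thesis unfolding cot_isotropy_def stab_def by blast
qed

lemma tangent_space_coordinate_zero:
  assumes x: "x \<in> cot_space n" and u: "u \<in> tangent_space n Y x" and j: "j < n"
  shows "(\<And>y. y \<in> Y \<Longrightarrow> fst y $ j = 0) \<Longrightarrow> fst u $ j = 0" "(\<And>y. y \<in> Y \<Longrightarrow> snd y $ j = 0) \<Longrightarrow> snd u $ j = 0"
proof -
  have uC: "u \<in> cot_space n" using u by (simp add: tangent_space_def)
  have d: "((\<lambda>s. f (x + cot_smult s u)) has_field_derivative 0) (at 0)"
    if "f \<in> cot_poly_funs n" "\<forall>y\<in>Y. f y = 0" for f
    using u that by (simp add: tangent_space_def)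
  have line: "fst (x + cot_smult s u) $ j = fst x $ j + s * fst u $ j" "snd (x + cot_smult s u) $ j = snd x $ j + s * snd u $ j" for s
    using j cot_spaceD[OF x] cot_spaceD[OF uC] by (simp_all add: fst_cot_smult snd_cot_smult)
  have lin: "((\<lambda>s. b + s * c) has_field_derivative c) (at 0)" for b c :: complex
    by (auto intro!: derivative_eq_intros)
  show "fst u $ j = 0" if "\<And>y. y \<in> Y \<Longrightarrow> fst y $ j = 0"
  proof -
    have "((\<lambda>s. fst (x + cot_smult s u) $ j) has_field_derivative 0) (at 0)"
      by (rule d[OF cot_coord_poly(1)[OF j]]) (use that in blast)
    then show ?thesis unfolding line using lin[of "fst x $ j" "fst u $ j"] by (rule DERIV_unique[symmetric])
  qed
  show "snd u $ j = 0" if "\<And>y. y \<in> Y \<Longrightarrow> snd y $ j = 0"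
  proof -
    have "((\<lambda>s. snd (x + cot_smult s u) $ j) has_field_derivative 0) (at 0)"
      by (rule d[OF cot_coord_poly(2)[OF j]]) (use that in blast)
    then show ?thesis unfolding line using lin[of "snd x $ j" "snd u $ j"] by (rule DERIV_unique[symmetric])
  qed
qed

text \<open>The nontrivial part of the slice is the diagonal model on the columns outside
  \<open>T\<close>. One column more than the bound requires would raise the quotient dimension to 3,
  so the bound is attained.\<close>

lemma type_O_imp_columns:
  fixes a :: "nat \<Rightarrow> nat \<Rightarrow> int"
  assumes bound: "card_bound l n a" and O: "has_slice_of_type_O l (torus l) n (drep l a id n)"
  shows "\<exists>T D. T \<subseteq> {..<n} \<and> is_basis l a T D \<and> card D < l \<and> card T + (l - card D) + 1 = n"
proof -
  let ?\<rho> = "drep l a id n"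
  obtain x where x: "x \<in> shell l (torus l) n ?\<rho>" "slice_type_O l (torus l) n ?\<rho> x"
    using O unfolding has_slice_of_type_O_def by blast
  have xC: "x \<in> cot_space n" using x(1) by (simp add: shell_def)
  define H where "H = cot_isotropy (torus l) ?\<rho> x"
  define E where "E = tangent_space n (cot_orbit (torus l) ?\<rho> x) x"
  define S where "S = {j. j < n \<and> (fst x $ j \<noteq> 0 \<or> snd x $ j \<noteq> 0)}"
  have HS: "H = stab l a S" unfolding H_def S_def by (rule isotropy_drep[OF xC])
  \<comment> \<open>Triviality on \<open>H\<close> replaces membership in the rational span of the
    support: \<open>H\<close> may be disconnected and act on a column of that span by a nontrivial
    character of finite order. The bound applies to \<open>T\<close> whether or not it contains all
    columns of its span.\<close>
  define T where "T = {j. j < n \<and> (\<forall>h\<in>H. chr l (a j) h = 1)}"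
  have Tn: "T \<subseteq> {..<n}" by (auto simp: T_def)
  have ST: "S \<subseteq> T" unfolding T_def HS using stabD(2) by (auto simp: S_def)
  have HT: "H = stab l a T"
  proof
    show "H \<subseteq> stab l a T" unfolding stab_def T_def using HS stabD(1) by auto
    show "stab l a T \<subseteq> H" unfolding HS stab_def using ST by auto
  qed
  from x(2) have dimH: "group_dim l H > 0" and
    ex: "\<exists>k \<sigma> p m \<tau>. is_module l H k \<sigma> \<and> slice_iso H n ?\<rho> E k \<sigma> \<and>
         splits_off_invariants l H k \<sigma> p m \<tau> \<and> krull_dim (shell_quotient_ring l H m \<tau>) = 2"
    unfolding slice_type_O_def Let_def H_def[symmetric] E_def[symmetric] by blast+
  from ex obtain k \<sigma> p m' \<tau> where mod\<sigma>: "is_module l H k \<sigma>" and slice: "slice_iso H n ?\<rho> E k \<sigma>"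
    and split: "splits_off_invariants l H k \<sigma> p m' \<tau>" and dim2: "krull_dim (shell_quotient_ring l H m' \<tau>) = 2"
    by (elim exE conjE)
  from split have k: "k = p + m'" and mod: "is_module l H m' \<tau>" and iso: "module_iso H k \<sigma> (add_trivial p m' \<tau>)"
    and inv: "invariant_vecs H m' \<tau> = {0\<^sub>v m'}" unfolding splits_off_invariants_def by blast+
  have Hinv: "tinv h \<in> H" if "h \<in> H" for h using that unfolding HT by (rule stab_tinv)
  obtain P where P: "P \<in> carrier_mat k k" "invertible_mat P" "\<forall>h\<in>H. \<sigma> h * P = P * add_trivial p m' \<tau> h"
    using iso unfolding module_iso_def by blast
  obtain Q where Q: "Q \<in> carrier_mat k k" "P * Q = 1\<^sub>m k" "Q * P = 1\<^sub>m k" using invertible_mat_inverse[OF P(1,2)] .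
  have "is_module l H k (add_trivial p m' \<tau>)" unfolding k by (rule add_trivial_is_module[OF mod])
  from conjugate_sympl_iso[OF P(1) Q mod\<sigma> this Hinv P(3)[rule_format]]
  have slice': "slice_iso H n ?\<rho> E (p + m') (add_trivial p m' \<tau>)"
    using slice_iso_compose[OF slice] unfolding k by blast
  obtain D where D: "is_basis l a T D" using basis_exists[of T l a] Tn finite_subset by blast
  have lt: "card D < l" using dimH group_dim_stab[OF D] unfolding HT by simp
  have "finite ({..<n} - T)" by simp
  then obtain e where "bij_betw e {0..<card ({..<n} - T)} ({..<n} - T)" using ex_bij_betw_nat_finite by blast
  then have e: "bij_betw e {..<card ({..<n} - T)} ({..<n} - T)" by (simp only: atLeast0LessThan)
  define m where "m = card ({..<n} - T)"
  note e = e[folded m_def]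
  have E0: "fst u $ j = 0 \<and> snd u $ j = 0" if u: "u \<in> E" and j: "j < n" "j \<notin> T" for u j
  proof -
    have "fst x $ j = 0" "snd x $ j = 0" using j ST by (auto simp: S_def)
    then have "fst y $ j = 0 \<and> snd y $ j = 0" if "y \<in> cot_orbit (torus l) ?\<rho> x" for y
      using that j(1) unfolding cot_orbit_def by (auto simp: cot_act_drep'[OF _ xC])
    then show ?thesis using tangent_space_coordinate_zero[OF xC u[unfolded E_def] j(1)] by blast
  qed
  have nontriv: "\<exists>h\<in>H. chr l (a j) h \<noteq> 1" if "j < n" "j \<notin> T" for j using that by (simp add: T_def)
  obtain \<Phi> \<Psi> where "sympl_iso H m (drep l a e m) m' \<tau> \<Phi> \<Psi>"
    using slice_nontrivial_part[OF slice' HT mod inv Tn nontriv e E0] by blast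
  from sympl_iso_quotient_dim[OF this _ mod Hinv]
  have le2: "krull_dim (shell_quotient_ring l H m (drep l a e m)) \<le> 2"
    using dim2 drep_stab_module unfolding HT by simp
  have ge: "m = n - card T" "m \<ge> l - card D + 1" by (rule card_complement[OF bound Tn D lt e])+
  have "\<not> m \<ge> l - card D + 2"
  proof
    assume "m \<ge> l - card D + 2"
    from model_dim_ge_3[OF bound Tn D lt e this] le2 have "(3::ereal) \<le> 2" unfolding HT by (rule order_trans)
    then show False by simp
  qed
  then have "card T + (l - card D) + 1 = n" using ge by linarith
  then show ?thesis using Tn D lt by blast
qed

section \<open>Closed orbits\<close>

text \<open>A homomorphism from a subgroup of \<open>\<int>\<^sup>l\<close> to the divisible group of nonzero complex numbers
  extends to one more generator.\<close>

definition compatible :: "nat \<Rightarrow> ('j \<Rightarrow> nat \<Rightarrow> int) \<Rightarrow> 'j set \<Rightarrow> ('j \<Rightarrow> complex) \<Rightarrow> bool" where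
  "compatible l g K w \<longleftrightarrow> (\<forall>j\<in>K. w j \<noteq> 0) \<and>
     (\<forall>b :: 'j \<Rightarrow> int. (\<forall>i<l. (\<Sum>j\<in>K. b j * g j i) = 0) \<longrightarrow> (\<Prod>j\<in>K. w j powi b j) = 1)"

lemma complex_root_exists:
  assumes "y \<noteq> (0::complex)" "0 < (q::int)"
  shows "\<exists>z. z \<noteq> 0 \<and> z powi q = y"
proof (intro exI conjI)
  have "exp (Ln y / of_int q) powi q = exp (of_int q * (Ln y / of_int q))" by (rule exp_power_int)
  then show "exp (Ln y / of_int q) powi q = y" using assms by simp
qed simp

lemma compatible_extend:
  assumes K: "finite K" "k \<notin> K" and w: "compatible l g K w"
  shows "\<exists>z. compatible l g (insert k K) (w(k := z))"
proof -
  define rel where "rel q b \<longleftrightarrow> (\<forall>i<l. q * g k i + (\<Sum>j\<in>K. b j * g j i) = 0)" for q :: int and b :: "'a \<Rightarrow> int"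
  have wnz: "w j \<noteq> 0" if "j \<in> K" for j using w that by (simp add: compatible_def)
  have rel0: "(\<Prod>j\<in>K. w j powi b j) = 1" if "rel 0 b" for b
    using w that by (simp add: compatible_def rel_def)
  have comb: "rel (q - c * q') (\<lambda>j. b j - c * b' j)" if "rel q b" "rel q' b'" for q q' b b' c
    unfolding rel_def
  proof (intro allI impI)
    fix i assume i: "i < l"
    have "(q - c * q') * g k i + (\<Sum>j\<in>K. (b j - c * b' j) * g j i) =
        (q * g k i + (\<Sum>j\<in>K. b j * g j i)) - c * (q' * g k i + (\<Sum>j\<in>K. b' j * g j i))"
      by (simp add: left_diff_distrib sum_subtractf sum_distrib_left distrib_left mult.assoc)
    also have "\<dots> = 0" using that i by (simp add: rel_def)
    finally show "(q - c * q') * g k i + (\<Sum>j\<in>K. (b j - c * b' j) * g j i) = 0" .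
  qed
  have goal: "compatible l g (insert k K) (w(k := z))"
    if z: "z \<noteq> 0" and rel1: "\<And>q b. rel q b \<Longrightarrow> z powi q * (\<Prod>j\<in>K. w j powi b j) = 1" for z
    unfolding compatible_def
  proof (intro conjI allI impI ballI)
    show "(w(k := z)) j \<noteq> 0" if "j \<in> insert k K" for j using that z wnz by auto
    fix b :: "'a \<Rightarrow> int" assume "\<forall>i<l. (\<Sum>j\<in>insert k K. b j * g j i) = 0"
    then have "rel (b k) b" using K by (simp add: rel_def)
    then have "z powi b k * (\<Prod>j\<in>K. w j powi b j) = 1" by (rule rel1)
    moreover have "(\<Prod>j\<in>K. (w(k := z)) j powi b j) = (\<Prod>j\<in>K. w j powi b j)"
      using K(2) by (intro prod.cong) auto
    ultimately show "(\<Prod>j\<in>insert k K. (w(k := z)) j powi b j) = 1" using K by simp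
  qed
  \<comment> \<open>The positive multipliers that bring \<open>g k\<close> into the group generated
    by \<open>K\<close>. All are multiples of the least one, so a single root determines an
    admissible \<open>z\<close>; if there are none, any nonzero value is admissible.\<close>
  define Z where "Z = {q. 0 < q \<and> (\<exists>b. rel (int q) b)}"
  show ?thesis
  proof (cases "Z = {}")
    case True
    have "compatible l g (insert k K) (w(k := 1))"
    proof (rule goal)
      fix q b assume r: "rel q b"
      have "q = 0"
      proof (rule ccontr)
        assume "q \<noteq> 0"
        have "rel 0 (\<lambda>_. 0)" by (simp add: rel_def)
        from comb[OF this r, of 1] have neg: "rel (- q) (\<lambda>j. 0 - 1 * b j)" by simp
        have "\<exists>b. rel \<bar>q\<bar> b"
        proof (cases "q > 0")
          case True
          then have "\<bar>q\<bar> = q" by simp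
          then show ?thesis using r exI[of "rel q" b] by simp
        next
          case False
          then have "\<bar>q\<bar> = - q" by simp
          then show ?thesis using neg exI[of "rel (- q)" "\<lambda>j. 0 - 1 * b j"] by simp
        qed
        then have "nat \<bar>q\<bar> \<in> Z" unfolding Z_def using \<open>q \<noteq> 0\<close> by simp
        then show False using True by blast
      qed
      then show "1 powi q * (\<Prod>j\<in>K. w j powi b j) = 1" using rel0 r by simp
    qed simp
    then show ?thesis by blast
  next
    case False
    define q0 where "q0 = (LEAST q. q \<in> Z)"
    obtain q' where "q' \<in> Z" using False by auto
    then have "q0 \<in> Z" unfolding q0_def by (rule LeastI)
    then have "0 < q0 \<and> (\<exists>b. rel (int q0) b)" by (simp add: Z_def)
    then obtain b0 where q0: "0 < q0" and b0: "rel (int q0) b0" by (elim conjE exE)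
    define y where "y = inverse (\<Prod>j\<in>K. w j powi b0 j)"
    have pnz: "(\<Prod>j\<in>K. w j powi b0 j) \<noteq> 0" using K(1) wnz by (simp add: power_int_eq_0_iff)
    obtain z where z: "z \<noteq> 0" "z powi int q0 = y"
      using complex_root_exists[of y "int q0"] pnz q0 by (auto simp: y_def)
    have "compatible l g (insert k K) (w(k := z))"
    proof (rule goal[OF z(1)])
      fix q b assume r: "rel q b"
      define c where "c = q div int q0"
      have "rel (q - c * int q0) (\<lambda>j. b j - c * b0 j)" by (rule comb[OF r b0])
      moreover have "q - c * int q0 = q mod int q0" unfolding c_def by (simp add: minus_div_mult_eq_mod)
      ultimately have rm: "rel (q mod int q0) (\<lambda>j. b j - c * b0 j)" by simp
      have m0: "q mod int q0 = 0"
      proof (rule ccontr)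
        assume nz: "q mod int q0 \<noteq> 0"
        have pos: "0 \<le> q mod int q0" "q mod int q0 < int q0" using q0 by simp_all
        then have "int (nat (q mod int q0)) = q mod int q0" by simp
        then have "rel (int (nat (q mod int q0))) (\<lambda>j. b j - c * b0 j)" using rm by simp
        then have "\<exists>b. rel (int (nat (q mod int q0))) b" by (rule exI[of "rel (int (nat (q mod int q0)))"])
        then have "nat (q mod int q0) \<in> Z" unfolding Z_def using nz pos by simp
        then have "q0 \<le> nat (q mod int q0)" unfolding q0_def by (rule Least_le)
        then show False using pos by linarith
      qed
      then have qc: "q = int q0 * c" by (auto simp: c_def)
      have "(\<Prod>j\<in>K. w j powi (b j - c * b0 j)) = 1" using rel0 rm m0 by simp
      moreover have "(\<Prod>j\<in>K. w j powi b j) = (\<Prod>j\<in>K. w j powi (b j - c * b0 j)) * (\<Prod>j\<in>K. w j powi b0 j) powi c"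
      proof -
        have pp: "(\<Prod>j\<in>K. w j powi b0 j) powi c = (\<Prod>j\<in>K. w j powi (b0 j * c))"
          using K(1) by (induction K rule: finite_induct) (auto simp: power_int_mult_distrib power_int_mult)
        have "w j powi b j = w j powi (b j - c * b0 j) * w j powi (b0 j * c)" if "j \<in> K" for j
          using power_int_add[of "w j" "b j - c * b0 j" "b0 j * c"] wnz[OF that] by (simp add: mult.commute)
        then show ?thesis unfolding pp prod.distrib[symmetric] by (intro prod.cong) auto
      qed
      moreover have "z powi q = inverse ((\<Prod>j\<in>K. w j powi b0 j) powi c)"
        unfolding qc power_int_mult z(2) y_def by (simp add: power_int_inverse)
      ultimately show "z powi q * (\<Prod>j\<in>K. w j powi b j) = 1" using pnz by (simp add: power_int_eq_0_iff)
    qed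
    then show ?thesis by blast
  qed
qed

text \<open>Extending the homomorphism to all unit vectors yields the coordinates of
  \<open>t\<close>. Hence integer relations alone decide which values the characters in
  \<open>J\<close> attain simultaneously, and this is what describes orbits by equations.\<close>

lemma torus_point_exists:
  fixes a :: "nat \<Rightarrow> nat \<Rightarrow> int"
  assumes J: "finite J" and v: "compatible l a J v"
  shows "\<exists>t\<in>torus l. \<forall>j\<in>J. chr l (a j) t = v j"
proof -
  let ?K = "\<lambda>i. Inl ` J \<union> Inr ` {..<i} :: (nat + nat) set"
  have vc: "(\<Prod>j\<in>J. v j powi b j) = 1" if "\<forall>i<l. (\<Sum>j\<in>J. b j * a j i) = 0" for b :: "nat \<Rightarrow> int"
    using v that by (simp add: compatible_def)
  have "\<exists>w. (\<forall>j. w (Inl j) = v j) \<and> compatible l (ext_cols a) (?K i) w" for i :: nat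
  proof (induction i)
    case 0
    have s: "(\<Sum>x\<in>Inl ` J. f x) = (\<Sum>j\<in>J. f (Inl j))" "(\<Prod>x\<in>Inl ` J. h x) = (\<Prod>j\<in>J. h (Inl j))"
      for f :: "nat + nat \<Rightarrow> int" and h :: "nat + nat \<Rightarrow> complex"
      by (simp_all add: sum.reindex prod.reindex)
    have "compatible l (ext_cols a) (?K 0) (case_sum v (\<lambda>_. 1))"
      unfolding compatible_def
    proof (intro conjI allI impI ballI)
      fix b :: "nat + nat \<Rightarrow> int" assume "\<forall>i<l. (\<Sum>j\<in>?K 0. b j * ext_cols a j i) = 0"
      then have "\<forall>i<l. (\<Sum>j\<in>J. b (Inl j) * a j i) = 0" by (simp add: s)
      then have "(\<Prod>j\<in>J. v j powi b (Inl j)) = 1" by (rule vc)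
      then show "(\<Prod>j\<in>?K 0. case_sum v (\<lambda>_. 1) j powi b j) = 1" by (simp add: s)
    qed (use v in \<open>auto simp: compatible_def\<close>)
    then show ?case by (intro exI[of _ "case_sum v (\<lambda>_. 1)"]) simp
  next
    case (Suc i)
    then obtain w where w: "\<forall>j. w (Inl j) = v j" "compatible l (ext_cols a) (?K i) w" by blast
    have "finite (?K i)" "Inr i \<notin> ?K i" using J by auto
    from compatible_extend[OF this w(2)]
    obtain z where z: "compatible l (ext_cols a) (insert (Inr i) (?K i)) (w(Inr i := z))" by (elim exE)
    have eq: "insert (Inr i) (?K i) = ?K (Suc i)" by (auto simp: less_Suc_eq)
    show ?case
    proof (rule exI[of _ "w(Inr i := z)"], rule conjI)
      show "\<forall>j. (w(Inr i := z)) (Inl j) = v j" using w(1) by simp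
      show "compatible l (ext_cols a) (?K (Suc i)) (w(Inr i := z))" using z unfolding eq .
    qed
  qed
  then obtain w where w: "\<forall>j. w (Inl j) = v j" "compatible l (ext_cols a) (?K l) w" by blast
  define t where "t = vec l (\<lambda>i. w (Inr i))"
  have t: "t \<in> torus l" using w(2) by (simp add: torus_def t_def compatible_def)
  have "chr l (a j) t = v j" if j: "j \<in> J" for j
  proof -
    \<comment> \<open>The integer relation that expresses the column \<open>j\<close> through the
      unit vectors.\<close>
    define b where "b x = (case x of Inl j' \<Rightarrow> if j' = j then 1 else 0 | Inr i \<Rightarrow> - a j i)" for x :: "nat + nat"
    have s: "(\<Sum>x\<in>?K l. f x) = (\<Sum>j\<in>J. f (Inl j)) + (\<Sum>i<l. f (Inr i))" for f :: "nat + nat \<Rightarrow> int"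
      using J by (subst sum.union_disjoint) (auto simp: sum.reindex)
    have p: "(\<Prod>x\<in>?K l. f x) = (\<Prod>j\<in>J. f (Inl j)) * (\<Prod>i<l. f (Inr i))" for f :: "nat + nat \<Rightarrow> complex"
      using J by (subst prod.union_disjoint) (auto simp: prod.reindex)
    have "(\<Sum>x\<in>?K l. b x * ext_cols a x i) = 0" if i: "i < l" for i
    proof -
      have "(\<Sum>j'\<in>J. b (Inl j') * a j' i) = (\<Sum>j'\<in>J. if j' = j then a j' i else 0)"
        by (intro sum.cong) (simp_all add: b_def)
      moreover have "(\<Sum>i'<l. b (Inr i') * (if i' = i then 1 else 0)) = (\<Sum>i'<l. if i' = i then - a j i' else 0)"
        by (intro sum.cong) (simp_all add: b_def)
      ultimately show ?thesis unfolding s using i j J by simp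
    qed
    then have "(\<Prod>x\<in>?K l. w x powi b x) = 1" using w(2) by (simp only: compatible_def) simp
    moreover have "(\<Prod>j'\<in>J. w (Inl j') powi b (Inl j')) = (\<Prod>j'\<in>J. if j' = j then v j' else 1)"
      using w(1) by (intro prod.cong) (simp_all add: b_def)
    moreover have "(\<Prod>i<l. w (Inr i) powi b (Inr i)) = inverse (chr l (a j) t)"
      unfolding chr_def prod_inversef[symmetric] by (intro prod.cong) (simp_all add: b_def t_def power_int_minus)
    ultimately have "v j * inverse (chr l (a j) t) = 1" unfolding p using j J by simp
    then show ?thesis using chr_nonzero[OF t, of "a j"] by (simp add: field_simps)
  qed
  then show ?thesis using t by blast
qed

text \<open>Removing a coloop lowers the rank by one and thus preserves the equality.\<close>

lemma coloop_free_subset: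
  fixes a :: "nat \<Rightarrow> nat \<Rightarrow> int"
  assumes "finite J" "is_basis l a J D" "card D < l" "card J + (l - card D) + 1 = n"
  shows "\<exists>J' D'. J' \<subseteq> J \<and> is_basis l a J' D' \<and> card D' < l \<and> card J' + (l - card D') + 1 = n \<and>
    (\<forall>j\<in>J'. in_span l a (J' - {j}) (a j))"
  using assms
proof (induction J arbitrary: D rule: finite_psubset_induct)
  case (psubset J)
  show ?case
  proof (cases "\<forall>j\<in>J. in_span l a (J - {j}) (a j)")
    case True
    then show ?thesis using psubset.prems by blast
  next
    case False
    then obtain j where j: "j \<in> J" "\<not> in_span l a (J - {j}) (a j)" by blast
    obtain D' where D': "is_basis l a (J - {j}) D'" using basis_exists[of "J - {j}" l a] psubset.hyps by auto
    have finD': "finite D'" and D'J: "D' \<subseteq> J - {j}" using basis_finite[OF D'] is_basisD(2)[OF D'] .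
    have "\<not> in_span l a D' (a j)" using in_span_mono[of l a D' "a j" "J - {j}"] j(2) D'J psubset.hyps by auto
    then have ind: "indep l a (insert j D')" using indep_insert[OF is_basisD(3)[OF D'] finD'] D'J by blast
    have "is_basis l a J (insert j D')"
      unfolding is_basis_def
    proof (intro conjI ballI ind psubset.hyps)
      show "insert j D' \<subseteq> J" using D'J j(1) by blast
      fix i assume i: "i \<in> J"
      show "in_span l a (insert j D') (a i)"
      proof (cases "i = j")
        case True
        then show ?thesis using finD' by (intro in_span_member) simp_all
      next
        case False
        then have "in_span l a D' (a i)" using is_basisD(4)[OF D'] i by simp
        then show ?thesis by (rule in_span_mono) (use finD' in auto)
      qed
    qed
    from basis_card_unique[OF psubset.prems(1) this] have "card D = card (insert j D')" .
    moreover have "j \<notin> D'" using D'J by blast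
    ultimately have cD: "card D = Suc (card D')" using finD' by simp
    have cJ: "card J = Suc (card (J - {j}))" using card.remove[OF psubset.hyps j(1)] by simp
    have "\<exists>J' D''. J' \<subseteq> J - {j} \<and> is_basis l a J' D'' \<and> card D'' < l \<and> card J' + (l - card D'') + 1 = n \<and>
        (\<forall>j\<in>J'. in_span l a (J' - {j}) (a j))"
      by (rule psubset.IH[OF _ D']) (use j(1) cD cJ psubset.prems in auto)
    then show ?thesis by blast
  qed
qed

text \<open>A vector dual to the column \<open>j\<close> with respect to \<open>insert j D\<close>
  annihilates \<open>J\<close>, and its exponential has character value exp 1 at
  \<open>j\<close>.\<close>

lemma nontrivial_character:
  fixes a :: "nat \<Rightarrow> nat \<Rightarrow> int"
  assumes D: "is_basis l a J D" and j: "\<not> in_span l a D (a j)" "j \<notin> D"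
  shows "\<exists>h\<in>stab l a J. chr l (a j) h \<noteq> 1"
proof -
  have finD: "finite D" by (rule basis_finite[OF D])
  have ind: "indep l a (insert j D)" by (rule indep_insert[OF is_basisD(3)[OF D] finD j(2,1)])
  obtain u :: "nat \<Rightarrow> nat \<Rightarrow> rat" where
    u: "\<forall>d\<in>insert j D. \<forall>d'\<in>insert j D. (\<Sum>i<l. u d i * of_int (a d' i)) = (if d = d' then 1 else 0)"
    using indep_dual_vectors[OF ind] finD by (auto elim!: exE conjE)
  define X where "X = vec l (\<lambda>i. complex_of_rat (u j i))"
  have XC: "X \<in> carrier_vec l" by (simp add: X_def)
  have lamX: "lam l (a d) X = (if j = d then 1 else 0)" if "d \<in> insert j D" for d
  proof -
    have "lam l (a d) X = complex_of_rat (\<Sum>i<l. u j i * of_int (a d i))"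
      unfolding lam_def X_def of_rat_sum by (intro sum.cong) (simp_all add: of_rat_mult mult.commute)
    also have "(\<Sum>i<l. u j i * of_int (a d i)) = (if j = d then 1 else 0)" using u that by blast
    finally show ?thesis by simp
  qed
  have "X \<in> ann l a J" by (rule ann_basis[OF D XC]) (use lamX j(2) in auto)
  then have "texp (1 \<cdot>\<^sub>v X) \<in> stab l a J" by (intro stab_texp ann_smult)
  moreover have "chr l (a j) (texp (1 \<cdot>\<^sub>v X)) \<noteq> 1"
    using chr_texp_smult[OF XC, of "a j" 1] lamX[of j] exp_one_neq_one by simp
  ultimately show ?thesis by blast
qed

text \<open>The derivative depends only on the position \<open>x\<close> and the velocity
  \<open>u\<close>. The value \<open>d\<close> is chosen before the curve, so that two curves can be
  compared.\<close>

lemma cot_poly_curve_derivative: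
  assumes "f \<in> cot_poly_funs n"
  shows "\<exists>d. \<forall>\<gamma> :: complex \<Rightarrow> complex vec \<times> complex vec. \<gamma> 0 = x \<longrightarrow>
    (\<forall>i<n. ((\<lambda>s. fst (\<gamma> s) $ i) has_field_derivative fst u $ i) (at 0)) \<longrightarrow>
    (\<forall>i<n. ((\<lambda>s. snd (\<gamma> s) $ i) has_field_derivative snd u $ i) (at 0)) \<longrightarrow>
    ((\<lambda>s. f (\<gamma> s)) has_field_derivative d) (at 0)"
  using assms unfolding cot_poly_funs_def
proof induction
  case (gen f)
  then consider i where "i < n" "f = (\<lambda>u. fst u $ i)" | i where "i < n" "f = (\<lambda>u. snd u $ i)" by blast
  then show ?case
  proof cases
    case 1
    then show ?thesis by (intro exI[of _ "fst u $ i"]) simp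
  next
    case 2
    then show ?thesis by (intro exI[of _ "snd u $ i"]) simp
  qed
next
  case (const c)
  show ?case by (intro exI[of _ 0]) simp
next
  case (add f g)
  obtain d where d: "\<forall>\<gamma>. \<gamma> 0 = x \<longrightarrow>
    (\<forall>i<n. ((\<lambda>s. fst (\<gamma> s) $ i) has_field_derivative fst u $ i) (at 0)) \<longrightarrow>
    (\<forall>i<n. ((\<lambda>s. snd (\<gamma> s) $ i) has_field_derivative snd u $ i) (at 0)) \<longrightarrow>
    ((\<lambda>s. f (\<gamma> s)) has_field_derivative d) (at 0)" using add.IH(1) by (elim exE)
  obtain d' where d': "\<forall>\<gamma>. \<gamma> 0 = x \<longrightarrow>
    (\<forall>i<n. ((\<lambda>s. fst (\<gamma> s) $ i) has_field_derivative fst u $ i) (at 0)) \<longrightarrow>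
    (\<forall>i<n. ((\<lambda>s. snd (\<gamma> s) $ i) has_field_derivative snd u $ i) (at 0)) \<longrightarrow>
    ((\<lambda>s. g (\<gamma> s)) has_field_derivative d') (at 0)" using add.IH(2) by (elim exE)
  show ?case
  proof (intro exI[of _ "d + d'"] allI impI)
    fix \<gamma> :: "complex \<Rightarrow> complex vec \<times> complex vec"
    assume \<gamma>: "\<gamma> 0 = x" "\<forall>i<n. ((\<lambda>s. fst (\<gamma> s) $ i) has_field_derivative fst u $ i) (at 0)"
      "\<forall>i<n. ((\<lambda>s. snd (\<gamma> s) $ i) has_field_derivative snd u $ i) (at 0)"
    show "((\<lambda>s. f (\<gamma> s) + g (\<gamma> s)) has_field_derivative d + d') (at 0)"
      by (rule DERIV_add[OF d[THEN spec, THEN mp, THEN mp, THEN mp, OF \<gamma>] d'[THEN spec, THEN mp, THEN mp, THEN mp, OF \<gamma>]])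
  qed
next
  case (mult f g)
  obtain d where d: "\<forall>\<gamma>. \<gamma> 0 = x \<longrightarrow>
    (\<forall>i<n. ((\<lambda>s. fst (\<gamma> s) $ i) has_field_derivative fst u $ i) (at 0)) \<longrightarrow>
    (\<forall>i<n. ((\<lambda>s. snd (\<gamma> s) $ i) has_field_derivative snd u $ i) (at 0)) \<longrightarrow>
    ((\<lambda>s. f (\<gamma> s)) has_field_derivative d) (at 0)" using mult.IH(1) by (elim exE)
  obtain d' where d': "\<forall>\<gamma>. \<gamma> 0 = x \<longrightarrow>
    (\<forall>i<n. ((\<lambda>s. fst (\<gamma> s) $ i) has_field_derivative fst u $ i) (at 0)) \<longrightarrow>
    (\<forall>i<n. ((\<lambda>s. snd (\<gamma> s) $ i) has_field_derivative snd u $ i) (at 0)) \<longrightarrow>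
    ((\<lambda>s. g (\<gamma> s)) has_field_derivative d') (at 0)" using mult.IH(2) by (elim exE)
  show ?case
  proof (intro exI[of _ "d * g x + d' * f x"] allI impI)
    fix \<gamma> :: "complex \<Rightarrow> complex vec \<times> complex vec"
    assume \<gamma>: "\<gamma> 0 = x" "\<forall>i<n. ((\<lambda>s. fst (\<gamma> s) $ i) has_field_derivative fst u $ i) (at 0)"
      "\<forall>i<n. ((\<lambda>s. snd (\<gamma> s) $ i) has_field_derivative snd u $ i) (at 0)"
    show "((\<lambda>s. f (\<gamma> s) * g (\<gamma> s)) has_field_derivative d * g x + d' * f x) (at 0)"
      using DERIV_mult[OF d[THEN spec, THEN mp, THEN mp, THEN mp, OF \<gamma>] d'[THEN spec, THEN mp, THEN mp, THEN mp, OF \<gamma>]] \<gamma>(1) by simp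
  qed
qed

text \<open>A curve inside \<open>Y\<close> and the straight line in direction \<open>u\<close>
  agree to first order, and functions vanishing on \<open>Y\<close> are constant along the
  former.\<close>

lemma tangent_space_curve:
  assumes x: "x \<in> cot_space n" and u: "u \<in> cot_space n"
    and \<gamma>: "\<gamma> 0 = x" "\<And>s. \<gamma> s \<in> Y"
      "\<And>i. i < n \<Longrightarrow> ((\<lambda>s. fst (\<gamma> s) $ i) has_field_derivative fst u $ i) (at 0)"
      "\<And>i. i < n \<Longrightarrow> ((\<lambda>s. snd (\<gamma> s) $ i) has_field_derivative snd u $ i) (at 0)"
  shows "u \<in> tangent_space n Y x"
proof -
  have "((\<lambda>s. f (x + cot_smult s u)) has_field_derivative 0) (at 0)"
    if f: "f \<in> cot_poly_funs n" "\<forall>y\<in>Y. f y = 0" for f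
  proof -
    from cot_poly_curve_derivative[OF f(1), of x u] obtain d where
      d: "\<forall>\<gamma> :: complex \<Rightarrow> complex vec \<times> complex vec. \<gamma> 0 = x \<longrightarrow>
        (\<forall>i<n. ((\<lambda>s. fst (\<gamma> s) $ i) has_field_derivative fst u $ i) (at 0)) \<longrightarrow>
        (\<forall>i<n. ((\<lambda>s. snd (\<gamma> s) $ i) has_field_derivative snd u $ i) (at 0)) \<longrightarrow>
        ((\<lambda>s. f (\<gamma> s)) has_field_derivative d) (at 0)" by (elim exE)
    have "((\<lambda>s. f (\<gamma> s)) has_field_derivative d) (at 0)"
      by (rule d[THEN spec, THEN mp, THEN mp, THEN mp]) (use \<gamma> in blast)+
    moreover have "(\<lambda>s. f (\<gamma> s)) = (\<lambda>s. 0)" using f(2) \<gamma>(2) by blast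
    ultimately have d0: "d = 0" using DERIV_unique[OF _ DERIV_const] by metis
    have line: "fst (x + cot_smult s u) $ i = fst x $ i + s * fst u $ i" "snd (x + cot_smult s u) $ i = snd x $ i + s * snd u $ i"
      if "i < n" for s i
      using that cot_spaceD[OF x] cot_spaceD[OF u] by (simp_all add: fst_cot_smult snd_cot_smult)
    have lin: "((\<lambda>s. b + s * c) has_field_derivative c) (at 0)" for b c :: complex
      by (auto intro!: derivative_eq_intros)
    have "((\<lambda>s. f (x + cot_smult s u)) has_field_derivative d) (at 0)"
    proof (rule d[THEN spec, THEN mp, THEN mp, THEN mp])
      show "x + cot_smult 0 u = x"
        using cot_spaceD[OF x] cot_spaceD[OF u] unfolding prod_eq_iff by (intro conjI eq_vecI) (auto simp: cot_smult_def)
      show "\<forall>i<n. ((\<lambda>s. fst (x + cot_smult s u) $ i) has_field_derivative fst u $ i) (at 0)"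
        by (intro allI impI) (simp only: line lin)
      show "\<forall>i<n. ((\<lambda>s. snd (x + cot_smult s u) $ i) has_field_derivative snd u $ i) (at 0)"
        by (intro allI impI) (simp only: line lin)
    qed
    then show ?thesis using d0 by simp
  qed
  then show ?thesis using u by (simp add: tangent_space_def)
qed

lemma power_nat_diff: "x \<noteq> 0 \<Longrightarrow> (x::complex) ^ nat b = x powi b * x ^ nat (- b)"
  by (cases "b \<ge> 0") (simp_all add: power_int_def field_simps flip: power_inverse)

text \<open>A coloop-free set J of columns supports a point with closed orbit in the shell, namely
  \<open>v\<^sub>j = 1\<close>, \<open>\<xi>\<^sub>j = c\<^sub>j\<close> for a relation c with full support; the substitution
  \<open>\<eta> = \<xi> + c v\<close> identifies its slice representation with
  \<open>T\<^sup>*(\<complex>\<^sup>J / E) \<oplus> W\<^sub>0 \<oplus> W\<^sub>0\<^sup>*\<close>.\<close>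

lemma columns_imp_type_O:
  fixes a :: "nat \<Rightarrow> nat \<Rightarrow> int"
  assumes bound: "card_bound l n a" and J: "J \<subseteq> {..<n}" and D: "is_basis l a J D" and lt: "card D < l"
    and card: "card J + (l - card D) + 1 = n" and free: "\<And>j. j \<in> J \<Longrightarrow> in_span l a (J - {j}) (a j)"
  shows "has_slice_of_type_O l (torus l) n (drep l a id n)"
proof -
  let ?\<rho> = "drep l a id n" and ?H = "stab l a J"
  have finJ: "finite J" using J finite_subset by blast
  have finD: "finite D" and DJ: "D \<subseteq> J" using basis_finite[OF D] is_basisD(2)[OF D] .
  have jn: "j < n" if "j \<in> J" for j using that J by auto
  obtain c0 :: "nat \<Rightarrow> rat" where c0: "\<forall>j\<in>J. c0 j \<noteq> 0" "\<forall>i<l. (\<Sum>j\<in>J. c0 j * of_int (a j i)) = 0"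
    using full_support_relation[OF finJ free] by blast
  define c where "c j = (if j \<in> J then complex_of_rat (c0 j) else 0)" for j
  have cJ: "c j \<noteq> 0" if "j \<in> J" for j using that c0(1) by (simp add: c_def)
  have crel: "(\<Sum>j\<in>J. c j * of_int (a j i)) = 0" if "i < l" for i
    using of_rat_kernel[where J = J and c = c0 and a = "\<lambda>j. a j i"] c0(2) that by (simp add: c_def)
  have clam: "(\<Sum>j\<in>J. c j * lam l (a j) X) = 0" for X
  proof -
    have "(\<Sum>j\<in>J. c j * lam l (a j) X) = (\<Sum>i<l. X $ i * (\<Sum>j\<in>J. c j * of_int (a j i)))"
      unfolding lam_def sum_distrib_left by (subst sum.swap) (simp add: mult_ac)
    then show ?thesis using crel by simp
  qed
  \<comment> \<open>With v_j = 1 on \<open>J\<close> the products are exactly the coefficients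
    \<open>c\<close>, so the moment equations at \<open>x\<close> say that \<open>c\<close> is a
    relation among the columns.\<close>
  define x :: "complex vec \<times> complex vec" where "x = (vec n (\<lambda>j. if j \<in> J then 1 else 0), vec n c)"
  have xC: "x \<in> cot_space n" by (simp add: x_def cot_space_def)
  have xi: "fst x $ j = (if j \<in> J then 1 else 0)" "snd x $ j = c j" if "j < n" for j using that by (simp_all add: x_def)
  have supp: "{j. j < n \<and> (fst x $ j \<noteq> 0 \<or> snd x $ j \<noteq> 0)} = J"
    using J xi by (auto simp: c_def split: if_splits)
  have H: "cot_isotropy (torus l) ?\<rho> x = ?H" using isotropy_drep[OF xC, of l a] supp by simp
  have act: "cot_act ?\<rho> t x = (vec n (\<lambda>j. if j \<in> J then chr l (a j) t else 0), vec n (\<lambda>j. inverse (chr l (a j) t) * c j))"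
    if "t \<in> torus l" for t
    unfolding cot_act_drep'[OF that xC] prod_eq_iff by (intro conjI eq_vecI) (auto simp: xi)
  have xshell: "x \<in> shell l (torus l) n ?\<rho>"
  proof -
    have "(\<Sum>j<n. lam l (a (id j)) X * (fst x $ j * snd x $ j)) = (\<Sum>j\<in>J. c j * lam l (a j) X)" for X
      using J by (intro sum.mono_neutral_cong_right) (auto simp: xi)
    then have "x \<in> shell l (stab l a {}) n ?\<rho>" unfolding shell_drep relations_def using xC clam by simp
    then show ?thesis by (simp only: stab_empty)
  qed
  define Orb where "Orb = cot_orbit (torus l) ?\<rho> x"
  have OrbI: "cot_act ?\<rho> t x \<in> Orb" if "t \<in> torus l" for t unfolding Orb_def cot_orbit_def by (rule imageI[OF that])
  have OrbE: "\<exists>t\<in>torus l. y = cot_act ?\<rho> t x" if "y \<in> Orb" for y using that unfolding Orb_def cot_orbit_def by blast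
  have OrbC: "y \<in> cot_space n" if "y \<in> Orb" for y
    using OrbE[OF that] act by (auto simp: cot_space_def)
  have van1: "fst y $ j = 0 \<and> snd y $ j = 0" if "y \<in> Orb" "j < n" "j \<notin> J" for y j
    using OrbE[OF that(1)] act that(2,3) by (auto simp: c_def)
  have van2: "fst y $ j * snd y $ j - c j = 0" if "y \<in> Orb" "j \<in> J" for y j
  proof -
    from OrbE[OF that(1)] obtain t where t: "t \<in> torus l" "y = cot_act ?\<rho> t x" by blast
    show ?thesis unfolding t(2) act[OF t(1)] using jn[OF that(2)] that(2) chr_nonzero[OF t(1)] by simp
  qed
  \<comment> \<open>The character belonging to an integer relation \<open>b\<close> is trivial, and
    on the orbit its value is the corresponding Laurent monomial in v. Sorting positive and negative
    exponents turns this into a binomial equation.\<close>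
  have van3: "(\<Prod>j\<in>J. fst y $ j ^ nat (b j)) - (\<Prod>j\<in>J. fst y $ j ^ nat (- b j)) = 0"
    if y: "y \<in> Orb" and b: "\<forall>i<l. (\<Sum>j\<in>J. b j * a j i) = 0" for y b
  proof -
    obtain t where t: "t \<in> torus l" "y = cot_act ?\<rho> t x" using OrbE[OF y] by blast
    have yj: "fst y $ j = chr l (a j) t" if "j \<in> J" for j unfolding t(2) act[OF t(1)] using jn[OF that] that by simp
    have "(\<Prod>j\<in>J. fst y $ j ^ nat (b j)) = (\<Prod>j\<in>J. chr l (a j) t powi b j * fst y $ j ^ nat (- b j))"
      by (intro prod.cong refl) (subst yj, assumption, subst yj, assumption, rule power_nat_diff[OF chr_nonzero[OF t(1)]])
    also have "\<dots> = chr l (\<lambda>i. \<Sum>j\<in>J. b j * a j i) t * (\<Prod>j\<in>J. fst y $ j ^ nat (- b j))"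
      by (simp only: prod.distrib chr_sum[OF t(1), of b a J])
    also have "chr l (\<lambda>i. \<Sum>j\<in>J. b j * a j i) t = chr l (\<lambda>_. 0) t" using b by (intro chr_cong) simp
    finally show ?thesis by (simp add: chr_zero)
  qed
  note alg = fun_algebraD[OF cot_poly_funs_algebra]
  have pol2: "(\<lambda>u. fst u $ j * snd u $ j - c j) \<in> cot_poly_funs n" if "j \<in> J" for j
    using jn[OF that] by (intro fun_algebra_diff[OF cot_poly_funs_algebra] alg cot_coord_poly)
  have pol3: "(\<lambda>u. (\<Prod>j\<in>J. fst u $ j ^ nat (b j)) - (\<Prod>j\<in>J. fst u $ j ^ nat (- b j))) \<in> cot_poly_funs n" for b
    by (intro fun_algebra_diff[OF cot_poly_funs_algebra] fun_algebra_prod[OF cot_poly_funs_algebra]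
        fun_algebra_power[OF cot_poly_funs_algebra] cot_coord_poly jn)
  have closed: "zariski_closed n Orb"
    unfolding zariski_closed_def
  proof (intro exI[of _ "{f \<in> cot_poly_funs n. \<forall>y\<in>Orb. f y = 0}"] conjI equalityI subsetI)
    fix u assume "u \<in> Orb"
    then show "u \<in> {u \<in> cot_space n. \<forall>f\<in>{f \<in> cot_poly_funs n. \<forall>y\<in>Orb. f y = 0}. f u = 0}" using OrbC by simp
  next
    fix u assume "u \<in> {u \<in> cot_space n. \<forall>f\<in>{f \<in> cot_poly_funs n. \<forall>y\<in>Orb. f y = 0}. f u = 0}"
    then have uC: "u \<in> cot_space n" and F: "\<And>f. f \<in> cot_poly_funs n \<Longrightarrow> \<forall>y\<in>Orb. f y = 0 \<Longrightarrow> f u = 0" by simp_all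
    have off: "fst u $ j = 0" "snd u $ j = 0" if "j < n" "j \<notin> J" for j
      using F[OF cot_coord_poly(1)[OF that(1)]] F[OF cot_coord_poly(2)[OF that(1)]] van1[OF _ that] by blast+
    have on: "fst u $ j * snd u $ j = c j" if "j \<in> J" for j
      using F[OF pol2[OF that]] van2[OF _ that] by simp
    have nz: "fst u $ j \<noteq> 0" if "j \<in> J" for j using on[OF that] cJ[OF that] by auto
    \<comment> \<open>The binomial equations say that the coordinates of \<open>u\<close> respect
      all integer relations, so some torus element carries \<open>x\<close> to \<open>u\<close>. The
      equations v_j \<xi>_j = c_j with c_j \<noteq> 0 keep these coordinates away from 0, and the
      closure adds no point.\<close>
    have "compatible l a J (\<lambda>j. fst u $ j)"
      unfolding compatible_def
    proof (intro conjI ballI allI impI nz)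
      fix b :: "nat \<Rightarrow> int" assume b: "\<forall>i<l. (\<Sum>j\<in>J. b j * a j i) = 0"
      have "(\<Prod>j\<in>J. fst u $ j ^ nat (b j)) = (\<Prod>j\<in>J. fst u $ j ^ nat (- b j))"
        using F[OF pol3[of b]] van3[OF _ b] by simp
      moreover have "(\<Prod>j\<in>J. fst u $ j ^ nat (b j)) = (\<Prod>j\<in>J. fst u $ j powi b j) * (\<Prod>j\<in>J. fst u $ j ^ nat (- b j))"
        unfolding prod.distrib[symmetric] by (intro prod.cong refl power_nat_diff nz)
      moreover have "(\<Prod>j\<in>J. fst u $ j ^ nat (- b j)) \<noteq> 0" using nz finJ by simp
      ultimately show "(\<Prod>j\<in>J. fst u $ j powi b j) = 1" by simp
    qed
    from torus_point_exists[OF finJ this] obtain t where t: "t \<in> torus l" "\<forall>j\<in>J. chr l (a j) t = fst u $ j" by blast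
    have eq: "fst u $ j = fst (cot_act ?\<rho> t x) $ j \<and> snd u $ j = snd (cot_act ?\<rho> t x) $ j" if "j < n" for j
    proof (cases "j \<in> J")
      case True
      have "snd u $ j = inverse (fst u $ j) * c j" using on[OF True] nz[OF True] by (simp add: field_simps)
      then show ?thesis unfolding act[OF t(1)] using t(2) True that by simp
    next
      case False
      then show ?thesis unfolding act[OF t(1)] using off[OF that False] that by (simp add: c_def)
    qed
    have "u = cot_act ?\<rho> t x"
      unfolding prod_eq_iff using eq cot_spaceD[OF uC] cot_spaceD[OF OrbC[OF OrbI[OF t(1)]]] by (intro conjI eq_vecI) auto
    then show "u \<in> Orb" using OrbI[OF t(1)] by simp
  qed auto
  obtain u0 :: "nat \<Rightarrow> nat \<Rightarrow> rat" where
    u0: "\<forall>d\<in>D. \<forall>d'\<in>D. (\<Sum>i<l. u0 d i * of_int (a d' i)) = (if d = d' then 1 else 0)"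
    using indep_dual_vectors[OF is_basisD(3)[OF D] finD] by (elim exE conjE)
  define X where "X d = vec l (\<lambda>i. complex_of_rat (u0 d i))" for d
  \<comment> \<open>For \<open>j\<close> in \<open>J\<close>, the coefficient of the column
    \<open>d\<close> when the column \<open>j\<close> is expanded in the basis
    \<open>D\<close>.\<close>
  define \<kappa> where "\<kappa> j d = lam l (a j) (X d)" for j d
  have K1: "\<kappa> d' d = (if d' = d then 1 else 0)" if "d \<in> D" "d' \<in> D" for d d'
  proof -
    have "\<kappa> d' d = complex_of_rat (\<Sum>i<l. u0 d i * of_int (a d' i))"
      unfolding \<kappa>_def lam_def X_def of_rat_sum by (intro sum.cong) (simp_all add: of_rat_mult mult.commute)
    also have "(\<Sum>i<l. u0 d i * of_int (a d' i)) = (if d = d' then 1 else 0)" using u0 that by blast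
    finally show ?thesis by simp
  qed
  have span: "\<exists>r :: nat \<Rightarrow> rat. (\<forall>i<l. of_int (a j i) = (\<Sum>d\<in>D. r d * of_int (a d i))) \<and> (\<forall>d\<in>D. \<kappa> j d = of_rat (r d)) \<and>
      (\<forall>Y. lam l (a j) Y = (\<Sum>d\<in>D. \<kappa> j d * lam l (a d) Y))" if j: "j \<in> J" for j
  proof -
    obtain r :: "nat \<Rightarrow> rat" where r: "\<forall>i<l. of_int (a j i) = (\<Sum>d\<in>D. r d * of_int (a d i))"
      using is_basisD(4)[OF D j] unfolding in_span_def by blast
    have rc: "complex_of_int (a j i) = (\<Sum>d\<in>D. of_rat (r d) * of_int (a d i))" if "i < l" for i
      using arg_cong[OF r[rule_format, OF that], of complex_of_rat] by (simp add: of_rat_sum of_rat_mult)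
    have lr: "lam l (a j) Y = (\<Sum>d\<in>D. of_rat (r d) * lam l (a d) Y)" for Y
    proof -
      have "lam l (a j) Y = (\<Sum>i<l. \<Sum>d\<in>D. of_rat (r d) * (of_int (a d i) * Y $ i))"
        unfolding lam_def using rc by (intro sum.cong) (simp_all add: sum_distrib_right mult.assoc)
      also have "\<dots> = (\<Sum>d\<in>D. of_rat (r d) * lam l (a d) Y)"
        unfolding lam_def by (subst sum.swap) (simp add: sum_distrib_left)
      finally show ?thesis .
    qed
    have kr: "\<kappa> j d = of_rat (r d)" if "d \<in> D" for d
    proof -
      have "\<kappa> j d = (\<Sum>d'\<in>D. of_rat (r d') * \<kappa> d' d)" unfolding \<kappa>_def by (rule lr)
      also have "\<dots> = (\<Sum>d'\<in>D. if d' = d then of_rat (r d') else 0)" using K1[OF that] by (intro sum.cong) simp_all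
      finally show ?thesis using that finD by simp
    qed
    have "lam l (a j) Y = (\<Sum>d\<in>D. \<kappa> j d * lam l (a d) Y)" for Y unfolding lr[of Y] using kr by (intro sum.cong) simp_all
    then show ?thesis using r kr by blast
  qed
  have K2: "lam l (a j) Y = (\<Sum>d\<in>D. \<kappa> j d * lam l (a d) Y)" if "j \<in> J" for j Y using span[OF that] by blast
  \<comment> \<open>The infinitesimal orbit of \<open>x\<close>: a Lie algebra element changes v_j =
    1 by its weight and \<xi>_j = c_j by -c_j times that weight. The vectors of weights on
    \<open>J\<close> are those determined by their entries at \<open>D\<close> through
    \<open>\<kappa>\<close>.\<close>
  define E where "E = {u \<in> cot_space n. (\<forall>j<n. j \<notin> J \<longrightarrow> fst u $ j = 0 \<and> snd u $ j = 0) \<and>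
    (\<forall>j\<in>J. snd u $ j = - c j * fst u $ j \<and> fst u $ j = (\<Sum>d\<in>D. \<kappa> j d * fst u $ d))}"
  have lamX: "lam l (a j) (vec l (\<lambda>i. \<Sum>d\<in>D. y d * X d $ i)) = (\<Sum>d\<in>D. \<kappa> j d * y d)" for j y
  proof -
    have "lam l (a j) (vec l (\<lambda>i. \<Sum>d\<in>D. y d * X d $ i)) = (\<Sum>i<l. \<Sum>d\<in>D. of_int (a j i) * (y d * X d $ i))"
      unfolding lam_def by (intro sum.cong) (simp_all add: sum_distrib_left)
    also have "\<dots> = (\<Sum>d\<in>D. \<kappa> j d * y d)"
      unfolding \<kappa>_def lam_def sum_distrib_right by (subst sum.swap) (simp add: mult_ac)
    finally show ?thesis .
  qed
  have tangent: "tangent_space n Orb x = E"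
  proof (intro equalityI subsetI)
    fix u assume uE: "u \<in> E"
    then have uC: "u \<in> cot_space n" by (simp add: E_def)
    define Y where "Y = vec l (\<lambda>i. \<Sum>d\<in>D. fst u $ d * X d $ i)"
    have YC: "Y \<in> carrier_vec l" by (simp add: Y_def)
    have fu: "fst u $ j = lam l (a j) Y" if "j \<in> J" for j using uE that lamX[of j "\<lambda>d. fst u $ d"] by (simp add: E_def Y_def)
    define \<gamma> where "\<gamma> s = cot_act ?\<rho> (texp (s \<cdot>\<^sub>v Y)) x" for s
    have tt: "texp (s \<cdot>\<^sub>v Y) \<in> torus l" for s using YC by (intro torus_texp) simp
    show "u \<in> tangent_space n Orb x"
    proof (rule tangent_space_curve[OF xC uC, where \<gamma> = \<gamma>])
      show "\<gamma> 0 = x"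
        unfolding \<gamma>_def act[OF tt] chr_texp_smult[OF YC] prod_eq_iff
        using cot_spaceD[OF xC] xi by (intro conjI eq_vecI) auto
      show "\<gamma> s \<in> Orb" for s unfolding \<gamma>_def by (rule OrbI[OF tt])
      fix i assume i: "i < n"
      have 1: "fst (\<gamma> s) $ i = (if i \<in> J then exp (s * lam l (a i) Y) else 0)" for s
        unfolding \<gamma>_def act[OF tt] chr_texp_smult[OF YC] using i by simp
      have 2: "snd (\<gamma> s) $ i = inverse (exp (s * lam l (a i) Y)) * c i" for s
        unfolding \<gamma>_def act[OF tt] chr_texp_smult[OF YC] using i by simp
      show "((\<lambda>s. fst (\<gamma> s) $ i) has_field_derivative fst u $ i) (at 0)"
        unfolding 1
      proof (cases "i \<in> J")
        case True
        then show "((\<lambda>s. if i \<in> J then exp (s * lam l (a i) Y) else 0) has_field_derivative fst u $ i) (at 0)"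
          using fu[OF True] by (auto intro!: derivative_eq_intros)
      next
        case False
        then have "fst u $ i = 0" using uE i by (simp add: E_def)
        then show "((\<lambda>s. if i \<in> J then exp (s * lam l (a i) Y) else 0) has_field_derivative fst u $ i) (at 0)"
          using False by simp
      qed
      have "snd u $ i = - lam l (a i) Y * c i"
      proof (cases "i \<in> J")
        case True
        then have "snd u $ i = - c i * fst u $ i" using uE by (simp add: E_def)
        then show ?thesis using fu[OF True] by simp
      next
        case False
        then show ?thesis using uE i by (simp add: E_def c_def)
      qed
      then show "((\<lambda>s. snd (\<gamma> s) $ i) has_field_derivative snd u $ i) (at 0)"
        unfolding 2 by (auto intro!: derivative_eq_intros)
    qed
  next
    fix u assume u: "u \<in> tangent_space n Orb x"
    then have uC: "u \<in> cot_space n" by (simp add: tangent_space_def)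
    have dz: "((\<lambda>s. f (x + cot_smult s u)) has_field_derivative 0) (at 0)"
      if "f \<in> cot_poly_funs n" "\<forall>y\<in>Orb. f y = 0" for f using u that by (simp add: tangent_space_def)
    have line: "fst (x + cot_smult s u) $ j = 1 + s * fst u $ j" "snd (x + cot_smult s u) $ j = c j + s * snd u $ j"
      if "j \<in> J" for s j
      using jn[OF that] that xi[OF jn[OF that]] cot_spaceD[OF xC] cot_spaceD[OF uC] by (simp_all add: fst_cot_smult snd_cot_smult)
    have off: "fst u $ j = 0 \<and> snd u $ j = 0" if "j < n" "j \<notin> J" for j
      using tangent_space_coordinate_zero[OF xC u that(1)] van1[OF _ that] by blast
    have sndu: "snd u $ j = - c j * fst u $ j" if j: "j \<in> J" for j
    proof -
      have "((\<lambda>s. (1 + s * fst u $ j) * (c j + s * snd u $ j) - c j) has_field_derivative 0) (at 0)"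
        using dz[OF pol2[OF j]] van2[OF _ j] unfolding line[OF j] by blast
      moreover have "((\<lambda>s. (1 + s * fst u $ j) * (c j + s * snd u $ j) - c j) has_field_derivative fst u $ j * c j + snd u $ j) (at 0)"
        by (auto intro!: derivative_eq_intros)
      ultimately have "fst u $ j * c j + snd u $ j = 0" by (rule DERIV_unique[symmetric])
      then show ?thesis by (simp add: eq_neg_iff_add_eq_0 add.commute mult.commute)
    qed
    \<comment> \<open>The derivative at \<open>x\<close> of the binomial equation of
      \<open>b\<close>: since v_j = 1 on \<open>J\<close>, it becomes the linear equation with the
      same integer coefficients.\<close>
    have rel: "(\<Sum>j\<in>J. of_int (b j) * fst u $ j) = 0" if b: "\<forall>i<l. (\<Sum>j\<in>J. b j * a j i) = 0" for b
    proof -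
      have lineprod: "(\<Prod>j\<in>J. fst (x + cot_smult s u) $ j ^ k j) = (\<Prod>j\<in>J. (1 + s * fst u $ j) ^ k j)" for s k
        by (intro prod.cong refl) (subst line, assumption, rule refl)
      have "((\<lambda>s. (\<Prod>j\<in>J. (1 + s * fst u $ j) ^ nat (b j)) - (\<Prod>j\<in>J. (1 + s * fst u $ j) ^ nat (- b j))) has_field_derivative 0) (at 0)"
        using dz[OF pol3[of b]] van3[OF _ b] unfolding lineprod by blast
      moreover have P: "((\<lambda>s. \<Prod>j\<in>J. (1 + s * fst u $ j) ^ k j) has_field_derivative (\<Sum>j\<in>J. of_nat (k j) * fst u $ j)) (at 0)" for k :: "nat \<Rightarrow> nat"
        using finJ
      proof (induction J rule: finite_induct)
        case (insert j K)
        have "((\<lambda>s. (1 + s * fst u $ j) ^ k j) has_field_derivative of_nat (k j) * fst u $ j) (at 0)"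
          by (auto intro!: derivative_eq_intros)
        from DERIV_mult[OF this insert.IH] show ?case using insert.hyps by (simp add: add.commute)
      qed simp
      have "((\<lambda>s. (\<Prod>j\<in>J. (1 + s * fst u $ j) ^ nat (b j)) - (\<Prod>j\<in>J. (1 + s * fst u $ j) ^ nat (- b j))) has_field_derivative
          (\<Sum>j\<in>J. of_nat (nat (b j)) * fst u $ j) - (\<Sum>j\<in>J. of_nat (nat (- b j)) * fst u $ j)) (at 0)"
        by (rule DERIV_diff[OF P P])
      ultimately have "(\<Sum>j\<in>J. of_nat (nat (b j)) * fst u $ j) - (\<Sum>j\<in>J. of_nat (nat (- b j)) * fst u $ j) = 0"
        using DERIV_unique by blast
      moreover have "of_nat (nat z) - of_nat (nat (- z)) = (of_int z :: complex)" for z :: int by (cases "z \<ge> 0") simp_all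
      ultimately show ?thesis unfolding sum_subtractf[symmetric] left_diff_distrib[symmetric] by simp
    qed
    have fstu: "fst u $ j = (\<Sum>d\<in>D. \<kappa> j d * fst u $ d)" if j: "j \<in> J" for j
    proof -
      obtain r :: "nat \<Rightarrow> rat" where r: "\<forall>i<l. of_int (a j i) = (\<Sum>d\<in>D. r d * of_int (a d i))" "\<forall>d\<in>D. \<kappa> j d = of_rat (r d)"
        using span[OF j] by blast
      obtain N where N: "N > 0" "\<forall>d\<in>D. \<exists>z::int. of_int N * r d = of_int z" using rat_common_denominator[OF finD, of r] by blast
      then have "\<forall>d. \<exists>z::int. d \<in> D \<longrightarrow> of_int N * r d = of_int z" by blast
      then obtain \<beta> :: "nat \<Rightarrow> int" where \<beta>: "\<And>d. d \<in> D \<Longrightarrow> of_int N * r d = of_int (\<beta> d)" by metis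
      \<comment> \<open>The expansion of the column \<open>j\<close> in the basis \<open>D\<close>,
        multiplied by a common denominator, written as an integer relation on
        \<open>J\<close>.\<close>
      define b where "b k = (if k = j then N else 0) - (if k \<in> D then \<beta> k else 0)" for k
      have sumb: "(\<Sum>k\<in>J. of_int (b k) * f k) = of_int N * f j - (\<Sum>d\<in>D. of_int (\<beta> d) * f d)" for f :: "nat \<Rightarrow> 'z::comm_ring_1"
      proof -
        have "(\<Sum>k\<in>J. of_int (b k) * f k) = (\<Sum>k\<in>J. if k = j then of_int N * f k else 0) - (\<Sum>k\<in>J. if k \<in> D then of_int (\<beta> k) * f k else 0)"
          unfolding sum_subtractf[symmetric] by (intro sum.cong) (simp_all add: b_def left_diff_distrib)
        also have "(\<Sum>k\<in>J. if k \<in> D then of_int (\<beta> k) * f k else 0) = (\<Sum>d\<in>D. of_int (\<beta> d) * f d)"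
          using DJ finJ by (intro sum.mono_neutral_cong_right) auto
        finally show ?thesis using j finJ by simp
      qed
      have "(\<Sum>k\<in>J. b k * a k i) = 0" if i: "i < l" for i
      proof -
        have "rat_of_int (\<Sum>k\<in>J. b k * a k i) = of_int N * of_int (a j i) - (\<Sum>d\<in>D. of_int (\<beta> d) * of_int (a d i))"
          using sumb[of "\<lambda>k. rat_of_int (a k i)"] by simp
        also have "(\<Sum>d\<in>D. rat_of_int (\<beta> d) * of_int (a d i)) = of_int N * (\<Sum>d\<in>D. r d * of_int (a d i))"
          unfolding sum_distrib_left using \<beta> by (intro sum.cong) (simp_all add: mult.assoc[symmetric])
        also have "of_int N * of_int (a j i) - \<dots> = 0" using r(1) i by simp
        finally show ?thesis by (simp only: of_int_eq_0_iff)
      qed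
      from rel[of b] this have "of_int N * fst u $ j = (\<Sum>d\<in>D. of_int (\<beta> d) * fst u $ d)"
        using sumb[of "\<lambda>k. fst u $ k"] by simp
      also have "\<dots> = of_int N * (\<Sum>d\<in>D. \<kappa> j d * fst u $ d)"
        unfolding sum_distrib_left
      proof (rule sum.cong[OF refl])
        fix d assume d: "d \<in> D"
        have "complex_of_int (\<beta> d) = of_int N * \<kappa> j d"
          using arg_cong[OF \<beta>[OF d], of complex_of_rat] r(2) d by (simp add: of_rat_mult)
        then show "complex_of_int (\<beta> d) * fst u $ d = of_int N * (\<kappa> j d * fst u $ d)" by (simp add: mult.assoc)
      qed
      finally show ?thesis using N(1) by simp
    qed
    show "u \<in> E" unfolding E_def using uC off sndu fstu by blast
  qed
  \<comment> \<open>All \<open>\<eta>\<close> vanish on \<open>E\<close>, and the pairing of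
    \<open>u\<close> with \<open>E\<close> involves \<open>u\<close> only through
    \<open>\<eta>\<close>. The substitution preserves the shape of the symplectic form, because the
    added terms with \<open>c\<close> are symmetric in the two arguments.\<close>
  define \<eta> where "\<eta> u j = snd u $ j + c j * fst u $ j" for u :: "complex vec \<times> complex vec" and j
  have EC: "\<epsilon> \<in> cot_space n" if "\<epsilon> \<in> E" for \<epsilon> using that by (simp add: E_def)
  have omE: "omega u \<epsilon> = - (\<Sum>j\<in>J. \<eta> u j * fst \<epsilon> $ j)" if "u \<in> cot_space n" "\<epsilon> \<in> E" for u \<epsilon>
  proof -
    have "omega u \<epsilon> = (\<Sum>j\<in>J. - (\<eta> u j * fst \<epsilon> $ j))"
      unfolding omega_sum[OF that(1) EC[OF that(2)]] using J that(2)
      by (intro sum.mono_neutral_cong_right) (auto simp: E_def \<eta>_def algebra_simps)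
    then show ?thesis by (simp add: sum_negf)
  qed
  have perp: "u \<in> omega_perp n E \<longleftrightarrow> u \<in> cot_space n \<and> (\<forall>d\<in>D. (\<Sum>j\<in>J. \<eta> u j * \<kappa> j d) = 0)" for u
  proof
    assume u: "u \<in> omega_perp n E"
    then have uC: "u \<in> cot_space n" by (simp add: omega_perp_def)
    have "(\<Sum>j\<in>J. \<eta> u j * \<kappa> j d) = 0" if d: "d \<in> D" for d
    proof -
      define \<epsilon> :: "complex vec \<times> complex vec" where
        "\<epsilon> = (vec n (\<lambda>j. if j \<in> J then \<kappa> j d else 0), vec n (\<lambda>j. if j \<in> J then - c j * \<kappa> j d else 0))"
      have f\<epsilon>: "fst \<epsilon> $ j = \<kappa> j d" if "j \<in> J" for j using that jn[OF that] by (simp add: \<epsilon>_def)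
      have "\<kappa> j d = (\<Sum>d'\<in>D. \<kappa> j d' * fst \<epsilon> $ d')" if "j \<in> J" for j
      proof -
        have "(\<Sum>d'\<in>D. \<kappa> j d' * fst \<epsilon> $ d') = (\<Sum>d'\<in>D. if d' = d then \<kappa> j d' else 0)"
          using DJ f\<epsilon> K1[OF d] by (intro sum.cong) auto
        then show ?thesis using d finD by simp
      qed
      then have "\<epsilon> \<in> E" unfolding E_def using f\<epsilon> jn by (simp add: \<epsilon>_def cot_space_def)
      then have "omega u \<epsilon> = 0" using u by (simp add: omega_perp_def)
      then show ?thesis unfolding omE[OF uC \<open>\<epsilon> \<in> E\<close>] using f\<epsilon> by simp
    qed
    then show "u \<in> cot_space n \<and> (\<forall>d\<in>D. (\<Sum>j\<in>J. \<eta> u j * \<kappa> j d) = 0)" using uC by blast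
  next
    assume u: "u \<in> cot_space n \<and> (\<forall>d\<in>D. (\<Sum>j\<in>J. \<eta> u j * \<kappa> j d) = 0)"
    have "omega u \<epsilon> = 0" if \<epsilon>: "\<epsilon> \<in> E" for \<epsilon>
    proof -
      have "(\<Sum>j\<in>J. \<eta> u j * fst \<epsilon> $ j) = (\<Sum>j\<in>J. \<Sum>d\<in>D. \<eta> u j * (\<kappa> j d * fst \<epsilon> $ d))"
        using \<epsilon> unfolding sum_distrib_left[symmetric] by (intro sum.cong) (simp_all add: E_def)
      also have "\<dots> = (\<Sum>d\<in>D. (\<Sum>j\<in>J. \<eta> u j * \<kappa> j d) * fst \<epsilon> $ d)"
        unfolding sum_distrib_right by (subst sum.swap) (simp add: mult.assoc)
      also have "\<dots> = 0" using u by simp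
      finally show ?thesis unfolding omE[OF conjunct1[OF u] \<epsilon>] by simp
    qed
    then show "u \<in> omega_perp n E" using u by (simp add: omega_perp_def)
  qed
  \<comment> \<open>On the orthogonal complement the values of \<open>\<eta>\<close> at
    \<open>D\<close> are determined by those on the rest of \<open>J\<close>, so the slice
    coordinates can omit \<open>D\<close>.\<close>
  have \<eta>D: "\<eta> u d = - (\<Sum>f\<in>J-D. \<eta> u f * \<kappa> f d)" if "u \<in> omega_perp n E" "d \<in> D" for u d
  proof -
    have "(\<Sum>j\<in>J. \<eta> u j * \<kappa> j d) = (\<Sum>f\<in>J-D. \<eta> u f * \<kappa> f d) + (\<Sum>d'\<in>D. \<eta> u d' * \<kappa> d' d)"
      by (rule sum.subset_diff[OF DJ finJ])
    also have "(\<Sum>d'\<in>D. \<eta> u d' * \<kappa> d' d) = (\<Sum>d'\<in>D. if d' = d then \<eta> u d' else 0)"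
      using K1[OF that(2)] by (intro sum.cong) simp_all
    also have "\<dots> = \<eta> u d" using that(2) finD by simp
    finally show ?thesis using that by (simp add: perp eq_neg_iff_add_eq_0 add.commute)
  qed
  define p where "p = card (J - D)"
  define m where "m = card ({..<n} - J)"
  define k where "k = p + m"
  have "finite (J - D)" "finite ({..<n} - J)" using finJ by auto
  then obtain e1 e2 where "bij_betw e1 {0..<p} (J - D)" "bij_betw e2 {0..<m} ({..<n} - J)"
    unfolding p_def m_def using ex_bij_betw_nat_finite by blast
  then have e1: "bij_betw e1 {..<p} (J - D)" and e2: "bij_betw e2 {..<m} ({..<n} - J)" by (simp_all only: atLeast0LessThan)
  \<comment> \<open>The trivial summand comes first: \<open>p\<close> is the number of columns of
    \<open>J\<close> outside \<open>D\<close>, the codimension of the orbit directions in the space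
    on \<open>J\<close>. The columns outside \<open>J\<close> follow.\<close>
  define e where "e i = (if i < p then e1 i else e2 (i - p))" for i
  have eh: "e i \<in> J - D" if "i < p" for i using bij_betw_apply[OF e1, of i] that by (simp add: e_def)
  have et: "e i \<in> {..<n} - J" if "p \<le> i" "i < k" for i using bij_betw_apply[OF e2, of "i - p"] that by (simp add: e_def k_def)
  have en: "e i < n" "e i \<notin> D" if "i < k" for i
    using eh[of i] et[of i] that jn DJ by (cases "i < p"; auto)+
  have im: "e ` {..<k} = {..<n} - D"
  proof (intro equalityI subsetI)
    fix j assume "j \<in> e ` {..<k}"
    then show "j \<in> {..<n} - D" using en by auto
  next
    fix j assume j: "j \<in> {..<n} - D"
    show "j \<in> e ` {..<k}"
    proof (cases "j \<in> J")
      case True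
      then have "j \<in> e1 ` {..<p}" using bij_betw_imp_surj_on[OF e1] j by simp
      then obtain i where "i < p" "j = e1 i" by blast
      then show ?thesis by (intro image_eqI[of _ _ i]) (simp_all add: e_def k_def)
    next
      case False
      then have "j \<in> e2 ` {..<m}" using bij_betw_imp_surj_on[OF e2] j by simp
      then obtain i where "i < m" "j = e2 i" by blast
      then show ?thesis by (intro image_eqI[of _ _ "p + i"]) (simp_all add: e_def k_def)
    qed
  qed
  have cardk: "card ({..<n} - D) = k"
  proof -
    have "{..<n} - D = (J - D) \<union> ({..<n} - J)" using DJ J by auto
    also have "card \<dots> = k" unfolding k_def p_def m_def using finJ by (intro card_Un_disjoint) auto
    finally show ?thesis .
  qed
  have inj: "inj_on e {..<k}" by (rule eq_card_imp_inj_on) (simp_all add: im cardk)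
  have bij: "bij_betw e {..<k} ({..<n} - D)" using inj im by (simp add: bij_betw_def)
  \<comment> \<open>On columns of \<open>J\<close> the first component is what remains of
    \<open>u\<close> after subtracting the vector of \<open>E\<close> with the same entries at
    \<open>D\<close>; the second component is \<open>\<eta>\<close>. Both vanish exactly on
    \<open>E\<close> within its orthogonal complement.\<close>
  define q where "q u = (vec k (\<lambda>i. fst u $ e i - (if e i \<in> J then \<Sum>d\<in>D. \<kappa> (e i) d * fst u $ d else 0)), vec k (\<lambda>i. \<eta> u (e i)))"
    for u :: "complex vec \<times> complex vec"
  have qC: "q u \<in> cot_space k" for u by (simp add: q_def cot_space_def)
  have dn: "d < n" if "d \<in> D" for d using that DJ jn by auto
  have q_omega: "omega (q u) (q u') = omega u u'" if u: "u \<in> omega_perp n E" "u' \<in> omega_perp n E" for u u'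
  proof -
    have C: "u \<in> cot_space n" "u' \<in> cot_space n" using u by (simp_all add: perp)
    \<comment> \<open>The sum on the left omits the columns of \<open>D\<close>. By
      \<open>\<eta>D\<close>, the terms subtracted in the first component of \<open>q\<close>
      restore exactly these.\<close>
    have half: "(\<Sum>i<k. snd (q u') $ i * fst (q u) $ i) = (\<Sum>j<n. \<eta> u' j * fst u $ j)"
      if u: "u' \<in> omega_perp n E" for u u'
    proof -
      have "(\<Sum>i<k. snd (q u') $ i * fst (q u) $ i) =
          (\<Sum>i<k. \<eta> u' (e i) * (fst u $ e i - (if e i \<in> J then \<Sum>d\<in>D. \<kappa> (e i) d * fst u $ d else 0)))"
        by (intro sum.cong) (simp_all add: q_def)
      also have "\<dots> = (\<Sum>j\<in>{..<n}-D. \<eta> u' j * (fst u $ j - (if j \<in> J then \<Sum>d\<in>D. \<kappa> j d * fst u $ d else 0)))"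
        by (rule sum.reindex_bij_betw[OF bij])
      also have "\<dots> = (\<Sum>j\<in>{..<n}-D. \<eta> u' j * fst u $ j) - (\<Sum>j\<in>{..<n}-D. if j \<in> J then \<eta> u' j * (\<Sum>d\<in>D. \<kappa> j d * fst u $ d) else 0)"
        unfolding sum_subtractf[symmetric] by (intro sum.cong) (simp_all add: right_diff_distrib)
      also have "(\<Sum>j\<in>{..<n}-D. if j \<in> J then \<eta> u' j * (\<Sum>d\<in>D. \<kappa> j d * fst u $ d) else 0) =
          (\<Sum>j\<in>J-D. \<eta> u' j * (\<Sum>d\<in>D. \<kappa> j d * fst u $ d))"
        using J by (intro sum.mono_neutral_cong_right) auto
      also have "\<dots> = (\<Sum>d\<in>D. (\<Sum>j\<in>J-D. \<eta> u' j * \<kappa> j d) * fst u $ d)"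
        unfolding sum_distrib_left sum_distrib_right by (subst sum.swap) (simp add: mult.assoc)
      also have "\<dots> = - (\<Sum>d\<in>D. \<eta> u' d * fst u $ d)"
        unfolding sum_negf[symmetric] using \<eta>D[OF u] by (intro sum.cong) simp_all
      also have "(\<Sum>j\<in>{..<n}-D. \<eta> u' j * fst u $ j) - - (\<Sum>d\<in>D. \<eta> u' d * fst u $ d) = (\<Sum>j<n. \<eta> u' j * fst u $ j)"
        using sum.subset_diff[of D "{..<n}" "\<lambda>j. \<eta> u' j * fst u $ j"] DJ J by auto
      finally show ?thesis .
    qed
    have "omega (q u) (q u') = (\<Sum>j<n. \<eta> u' j * fst u $ j) - (\<Sum>j<n. \<eta> u j * fst u' $ j)"
      unfolding omega_sum[OF qC qC] sum_subtractf half[OF u(1)] half[OF u(2)] ..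
    also have "\<dots> = omega u u'"
      unfolding omega_sum[OF C] sum_subtractf[symmetric] by (intro sum.cong) (simp_all add: \<eta>_def algebra_simps)
    finally show ?thesis .
  qed
  have cact: "cot_act ?\<rho> h u = (vec n (\<lambda>i. chr l (a i) h * fst u $ i), vec n (\<lambda>i. inverse (chr l (a i) h) * snd u $ i))"
    if "h \<in> ?H" "u \<in> cot_space n" for h u
    using cot_act_drep'[OF stabD(1)[OF that(1)] that(2), of a id] by simp
  have slice: "slice_iso ?H n ?\<rho> E k (drep l a e k)"
    unfolding slice_iso_def
  proof (intro exI[of _ q] conjI ballI allI)
    fix u assume u: "u \<in> omega_perp n E"
    then have uC: "u \<in> cot_space n" by (simp add: perp)
    note C = cot_spaceD[OF uC]
    show "q (cot_smult s u) = cot_smult s (q u)" for s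
      unfolding prod_eq_iff using C en dn
      by (intro conjI eq_vecI) (simp_all add: q_def \<eta>_def cot_smult_def sum_distrib_left algebra_simps)
    show "q (cot_act ?\<rho> h u) = cot_act (drep l a e k) h (q u)" if h: "h \<in> ?H" for h
    proof -
      have one: "chr l (a j) h = 1" if "j \<in> J" for j by (rule stabD(2)[OF h that])
      have D1: "fst (cot_act ?\<rho> h u) $ d = fst u $ d" if "d \<in> D" for d
        unfolding cact[OF h uC] using dn[OF that] one DJ that by auto
      have 1: "fst (cot_act ?\<rho> h u) $ e i = chr l (a (e i)) h * fst u $ e i"
        "snd (cot_act ?\<rho> h u) $ e i = inverse (chr l (a (e i)) h) * snd u $ e i" if "i < k" for i
        unfolding cact[OF h uC] using en[OF that] by simp_all
      have "fst (cot_act ?\<rho> h u) $ e i - (if e i \<in> J then \<Sum>d\<in>D. \<kappa> (e i) d * fst (cot_act ?\<rho> h u) $ d else 0) =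
          chr l (a (e i)) h * (fst u $ e i - (if e i \<in> J then \<Sum>d\<in>D. \<kappa> (e i) d * fst u $ d else 0))" if "i < k" for i
        using 1[OF that] D1 one[of "e i"] by simp
      moreover have "\<eta> (cot_act ?\<rho> h u) (e i) = inverse (chr l (a (e i)) h) * \<eta> u (e i)" if "i < k" for i
        unfolding \<eta>_def 1[OF that] using one[of "e i"] by (cases "e i \<in> J") (simp_all add: c_def)
      ultimately show ?thesis
        unfolding cot_act_drep'[OF stabD(1)[OF h] qC] prod_eq_iff by (intro conjI eq_vecI) (simp_all add: q_def)
    qed
    fix u' assume u': "u' \<in> omega_perp n E"
    then have uC': "u' \<in> cot_space n" by (simp add: perp)
    note C' = cot_spaceD[OF uC']
    have Dsum: "(\<Sum>d\<in>D. \<kappa> j d * fst (u + u') $ d) = (\<Sum>d\<in>D. \<kappa> j d * fst u $ d) + (\<Sum>d\<in>D. \<kappa> j d * fst u' $ d)" for j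
      unfolding sum.distrib[symmetric] using dn C C' by (intro sum.cong) (simp_all add: distrib_left)
    show "q (u + u') = q u + q u'"
      unfolding prod_eq_iff using C C' en
      by (intro conjI eq_vecI) (simp_all add: q_def \<eta>_def Dsum[unfolded fst_add] algebra_simps)
    show "omega (q u) (q u') = omega u u'" by (rule q_omega[OF u u'])
  next
    show "q ` omega_perp n E = cot_space k"
    proof (intro equalityI subsetI)
      fix w assume "w \<in> q ` omega_perp n E"
      then show "w \<in> cot_space k" using qC by blast
    next
      fix w assume w: "w \<in> cot_space k"
      note wC = cot_spaceD[OF w]
      define ix where "ix j = the_inv_into {..<k} e j" for j
      have ixe: "ix (e i) = i" if "i < k" for i unfolding ix_def by (rule the_inv_into_f_f[OF inj]) (use that in simp)
      define f where "f j = (if j \<in> D then 0 else fst w $ ix j)" for j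
      define y where "y j = (if j \<in> D then - (\<Sum>g\<in>J-D. snd w $ ix g * \<kappa> g j) else snd w $ ix j)" for j
      define u :: "complex vec \<times> complex vec" where
        "u = (vec n (\<lambda>j. f j), vec n (\<lambda>j. y j - c j * f j))"
      have \<eta>u: "\<eta> u j = y j" if "j < n" for j using that by (simp add: \<eta>_def u_def)
      have uC: "u \<in> cot_space n" by (simp add: u_def cot_space_def)
      have "(\<Sum>j\<in>J. \<eta> u j * \<kappa> j d) = 0" if d: "d \<in> D" for d
      proof -
        have "(\<Sum>j\<in>J. \<eta> u j * \<kappa> j d) = (\<Sum>g\<in>J-D. \<eta> u g * \<kappa> g d) + (\<Sum>d'\<in>D. \<eta> u d' * \<kappa> d' d)"
          by (rule sum.subset_diff[OF DJ finJ])
        also have "(\<Sum>d'\<in>D. \<eta> u d' * \<kappa> d' d) = (\<Sum>d'\<in>D. if d' = d then \<eta> u d' else 0)"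
          using K1[OF d] by (intro sum.cong) simp_all
        also have "\<dots> = y d" using d finD \<eta>u[OF dn[OF d]] by simp
        also have "(\<Sum>g\<in>J-D. \<eta> u g * \<kappa> g d) = (\<Sum>g\<in>J-D. snd w $ ix g * \<kappa> g d)"
          using \<eta>u jn by (intro sum.cong) (auto simp: y_def)
        finally show ?thesis using d by (simp add: y_def)
      qed
      then have uN: "u \<in> omega_perp n E" unfolding perp using uC by blast
      have "(\<Sum>d\<in>D. \<kappa> j d * fst u $ d) = 0" for j using dn by (simp add: u_def f_def)
      then have "q u = w"
        unfolding prod_eq_iff using wC en \<eta>u ixe
        by (intro conjI eq_vecI) (simp_all add: q_def y_def u_def f_def)
      then show "w \<in> q ` omega_perp n E" using uN by blast
    qed
    show "{u \<in> omega_perp n E. q u = (0\<^sub>v k, 0\<^sub>v k)} = E"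
    proof (intro equalityI subsetI)
      fix u assume "u \<in> {u \<in> omega_perp n E. q u = (0\<^sub>v k, 0\<^sub>v k)}"
      then have uN: "u \<in> omega_perp n E" and q0: "q u = (0\<^sub>v k, 0\<^sub>v k)" by simp_all
      have uC: "u \<in> cot_space n" using uN by (simp add: perp)
      have z: "fst u $ j - (if j \<in> J then \<Sum>d\<in>D. \<kappa> j d * fst u $ d else 0) = 0 \<and> \<eta> u j = 0" if j: "j < n" "j \<notin> D" for j
      proof -
        have "j \<in> e ` {..<k}" unfolding im using j by simp
        then obtain i where i: "i < k" "j = e i" by blast
        have "fst (q u) $ i = 0" "snd (q u) $ i = 0" using q0 i(1) by simp_all
        then show ?thesis using i by (simp add: q_def)
      qed
      have \<eta>0: "\<eta> u j = 0" if "j < n" for j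
      proof (cases "j \<in> D")
        case True
        then have "\<eta> u j = - (\<Sum>f\<in>J-D. \<eta> u f * \<kappa> f j)" by (rule \<eta>D[OF uN])
        also have "(\<Sum>f\<in>J-D. \<eta> u f * \<kappa> f j) = 0" using z jn by (intro sum.neutral) auto
        finally show ?thesis by simp
      qed (use z that in blast)
      have "fst u $ j = 0 \<and> snd u $ j = 0" if "j < n" "j \<notin> J" for j
        using z[of j] that DJ by (auto simp: \<eta>_def c_def)
      moreover have "snd u $ j = - c j * fst u $ j" if "j \<in> J" for j
        using \<eta>0[OF jn[OF that]] by (simp add: \<eta>_def eq_neg_iff_add_eq_0)
      moreover have "fst u $ j = (\<Sum>d\<in>D. \<kappa> j d * fst u $ d)" if j: "j \<in> J" for j
      proof (cases "j \<in> D")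
        case True
        have "(\<Sum>d\<in>D. \<kappa> j d * fst u $ d) = (\<Sum>d\<in>D. if d = j then fst u $ d else 0)"
          using K1[OF _ True] by (intro sum.cong) auto
        then show ?thesis using True finD by simp
      next
        case False
        then show ?thesis using z[OF jn[OF j] False] j by simp
      qed
      ultimately show "u \<in> E" unfolding E_def using uC by blast
    next
      fix u assume uE: "u \<in> E"
      have uC: "u \<in> cot_space n" by (rule EC[OF uE])
      have \<eta>0: "\<eta> u j = 0" if "j < n" for j using uE that by (cases "j \<in> J") (simp_all add: E_def \<eta>_def c_def)
      have "u \<in> omega_perp n E" unfolding perp using uC \<eta>0 jn by simp
      moreover have "q u = (0\<^sub>v k, 0\<^sub>v k)"
      proof -
        have "fst u $ j - (if j \<in> J then \<Sum>d\<in>D. \<kappa> j d * fst u $ d else 0) = 0" if "j < n" for j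
          using uE that by (cases "j \<in> J") (simp_all add: E_def)
        then show ?thesis unfolding prod_eq_iff using \<eta>0 en by (intro conjI eq_vecI) (simp_all add: q_def)
      qed
      ultimately show "u \<in> {u \<in> omega_perp n E. q u = (0\<^sub>v k, 0\<^sub>v k)}" by simp
    qed
  qed
  let ?\<tau> = "drep l a e2 m"
  have eqrep: "drep l a e k h = add_trivial p m ?\<tau> h" if h: "h \<in> ?H" for h
  proof (rule eq_matI)
    fix i j assume "i < dim_row (add_trivial p m ?\<tau> h)" "j < dim_col (add_trivial p m ?\<tau> h)"
    then have ij: "i < p + m" "j < p + m" by (simp_all add: add_trivial_def drep_def)
    have "chr l (a (e i)) h = 1" if "i < p" for i using stabD(2)[OF h] eh[OF that] by simp
    then show "drep l a e k h $$ (i, j) = add_trivial p m ?\<tau> h $$ (i, j)"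
      using ij by (auto simp: drep_def add_trivial_def k_def e_def)
  qed (simp_all add: add_trivial_def drep_def k_def)
  have nontriv: "\<exists>h\<in>?H. chr l (a j) h \<noteq> 1" if j: "j < n" "j \<notin> J" for j
  proof (rule nontrivial_character[OF D])
    show "j \<notin> D" using j DJ by blast
    \<comment> \<open>\<open>J\<close> attains the bound, so adding another column of its span would
      violate it.\<close>
    show "\<not> in_span l a D (a j)"
    proof
      assume "in_span l a D (a j)"
      then have "is_basis l a (insert j J) D" using D by (auto simp: is_basis_def)
      from card_boundD[OF bound _ this lt] have "card (insert j J) + (l - card D) + 1 \<le> n" using J j by simp
      then show False using card finJ j by simp
    qed
  qed
  have inv: "invariant_vecs ?H m ?\<tau> = {0\<^sub>v m}"
  proof (intro equalityI subsetI)
    fix w assume w: "w \<in> invariant_vecs ?H m ?\<tau>"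
    then have wC: "w \<in> carrier_vec m" by (simp add: invariant_vecs_def)
    have "w $ i = 0" if i: "i < m" for i
    proof -
      have "e2 i < n" "e2 i \<notin> J" using bij_betw_apply[OF e2, of i] i by simp_all
      then obtain h where h: "h \<in> ?H" "chr l (a (e2 i)) h \<noteq> 1" using nontriv by blast
      have "?\<tau> h *\<^sub>v w = w" using w h(1) by (simp add: invariant_vecs_def)
      from arg_cong[OF this, of "\<lambda>v. v $ i"] have "chr l (a (e2 i)) h * w $ i = w $ i"
        unfolding drep_mult_vec[OF wC] using i by simp
      then show ?thesis using h(2) by simp
    qed
    then show "w \<in> {0\<^sub>v m}" using wC by (auto intro!: eq_vecI)
  next
    fix w assume "w \<in> {0\<^sub>v m :: complex vec}"
    then show "w \<in> invariant_vecs ?H m ?\<tau>"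
      using mult_mat_zero_vec[OF drep_carrier[of l a e2 m]] by (simp add: invariant_vecs_def)
  qed
  have mod: "is_module l ?H k (drep l a e k)" by (rule drep_stab_module)
  have "module_iso ?H k (drep l a e k) (add_trivial p m ?\<tau>)"
    unfolding module_iso_def
  proof (intro bexI[of _ "1\<^sub>m k"] conjI ballI)
    show "invertible_mat (1\<^sub>m k :: complex mat)" unfolding invertible_mat_def inverts_mat_def
      by (intro conjI exI[of _ "1\<^sub>m k"]) simp_all
    fix h assume h: "h \<in> ?H"
    show "drep l a e k h * 1\<^sub>m k = 1\<^sub>m k * add_trivial p m ?\<tau> h"
      unfolding eqrep[OF h, symmetric] using drep_carrier[of l a e k h] by simp
  qed simp
  then have split: "splits_off_invariants l ?H k (drep l a e k) p m ?\<tau>"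
    unfolding splits_off_invariants_def using inv drep_stab_module k_def by blast
  have "m = n - card J" unfolding m_def using J finJ by (simp add: card_Diff_subset)
  then have "m = l - card D + 1" using card by linarith
  then have dim: "krull_dim (shell_quotient_ring l ?H m ?\<tau>) = 2" by (rule model_dim_eq_2[OF bound J D lt e2])
  have "group_dim l ?H > 0" using group_dim_stab[OF D] lt by simp
  then have "slice_type_O l (torus l) n ?\<rho> x"
    unfolding slice_type_O_def Let_def H Orb_def[symmetric] tangent using mod slice split dim by blast
  then show ?thesis
    unfolding has_slice_of_type_O_def using xshell closed[unfolded Orb_def] by blast
qed

theorem proposition4:
  fixes l n :: nat and \<rho> :: "complex vec \<Rightarrow> complex mat" and A :: "int mat"
  assumes "l > 0"
    and "is_module l (torus l) n \<rho>"
    and "faithful (torus l) \<rho>"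
    and "modular 1 l (torus l) n \<rho>"
    and "weight_matrix l n \<rho> A"
  shows "has_slice_of_type_O l (torus l) n \<rho> \<longleftrightarrow>
    (\<exists>r J. 1 \<le> r \<and> r \<le> l \<and> J \<subseteq> {..<n} \<and> card J + r + 1 = n \<and> column_rank A J = l - r)"
proof -
  let ?a = "\<lambda>j i. A $$ (i, j)" and ?\<rho>' = "drep l (\<lambda>j i. A $$ (i, j)) id n"
  have A: "A \<in> carrier_mat l n" using assms(5) by (simp add: weight_matrix_def)
  have bound: "card_bound l n ?a" unfolding card_bound_def using modular_card_bound[OF assms(2,4,5)] by blast
  obtain P Q where PQ: "P \<in> carrier_mat n n" "Q \<in> carrier_mat n n" "P * Q = 1\<^sub>m n" "Q * P = 1\<^sub>m n"
    and conj: "\<And>t. t \<in> torus l \<Longrightarrow> \<rho> t * P = P * ?\<rho>' t"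
    using weight_matrix_diagonalize[OF assms(2,5)] by (metis (lifting))
  have mod': "is_module l (torus l) n ?\<rho>'" by (rule drep_is_module) simp
  note iso = conjugate_sympl_iso[OF PQ assms(2) mod' torus_tinv conj]
  note iso' = sympl_iso_sym[OF iso assms(2) torus_tinv]
  have diag: "has_slice_of_type_O l (torus l) n \<rho> \<longleftrightarrow> has_slice_of_type_O l (torus l) n ?\<rho>'"
    using sympl_iso_slice_type_O[OF iso assms(2) mod' torus_tinv] sympl_iso_slice_type_O[OF iso' mod' assms(2) torus_tinv]
    by blast
  show ?thesis
    unfolding diag
  proof
    assume "has_slice_of_type_O l (torus l) n ?\<rho>'"
    then obtain T D where T: "T \<subseteq> {..<n}" "is_basis l ?a T D" "card D < l" "card T + (l - card D) + 1 = n"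
      using type_O_imp_columns[OF bound] by blast
    have "column_rank A T = card D" by (rule column_rank_eq_card_basis[OF A T(1,2)])
    then show "\<exists>r J. 1 \<le> r \<and> r \<le> l \<and> J \<subseteq> {..<n} \<and> card J + r + 1 = n \<and> column_rank A J = l - r"
      using T by (intro exI[of _ "l - card D"] exI[of _ T]) auto
  next
    assume "\<exists>r J. 1 \<le> r \<and> r \<le> l \<and> J \<subseteq> {..<n} \<and> card J + r + 1 = n \<and> column_rank A J = l - r"
    then obtain r J where r: "1 \<le> r" "r \<le> l" "J \<subseteq> {..<n}" "card J + r + 1 = n" "column_rank A J = l - r" by blast
    have finJ: "finite J" using r(3) finite_subset by blast
    obtain D where D: "is_basis l ?a J D" using basis_exists[OF finJ] by blast
    have "card D = l - r" using column_rank_eq_card_basis[OF A r(3) D] r(5) by simp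
    then have "card D < l" "card J + (l - card D) + 1 = n" using r by auto
    from coloop_free_subset[OF finJ D this] obtain J' D' where
      J': "J' \<subseteq> J" "is_basis l ?a J' D'" "card D' < l" "card J' + (l - card D') + 1 = n"
        "\<forall>j\<in>J'. in_span l ?a (J' - {j}) (?a j)"
      by (elim exE conjE)
    have "J' \<subseteq> {..<n}" using J'(1) r(3) by blast
    from columns_imp_type_O[OF bound this J'(2-4) J'(5)[rule_format]]
    show "has_slice_of_type_O l (torus l) n ?\<rho>'" by simp
  qed
qed

end
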